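(* Let $X$ be a compact metric space, $f\colon X\to X$ a homeomorphism, and $\phi\colon X\to\mathbb{R}$ continuous. Suppose there are $\delta,\varepsilon>0$ with $\varepsilon>40\delta$ such that $P^\perp_{\exp}(\phi,\varepsilon)<P(\phi)$ and there exists $\mathcal{D}\subset X\times\mathbb{N}$ which admits a decomposition $(\mathcal{P},\mathcal{G},\mathcal{S})$ such that: (I$'$) for every $M\in\mathbb{N}$, $\mathcal{G}^M$ has tail (W)-specification at scale $\delta$; (II) $\phi$ has the Bowen property at scale $\varepsilon$ on $\mathcal{G}$; (III$'$) $P(\mathcal{P}\cup\mathcal{S}\cup\mathcal{D}^c,\phi,\delta,\varepsilon)<P(\phi)$. Then $(X,f,\phi)$ has a unique equilibrium state.
   Context: $d$ the metric; $\mathbb{N}_0=\mathbb{N}\cup\{0\}$. $d_n(x,y)=\max_{0\le k<n}d(f^kx,f^ky)$, $B_n(x,\delta)=\{y:d_n(x,y)<\delta\}$; $E$ is $(n,\delta)$-separated if $d_n(x,y)>\delta$ for distinct $x,y\in E$. Pairs $(x,n)$ are orbit segments $\{f^kx:0\le k<n\}$ ($(x,0)$ empty); $\mathcal{C}_n=\{x:(x,n)\in\mathcal{C}\}$; $\mathcal{D}^c=(X\times\mathbb{N})\setminus\mathcal{D}$. $\Phi_\varepsilon(x,n)=\sup_{y\in B_n(x,\varepsilon)}\sum_{k=0}^{n-1}\phi(f^ky)$; $\Lambda(\mathcal{C},\phi,\delta,\varepsilon,n)=\sup\{\sum_{x\in E}e^{\Phi_\varepsilon(x,n)}:E\subset\mathcal{C}_n\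 (n,\delta)\text{-separated}\}$; $P(\mathcal{C},\phi,\delta,\varepsilon)=\limsup_n\frac1n\log\Lambda(\mathcal{C},\phi,\delta,\varepsilon,n)$; $P(\phi)$ topological pressure. Equilibrium state: $f$-invariant Borel probability measure maximizing $h_\mu(f)+\int\phi\,d\mu$. $\Gamma_\varepsilon(x)=\{y:d(f^nx,f^ny)\le\varepsilon\ \forall n\in\mathbb{Z}\}$, $\mathrm{NE}(\varepsilon)=\{x:\Gamma_\varepsilon(x)\ne\{x\}\}$, $P^\perp_{\exp}(\phi,\varepsilon)=\sup\{h_\mu(f)+\int\phi\,d\mu:\mu\text{ ergodic},\ \mu(\mathrm{NE}(\varepsilon))>0\}$. Decomposition for $\mathcal{D}$: $\mathcal{P},\mathcal{G},\mathcal{S}\subset X\times\mathbb{N}_0$ and $p,g,s:\mathcal{D}\to\mathbb{N}_0$ with $n=p+g+s$, $(x,p)\in\mathcal{P}$, $(f^px,g)\in\mathcal{G}$, $(f^{p+g}x,s)\in\mathcal{S}$ for each $(x,n)\in\mathcal{D}$; standing assumption $X\times\{0\}\subset\mathcal{P}\cap\mathcal{G}\cap\mathcal{S}$. $\mathcal{G}^M=\{(x,n)\in\mathcal{D}:p\le M,\ s\le M\}$. (W)-specification at scale $\delta$: there is $\tau\in\mathbb{N}$ such that for every $\{(x_i,n_i)\}_{i=1}^k$ in the collection there are $y$ and $\tau_1,\dots,\tau_{k-1}\in\mathbb{N}$, $\tau_i\le\tau$, with $d_{n_j}(f^{N_{j-1}+\tau_{j-1}}y,x_j)<\delta$ for all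 $j$, where $N_j=\sum_{i\le j}n_i+\sum_{i\le j-1}\tau_i$, $N_0=\tau_0=0$. Tail (W)-specification at scale $\delta$: there is $N_0\in\mathbb{N}$ such that the subcollection of segments with $n\ge N_0$ has (W)-specification at scale $\delta$. Bowen property at scale $\varepsilon$ on $\mathcal{C}$: there is $K$ with $|\Phi_0(x,n)-\Phi_0(y,n)|\le K$ for all $(x,n)\in\mathcal{C}$, $y\in B_n(x,\varepsilon)$. *)

theory Defs
  imports "HOL-Probability.Probability"
begin

text \<open>Bowen metric d_n; for n = 0 it is 0 (maximum over the empty set taken as 0).\<close>
definition dn :: "('a::metric_space \<Rightarrow> 'a) \<Rightarrow> nat \<Rightarrow> 'a \<Rightarrow> 'a \<Rightarrow> real" where
  "dn f n x y = Max (insert 0 ((\<lambda>k. dist ((f ^^ k) x) ((f ^^ k) y)) ` {..<n}))"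

definition birkhoff :: "('a \<Rightarrow> 'a) \<Rightarrow> ('a \<Rightarrow> real) \<Rightarrow> nat \<Rightarrow> 'a \<Rightarrow> real" where
  "birkhoff f \<phi> n x = (\<Sum>k<n. \<phi> ((f ^^ k) x))"

definition Phi :: "('a::metric_space \<Rightarrow> 'a) \<Rightarrow> ('a \<Rightarrow> real) \<Rightarrow> real \<Rightarrow> 'a \<Rightarrow> nat \<Rightarrow> real" where
  "Phi f \<phi> \<epsilon> x n =
     (if \<epsilon> = 0 then birkhoff f \<phi> n x
      else (SUP y\<in>{y. dn f n x y < \<epsilon>}. birkhoff f \<phi> n y))"

definition separated :: "('a::metric_space \<Rightarrow> 'a) \<Rightarrow> nat \<Rightarrow> real \<Rightarrow> 'a set \<Rightarrow> bool" where
  "separated f n \<delta> E \<longleftrightarrow> (\<forall>x\<in>E. \<forall>y\<in>E. x \<noteq> y \<longrightarrow> dn f n x y > \<delta>)"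

definition slice :: "('a \<times> nat) set \<Rightarrow> nat \<Rightarrow> 'a set" where
  "slice C n = {x. (x, n) \<in> C}"

definition Lambda :: "('a::metric_space \<Rightarrow> 'a) \<Rightarrow> ('a \<times> nat) set \<Rightarrow> ('a \<Rightarrow> real)
                       \<Rightarrow> real \<Rightarrow> real \<Rightarrow> nat \<Rightarrow> ereal" where
  "Lambda f C \<phi> \<delta> \<epsilon> n =
     (SUP E\<in>{E. finite E \<and> E \<subseteq> slice C n \<and> separated f n \<delta> E}.
        ereal (\<Sum>x\<in>E. exp (Phi f \<phi> \<epsilon> x n)))"

definition elog :: "ereal \<Rightarrow> ereal" where
  "elog t = (if t = \<infinity> then \<infinity> else if t \<le> 0 then -\<infinity> else ereal (ln (real_of_ereal t)))"

definition pressure_C :: "('a::metric_space \<Rightarrow> 'a) \<Rightarrow> ('a \<times> nat) set \<Rightarrow> ('a \<Rightarrow> real)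
                          \<Rightarrow> real \<Rightarrow> real \<Rightarrow> ereal" where
  "pressure_C f C \<phi> \<delta> \<epsilon> =
     limsup (\<lambda>n. elog (Lambda f C \<phi> \<delta> \<epsilon> n) / ereal (real n))"

text \<open>Topological pressure: P(phi) = lim_{delta -> 0} P(X x N, phi, delta, 0)
  (the limit is a monotone one, hence a supremum over delta > 0).\<close>
definition top_pressure :: "('a::metric_space \<Rightarrow> 'a) \<Rightarrow> ('a \<Rightarrow> real) \<Rightarrow> ereal" where
  "top_pressure f \<phi> = (SUP \<delta>\<in>{0<..}. pressure_C f UNIV \<phi> \<delta> 0)"

definition W_spec :: "('a::metric_space \<Rightarrow> 'a) \<Rightarrow> ('a \<times> nat) set \<Rightarrow> real \<Rightarrow> bool" where
  "W_spec f C \<delta> \<longleftrightarrow>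
     (\<exists>\<tau>::nat. \<tau> \<ge> 1 \<and>
        (\<forall>k::nat. \<forall>xs::nat \<Rightarrow> 'a. \<forall>ns::nat \<Rightarrow> nat.
           (\<forall>i<k. (xs i, ns i) \<in> C) \<longrightarrow>
           (\<exists>y ts. (\<forall>i. i + 1 < k \<longrightarrow> 1 \<le> ts i \<and> ts i \<le> \<tau>) \<and>
                   (\<forall>j<k. dn f (ns j) ((f ^^ (\<Sum>i<j. ns i + ts i)) y) (xs j) < \<delta>))))"

definition tail_W_spec :: "('a::metric_space \<Rightarrow> 'a) \<Rightarrow> ('a \<times> nat) set \<Rightarrow> real \<Rightarrow> bool" where
  "tail_W_spec f C \<delta> \<longleftrightarrow>
     (\<exists>N0::nat. N0 \<ge> 1 \<and> W_spec f {(x, n) \<in> C. n \<ge> N0} \<delta>)"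

definition bowen_prop :: "('a::metric_space \<Rightarrow> 'a) \<Rightarrow> ('a \<Rightarrow> real) \<Rightarrow> real \<Rightarrow> ('a \<times> nat) set \<Rightarrow> bool" where
  "bowen_prop f \<phi> \<epsilon> C \<longleftrightarrow>
     (\<exists>K. \<forall>(x, n)\<in>C. \<forall>y. dn f n x y < \<epsilon> \<longrightarrow>
            \<bar>birkhoff f \<phi> n x - birkhoff f \<phi> n y\<bar> \<le> K)"

definition decomposition :: "('a \<Rightarrow> 'a) \<Rightarrow> ('a \<times> nat) set \<Rightarrow> ('a \<times> nat) set \<Rightarrow> ('a \<times> nat) set
    \<Rightarrow> ('a \<times> nat) set \<Rightarrow> ('a \<times> nat \<Rightarrow> nat) \<Rightarrow> ('a \<times> nat \<Rightarrow> nat) \<Rightarrow> ('a \<times> nat \<Rightarrow> nat) \<Rightarrow> bool" where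
  "decomposition f D P G S p g s \<longleftrightarrow>
     UNIV \<times> {0} \<subseteq> P \<inter> G \<inter> S \<and>
     (\<forall>(x, n)\<in>D. p (x, n) + g (x, n) + s (x, n) = n \<and>
                  (x, p (x, n)) \<in> P \<and>
                  ((f ^^ p (x, n)) x, g (x, n)) \<in> G \<and>
                  ((f ^^ (p (x, n) + g (x, n))) x, s (x, n)) \<in> S)"

definition GM :: "('a \<times> nat) set \<Rightarrow> ('a \<times> nat \<Rightarrow> nat) \<Rightarrow> ('a \<times> nat \<Rightarrow> nat) \<Rightarrow> nat \<Rightarrow> ('a \<times> nat) set" where
  "GM D p s M = {(x, n) \<in> D. p (x, n) \<le> M \<and> s (x, n) \<le> M}"

definition fpow :: "('a \<Rightarrow> 'a) \<Rightarrow> int \<Rightarrow> 'a \<Rightarrow> 'a" where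
  "fpow f n = (if n \<ge> 0 then f ^^ nat n else inv f ^^ nat (- n))"

definition Gamma :: "('a::metric_space \<Rightarrow> 'a) \<Rightarrow> real \<Rightarrow> 'a \<Rightarrow> 'a set" where
  "Gamma f \<epsilon> x = {y. \<forall>n::int. dist (fpow f n x) (fpow f n y) \<le> \<epsilon>}"

definition NE :: "('a::metric_space \<Rightarrow> 'a) \<Rightarrow> real \<Rightarrow> 'a set" where
  "NE f \<epsilon> = {x. Gamma f \<epsilon> x \<noteq> {x}}"

definition invariant_prob :: "('a::metric_space \<Rightarrow> 'a) \<Rightarrow> 'a measure \<Rightarrow> bool" where
  "invariant_prob f M \<longleftrightarrow> sets M = sets borel \<and> prob_space M \<and>
     f \<in> measurable M M \<and> distr M M f = M"

definition ergodic :: "('a::metric_space \<Rightarrow> 'a) \<Rightarrow> 'a measure \<Rightarrow> bool" where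
  "ergodic f M \<longleftrightarrow> invariant_prob f M \<and>
     (\<forall>A\<in>sets M. f -` A \<inter> space M = A \<longrightarrow> measure M A = 0 \<or> measure M A = 1)"

definition meas_partition :: "'a measure \<Rightarrow> 'a set set \<Rightarrow> bool" where
  "meas_partition M Q \<longleftrightarrow> finite Q \<and> Q \<subseteq> sets M \<and> disjoint Q \<and> \<Union>Q = space M \<and> {} \<notin> Q"

definition join_part :: "('a \<Rightarrow> 'a) \<Rightarrow> 'a set set \<Rightarrow> nat \<Rightarrow> 'a set set" where
  "join_part f Q n = {(\<Inter>k<n. (f ^^ k) -` c k) | c. \<forall>k<n. c k \<in> Q} - {{}}"

definition part_entropy :: "'a measure \<Rightarrow> 'a set set \<Rightarrow> real" where
  "part_entropy M Q = - (\<Sum>A\<in>Q. measure M A * ln (measure M A))"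

definition entropy_rel :: "('a \<Rightarrow> 'a) \<Rightarrow> 'a measure \<Rightarrow> 'a set set \<Rightarrow> real" where
  "entropy_rel f M Q = lim (\<lambda>n. part_entropy M (join_part f Q (Suc n)) / real (Suc n))"

definition ks_entropy :: "('a \<Rightarrow> 'a) \<Rightarrow> 'a measure \<Rightarrow> ereal" where
  "ks_entropy f M = (SUP Q\<in>{Q. meas_partition M Q}. ereal (entropy_rel f M Q))"

definition free_energy :: "('a \<Rightarrow> 'a) \<Rightarrow> ('a \<Rightarrow> real) \<Rightarrow> 'a measure \<Rightarrow> ereal" where
  "free_energy f \<phi> M = ks_entropy f M + ereal (integral\<^sup>L M \<phi>)"

definition P_perp_exp :: "('a::metric_space \<Rightarrow> 'a) \<Rightarrow> ('a \<Rightarrow> real) \<Rightarrow> real \<Rightarrow> ereal" where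
  "P_perp_exp f \<phi> \<epsilon> =
     (SUP M\<in>{M. ergodic f M \<and> measure M (NE f \<epsilon>) > 0}. free_energy f \<phi> M)"

definition equilibrium_state :: "('a::metric_space \<Rightarrow> 'a) \<Rightarrow> ('a \<Rightarrow> real) \<Rightarrow> 'a measure \<Rightarrow> bool" where
  "equilibrium_state f \<phi> M \<longleftrightarrow> invariant_prob f M \<and>
     (\<forall>N. invariant_prob f N \<longrightarrow> free_energy f \<phi> N \<le> free_energy f \<phi> M)"

end

theory Submission
  imports Defs
begin

text \<open>
  Entropy is computed throughout from finite-valued functions, and ergodic measures of free energy above
  \<open>P\<^sub>exp\<^sup>\<bottom>(\<phi>, \<epsilon>)\<close> see an expansive system at scale \<open>\<epsilon>\<close>, so that their free energy is bounded by partition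
  sums over cells of \<open>d\<^sub>n\<close>-diameter at most \<open>\<epsilon>\<close>. This gives an equilibrium state as a weak limit of ergodic measures
  whose free energies approach \<open>P\<close>, and shows that equilibrium states do not charge \<open>NE(\<epsilon>)\<close>.

  Uniqueness does not pass through the Gibbs property. A renewal induction over the lengths of prefixes and suffixes
  bounds the partition sums of all \<open>(n, 2\<delta>)\<close>-separated sets by \<open>B e\<^bsup>nP\<^esup>\<close>; in return, for every equilibrium state
  every set of measure at least \<open>3/4\<close> contains an \<open>(n, 2\<delta>)\<close>-separated set of points of \<open>\<G>\<^sup>M\<^sub>n\<close> with partition sum at least
  \<open>c e\<^bsup>nP\<^esup>\<close>. Two different equilibrium states yield, by conditioning, equilibrium states carried by complementary
  invariant sets. Glue a segment typical for the first one to a segment typical for the second one, the total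
  length being fixed and the time of the switch taking \<open>R\<close> values: expansivity separates orbits with different
  switching times, so that the glued orbits have a partition sum of order \<open>R c\<^sup>2 e\<^bsup>nP\<^esup>\<close>, which is too large for large \<open>R\<close>.
\<close>

section \<open>Orbit segments and separated sets\<close>

text \<open>The gaps allowed by (W)-specification vary from orbit to orbit, so a glued orbit does
  not reveal the segments it follows. \<open>glue\<close> concatenates many blocks, sorts the
  choices by their sequence of gaps and takes the root: the growth rate of separated sets is at most
  P at every positive scale, so the error in the exponent vanishes and each segment costs only a
  bounded factor. The scale \<open>r\<close> at which the glued orbits are separated does not enter
  the bound. This is why shadowing up to \<delta> at both ends loses no scale: a finite set with all
  distances strictly above 2\<delta> still leaves some positive \<open>r\<close>, however small.
  Partition sums of (n, 2\<delta>)-separated sets can therefore be bounded above and below at the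
  same scale. Bad segments decay like exp(-\<kappa>n) relative to exp(nP), so prefixes or suffixes
  longer than M have total weight of order exp(-\<kappa>M). One choice of M makes the renewal
  inequality a contraction, and another, larger than the upper constant requires, makes bad segments
  too light to support an equilibrium state.\<close>

lemma dn_le_iff: "0 \<le> r \<Longrightarrow> dn f n x y \<le> r \<longleftrightarrow> (\<forall>k<n. dist ((f ^^ k) x) ((f ^^ k) y) \<le> r)"
  by (auto simp: dn_def)

lemma dn_less_iff: "0 < r \<Longrightarrow> dn f n x y < r \<longleftrightarrow> (\<forall>k<n. dist ((f ^^ k) x) ((f ^^ k) y) < r)"
  by (auto simp: dn_def)

lemma dn_nonneg: "0 \<le> dn f n x y"
  by (auto simp: dn_def)

lemma dist_le_dn: "k < n \<Longrightarrow> dist ((f ^^ k) x) ((f ^^ k) y) \<le> dn f n x y"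
  using dn_le_iff[OF dn_nonneg, of f n x y f n x y] by simp

lemma dn_refl [simp]: "dn f n x x = 0"
  using dn_le_iff[of 0 f n x x] dn_nonneg[of f n x x] by simp

lemma dn_commute: "dn f n x y = dn f n y x"
  by (simp add: dn_def dist_commute)

lemma dn_triangle: "dn f n x z \<le> dn f n x y + dn f n y z"
proof -
  have "dist ((f ^^ k) x) ((f ^^ k) z) \<le> dn f n x y + dn f n y z" if "k < n" for k
    using dist_triangle[of "(f ^^ k) x" "(f ^^ k) z" "(f ^^ k) y"]
      dist_le_dn[OF that, of f x y] dist_le_dn[OF that, of f y z] by linarith
  then show ?thesis
    by (subst dn_le_iff) (auto simp: dn_nonneg)
qed

lemma dn_shift: "p + g \<le> n \<Longrightarrow> dn f g ((f ^^ p) x) ((f ^^ p) y) \<le> dn f n x y"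
  by (subst dn_le_iff)
     (auto simp: dn_nonneg funpow_add[symmetric, THEN fun_cong, simplified] intro!: dist_le_dn)

lemma dn_mono: "m \<le> n \<Longrightarrow> dn f m x y \<le> dn f n x y"
  using dn_shift[of 0 m n f x y] by simp

lemma dn_split:
  assumes "0 \<le> r" "dn f p x y \<le> r" "dn f q ((f ^^ p) x) ((f ^^ p) y) \<le> r"
  shows "dn f (p + q) x y \<le> r"
proof -
  have "dist ((f ^^ k) x) ((f ^^ k) y) \<le> r" if k: "k < p + q" for k
  proof (cases "k < p")
    case True then show ?thesis using dist_le_dn[OF True, of f x y] assms by linarith
  next
    case False
    then obtain j where j: "k = j + p" "j < q"
      using k by (metis add.commute add_less_cancel_left le_Suc_ex not_less)
    then show ?thesis using dist_le_dn[OF j(2), of f "(f ^^ p) x" "(f ^^ p) y"] assms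
      by (simp add: funpow_add)
  qed
  then show ?thesis using assms by (simp add: dn_le_iff)
qed

lemma birkhoff_add: "birkhoff f \<phi> (m + n) x = birkhoff f \<phi> m x + birkhoff f \<phi> n ((f ^^ m) x)"
proof (induction n)
  case (Suc n)
  then show ?case by (simp add: birkhoff_def funpow_add add.commute[of m n])
qed (simp add: birkhoff_def)

lemma birkhoff_0 [simp]: "birkhoff f \<phi> 0 x = 0"
  by (simp add: birkhoff_def)

lemma birkhoff_Suc: "birkhoff f \<phi> (Suc n) x = birkhoff f \<phi> n x + \<phi> ((f ^^ n) x)"
  by (simp add: birkhoff_def)

lemma birkhoff_abs_le:
  assumes "\<And>x. \<bar>\<phi> x\<bar> \<le> b"
  shows "\<bar>birkhoff f \<phi> n x\<bar> \<le> real n * b"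
proof -
  have "\<bar>birkhoff f \<phi> n x\<bar> \<le> (\<Sum>k<n. \<bar>\<phi> ((f ^^ k) x)\<bar>)"
    unfolding birkhoff_def by (rule sum_abs)
  also have "\<dots> \<le> (\<Sum>k<n. b)" by (intro sum_mono assms)
  finally show ?thesis by simp
qed

lemma separated_subset: "separated f n r E \<Longrightarrow> F \<subseteq> E \<Longrightarrow> separated f n r F"
  by (auto simp: separated_def)

lemma separated_empty [simp]: "separated f n r {}"
  by (auto simp: separated_def)

lemma separated_insert:
  "separated f n r (insert a E) \<longleftrightarrow> separated f n r E \<and> (\<forall>x\<in>E. x \<noteq> a \<longrightarrow> dn f n x a > r)"
  by (auto simp: separated_def dn_commute)

section \<open>Compactness: size of separated sets and maximal separated sets\<close>

locale compact_dynamics =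
  fixes f :: "'a::metric_space \<Rightarrow> 'a"
  assumes compact_space: "compact (UNIV :: 'a set)"
    and homeo: "\<exists>h. homeomorphism UNIV UNIV f h"
begin

lemma cont_f: "continuous_on UNIV f"
  using homeo by (auto simp: homeomorphism_def)

lemma cont_comp: "continuous_on UNIV g \<Longrightarrow> continuous_on UNIV f' \<Longrightarrow> continuous_on UNIV (\<lambda>x. g (f' x))"
  by (rule continuous_on_compose2[of UNIV g]) auto

lemma cont_iter: "continuous_on UNIV (f ^^ k)"
proof (induction k)
  case 0
  then show ?case by (simp add: id_def)
next
  case (Suc k)
  then show ?case using cont_comp[OF cont_f, of "f ^^ k"] by (simp add: o_def)
qed

lemma cont_birkhoff: "continuous_on UNIV \<phi> \<Longrightarrow> continuous_on UNIV (birkhoff f \<phi> n)"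
  unfolding birkhoff_def by (intro continuous_on_sum) (erule cont_comp[OF _ cont_iter])

lemma bij_f: "bij f"
proof -
  obtain h where "homeomorphism UNIV UNIV f h" using homeo by blast
  then have "h (f x) = x" "f (h x) = x" for x by (auto simp: homeomorphism_def)
  then show ?thesis by (intro o_bij[of h]) (auto simp: fun_eq_iff)
qed

lemma cont_inv_f: "continuous_on UNIV (inv f)"
proof -
  obtain h where h: "homeomorphism UNIV UNIV f h" using homeo by blast
  then have "h (f x) = x" "f (h x) = x" for x by (auto simp: homeomorphism_def)
  then have "inv f = h" by (intro inv_equality) auto
  then show ?thesis using h by (auto simp: homeomorphism_def)
qed

lemma bdd_cont:
  fixes \<phi> :: "'a \<Rightarrow> real"
  assumes "continuous_on UNIV \<phi>"
  obtains b where "b \<ge> 0" "\<And>x. \<bar>\<phi> x\<bar> \<le> b"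
proof -
  have "bounded (\<phi> ` UNIV)"
    using compact_continuous_image[OF assms compact_space] compact_imp_bounded by blast
  then obtain b where "\<And>x. \<bar>\<phi> x\<bar> \<le> b" by (auto simp: bounded_iff)
  moreover from this have "0 \<le> b" using abs_ge_zero order_trans by blast
  ultimately show ?thesis using that by blast
qed

lemma uniform_cont:
  fixes \<phi> :: "'a \<Rightarrow> 'b::metric_space"
  assumes "continuous_on UNIV \<phi>" "e > 0"
  obtains d where "d > 0" "\<And>x y. dist x y < d \<Longrightarrow> dist (\<phi> x) (\<phi> y) < e"
  using compact_uniformly_continuous[OF assms(1) compact_space] assms(2)
  unfolding uniformly_continuous_on_def by (metis UNIV_I dist_commute)

text \<open>A ball of \<open>d_n\<close>-radius \<open>r / 2\<close> contains at most one point of a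
  separated set, so the size of a finite cover by such balls bounds all separated sets at
  once.\<close>

lemma separated_bound:
  assumes r: "r > 0"
  obtains K where "\<And>E. separated f n r E \<Longrightarrow> finite E \<and> card E \<le> K"
proof -
  let ?U = "\<lambda>x. {y. dn f n x y < r / 2}"
  have op: "open (?U x)" for x
  proof -
    have "?U x = (\<Inter>k\<in>{..<n}. {y. dist ((f ^^ k) x) ((f ^^ k) y) < r / 2})"
      using r dn_less_iff[of "r / 2" f n x] by (auto simp del: less_divide_eq_numeral1)
    moreover have "open {y. dist ((f ^^ k) x) ((f ^^ k) y) < r / 2}" for k
      by (rule open_Collect_less) (auto intro!: continuous_intros cont_iter)
    ultimately show ?thesis by auto
  qed
  have cov: "UNIV \<subseteq> (\<Union>x\<in>UNIV. ?U x)" using r by fastforce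
  obtain T where T: "finite T" "UNIV \<subseteq> (\<Union>x\<in>T. ?U x)"
    by (rule compactE_image[OF compact_space op cov])
  have "finite E \<and> card E \<le> card T" if E: "separated f n r E" for E
  proof -
    have "\<forall>x. \<exists>t. t \<in> T \<and> dn f n t x < r / 2" using T(2) by auto
    from choice[OF this] obtain t where t: "\<And>x. t x \<in> T" "\<And>x. dn f n (t x) x < r / 2"
      by auto
    have "inj_on t E"
    proof (rule inj_onI)
      fix x y assume xy: "x \<in> E" "y \<in> E" "t x = t y"
      have "dn f n x y \<le> dn f n x (t x) + dn f n (t x) y" by (rule dn_triangle)
      then have "dn f n x y < r" using t(2)[of x] t(2)[of y] xy(3) by (simp add: dn_commute)
      then show "x = y" using E xy unfolding separated_def by force
    qed
    moreover have "t ` E \<subseteq> T" using t by auto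
    ultimately show ?thesis using T(1) inj_on_finite[of t E T] card_inj_on_le[of t E T] by auto
  qed
  then show ?thesis using that by blast
qed

text \<open>Cardinalities are bounded, so a separated subset of \<open>A\<close> of largest size
  exists; a point of \<open>A\<close> farther than \<open>r\<close> from it could be added. Being
  both separated and a net, it carries partition sums and also indexes partitions into small
  cells.\<close>

lemma maximal_separated:
  assumes r: "r > 0"
  obtains E where "E \<subseteq> A" "finite E" "separated f n r E" "\<And>x. x \<in> A \<Longrightarrow> \<exists>e\<in>E. dn f n x e \<le> r"
proof -
  obtain K where K: "\<And>E. separated f n r E \<Longrightarrow> finite E \<and> card E \<le> K"
    using separated_bound[OF r, of n] by blast
  let ?P = "\<lambda>E. E \<subseteq> A \<and> separated f n r E"
  have "\<exists>E. ?P E \<and> (\<forall>F. ?P F \<longrightarrow> card F \<le> card E)"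
    by (rule ex_has_greatest_nat[of ?P "{}" card "Suc K"]) (use K in \<open>auto simp: less_Suc_eq_le le_Suc_eq\<close>)
  then obtain E where E: "?P E" "\<And>F. ?P F \<Longrightarrow> card F \<le> card E" by (elim exE) auto
  have "\<exists>e\<in>E. dn f n x e \<le> r" if "x \<in> A" for x
  proof (rule ccontr)
    assume *: "\<not> (\<exists>e\<in>E. dn f n x e \<le> r)"
    then have "x \<notin> E" using r by force
    moreover have "?P (insert x E)"
      using E * that by (auto simp: separated_insert dn_commute not_le)
    ultimately show False using E(2)[of "insert x E"] K E(1) by auto
  qed
  then show ?thesis using that E K by blast
qed

text \<open>Supplies a finite constant for each single \<open>n\<close>; it absorbs the finitely
  many lengths below an asymptotic threshold.\<close>

lemma separated_sum_bound:
  fixes \<psi> :: "'a \<Rightarrow> real"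
  assumes "r > 0" "\<And>x. \<psi> x \<le> c"
  obtains B where "B \<ge> 0" "\<And>E. separated f n r E \<Longrightarrow> (\<Sum>x\<in>E. exp (\<psi> x)) \<le> B"
proof -
  obtain K where K: "\<And>E. separated f n r E \<Longrightarrow> finite E \<and> card E \<le> K"
    using separated_bound[OF assms(1), of n] by blast
  have "(\<Sum>x\<in>E. exp (\<psi> x)) \<le> real K * exp c" if "separated f n r E" for E
  proof -
    have "(\<Sum>x\<in>E. exp (\<psi> x)) \<le> (\<Sum>x\<in>E. exp c)" by (intro sum_mono) (simp add: assms)
    also have "\<dots> \<le> real K * exp c" using K[OF that] by simp
    finally show ?thesis .
  qed
  then show ?thesis using that[of "real K * exp c"] by simp
qed

end

section \<open>Entropy of finite-valued functions\<close>

definition eta :: "real \<Rightarrow> real" where "eta t = - t * ln t"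

lemma eta_0 [simp]: "eta 0 = 0" and eta_1 [simp]: "eta 1 = 0"
  by (auto simp: eta_def)

lemma eta_nonneg: "0 \<le> t \<Longrightarrow> t \<le> 1 \<Longrightarrow> 0 \<le> eta t"
  by (cases "t = 0") (auto simp: eta_def mult_nonneg_nonpos)

lemma eta_mult: "0 \<le> p \<Longrightarrow> 0 \<le> q \<Longrightarrow> eta (p * q) = p * eta q + q * eta p"
  by (cases "p = 0 \<or> q = 0") (auto simp: eta_def ln_mult algebra_simps)

text \<open>This is \<open>ln t \<le> t - 1\<close> at \<open>t = b / a\<close>. The convexity
  inequalities below sum it over cells, with \<open>b\<close> chosen so that the right-hand sides
  cancel.\<close>

lemma mult_ln_ratio_le: "0 \<le> (a::real) \<Longrightarrow> 0 < b \<Longrightarrow> a * (ln b - ln a) \<le> b - a"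
proof (cases "a = 0")
  case False
  assume ab: "0 \<le> a" "0 < b"
  then have a: "a > 0" using False by simp
  have "ln b - ln a \<le> b / a - 1" using ln_le_minus_one[of "b / a"] a ab by (simp add: ln_div)
  then have "a * (ln b - ln a) \<le> a * (b / a - 1)" using a by (intro mult_left_mono) auto
  also have "a * (b / a - 1) = b - a" using a by (simp add: field_simps)
  finally show ?thesis .
qed simp

lemma eta_le: "0 \<le> t \<Longrightarrow> eta t \<le> 1 - t"
  using mult_ln_ratio_le[of t 1] by (simp add: eta_def)

text \<open>Gibbs' inequality for weights of arbitrary total mass: the \<open>p i\<close> are
  compared with \<open>exp (a i)\<close> rescaled to the same total, and the extra
  \<open>eta\<close> term accounts for a total different from 1. Sums over one group of cells need
  this form.\<close>

lemma log_sum_le: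
  fixes p a :: "'i \<Rightarrow> real"
  assumes I: "finite I" and p: "\<And>i. i \<in> I \<Longrightarrow> 0 \<le> p i"
  shows "(\<Sum>i\<in>I. eta (p i) + p i * a i) \<le> (\<Sum>i\<in>I. p i) * ln (\<Sum>i\<in>I. exp (a i)) + eta (\<Sum>i\<in>I. p i)"
proof (cases "(\<Sum>i\<in>I. p i) = 0")
  case True
  then have "\<And>i. i \<in> I \<Longrightarrow> p i = 0" using sum_nonneg_eq_0_iff[OF I, of p] p by auto
  then show ?thesis by simp
next
  case False
  define P where "P = (\<Sum>i\<in>I. p i)"
  define S where "S = (\<Sum>i\<in>I. exp (a i))"
  have P: "P > 0" using False p by (simp add: P_def less_le sum_nonneg)
  then have "I \<noteq> {}" by (auto simp: P_def)
  then have S: "S > 0" unfolding S_def using I by (intro sum_pos) auto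
  have "(\<Sum>i\<in>I. eta (p i) + p i * a i - p i * (ln S - ln P)) \<le> (\<Sum>i\<in>I. exp (a i) * P / S - p i)"
  proof (rule sum_mono)
    fix i assume i: "i \<in> I"
    have "p i * (ln (exp (a i) * P / S) - ln (p i)) \<le> exp (a i) * P / S - p i"
      using P S p[OF i] by (intro mult_ln_ratio_le) auto
    then show "eta (p i) + p i * a i - p i * (ln S - ln P) \<le> exp (a i) * P / S - p i"
      using P S by (simp add: eta_def ln_div ln_mult algebra_simps)
  qed
  also have "\<dots> = S * P / S - P"
    by (simp add: sum_subtractf S_def P_def sum_distrib_right sum_divide_distrib)
  also have "\<dots> = 0" using S by simp
  finally have "(\<Sum>i\<in>I. eta (p i) + p i * a i) \<le> (\<Sum>i\<in>I. p i * (ln S - ln P))"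
    by (simp add: sum_subtractf)
  also have "\<dots> = P * (ln S - ln P)" by (simp only: P_def sum_distrib_right[symmetric])
  also have "\<dots> = P * ln S + eta P" by (simp add: eta_def algebra_simps)
  finally show ?thesis by (simp add: P_def S_def)
qed

text \<open>Jensen's inequality by the tangent of \<open>eta\<close> at the mean \<open>Q\<close>;
  the linear error terms have weighted sum zero.\<close>

lemma eta_concave_sum:
  assumes I: "finite I" and w: "\<And>i. i \<in> I \<Longrightarrow> 0 \<le> w i" "(\<Sum>i\<in>I. w i) = 1"
    and q: "\<And>i. i \<in> I \<Longrightarrow> 0 \<le> q i"
  shows "(\<Sum>i\<in>I. w i * eta (q i)) \<le> eta (\<Sum>i\<in>I. w i * q i)"
proof (cases "(\<Sum>i\<in>I. w i * q i) = 0")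
  case True
  then have "\<And>i. i \<in> I \<Longrightarrow> w i * q i = 0"
    using sum_nonneg_eq_0_iff[OF I, of "\<lambda>i. w i * q i"] w q by auto
  then have "\<And>i. i \<in> I \<Longrightarrow> w i * eta (q i) = 0" by (auto simp: eta_def)
  then have "(\<Sum>i\<in>I. w i * eta (q i)) = 0" by (rule sum.neutral[OF ballI])
  then show ?thesis using True by simp
next
  case False
  define Q where "Q = (\<Sum>i\<in>I. w i * q i)"
  have Q: "Q > 0" using False w q by (simp add: Q_def less_le sum_nonneg)
  have "(\<Sum>i\<in>I. w i * eta (q i) + w i * q i * ln Q) \<le> (\<Sum>i\<in>I. w i * (Q - q i))"
  proof (rule sum_mono)
    fix i assume i: "i \<in> I"
    have "q i * (ln Q - ln (q i)) \<le> Q - q i" using Q q[OF i] by (intro mult_ln_ratio_le)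
    then have "w i * (q i * (ln Q - ln (q i))) \<le> w i * (Q - q i)" using w(1)[OF i] by (rule mult_left_mono)
    then show "w i * eta (q i) + w i * q i * ln Q \<le> w i * (Q - q i)" by (simp add: eta_def algebra_simps)
  qed
  also have "\<dots> = 0"
    by (simp add: right_diff_distrib sum_subtractf sum_distrib_right[symmetric] w Q_def)
  finally have "(\<Sum>i\<in>I. w i * eta (q i)) + Q * ln Q \<le> 0"
    by (simp only: sum.distrib sum_distrib_right[symmetric] Q_def)
  then show ?thesis by (simp add: Q_def[symmetric] eta_def[of Q])
qed

lemma continuous_on_eta: "continuous_on {0..1} eta"
proof -
  have "continuous (at x within {0..1}) eta" if x: "x \<in> {0..1}" for x
  proof (cases "x = 0")
    case True
    have "((\<lambda>t. - t * ln t) \<longlongrightarrow> 0) (at_right (0::real))" by real_asymp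
    then have "(eta \<longlongrightarrow> eta 0) (at_right 0)" by (simp add: eta_def[abs_def])
    then have "(eta \<longlongrightarrow> eta 0) (at 0 within {0..1})"
      by (rule tendsto_mono[rotated]) (unfold at_within_def, intro inf_mono order_refl, auto)
    then show ?thesis using True by (simp add: continuous_within)
  next
    case False
    then show ?thesis using x unfolding eta_def[abs_def]
      by (intro continuous_intros) auto
  qed
  then show ?thesis by (simp add: continuous_on_eq_continuous_within)
qed

lemma eta_uniform:
  assumes "e > 0"
  obtains d where "d > 0"
    "\<And>s t. 0 \<le> s \<Longrightarrow> s \<le> 1 \<Longrightarrow> 0 \<le> t \<Longrightarrow> t \<le> 1 \<Longrightarrow> \<bar>s - t\<bar> < d \<Longrightarrow> \<bar>eta s - eta t\<bar> < e"
  using compact_uniformly_continuous[OF continuous_on_eta] assms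
  unfolding uniformly_continuous_on_def dist_real_def by (metis atLeastAtMost_iff compact_Icc)

section \<open>Finite-valued functions, their Shannon entropy and its inequalities\<close>

definition finmeas :: "'a measure \<Rightarrow> ('a \<Rightarrow> 'b) \<Rightarrow> bool" where
  "finmeas M X \<longleftrightarrow> finite (range X) \<and> (\<forall>v. X -` {v} \<in> sets M)"

definition shannon :: "'a measure \<Rightarrow> ('a \<Rightarrow> 'b) \<Rightarrow> real" where
  "shannon M X = (\<Sum>v\<in>range X. eta (measure M (X -` {v})))"

text \<open>The fibres are the cells of the \<open>n\<close>-fold join of the fibre partition of
  \<open>X\<close>; with lists, the composition rule for joins becomes concatenation.\<close>

definition itin :: "('a \<Rightarrow> 'a) \<Rightarrow> ('a \<Rightarrow> 'b) \<Rightarrow> nat \<Rightarrow> 'a \<Rightarrow> 'b list" where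
  "itin f X n x = map (\<lambda>k. X ((f ^^ k) x)) [0..<n]"

definition hent :: "('a \<Rightarrow> 'a) \<Rightarrow> 'a measure \<Rightarrow> ('a \<Rightarrow> 'b) \<Rightarrow> real" where
  "hent f M X = lim (\<lambda>n. shannon M (itin f X (Suc n)) / real (Suc n))"

lemma finmeas_vimage: "finmeas M X \<Longrightarrow> X -` B \<in> sets M"
proof -
  assume X: "finmeas M X"
  have "X -` B = (\<Union>v\<in>range X \<inter> B. X -` {v})" by auto
  also have "\<dots> \<in> sets M" using X unfolding finmeas_def by (intro sets.finite_UN) auto
  finally show ?thesis .
qed

lemma finmeas_comp: "finmeas M X \<Longrightarrow> finmeas M (\<lambda>x. g (X x))"
proof -
  assume X: "finmeas M X"
  have "finite (range (\<lambda>x. g (X x)))" using X finite_imageI[of "range X" g] by (simp add: finmeas_def image_image)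
  moreover have "(\<lambda>x. g (X x)) -` {v} = X -` (g -` {v})" for v by auto
  ultimately show ?thesis using finmeas_vimage[OF X] by (simp add: finmeas_def)
qed

lemma finmeas_pair: "finmeas M X \<Longrightarrow> finmeas M Y \<Longrightarrow> finmeas M (\<lambda>x. (X x, Y x))"
proof -
  assume X: "finmeas M X" and Y: "finmeas M Y"
  have "finite (range (\<lambda>x. (X x, Y x)))"
    by (rule finite_subset[of _ "range X \<times> range Y"]) (use X Y in \<open>auto simp: finmeas_def\<close>)
  moreover have "(\<lambda>x. (X x, Y x)) -` {v} = X -` {fst v} \<inter> Y -` {snd v}" for v by (cases v) auto
  ultimately show ?thesis using X Y by (auto simp: finmeas_def)
qed

lemma finmeas_const: "space M = UNIV \<Longrightarrow> finmeas M (\<lambda>_. c)"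
proof -
  assume "space M = UNIV"
  then have "UNIV \<in> sets M" by (metis sets.top)
  moreover have "(\<lambda>_. c) -` {v} = (if v = c then UNIV else {})" for v by auto
  ultimately show ?thesis by (auto simp: finmeas_def)
qed

lemma shannon_superset:
  assumes "finite V" "range X \<subseteq> V"
  shows "shannon M X = (\<Sum>v\<in>V. eta (measure M (X -` {v})))"
  unfolding shannon_def
proof (rule sum.mono_neutral_left[OF assms])
  have "X -` {v} = {}" if "v \<notin> range X" for v using that by auto
  then show "\<forall>v\<in>V - range X. eta (measure M (X -` {v})) = 0" by simp
qed

lemma shannon_relabel: "inj_on g (range X) \<Longrightarrow> shannon M (\<lambda>x. g (X x)) = shannon M X"
proof -
  assume g: "inj_on g (range X)"
  have "shannon M (\<lambda>x. g (X x)) = (\<Sum>v\<in>g ` range X. eta (measure M ((\<lambda>x. g (X x)) -` {v})))"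
    by (simp add: shannon_def image_image)
  also have "\<dots> = (\<Sum>v\<in>range X. eta (measure M ((\<lambda>x. g (X x)) -` {g v})))"
    using g by (simp add: sum.reindex)
  also have "\<dots> = shannon M X"
  proof -
    have "(\<lambda>x. g (X x)) -` {g v} = X -` {v}" if "v \<in> range X" for v
      using that g by (auto dest: inj_onD)
    then show ?thesis unfolding shannon_def by (intro sum.cong) auto
  qed
  finally show ?thesis .
qed

locale full_prob_space = prob_space M for M :: "'a measure" +
  assumes space_UNIV: "space M = UNIV"
begin

lemma marginal:
  assumes "finmeas M Y" "A \<in> sets M"
  shows "(\<Sum>y\<in>range Y. measure M (A \<inter> Y -` {y})) = measure M A"
proof -
  have "measure M (\<Union>y\<in>range Y. A \<inter> Y -` {y}) = (\<Sum>y\<in>range Y. measure M (A \<inter> Y -` {y}))"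
    using assms by (intro finite_measure_finite_Union) (auto simp: finmeas_def disjoint_family_on_def)
  moreover have "(\<Union>y\<in>range Y. A \<inter> Y -` {y}) = A" by auto
  ultimately show ?thesis by simp
qed

lemma marginal1: "finmeas M Y \<Longrightarrow> (\<Sum>y\<in>range Y. measure M (Y -` {y})) = 1"
  using marginal[of Y UNIV] prob_space sets.top[of M] by (simp add: space_UNIV)

lemma shannon_nonneg: "0 \<le> shannon M X"
  unfolding shannon_def by (intro sum_nonneg eta_nonneg) auto

lemma shannon_pair:
  assumes "finmeas M X" "finmeas M Y"
  shows "shannon M (\<lambda>w. (X w, Y w)) = (\<Sum>x\<in>range X. \<Sum>y\<in>range Y. eta (measure M (X -` {x} \<inter> Y -` {y})))"
proof -
  have "(\<lambda>w. (X w, Y w)) -` {(x, y)} = X -` {x} \<inter> Y -` {y}" for x y by auto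
  then show ?thesis
    using assms by (subst shannon_superset[of "range X \<times> range Y"])
      (auto simp: finmeas_def sum.cartesian_product intro!: sum.cong)
qed

text \<open>When a cell of mass \<open>a\<close> is split into masses \<open>a_y\<close>, each
  \<open>- ln a_y\<close> is at least \<open>- ln a\<close>; weighting with \<open>a_y\<close> and
  summing compares the entropies cell by cell.\<close>

lemma shannon_le_pair:
  assumes X: "finmeas M X" and Y: "finmeas M Y"
  shows "shannon M X \<le> shannon M (\<lambda>w. (X w, Y w))"
proof -
  have "eta (measure M (X -` {x})) \<le> (\<Sum>y\<in>range Y. eta (measure M (X -` {x} \<inter> Y -` {y})))" for x
  proof -
    let ?a = "\<lambda>y. measure M (X -` {x} \<inter> Y -` {y})"
    have sX: "X -` {x} \<in> sets M" using X by (simp add: finmeas_def)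
    have "eta (measure M (X -` {x})) = (\<Sum>y\<in>range Y. ?a y * - ln (measure M (X -` {x})))"
      unfolding eta_def by (subst marginal[OF Y sX, symmetric]) (simp add: sum_distrib_right[symmetric] sum_negf)
    also have "\<dots> \<le> (\<Sum>y\<in>range Y. eta (?a y))"
    proof (rule sum_mono)
      fix y
      have le: "?a y \<le> measure M (X -` {x})" using sX by (intro finite_measure_mono) auto
      show "?a y * - ln (measure M (X -` {x})) \<le> eta (?a y)"
      proof (cases "?a y = 0")
        case False
        then have "?a y > 0" by (simp add: less_le)
        then have "ln (?a y) \<le> ln (measure M (X -` {x}))" using le by simp
        then have "?a y * ln (?a y) \<le> ?a y * ln (measure M (X -` {x}))" by (intro mult_left_mono) auto
        then show ?thesis by (simp add: eta_def)
      qed simp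
    qed
    finally show ?thesis .
  qed
  then show ?thesis unfolding shannon_pair[OF X Y] unfolding shannon_def by (intro sum_mono) simp
qed

lemma shannon_comp_le:
  assumes X: "finmeas M X"
  shows "shannon M (\<lambda>x. g (X x)) \<le> shannon M X"
proof -
  have "shannon M (\<lambda>x. g (X x)) \<le> shannon M (\<lambda>w. (g (X w), X w))"
    by (rule shannon_le_pair[OF finmeas_comp[OF X] X])
  also have "\<dots> = shannon M X" by (rule shannon_relabel[of "\<lambda>x. (g x, x)"]) (auto simp: inj_on_def)
  finally show ?thesis .
qed

text \<open>Given a value \<open>z\<close>, the joint masses are compared with the masses
  \<open>u v / p\<close> of the conditionally independent coupling, which have the same total.
  Subadditivity and the comparison of itineraries are derived from it.\<close>

lemma shannon_strong_subadditive:
  assumes X: "finmeas M X" and Y: "finmeas M Y" and Z: "finmeas M Z"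
  shows "shannon M (\<lambda>w. (X w, Y w, Z w)) + shannon M Z \<le> shannon M (\<lambda>w. (X w, Z w)) + shannon M (\<lambda>w. (Y w, Z w))"
proof -
  let ?m = "measure M"
  let ?a = "\<lambda>x y z. ?m (X -` {x} \<inter> Y -` {y} \<inter> Z -` {z})"
  let ?u = "\<lambda>x z. ?m (X -` {x} \<inter> Z -` {z})"
  let ?v = "\<lambda>y z. ?m (Y -` {y} \<inter> Z -` {z})"
  let ?p = "\<lambda>z. ?m (Z -` {z})"
  have s [simp]: "X -` {x} \<in> sets M" "Y -` {y} \<in> sets M" "Z -` {z} \<in> sets M" for x y z
    using X Y Z by (auto simp: finmeas_def)
  have sY: "(\<Sum>y\<in>range Y. ?a x y z) = ?u x z" for x z
    using marginal[OF Y sets.Int[OF s(1)[of x] s(3)[of z]]] by (simp add: Int_ac)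
  have sX: "(\<Sum>x\<in>range X. ?a x y z) = ?v y z" for y z
    using marginal[OF X sets.Int[OF s(2)[of y] s(3)[of z]]] by (simp add: Int_ac)
  have sX': "(\<Sum>x\<in>range X. ?u x z) = ?p z" for z
    using marginal[OF X s(3)[of z]] by (simp add: Int_ac)
  have sY': "(\<Sum>y\<in>range Y. ?v y z) = ?p z" for z
    using marginal[OF Y s(3)[of z]] by (simp add: Int_ac)
  have H3: "shannon M (\<lambda>w. (X w, Y w, Z w)) = (\<Sum>z\<in>range Z. \<Sum>x\<in>range X. \<Sum>y\<in>range Y. eta (?a x y z))"
  proof -
    have "shannon M (\<lambda>w. (X w, Y w, Z w)) = shannon M (\<lambda>w. (Z w, (X w, Y w)))"
      by (rule shannon_relabel[of "\<lambda>(z, x, y). (x, y, z)" "\<lambda>w. (Z w, (X w, Y w))", simplified, unfolded split_beta, simplified])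
         (auto simp: inj_on_def)
    also have "\<dots> = (\<Sum>z\<in>range Z. \<Sum>t\<in>range X \<times> range Y. eta (?m (Z -` {z} \<inter> (\<lambda>w. (X w, Y w)) -` {t})))"
    proof -
      have "finite (range Z)" "finite (range X \<times> range Y)" using X Y Z by (auto simp: finmeas_def)
      moreover have "(\<lambda>w. (Z w, (X w, Y w))) -` {(z, t)} = Z -` {z} \<inter> (\<lambda>w. (X w, Y w)) -` {t}" for z t by auto
      ultimately show ?thesis
        by (subst shannon_superset[of "range Z \<times> (range X \<times> range Y)"]) (auto simp: sum.cartesian_product intro!: sum.cong)
    qed
    also have "\<dots> = (\<Sum>z\<in>range Z. \<Sum>x\<in>range X. \<Sum>y\<in>range Y. eta (?a x y z))"
    proof -
      have "Z -` {z} \<inter> (\<lambda>w. (X w, Y w)) -` {(x, y)} = X -` {x} \<inter> Y -` {y} \<inter> Z -` {z}" for x y z by auto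
      then show ?thesis by (auto simp: sum.cartesian_product intro!: sum.cong)
    qed
    finally show ?thesis .
  qed
  have HX: "shannon M (\<lambda>w. (X w, Z w)) = (\<Sum>z\<in>range Z. \<Sum>x\<in>range X. eta (?u x z))"
    unfolding shannon_pair[OF X Z] by (rule sum.swap)
  have HY: "shannon M (\<lambda>w. (Y w, Z w)) = (\<Sum>z\<in>range Z. \<Sum>y\<in>range Y. eta (?v y z))"
    unfolding shannon_pair[OF Y Z] by (rule sum.swap)
  have "(\<Sum>x\<in>range X. \<Sum>y\<in>range Y. eta (?a x y z)) + eta (?p z)
      \<le> (\<Sum>x\<in>range X. eta (?u x z)) + (\<Sum>y\<in>range Y. eta (?v y z))" for z
  proof (cases "?p z = 0")
    case True
    have "?a x y z = 0" "?u x z = 0" "?v y z = 0" for x y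
      using True finite_measure_mono[of "X -` {x} \<inter> Y -` {y} \<inter> Z -` {z}" "Z -` {z}"]
        finite_measure_mono[of "X -` {x} \<inter> Z -` {z}" "Z -` {z}"]
        finite_measure_mono[of "Y -` {y} \<inter> Z -` {z}" "Z -` {z}"]
      by (auto intro!: antisym)
    then show ?thesis using True by simp
  next
    case False
    then have pz: "?p z > 0" by (simp add: less_le)
    have u: "(\<Sum>x\<in>range X. eta (?u x z)) = (\<Sum>x\<in>range X. \<Sum>y\<in>range Y. - ?a x y z * ln (?u x z))"
      by (simp add: eta_def sum_distrib_right[symmetric] sum_negf sY)
    have v: "(\<Sum>y\<in>range Y. eta (?v y z)) = (\<Sum>x\<in>range X. \<Sum>y\<in>range Y. - ?a x y z * ln (?v y z))"
      by (subst sum.swap) (simp add: eta_def sum_distrib_right[symmetric] sum_negf sX)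
    have p: "eta (?p z) = (\<Sum>x\<in>range X. \<Sum>y\<in>range Y. - ?a x y z * ln (?p z))"
      by (simp add: eta_def sum_distrib_right[symmetric] sum_negf sY sX')
    have "(\<Sum>x\<in>range X. \<Sum>y\<in>range Y. eta (?a x y z) + (- ?a x y z * ln (?p z))
             - (- ?a x y z * ln (?u x z)) - (- ?a x y z * ln (?v y z)))
        \<le> (\<Sum>x\<in>range X. \<Sum>y\<in>range Y. ?u x z * ?v y z / ?p z - ?a x y z)"
    proof (intro sum_mono)
      fix x y
      let ?A = "?a x y z"
      show "eta ?A + (- ?A * ln (?p z)) - (- ?A * ln (?u x z)) - (- ?A * ln (?v y z))
          \<le> ?u x z * ?v y z / ?p z - ?A"
      proof (cases "?A = 0")
        case False
        then have A: "?A > 0" by (simp add: less_le)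
        have "?A \<le> ?u x z" "?A \<le> ?v y z" by (auto intro!: finite_measure_mono)
        then have uv: "?u x z > 0" "?v y z > 0" using A by linarith+
        have "?A * (ln (?u x z * ?v y z / ?p z) - ln ?A) \<le> ?u x z * ?v y z / ?p z - ?A"
          using A uv pz by (intro mult_ln_ratio_le) auto
        then show ?thesis using A uv pz by (simp add: ln_mult ln_div eta_def algebra_simps)
      qed simp
    qed
    also have "\<dots> = (\<Sum>x\<in>range X. ?u x z) * (\<Sum>y\<in>range Y. ?v y z) / ?p z - (\<Sum>x\<in>range X. \<Sum>y\<in>range Y. ?a x y z)"
      by (simp add: sum_subtractf sum_product sum_divide_distrib)
    also have "\<dots> = 0" using pz by (simp add: sY sX' sY')
    finally show ?thesis unfolding u v p by (simp add: sum_subtractf sum.distrib sum_negf)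
  qed
  then have "(\<Sum>z\<in>range Z. (\<Sum>x\<in>range X. \<Sum>y\<in>range Y. eta (?a x y z)) + eta (?p z))
      \<le> (\<Sum>z\<in>range Z. (\<Sum>x\<in>range X. eta (?u x z)) + (\<Sum>y\<in>range Y. eta (?v y z)))"
    by (intro sum_mono)
  then show ?thesis unfolding H3 HX HY by (simp add: shannon_def[of M Z] sum.distrib)
qed

lemma shannon_const: "shannon M (\<lambda>_. c) = 0"
proof -
  have "measure M UNIV = 1" using prob_space by (simp add: space_UNIV)
  then show ?thesis by (simp add: shannon_def)
qed

lemma shannon_subadditive:
  assumes X: "finmeas M X" and Y: "finmeas M Y"
  shows "shannon M (\<lambda>w. (X w, Y w)) \<le> shannon M X + shannon M Y"
proof -
  have "shannon M (\<lambda>w. (X w, Y w, ())) + shannon M (\<lambda>w. ()) \<le> shannon M (\<lambda>w. (X w, ())) + shannon M (\<lambda>w. (Y w, ()))"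
    by (rule shannon_strong_subadditive[OF X Y finmeas_const[OF space_UNIV]])
  moreover have "shannon M (\<lambda>w. (X w, Y w)) \<le> shannon M (\<lambda>w. (X w, Y w, ()))"
    using shannon_comp_le[OF finmeas_pair[OF X finmeas_pair[OF Y finmeas_const[OF space_UNIV, of "()"]]],
        of "\<lambda>(x, y, z). (x, y)"] by simp
  moreover have "shannon M (\<lambda>w. (X w, ())) \<le> shannon M X" "shannon M (\<lambda>w. (Y w, ())) \<le> shannon M Y"
    using shannon_comp_le[OF X, of "\<lambda>x. (x, ())"] shannon_comp_le[OF Y, of "\<lambda>x. (x, ())"] by auto
  ultimately show ?thesis by (simp add: shannon_const)
qed

text \<open>The weights \<open>a\<close> are free: 0 gives the logarithm of the number of values,
  suprema of Birkhoff sums give logarithms of partition sums.\<close>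

lemma shannon_le_ln_sum:
  assumes X: "finmeas M X"
  shows "shannon M X + (\<Sum>v\<in>range X. measure M (X -` {v}) * a v) \<le> ln (\<Sum>v\<in>range X. exp (a v))"
  using log_sum_le[of "range X" "\<lambda>v. measure M (X -` {v})" a] X marginal1[OF X]
  by (simp add: shannon_def finmeas_def sum.distrib)

lemma shannon_le_card:
  assumes "finmeas M X" "finite V" "range X \<subseteq> V"
  shows "shannon M X \<le> ln (card V)"
proof -
  have "card (range X) > 0" using assms by (auto simp: finmeas_def card_gt_0_iff)
  moreover have "card (range X) \<le> card V" using assms by (simp add: card_mono)
  ultimately have "ln (card (range X)) \<le> ln (card V)" by simp
  then show ?thesis using shannon_le_ln_sum[OF assms(1), of "\<lambda>_. 0"] by simp
qed

text \<open>Chain rule: \<open>eta_mult\<close> splits the joint entropy with \<open>R\<close> into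
  the entropy of \<open>R\<close> and the average of the conditional entropies. Null fibres carry
  the factor 0, which hides the default value of \<open>uniform_measure\<close> there.\<close>

lemma shannon_condition:
  assumes X: "finmeas M X" and R: "finmeas M R"
  shows "shannon M X \<le> shannon M R + (\<Sum>r\<in>range R. measure M (R -` {r}) * shannon (uniform_measure M (R -` {r})) X)"
proof -
  have "shannon M X \<le> shannon M (\<lambda>w. (X w, R w))" by (rule shannon_le_pair[OF X R])
  also have "\<dots> = (\<Sum>r\<in>range R. \<Sum>x\<in>range X. eta (measure M (X -` {x} \<inter> R -` {r})))"
    unfolding shannon_pair[OF X R] by (rule sum.swap)
  also have "\<dots> = (\<Sum>r\<in>range R. eta (measure M (R -` {r})) + measure M (R -` {r}) * shannon (uniform_measure M (R -` {r})) X)"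
  proof (rule sum.cong[OF refl])
    fix r
    let ?p = "measure M (R -` {r})"
    have sR: "R -` {r} \<in> sets M" using R by (simp add: finmeas_def)
    show "(\<Sum>x\<in>range X. eta (measure M (X -` {x} \<inter> R -` {r}))) = eta ?p + ?p * shannon (uniform_measure M (R -` {r})) X"
    proof (cases "?p = 0")
      case True
      have "measure M (X -` {x} \<inter> R -` {r}) = 0" for x
        using True finite_measure_mono[of "X -` {x} \<inter> R -` {r}" "R -` {r}"] sR
        by (auto intro!: antisym)
      then show ?thesis using True by simp
    next
      case False
      let ?q = "\<lambda>x. measure (uniform_measure M (R -` {r})) (X -` {x})"
      have q: "measure M (X -` {x} \<inter> R -` {r}) = ?p * ?q x" for x
        using False X sR by (subst measure_uniform_measure)
          (auto simp: finmeas_def emeasure_eq_measure Int_commute)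
      have "?p * (\<Sum>x\<in>range X. ?q x) = ?p"
        using marginal[OF X sR] by (simp add: sum_distrib_left q[symmetric] Int_commute)
      then have 1: "(\<Sum>x\<in>range X. ?q x) = 1" using False by simp
      have "(\<Sum>x\<in>range X. eta (measure M (X -` {x} \<inter> R -` {r})))
          = (\<Sum>x\<in>range X. ?p * eta (?q x) + ?q x * eta ?p)"
        unfolding q by (intro sum.cong refl eta_mult) auto
      also have "\<dots> = ?p * shannon (uniform_measure M (R -` {r})) X + eta ?p"
        by (simp add: sum.distrib sum_distrib_left[symmetric] sum_distrib_right[symmetric] 1 shannon_def)
      finally show ?thesis by simp
    qed
  qed
  finally show ?thesis by (simp add: sum.distrib shannon_def[of M R])
qed

end

section \<open>Itineraries and Kolmogorov-Sinai entropy\<close>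

text \<open>Fekete's lemma: division with remainder by a nearly optimal \<open>N\<close> leaves a
  bounded remainder, which vanishes after division by \<open>n\<close>. The index
  \<open>Suc n\<close> keeps the denominator positive.\<close>

lemma subadditive_limit:
  fixes a :: "nat \<Rightarrow> real"
  assumes sub: "\<And>m n. a (m + n) \<le> a m + a n" and nn: "\<And>n. 0 \<le> a n"
  obtains l where "(\<lambda>n. a (Suc n) / real (Suc n)) \<longlonglongrightarrow> l" "\<And>N. N \<ge> 1 \<Longrightarrow> l \<le> a N / real N"
proof -
  define l where "l = (INF N\<in>{1..}. a N / real N)"
  have bdd: "bdd_below ((\<lambda>N. a N / real N) ` {1..})"
    by (rule bdd_belowI[of _ 0]) (auto simp: nn)
  have le: "l \<le> a N / real N" if "N \<ge> 1" for N
    unfolding l_def using that by (intro cINF_lower[OF bdd]) auto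
  have mult: "a (q * N + r) \<le> real q * a N + a r" for q N r
  proof (induction q)
    case (Suc q)
    have "a (Suc q * N + r) = a (N + (q * N + r))" by (simp add: algebra_simps)
    also have "\<dots> \<le> a N + a (q * N + r)" by (rule sub)
    finally show ?case using Suc by (simp add: algebra_simps)
  qed simp
  have "(\<lambda>n. a (Suc n) / real (Suc n)) \<longlonglongrightarrow> l"
  proof (rule LIMSEQ_I)
    fix e :: real assume e: "e > 0"
    have "l < l + e / 2" using e by simp
    then obtain N where N: "N \<ge> 1" "a N / real N < l + e / 2"
      unfolding l_def by (subst (asm) cINF_less_iff[OF _ bdd]) auto
    define C where "C = (\<Sum>r<N. a r)"
    have C: "a r \<le> C" if "r < N" for r
      unfolding C_def using that nn by (intro member_le_sum) auto
    have bound: "a n / real n \<le> a N / real N + C / real n" if n: "n \<ge> 1" for n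
    proof -
      have "a n = a (n div N * N + n mod N)" by simp
      also have "\<dots> \<le> real (n div N) * a N + a (n mod N)" by (rule mult)
      also have "\<dots> \<le> real n / real N * a N + C"
      proof (intro add_mono mult_right_mono nn)
        show "real (n div N) \<le> real n / real N"
          using of_nat_mono[OF div_times_less_eq_dividend[of n N], where 'a = real] N by (simp add: le_divide_eq)
        show "a (n mod N) \<le> C" using N by (intro C) simp
      qed
      finally show ?thesis using n by (simp add: field_simps)
    qed
    obtain n0 :: nat where n0: "real n0 > C / (e / 2)" using reals_Archimedean2 by blast
    show "\<exists>no. \<forall>n\<ge>no. norm (a (Suc n) / real (Suc n) - l) < e"
    proof (intro exI allI impI)
      fix n assume n: "n \<ge> n0"
      have "C / (e / 2) < real (Suc n)" using n0 n by linarith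
      then have "C / real (Suc n) < e / 2" using e by (simp add: field_simps)
      moreover have "a (Suc n) / real (Suc n) \<le> a N / real N + C / real (Suc n)" by (rule bound) simp
      ultimately have "a (Suc n) / real (Suc n) < l + e" using N(2) by linarith
      moreover have "l \<le> a (Suc n) / real (Suc n)" by (rule le) simp
      ultimately show "norm (a (Suc n) / real (Suc n) - l) < e" by simp
    qed
  qed
  then show ?thesis using that le by blast
qed

lemma itin_append: "itin f X (m + n) x = itin f X m x @ itin f X n ((f ^^ m) x)"
proof -
  have "[0..<m + n] = [0..<m] @ map (\<lambda>k. k + m) [0..<n]"
    by (metis add.commute map_add_upt upt_add_eq_append zero_le)
  then show ?thesis by (simp add: itin_def funpow_add)
qed

lemma itin_0 [simp]: "itin f X 0 = (\<lambda>_. [])"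
  by (simp add: itin_def fun_eq_iff)

lemma itin_Suc: "itin f X (Suc n) x = itin f X n x @ [X ((f ^^ n) x)]"
  by (simp add: itin_def)

lemma itin_eq_iff: "itin f X n x = itin f X n y \<longleftrightarrow> (\<forall>k<n. X ((f ^^ k) x) = X ((f ^^ k) y))"
  by (auto simp: itin_def)

definition mpt :: "('a \<Rightarrow> 'a) \<Rightarrow> 'a measure \<Rightarrow> bool" where
  "mpt f M \<longleftrightarrow> f \<in> measurable M M \<and> distr M M f = M"

lemma mpt_measure: "mpt f M \<Longrightarrow> space M = UNIV \<Longrightarrow> A \<in> sets M \<Longrightarrow> measure M (f -` A) = measure M A"
  using measure_distr[of f M M A] by (simp add: mpt_def)

lemma mpt_sets: "mpt f M \<Longrightarrow> space M = UNIV \<Longrightarrow> A \<in> sets M \<Longrightarrow> f -` A \<in> sets M"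
  using measurable_sets[of f M M A] by (simp add: mpt_def)

lemma mpt_iter: "mpt f M \<Longrightarrow> mpt (f ^^ k) M"
proof (induction k)
  case 0
  then show ?case by (simp add: mpt_def id_def distr_id)
next
  case (Suc k)
  then have m: "f \<in> measurable M M" "f ^^ k \<in> measurable M M" "distr M M (f ^^ k) = M" "distr M M f = M"
    by (auto simp: mpt_def)
  have "distr M M (f \<circ> f ^^ k) = M" using distr_distr[OF m(1,2)] m(3,4) by simp
  then show ?case using measurable_comp[OF m(2,1)] by (simp only: mpt_def funpow.simps)
qed

lemma finmeas_mpt: "space M = UNIV \<Longrightarrow> mpt f M \<Longrightarrow> finmeas M X \<Longrightarrow> finmeas M (\<lambda>x. X (f x))"
proof -
  assume M: "space M = UNIV" "mpt f M" and X: "finmeas M X"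
  have "finite (range (\<lambda>x. X (f x)))" by (rule finite_subset[of _ "range X"]) (use X in \<open>auto simp: finmeas_def\<close>)
  moreover have "(\<lambda>x. X (f x)) -` {v} = f -` (X -` {v})" for v by auto
  ultimately show ?thesis using mpt_sets[OF M(2,1)] X by (simp add: finmeas_def)
qed

lemma finmeas_itin: "space M = UNIV \<Longrightarrow> mpt f M \<Longrightarrow> finmeas M X \<Longrightarrow> finmeas M (itin f X n)"
proof (induction n)
  case 0
  then show ?case by (simp add: finmeas_const)
next
  case (Suc n)
  have "finmeas M (\<lambda>x. (itin f X n x, X ((f ^^ n) x)))"
    using Suc by (intro finmeas_pair finmeas_mpt[OF _ mpt_iter]) auto
  from finmeas_comp[OF this, of "\<lambda>(a, b). a @ [b]"] show ?case
    by (simp add: itin_Suc[abs_def])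
qed

lemma shannon_mpt:
  assumes "space M = UNIV" "mpt f M" "finmeas M X"
  shows "shannon M (\<lambda>x. X (f x)) = shannon M X"
proof -
  have "shannon M (\<lambda>x. X (f x)) = (\<Sum>v\<in>range X. eta (measure M ((\<lambda>x. X (f x)) -` {v})))"
    using assms(3) by (intro shannon_superset) (auto simp: finmeas_def)
  also have "\<dots> = (\<Sum>v\<in>range X. eta (measure M (X -` {v})))"
  proof (rule sum.cong[OF refl])
    fix v
    have "(\<lambda>x. X (f x)) -` {v} = f -` (X -` {v})" by auto
    then show "eta (measure M ((\<lambda>x. X (f x)) -` {v})) = eta (measure M (X -` {v}))"
      using mpt_measure[OF assms(2,1)] assms(3) by (simp add: finmeas_def)
  qed
  finally show ?thesis by (simp add: shannon_def)
qed

locale mpt_space = full_prob_space M for M :: "'a measure" +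
  fixes f :: "'a \<Rightarrow> 'a"
  assumes mpt: "mpt f M"
begin

lemma iter_finmeas: "finmeas M X \<Longrightarrow> finmeas M (\<lambda>x. X ((f ^^ k) x))"
  by (rule finmeas_mpt[OF space_UNIV mpt_iter[OF mpt]])

lemma iter_HH: "finmeas M X \<Longrightarrow> shannon M (\<lambda>x. X ((f ^^ k) x)) = shannon M X"
  by (rule shannon_mpt[OF space_UNIV mpt_iter[OF mpt]])

lemma itin_finmeas: "finmeas M X \<Longrightarrow> finmeas M (itin f X n)"
  by (rule finmeas_itin[OF space_UNIV mpt])

lemma shannon_itin_add:
  assumes X: "finmeas M X"
  shows "shannon M (itin f X (m + n)) \<le> shannon M (itin f X m) + shannon M (itin f X n)"
proof -
  have "shannon M (itin f X (m + n)) = shannon M (\<lambda>x. (\<lambda>(a, b). a @ b) (itin f X m x, itin f X n ((f ^^ m) x)))"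
    by (simp add: itin_append[abs_def])
  also have "\<dots> \<le> shannon M (\<lambda>x. (itin f X m x, itin f X n ((f ^^ m) x)))"
    by (intro shannon_comp_le finmeas_pair itin_finmeas iter_finmeas X)
  also have "\<dots> \<le> shannon M (itin f X m) + shannon M (\<lambda>x. itin f X n ((f ^^ m) x))"
    by (intro shannon_subadditive itin_finmeas iter_finmeas X)
  also have "shannon M (\<lambda>x. itin f X n ((f ^^ m) x)) = shannon M (itin f X n)"
    by (intro iter_HH itin_finmeas X)
  finally show ?thesis .
qed

lemma hent:
  assumes X: "finmeas M X"
  shows hent_LIMSEQ: "(\<lambda>n. shannon M (itin f X (Suc n)) / real (Suc n)) \<longlonglongrightarrow> hent f M X"
    and hent_le: "N \<ge> 1 \<Longrightarrow> hent f M X \<le> shannon M (itin f X N) / real N"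
proof -
  obtain l where l: "(\<lambda>n. shannon M (itin f X (Suc n)) / real (Suc n)) \<longlonglongrightarrow> l"
    "\<And>N. N \<ge> 1 \<Longrightarrow> l \<le> shannon M (itin f X N) / real N"
    by (rule subadditive_limit[of "\<lambda>n. shannon M (itin f X n)", OF shannon_itin_add[OF X] shannon_nonneg]) (rule that)
  then show "(\<lambda>n. shannon M (itin f X (Suc n)) / real (Suc n)) \<longlonglongrightarrow> hent f M X"
    "N \<ge> 1 \<Longrightarrow> hent f M X \<le> shannon M (itin f X N) / real N"
    unfolding hent_def using limI[OF l(1)] by auto
qed

text \<open>The conditional entropy of the \<open>X\<close>-itinerary given the
  \<open>Y\<close>-itinerary grows in each step by at most the conditional entropy of
  \<open>X\<close> given \<open>Y\<close>: conditioning on more only lowers it, and by invariance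
  all steps cost the same.\<close>

lemma shannon_itin_compare:
  assumes X: "finmeas M X" and Y: "finmeas M Y"
  shows "shannon M (itin f X n) \<le> shannon M (itin f Y n) + real n * (shannon M (\<lambda>x. (X x, Y x)) - shannon M Y)"
proof -
  let ?D = "shannon M (\<lambda>x. (X x, Y x)) - shannon M Y"
  have "shannon M (\<lambda>x. (itin f X n x, itin f Y n x)) \<le> shannon M (itin f Y n) + real n * ?D"
  proof (induction n)
    case 0
    show ?case by (simp add: shannon_const)
  next
    case (Suc n)
    let ?A = "itin f X n" and ?B = "itin f Y n"
    let ?X = "\<lambda>x. X ((f ^^ n) x)" and ?Y = "\<lambda>x. Y ((f ^^ n) x)"
    note fm = itin_finmeas[OF X, of n] itin_finmeas[OF Y, of n] iter_finmeas[OF X, of n] iter_finmeas[OF Y, of n]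
    have rel: "shannon M (\<lambda>x. (itin f X (Suc n) x, itin f Y (Suc n) x)) \<le> shannon M (\<lambda>x. (?X x, (?A x, ?B x), ?Y x))"
      using shannon_comp_le[OF finmeas_pair[OF fm(3) finmeas_pair[OF finmeas_pair[OF fm(1,2)] fm(4)]],
          of "\<lambda>(x, (a, b), y). (a @ [x], b @ [y])"] by (simp add: itin_Suc)
    \<comment> \<open>Here the past is dropped from the condition on the new symbol of
      \<open>X\<close>; in \<open>2\<close> the \<open>X\<close>-past is dropped from the condition
      on the new symbol of \<open>Y\<close>.\<close>
    have 1: "shannon M (\<lambda>x. (?X x, (?A x, ?B x), ?Y x)) + shannon M ?Y \<le> shannon M (\<lambda>x. (?X x, ?Y x)) + shannon M (\<lambda>x. ((?A x, ?B x), ?Y x))"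
      by (rule shannon_strong_subadditive[OF fm(3) finmeas_pair[OF fm(1,2)] fm(4)])
    have 2: "shannon M (\<lambda>x. (?A x, ?Y x, ?B x)) + shannon M ?B \<le> shannon M (\<lambda>x. (?A x, ?B x)) + shannon M (\<lambda>x. (?Y x, ?B x))"
      by (rule shannon_strong_subadditive[OF fm(1,4,2)])
    have 3: "shannon M (\<lambda>x. ((?A x, ?B x), ?Y x)) \<le> shannon M (\<lambda>x. (?A x, ?Y x, ?B x))"
      using shannon_comp_le[OF finmeas_pair[OF fm(1) finmeas_pair[OF fm(4,2)]], of "\<lambda>(a, y, b). ((a, b), y)"] by simp
    have 4: "shannon M (\<lambda>x. (?Y x, ?B x)) = shannon M (itin f Y (Suc n))"
      using shannon_relabel[of "\<lambda>(y, b). b @ [y]" "\<lambda>x. (?Y x, ?B x)" M] by (simp add: itin_Suc[abs_def] inj_on_def)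
    have 5: "shannon M (\<lambda>x. (?X x, ?Y x)) = shannon M (\<lambda>x. (X x, Y x))" "shannon M ?Y = shannon M Y"
      using iter_HH[OF finmeas_pair[OF X Y]] iter_HH[OF Y] by auto
    show ?case using rel 1 2 3 4 5 Suc by (simp add: algebra_simps)
  qed
  moreover have "shannon M (itin f X n) \<le> shannon M (\<lambda>x. (itin f X n x, itin f Y n x))"
    by (intro shannon_le_pair itin_finmeas X Y)
  ultimately show ?thesis by linarith
qed

end

section \<open>Agreement with the entropy defined through partitions\<close>

lemma join_part_fibres:
  fixes X :: "'a \<Rightarrow> 'b"
  assumes "inj_on c (range X)" "\<And>v. v \<in> range X \<Longrightarrow> c v = X -` {v}"
  shows "join_part f (c ` range X) n = (\<lambda>v. itin f X n -` {v}) ` range (itin f X n)"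
proof (intro equalityI subsetI)
  fix W assume "W \<in> join_part f (c ` range X) n"
  then obtain d where d: "W = (\<Inter>k<n. (f ^^ k) -` d k)" "\<forall>k<n. d k \<in> c ` range X" "W \<noteq> {}"
    by (auto simp: join_part_def)
  then obtain x where x: "x \<in> W" by blast
  have dk: "d k = X -` {X ((f ^^ k) x)}" if k: "k < n" for k
  proof -
    obtain v where v: "v \<in> range X" "d k = c v" using d(2) k by blast
    then have "d k = X -` {v}" using assms(2) by simp
    moreover have "(f ^^ k) x \<in> d k" using x d(1) k by auto
    ultimately show ?thesis by auto
  qed
  have "W = itin f X n -` {itin f X n x}"
    unfolding d(1) using dk by (auto simp: itin_eq_iff)
  then show "W \<in> (\<lambda>v. itin f X n -` {v}) ` range (itin f X n)" by blast
next
  fix W assume "W \<in> (\<lambda>v. itin f X n -` {v}) ` range (itin f X n)"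
  then obtain x where x: "W = itin f X n -` {itin f X n x}" by auto
  have "W = (\<Inter>k<n. (f ^^ k) -` c (X ((f ^^ k) x)))"
    unfolding x using assms(2) by (auto simp: itin_eq_iff)
  moreover have "x \<in> W" using x by simp
  ultimately show "W \<in> join_part f (c ` range X) n"
    unfolding join_part_def by (auto intro!: exI[of _ "\<lambda>k. c (X ((f ^^ k) x))"])
qed

lemma entropy_rel_fibres:
  assumes "inj_on c (range X)" "\<And>v. v \<in> range X \<Longrightarrow> c v = X -` {v}"
  shows "entropy_rel f M (c ` range X) = hent f M X"
proof -
  have "part_entropy M (join_part f (c ` range X) n) = shannon M (itin f X n)" for n
  proof -
    have "inj_on (\<lambda>v. itin f X n -` {v}) (range (itin f X n))" by (auto simp: inj_on_def)
    then show ?thesis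
      unfolding part_entropy_def shannon_def
      by (subst join_part_fibres[OF assms]) (simp_all only: sum.reindex o_def eta_def sum_negf mult_minus_left)
  qed
  then show ?thesis unfolding entropy_rel_def hent_def by simp
qed

lemma ks_ge:
  assumes M: "space M = UNIV" and X: "finmeas M X"
  shows "ereal (hent f M X) \<le> ks_entropy f M"
proof -
  let ?c = "\<lambda>v. X -` {v}"
  have "meas_partition M (?c ` range X)"
    using X M by (auto simp: meas_partition_def finmeas_def disjoint_def)
  moreover have "entropy_rel f M (?c ` range X) = hent f M X"
    by (rule entropy_rel_fibres) (auto simp: inj_on_def)
  ultimately show ?thesis
    unfolding ks_entropy_def using SUP_upper[of "?c ` range X" "{Q. meas_partition M Q}" "\<lambda>Q. ereal (entropy_rel f M Q)"]
    by simp
qed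

lemma partition_fibres:
  assumes M: "space M = UNIV" and Q: "meas_partition M Q"
  obtains X :: "'a \<Rightarrow> 'a set" where "finmeas M X" "entropy_rel f M Q = hent f M X"
proof -
  have "\<exists>A. A \<in> Q \<and> x \<in> A" for x using Q M by (auto simp: meas_partition_def)
  then obtain X where X: "\<And>x. X x \<in> Q" "\<And>x. x \<in> X x" by metis
  have uniq: "A = X x" if "A \<in> Q" "x \<in> A" for A x
    using that X[of x] Q by (auto simp: meas_partition_def disjoint_def)
  have ran: "range X = Q"
  proof
    show "range X \<subseteq> Q" using X by auto
    show "Q \<subseteq> range X"
    proof
      fix A assume A: "A \<in> Q"
      then have "A \<noteq> {}" using Q by (auto simp: meas_partition_def)
      then obtain x where "x \<in> A" by blast
      then show "A \<in> range X" using uniq[OF A] by auto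
    qed
  qed
  have fib: "X -` {A} = A" if "A \<in> Q" for A
    using X uniq[OF that] by auto
  have "finmeas M X"
    unfolding finmeas_def
  proof (intro conjI allI)
    show "finite (range X)" using Q ran by (simp add: meas_partition_def)
    show "X -` {v} \<in> sets M" for v
    proof (cases "v \<in> Q")
      case True
      then show ?thesis using fib Q by (auto simp: meas_partition_def)
    next
      case False
      then have "X -` {v} = {}" using X by auto
      then show ?thesis by simp
    qed
  qed
  moreover have "entropy_rel f M ((\<lambda>A. A) ` range X) = hent f M X"
    by (rule entropy_rel_fibres) (auto simp: fib ran)
  ultimately show ?thesis using that by (simp add: ran)
qed

lemma ks_less:
  assumes M: "space M = UNIV" and c: "c < ks_entropy f M"
  obtains X :: "'a \<Rightarrow> 'a set" where "finmeas M X" "c < ereal (hent f M X)"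
proof -
  obtain Q where "meas_partition M Q" "c < ereal (entropy_rel f M Q)"
    using c unfolding ks_entropy_def less_SUP_iff by auto
  moreover from this(1) obtain X :: "'a \<Rightarrow> 'a set" where "finmeas M X" "entropy_rel f M Q = hent f M X"
    by (rule partition_fibres[OF M])
  ultimately show ?thesis using that[of X] by simp
qed

lemma ks_le:
  fixes M :: "'a measure"
  assumes M: "space M = UNIV" and c: "\<And>X :: 'a \<Rightarrow> 'a set. finmeas M X \<Longrightarrow> ereal (hent f M X) \<le> c"
  shows "ks_entropy f M \<le> c"
proof (rule ccontr)
  assume "\<not> ks_entropy f M \<le> c"
  then have "c < ks_entropy f M" by simp
  then obtain X :: "'a \<Rightarrow> 'a set" where "finmeas M X" "c < ereal (hent f M X)" by (rule ks_less[OF M])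
  then show False using c[of X] by simp
qed

section \<open>The Riesz representation on a compact metric space\<close>

locale mean_functional =
  fixes L :: "('a::metric_space \<Rightarrow> real) \<Rightarrow> real"
  assumes cpt: "compact (UNIV :: 'a set)"
    and L_add: "\<And>g h. continuous_on UNIV g \<Longrightarrow> continuous_on UNIV h \<Longrightarrow> L (\<lambda>x. g x + h x) = L g + L h"
    and L_scale: "\<And>g c. continuous_on UNIV g \<Longrightarrow> L (\<lambda>x. c * g x) = c * L g"
    and L_pos: "\<And>g. continuous_on UNIV g \<Longrightarrow> (\<And>x. 0 \<le> g x) \<Longrightarrow> 0 \<le> L g"
    and L_one: "L (\<lambda>_. 1) = 1"
begin

lemma L_const: "L (\<lambda>_. c) = c"
  using L_scale[of "\<lambda>_. 1" c] L_one by simp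

lemma L_diff: "continuous_on UNIV g \<Longrightarrow> continuous_on UNIV h \<Longrightarrow> L (\<lambda>x. g x - h x) = L g - L h"
proof -
  assume g: "continuous_on UNIV g" and h: "continuous_on UNIV h"
  have "L (\<lambda>x. g x + (- 1) * h x) = L g + L (\<lambda>x. (- 1) * h x)"
    by (rule L_add) (intro g h continuous_intros)+
  then show ?thesis using L_scale[OF h, of "- 1"] by simp
qed

lemma L_mono: "continuous_on UNIV g \<Longrightarrow> continuous_on UNIV h \<Longrightarrow> (\<And>x. g x \<le> h x) \<Longrightarrow> L g \<le> L h"
  using L_pos[of "\<lambda>x. h x - g x"] L_diff[of h g] by (simp add: continuous_on_diff)

lemma L_sum: "finite I \<Longrightarrow> (\<And>i. i \<in> I \<Longrightarrow> continuous_on UNIV (g i)) \<Longrightarrow> L (\<lambda>x. \<Sum>i\<in>I. g i x) = (\<Sum>i\<in>I. L (g i))"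
proof (induction I rule: finite_induct)
  case empty
  then show ?case using L_const[of 0] by simp
next
  case (insert a I)
  then show ?case using L_add[of "g a" "\<lambda>x. \<Sum>i\<in>I. g i x"] by (simp add: continuous_on_sum)
qed

section \<open>The outer measure of a positive functional\<close>

definition covers :: "'a set \<Rightarrow> (nat \<Rightarrow> 'a \<Rightarrow> real) set" where
  "covers A = {gs. (\<forall>i. continuous_on UNIV (gs i) \<and> (\<forall>x. 0 \<le> gs i x)) \<and> (\<forall>x\<in>A. 1 \<le> (\<Sum>i. ennreal (gs i x)))}"

text \<open>Countable covers by nonnegative continuous functions take the place of open sets:
  countable subadditivity only rearranges a double series, and in \<open>ennreal\<close> every such
  series converges.\<close>

definition outer :: "'a set \<Rightarrow> ennreal" where
  "outer A = (INF gs\<in>covers A. \<Sum>i. ennreal (L (gs i)))"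

lemma coversI:
  assumes "\<And>i. continuous_on UNIV (gs i)" "\<And>i x. 0 \<le> gs i x" "\<And>x. x \<in> A \<Longrightarrow> 1 \<le> (\<Sum>i. ennreal (gs i x))"
  shows "gs \<in> covers A"
  using assms by (auto simp: covers_def)

lemma outer_le: "gs \<in> covers A \<Longrightarrow> outer A \<le> (\<Sum>i. ennreal (L (gs i)))"
  unfolding outer_def by (rule INF_lower)

lemma outer_le_L:
  assumes "continuous_on UNIV g" "\<And>x. 0 \<le> g x" "\<And>x. x \<in> A \<Longrightarrow> 1 \<le> g x"
  shows "outer A \<le> ennreal (L g)"
proof -
  define gs where "gs = (\<lambda>i::nat. if i = 0 then g else (\<lambda>_. 0))"
  have s: "(\<Sum>i. ennreal (gs i x)) = ennreal (g x)" for x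
    by (subst suminf_finite[of "{0}"]) (auto simp: gs_def)
  have "gs \<in> covers A"
  proof (rule coversI)
    show "continuous_on UNIV (gs i)" for i using assms(1) by (simp add: gs_def)
    show "0 \<le> gs i x" for i x using assms(2) by (simp add: gs_def)
    show "1 \<le> (\<Sum>i. ennreal (gs i x))" if "x \<in> A" for x
      using assms(3)[OF that] by (simp add: s)
  qed
  moreover have "(\<Sum>i. ennreal (L (gs i))) = ennreal (L g)"
    using L_const[of 0] by (subst suminf_finite[of "{0}"]) (auto simp: gs_def)
  ultimately show ?thesis using outer_le[of gs A] by simp
qed

lemma outer_le_1: "outer A \<le> 1"
  using outer_le_L[of "\<lambda>_. 1" A] L_one by simp

lemma outer_finite: "outer A < \<infinity>"
  using outer_le_1[of A] by (simp add: le_less_trans)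

lemma outer_approx:
  assumes "e > 0"
  obtains gs where "gs \<in> covers A" "(\<Sum>i. ennreal (L (gs i))) \<le> outer A + e"
proof -
  have "outer A < outer A + e"
    using outer_finite[of A] assms by (metis add.right_neutral ennreal_add_left_cancel_less infinity_ennreal_def)
  then obtain gs where "gs \<in> covers A" "(\<Sum>i. ennreal (L (gs i))) < outer A + e"
    unfolding outer_def INF_less_iff by auto
  then show ?thesis using that by (meson less_imp_le)
qed

lemma outer_mono: "A \<subseteq> B \<Longrightarrow> outer A \<le> outer B"
  unfolding outer_def by (rule INF_superset_mono) (auto simp: covers_def)

lemma outer_empty: "outer {} = 0"
  using outer_le_L[of "\<lambda>_. 0" "{}"] L_const[of 0] by simp

lemma outer_UN: "outer (\<Union>i. A i) \<le> (\<Sum>i. outer (A i))"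
proof (rule ennreal_le_epsilon)
  fix e :: real assume e: "e > 0"
  have "\<exists>gs. gs \<in> covers (A n) \<and> (\<Sum>i. ennreal (L (gs i))) \<le> outer (A n) + ennreal (e * (1/2) ^ Suc n)" for n
    using outer_approx[of "ennreal (e * (1/2) ^ Suc n)" "A n"] e by (auto simp: ennreal_less_zero_iff)
  then obtain gs where gs: "\<And>n. gs n \<in> covers (A n)"
    "\<And>n. (\<Sum>i. ennreal (L (gs n i))) \<le> outer (A n) + ennreal (e * (1/2) ^ Suc n)"
    by metis
  define h where "h k = gs (fst (prod_decode k)) (snd (prod_decode k))" for k
  have "h \<in> covers (\<Union>i. A i)"
  proof (rule coversI)
    show "continuous_on UNIV (h i)" "0 \<le> h i x" for i x
      using gs(1)[of "fst (prod_decode i)"] by (auto simp: h_def covers_def)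
    show "1 \<le> (\<Sum>i. ennreal (h i x))" if x: "x \<in> (\<Union>i. A i)" for x
    proof -
      obtain n where n: "x \<in> A n" using x by auto
      have "1 \<le> (\<Sum>i. ennreal (gs n i x))" using gs(1)[of n] n by (auto simp: covers_def)
      also have "\<dots> \<le> (\<Sum>m. \<Sum>i. ennreal (gs m i x))"
        using sum_le_suminf[of "\<lambda>m. \<Sum>i. ennreal (gs m i x)" "{n}"] by simp
      also have "\<dots> = (\<Sum>i. ennreal (h i x))"
        using suminf_ennreal_2dimen[of "\<lambda>m. \<Sum>i. ennreal (gs m i x)" "\<lambda>p. ennreal (gs (fst p) (snd p) x)"]
        by (simp add: h_def)
      finally show ?thesis .
    qed
  qed
  then have "outer (\<Union>i. A i) \<le> (\<Sum>i. ennreal (L (h i)))" by (rule outer_le)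
  also have "\<dots> = (\<Sum>m. \<Sum>i. ennreal (L (gs m i)))"
    using suminf_ennreal_2dimen[of "\<lambda>m. \<Sum>i. ennreal (L (gs m i))" "\<lambda>p. ennreal (L (gs (fst p) (snd p)))"]
    by (simp add: h_def)
  also have "\<dots> \<le> (\<Sum>m. outer (A m) + ennreal (e * (1/2) ^ Suc m))"
    by (intro suminf_le gs(2)) auto
  also have "\<dots> = (\<Sum>m. outer (A m)) + (\<Sum>m. ennreal (e * (1/2) ^ Suc m))"
    by (rule suminf_add[symmetric]) auto
  also have "(\<Sum>m. ennreal (e * (1/2) ^ Suc m)) = ennreal e"
    using e sums_mult[OF power_half_series, of e] by (intro suminf_ennreal_eq) auto
  finally show "outer (\<Union>i. A i) \<le> (\<Sum>i. outer (A i)) + ennreal e" .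
qed

lemma outer_measure_space: "outer_measure_space (Pow UNIV) outer"
  unfolding outer_measure_space_def positive_def increasing_def countably_subadditive_def
  using outer_empty outer_mono outer_UN by simp

lemma outer_Un: "outer (A \<union> B) \<le> outer A + outer B"
proof -
  have "outer (A \<union> B) \<le> (\<Sum>i. outer (binaryset A B i))"
    using outer_UN[of "binaryset A B"] by (simp add: UN_binaryset_eq)
  also have "\<dots> = outer A + outer B"
    using suminf_binaryset_eq[of outer A B] outer_empty by simp
  finally show ?thesis .
qed

text \<open>Caratheodory's criterion for open sets. A cover of \<open>T\<close> multiplied by the
  increments of functions increasing to the indicator of \<open>U\<close> covers
  \<open>U \<inter> T\<close>; multiplied by \<open>1 - psi K\<close> it covers
  \<open>T - U\<close>. The first \<open>K\<close> increments and this factor add up to the original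
  cover.\<close>

lemma outer_open_split:
  assumes U: "open U"
  shows "outer (U \<inter> T) + outer (T - U) \<le> outer T"
proof (cases "U = UNIV")
  case True
  then show ?thesis by (simp add: outer_empty)
next
  case False
  have cl: "closed (- U)" "- U \<noteq> {}" using U False by auto
  define psi where "psi K x = min 1 (real K * infdist x (- U))" for K :: nat and x
  have psi0: "psi 0 x = 0" for x by (simp add: psi_def)
  have psi01: "0 \<le> psi K x" "psi K x \<le> 1" for K x by (auto simp: psi_def infdist_nonneg)
  have psi_mono: "psi K x \<le> psi (Suc K) x" for K x
    unfolding psi_def by (intro min.mono order_refl mult_right_mono infdist_nonneg) simp
  have psi_cont: "continuous_on UNIV (psi K)" for K
    unfolding psi_def by (intro continuous_intros)
  have psi_out: "psi K x = 0" if "x \<notin> U" for K x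
    using that by (simp add: psi_def)
  have psi_lim: "(\<lambda>K. psi K x) \<longlonglongrightarrow> 1" if "x \<in> U" for x
  proof -
    have pos: "infdist x (- U) > 0" using infdist_pos_not_in_closed[OF cl] that by auto
    obtain K0 :: nat where K0: "real K0 > 1 / infdist x (- U)" using reals_Archimedean2 by blast
    have "psi K x = 1" if "K \<ge> K0" for K
    proof -
      have "real K > 1 / infdist x (- U)" using K0 that by linarith
      then have "1 < real K * infdist x (- U)" using pos by (simp add: field_simps)
      then show ?thesis by (simp add: psi_def)
    qed
    then have "eventually (\<lambda>K. psi K x = 1) sequentially" unfolding eventually_sequentially by blast
    then show ?thesis by (rule tendsto_eventually)
  qed
  show ?thesis unfolding outer_def[of T]
  proof (rule INF_greatest)
    fix gs assume gs: "gs \<in> covers T"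
    then have gc: "continuous_on UNIV (gs i)" and g0: "0 \<le> gs i x" for i x by (auto simp: covers_def)
    define h where "h k i x = gs i x * (psi (Suc k) x - psi k x)" for k i x
    have hc: "continuous_on UNIV (h k i)" for k i
      unfolding h_def by (intro continuous_intros gc psi_cont)
    have h0: "0 \<le> h k i x" for k i x using g0 psi_mono by (simp add: h_def)
    define H where "H = (\<lambda>k. h (fst (prod_decode k)) (snd (prod_decode k)))"
    have "H \<in> covers (U \<inter> T)"
    proof (rule coversI)
      show "continuous_on UNIV (H i)" "0 \<le> H i x" for i x by (auto simp: H_def hc h0)
      show "1 \<le> (\<Sum>i. ennreal (H i x))" if x: "x \<in> U \<inter> T" for x
      proof -
        have "(\<lambda>k. psi (Suc k) x - psi k x) sums (1 - psi 0 x)"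
          using x by (intro telescope_sums psi_lim) auto
        then have d: "(\<Sum>k. ennreal (psi (Suc k) x - psi k x)) = 1"
          using psi_mono by (subst suminf_ennreal_eq) (auto simp: psi0)
        have "1 \<le> (\<Sum>i. ennreal (gs i x))" using gs x by (auto simp: covers_def)
        also have "\<dots> = (\<Sum>k. ennreal (psi (Suc k) x - psi k x) * (\<Sum>i. ennreal (gs i x)))"
          using d by (simp add: mult.commute[of _ "\<Sum>i. ennreal (gs i x)"])
        also have "\<dots> = (\<Sum>k. \<Sum>i. ennreal (h k i x))"
          using g0 psi_mono by (simp add: h_def ennreal_suminf_cmult[symmetric] ennreal_mult' mult.commute[of "gs _ x"] del: ennreal_suminf_cmult)
        also have "\<dots> = (\<Sum>i. ennreal (H i x))"
          using suminf_ennreal_2dimen[of "\<lambda>k. \<Sum>i. ennreal (h k i x)" "\<lambda>p. ennreal (h (fst p) (snd p) x)"]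
          by (simp add: H_def)
        finally show ?thesis .
      qed
    qed
    then have "outer (U \<inter> T) \<le> (\<Sum>i. ennreal (L (H i)))" by (rule outer_le)
    also have "\<dots> = (\<Sum>k. \<Sum>i. ennreal (L (h k i)))"
      using suminf_ennreal_2dimen[of "\<lambda>k. \<Sum>i. ennreal (L (h k i))" "\<lambda>p. ennreal (L (h (fst p) (snd p)))"]
      by (simp add: H_def)
    finally have A: "outer (U \<inter> T) \<le> (\<Sum>k. \<Sum>i. ennreal (L (h k i)))" .
    have B: "(\<Sum>k<K. \<Sum>i. ennreal (L (h k i))) + outer (T - U) \<le> (\<Sum>i. ennreal (L (gs i)))" for K
    proof -
      have "(\<lambda>i x. gs i x * (1 - psi K x)) \<in> covers (T - U)"
      proof (rule coversI)
        show "continuous_on UNIV (\<lambda>x. gs i x * (1 - psi K x))" "0 \<le> gs i x * (1 - psi K x)" for i x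
          using g0 psi01 by (auto intro!: continuous_intros gc psi_cont)
        show "1 \<le> (\<Sum>i. ennreal (gs i x * (1 - psi K x)))" if "x \<in> T - U" for x
          using gs that by (auto simp: psi_out covers_def)
      qed
      then have o: "outer (T - U) \<le> (\<Sum>i. ennreal (L (\<lambda>x. gs i x * (1 - psi K x))))" by (rule outer_le)
      have t: "(\<Sum>k<K. L (h k i)) = L (\<lambda>x. gs i x * psi K x)" for i
      proof -
        have "(\<Sum>k<K. L (h k i)) = L (\<lambda>x. \<Sum>k<K. h k i x)" by (rule L_sum[symmetric]) (auto simp: hc)
        also have "(\<lambda>x. \<Sum>k<K. h k i x) = (\<lambda>x. gs i x * psi K x)"
          using sum_lessThan_telescope[of "\<lambda>k. psi k x" K for x]
          by (simp add: h_def sum_distrib_left[symmetric] psi0)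
        finally show ?thesis .
      qed
      have "(\<Sum>k<K. \<Sum>i. ennreal (L (h k i))) = (\<Sum>i. \<Sum>k<K. ennreal (L (h k i)))"
        by (rule suminf_sum[symmetric]) auto
      also have "\<dots> = (\<Sum>i. ennreal (L (\<lambda>x. gs i x * psi K x)))"
        using L_pos[OF hc h0] by (simp add: t[symmetric] sum_ennreal)
      finally have "(\<Sum>k<K. \<Sum>i. ennreal (L (h k i))) + outer (T - U)
          \<le> (\<Sum>i. ennreal (L (\<lambda>x. gs i x * psi K x))) + (\<Sum>i. ennreal (L (\<lambda>x. gs i x * (1 - psi K x))))"
        using o by (simp add: add_left_mono)
      also have "\<dots> = (\<Sum>i. ennreal (L (\<lambda>x. gs i x * psi K x)) + ennreal (L (\<lambda>x. gs i x * (1 - psi K x))))"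
        by (rule suminf_add) auto
      also have "\<dots> = (\<Sum>i. ennreal (L (gs i)))"
      proof (rule suminf_cong)
        fix i
        have c: "continuous_on UNIV (\<lambda>x. gs i x * psi K x)" "continuous_on UNIV (\<lambda>x. gs i x * (1 - psi K x))"
          by (intro continuous_intros gc psi_cont)+
        have "0 \<le> L (\<lambda>x. gs i x * psi K x)" "0 \<le> L (\<lambda>x. gs i x * (1 - psi K x))"
          using g0 psi01 by (auto intro!: L_pos c)
        moreover have "L (\<lambda>x. gs i x * psi K x) + L (\<lambda>x. gs i x * (1 - psi K x)) = L (gs i)"
          using L_add[OF c] by (simp add: algebra_simps)
        ultimately show "ennreal (L (\<lambda>x. gs i x * psi K x)) + ennreal (L (\<lambda>x. gs i x * (1 - psi K x))) = ennreal (L (gs i))"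
          by (simp add: ennreal_plus[symmetric] del: ennreal_plus)
      qed
      finally show ?thesis .
    qed
    have "(\<Sum>k. \<Sum>i. ennreal (L (h k i))) + outer (T - U) = (SUP K. (\<Sum>k<K. \<Sum>i. ennreal (L (h k i))) + outer (T - U))"
      by (simp add: suminf_eq_SUP ennreal_SUP_add_left)
    also have "\<dots> \<le> (\<Sum>i. ennreal (L (gs i)))" by (rule SUP_least) (rule B)
    finally show "outer (U \<inter> T) + outer (T - U) \<le> (\<Sum>i. ennreal (L (gs i)))"
      using A by (meson add_right_mono order_trans)
  qed
qed

text \<open>By compactness finitely many terms of a cover already exceed \<open>1 - e\<close>
  everywhere, and monotonicity of \<open>L\<close> bounds their total from below.\<close>

lemma outer_UNIV: "outer UNIV = 1"
proof (rule antisym[OF outer_le_1])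
  show "1 \<le> outer UNIV" unfolding outer_def
  proof (rule INF_greatest)
    fix gs assume gs: "gs \<in> covers UNIV"
    then have gc: "continuous_on UNIV (gs i)" and g0: "0 \<le> gs i x" for i x by (auto simp: covers_def)
    show "1 \<le> (\<Sum>i. ennreal (L (gs i)))"
    proof (rule ennreal_le_epsilon)
      fix e :: real assume e: "e > 0"
      let ?U = "\<lambda>N. {x. (\<Sum>i<N. gs i x) > 1 - e}"
      have "open (?U N)" for N by (rule open_Collect_less) (intro continuous_intros gc)+
      moreover have "UNIV \<subseteq> (\<Union>N\<in>UNIV. ?U N)"
      proof
        fix x
        have "ennreal (1 - e) < 1" using e by (simp add: ennreal_less_one_iff)
        also have "1 \<le> (\<Sum>i. ennreal (gs i x))" using gs by (simp add: covers_def)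
        also have "\<dots> = (SUP N. \<Sum>i<N. ennreal (gs i x))" by (rule suminf_eq_SUP)
        finally obtain N where "ennreal (1 - e) < (\<Sum>i<N. ennreal (gs i x))"
          unfolding less_SUP_iff by auto
        then have "1 - e < (\<Sum>i<N. gs i x)"
          using g0 by (simp add: sum_ennreal sum_nonneg ennreal_less_iff) (metis ennreal_leI not_le)
        then show "x \<in> (\<Union>N\<in>UNIV. ?U N)" by blast
      qed
      ultimately obtain C where C: "finite C" "UNIV \<subseteq> (\<Union>N\<in>C. ?U N)"
        by (rule compactE_image[OF cpt])
      define N where "N = Max (insert 0 C)"
      have N: "1 - e \<le> (\<Sum>i<N. gs i x)" for x
      proof -
        obtain n where n: "n \<in> C" "(\<Sum>i<n. gs i x) > 1 - e" using C(2) by auto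
        then have "n \<le> N" using C(1) by (simp add: N_def)
        then have "(\<Sum>i<n. gs i x) \<le> (\<Sum>i<N. gs i x)" using g0 by (intro sum_mono2) auto
        then show ?thesis using n by simp
      qed
      have "1 - e \<le> L (\<lambda>x. \<Sum>i<N. gs i x)"
        using L_mono[of "\<lambda>_. 1 - e" "\<lambda>x. \<Sum>i<N. gs i x"] N gc by (simp add: L_const continuous_on_sum)
      also have "\<dots> = (\<Sum>i<N. L (gs i))" by (rule L_sum) (auto simp: gc)
      finally have "ennreal 1 \<le> ennreal ((\<Sum>i<N. L (gs i)) + e)" by (intro ennreal_leI) simp
      also have "\<dots> = (\<Sum>i<N. ennreal (L (gs i))) + ennreal e"
        using L_pos[OF gc g0] e by (simp add: sum_nonneg)
      also have "\<dots> \<le> (\<Sum>i. ennreal (L (gs i))) + ennreal e"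
        by (intro add_right_mono sum_le_suminf) auto
      finally show "1 \<le> (\<Sum>i. ennreal (L (gs i))) + ennreal e" by simp
    qed
  qed
qed

section \<open>The representing measure and integration against it\<close>

definition riesz :: "'a measure" where "riesz = measure_of UNIV (sets borel) outer"

lemma sets_riesz [simp]: "sets riesz = sets borel" and space_riesz [simp]: "space riesz = UNIV"
  by (auto simp: riesz_def sets.sigma_sets_eq[of borel, simplified] sets_measure_of_conv space_measure_of_conv)

lemma emeasure_riesz: "A \<in> sets borel \<Longrightarrow> emeasure riesz A = outer A"
proof -
  let ?L = "lambda_system UNIV (Pow UNIV) outer"
  have ms: "measure_space UNIV ?L outer"
    using sigma_algebra.caratheodory_lemma[OF sigma_algebra_Pow outer_measure_space] .
  then interpret sa: sigma_algebra UNIV ?L by (simp add: measure_space_def)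
  have "U \<in> ?L" if "open U" for U
    unfolding lambda_system_def
  proof (intro CollectI conjI ballI)
    fix T
    have "outer T \<le> outer (U \<inter> T) + outer (T - U)"
      using outer_Un[of "U \<inter> T" "T - U"] by (simp add: Int_commute Un_Diff_Int Int_Diff_Un sup_commute inf_commute)
    moreover have "(UNIV - U) \<inter> T = T - U" by auto
    ultimately show "outer (U \<inter> T) + outer ((UNIV - U) \<inter> T) = outer T"
      using outer_open_split[OF that, of T] by (simp add: antisym)
  qed simp
  then have "sigma_sets UNIV {S. open S} \<subseteq> ?L" by (intro sa.sigma_sets_subset) auto
  then have "sets borel \<subseteq> ?L" unfolding borel_def by (subst sets_measure_of) auto
  then have "measure_space UNIV (sets borel) outer"
    by (rule measure_down[OF ms _, rotated]) (metis sets.sigma_algebra_axioms space_borel)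
  moreover assume "A \<in> sets borel"
  ultimately show ?thesis
    unfolding riesz_def measure_space_def by (intro emeasure_measure_of_sigma) auto
qed

lemma prob_riesz: "prob_space riesz"
  by (rule prob_spaceI) (simp add: emeasure_riesz outer_UNIV)

text \<open>Layer-cake comparison: \<open>n * g\<close> is the sum of the layers
  \<open>gk k\<close>, and \<open>gk k\<close> is 1 on \<open>?A k\<close>, so
  \<open>outer_le_L\<close> bounds the measure of \<open>?A k\<close> by \<open>L (gk k)\<close>.
  One inequality is enough, since the reverse one follows by applying it to an affine image of
  \<open>- g\<close>.\<close>

lemma integral_riesz_le:
  assumes g: "continuous_on UNIV g" "\<And>x. 0 \<le> g x" "\<And>x. g x \<le> 1"
  shows "integral\<^sup>L riesz g \<le> L g"
proof (rule field_le_epsilon)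
  interpret prob_space riesz by (rule prob_riesz)
  fix e :: real assume "e > 0"
  then obtain n :: nat where n: "n > 0" "1 / real n < e" by (metis ex_inverse_of_nat_less inverse_eq_divide)
  define gk where "gk k x = max 0 (min 1 (real n * g x - real k))" for k :: nat and x
  have gkc: "continuous_on UNIV (gk k)" for k unfolding gk_def by (intro continuous_intros g)
  have tele: "(\<Sum>k<m. max 0 (min 1 (t - real k))) = min t (real m)" if "0 \<le> t" for m and t :: real
    using that by (induction m) auto
  have sumgk: "(\<Sum>k<n. gk k x) = real n * g x" for x
    using tele[of "real n * g x" n] g(2,3)[of x] by (simp add: gk_def min_def mult_left_le)
  let ?A = "\<lambda>k. {x. real (Suc k) \<le> real n * g x}"
  have A: "?A k \<in> sets borel" for k
    by (intro borel_closed closed_Collect_le continuous_intros g)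
  have mA: "measure riesz (?A k) \<le> L (gk k)" for k
  proof -
    have "emeasure riesz (?A k) \<le> ennreal (L (gk k))"
      unfolding emeasure_riesz[OF A] by (rule outer_le_L[OF gkc]) (auto simp: gk_def)
    then show ?thesis
      using L_pos[OF gkc, of k] by (simp add: emeasure_eq_measure gk_def)
  qed
  \<comment> \<open>Only the layer with index \<open>nat \<lfloor>real n * g x\<rfloor>\<close> can
    be partially filled, and it contributes at most 1.\<close>
  have le: "real n * g x \<le> 1 + (\<Sum>k<n. indicator (?A k) x)" for x
  proof -
    have "gk k x \<le> indicator (?A k) x + (if k = nat \<lfloor>real n * g x\<rfloor> then 1 else 0)" for k
    proof (cases "real (Suc k) \<le> real n * g x")
      case True then show ?thesis by (simp add: gk_def)
    next
      case False
      show ?thesis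
      proof (cases "k = nat \<lfloor>real n * g x\<rfloor>")
        case True then show ?thesis by (auto simp: gk_def indicator_def)
      next
        case False': False
        have "real n * g x \<le> real k"
        proof (rule ccontr)
          assume "\<not> real n * g x \<le> real k"
          then have "\<lfloor>real n * g x\<rfloor> = int k" using False by (intro floor_unique) auto
          then show False using False' by simp
        qed
        then show ?thesis by (simp add: gk_def)
      qed
    qed
    then have "(\<Sum>k<n. gk k x) \<le> (\<Sum>k<n. indicator (?A k) x + (if k = nat \<lfloor>real n * g x\<rfloor> then 1 else 0))"
      by (intro sum_mono)
    also have "\<dots> \<le> 1 + (\<Sum>k<n. indicator (?A k) x)" by (simp add: sum.distrib)
    finally show ?thesis by (simp add: sumgk)
  qed
  have bm: "g \<in> borel_measurable riesz"
    using borel_measurable_continuous_onI[OF g(1)] by (simp cong: measurable_cong_sets)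
  have ig: "integrable riesz g"
    by (rule integrable_const_bound[of _ 1]) (use bm g in auto)
  have "real n * integral\<^sup>L riesz g = (\<integral>x. real n * g x \<partial>riesz)" by simp
  also have "\<dots> \<le> (\<integral>x. 1 + (\<Sum>k<n. indicator (?A k) x) \<partial>riesz)"
    using A ig le by (intro integral_mono) (auto simp: emeasure_eq_measure intro!: integrable_real_indicator)
  also have "\<dots> = 1 + (\<Sum>k<n. measure riesz (?A k))"
  proof -
    have i: "integrable riesz (indicator (?A k) :: _ \<Rightarrow> real)" for k
      using A[of k] by (intro integrable_real_indicator) (auto simp: emeasure_eq_measure)
    show ?thesis using A i prob_space
      by (simp add: Bochner_Integration.integral_add Bochner_Integration.integral_sum Bochner_Integration.integrable_sum)
  qed
  also have "\<dots> \<le> 1 + (\<Sum>k<n. L (gk k))" by (intro add_left_mono sum_mono mA)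
  also have "(\<Sum>k<n. L (gk k)) = real n * L g"
    using L_sum[of "{..<n}" gk] gkc L_scale[OF g(1), of "real n"] by (simp add: sumgk)
  finally have "integral\<^sup>L riesz g \<le> 1 / real n + L g" using n(1) by (simp add: field_simps)
  then show "integral\<^sup>L riesz g \<le> L g + e" using n(2) by simp
qed

lemma integral_riesz:
  assumes g: "continuous_on UNIV g"
  shows "integral\<^sup>L riesz g = L g"
proof -
  interpret prob_space riesz by (rule prob_riesz)
  have "bounded (g ` UNIV)" using compact_imp_bounded[OF compact_continuous_image[OF g cpt]] .
  then obtain b where b: "b > 0" "\<And>x. \<bar>g x\<bar> \<le> b" by (auto simp: bounded_pos)
  have bm: "g \<in> borel_measurable riesz"
    using borel_measurable_continuous_onI[OF g] by (simp cong: measurable_cong_sets)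
  have ig: "integrable riesz g"
    by (rule integrable_const_bound[of _ b]) (use bm b in auto)
  have r: "0 \<le> 1 / 2 + s * (1 / (2 * b)) * g x" "1 / 2 + s * (1 / (2 * b)) * g x \<le> 1" if "s = 1 \<or> s = - 1" for s x
  proof -
    have "\<bar>s * (1 / (2 * b)) * g x\<bar> = \<bar>g x\<bar> / (2 * b)" using that b(1) by (auto simp: abs_mult)
    also have "\<dots> \<le> b / (2 * b)" using b by (intro divide_right_mono) auto
    finally have "\<bar>s * (1 / (2 * b)) * g x\<bar> \<le> 1 / 2" using b(1) by simp
    then show "0 \<le> 1 / 2 + s * (1 / (2 * b)) * g x" "1 / 2 + s * (1 / (2 * b)) * g x \<le> 1" by linarith+
  qed
  have "s * integral\<^sup>L riesz g \<le> s * L g" if s: "s = 1 \<or> s = - 1" for s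
  proof -
    have c: "continuous_on UNIV (\<lambda>x. s * (1 / (2 * b)) * g x)" by (intro continuous_intros g)
    have "integral\<^sup>L riesz (\<lambda>x. 1 / 2 + s * (1 / (2 * b)) * g x) \<le> L (\<lambda>x. 1 / 2 + s * (1 / (2 * b)) * g x)"
      by (rule integral_riesz_le[OF _ r[OF s]]) (intro continuous_intros g)
    also have "\<dots> = 1 / 2 + s * (1 / (2 * b)) * L g"
      using L_add[OF continuous_on_const c, of "1 / 2"] L_scale[OF g, of "s * (1 / (2 * b))"] L_const[of "1 / 2"] by simp
    also have "integral\<^sup>L riesz (\<lambda>x. 1 / 2 + s * (1 / (2 * b)) * g x) = 1 / 2 + s * (1 / (2 * b)) * integral\<^sup>L riesz g"
      using ig prob_space by (subst Bochner_Integration.integral_add) auto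
    finally have "(1 / (2 * b)) * (s * integral\<^sup>L riesz g) \<le> (1 / (2 * b)) * (s * L g)" by (simp add: ac_simps)
    moreover have "1 / (2 * b) > 0" using b(1) by simp
    ultimately show ?thesis by (simp only: mult_le_cancel_left_pos)
  qed
  from this[of 1] this[of "- 1"] show ?thesis by simp
qed

end

section \<open>Borel probability measures and their weak limits\<close>

definition bump :: "'a::metric_space set \<Rightarrow> nat \<Rightarrow> 'a \<Rightarrow> real" where
  "bump A k x = max 0 (1 - real k * infdist x A)"

lemma bump_cont: "continuous_on UNIV (bump A k)"
  unfolding bump_def by (intro continuous_intros)

lemma bump_bounds: "0 \<le> bump A k x" "bump A k x \<le> 1"
  by (auto simp: bump_def infdist_nonneg)

lemma bump_in: "x \<in> A \<Longrightarrow> bump A k x = 1"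
  by (simp add: bump_def)

lemma bump_lim:
  assumes "closed A" "A \<noteq> {}"
  shows "(\<lambda>k. bump A k x) \<longlonglongrightarrow> indicator A x"
proof (cases "x \<in> A")
  case False
  then have pos: "infdist x A > 0" using infdist_pos_not_in_closed[OF assms] by auto
  obtain K0 :: nat where K0: "real K0 > 1 / infdist x A" using reals_Archimedean2 by blast
  have "bump A K x = 0" if "K \<ge> K0" for K
  proof -
    have "real K > 1 / infdist x A" using K0 that by linarith
    then have "1 < real K * infdist x A" using pos by (simp add: field_simps)
    then show ?thesis by (simp add: bump_def)
  qed
  then have "eventually (\<lambda>k. bump A k x = indicator A x) sequentially"
    using False unfolding eventually_sequentially by auto
  then show ?thesis by (rule tendsto_eventually)
qed (simp add: bump_in)

locale borel_prob = prob_space M for M :: "'a::metric_space measure" +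
  assumes sets_eq: "sets M = sets borel"
begin

lemma space_eq: "space M = UNIV"
  using sets_eq_imp_space_eq[OF sets_eq] by simp

lemma meas_cont: "continuous_on UNIV g \<Longrightarrow> (g :: 'a \<Rightarrow> real) \<in> borel_measurable M"
  using borel_measurable_continuous_onI[of g] by (simp add: measurable_cong_sets[OF sets_eq refl])

lemma meas_closed: "closed A \<Longrightarrow> A \<in> sets M" and meas_open: "open A \<Longrightarrow> A \<in> sets M"
  by (auto simp: sets_eq)

lemma integrable_bdd: "(g :: 'a \<Rightarrow> real) \<in> borel_measurable M \<Longrightarrow> (\<And>x. \<bar>g x\<bar> \<le> b) \<Longrightarrow> integrable M g"
  by (rule integrable_const_bound[of _ b]) auto

lemma integrable_cont:
  assumes "compact (UNIV :: 'a set)" "continuous_on UNIV (g :: 'a \<Rightarrow> real)"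
  shows "integrable M g"
proof -
  have "bounded (g ` UNIV)" using compact_imp_bounded[OF compact_continuous_image[OF assms(2,1)]] .
  then obtain b where "\<And>x. \<bar>g x\<bar> \<le> b" by (auto simp: bounded_iff)
  then show ?thesis using integrable_bdd meas_cont assms by blast
qed

lemma mean_functional:
  assumes "compact (UNIV :: 'a set)"
  shows "mean_functional (\<lambda>g. integral\<^sup>L M g)"
  using assms integrable_cont[OF assms] prob_space
  by unfold_locales auto

lemma bump_integral_lim:
  assumes A: "closed A" "A \<noteq> {}"
  shows "(\<lambda>k. integral\<^sup>L M (bump A k)) \<longlonglongrightarrow> measure M A"
proof -
  have "(\<lambda>k. integral\<^sup>L M (bump A k)) \<longlonglongrightarrow> integral\<^sup>L M (indicator A)"
    by (rule integral_dominated_convergence[where w = "\<lambda>_. 1"])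
       (use A in \<open>auto simp: bump_bounds intro!: bump_lim meas_cont bump_cont meas_closed borel_measurable_indicator\<close>)
  then show ?thesis using meas_closed[OF A(1)] by simp
qed

text \<open>Closed sets are approximated from outside by superlevel sets of \<open>bump\<close>. The
  two-sided form is stable under complements; for a countable union the inner set is cut down to a
  finite union, which stays closed.\<close>

lemma regular:
  assumes "B \<in> sets borel" "e > 0"
  shows "\<exists>K U. closed K \<and> open U \<and> K \<subseteq> B \<and> B \<subseteq> U \<and> measure M (U - K) < e"
proof -
  have "B \<in> sigma_sets UNIV (Collect closed)" using assms(1) by (simp add: borel_eq_closed)
  then show ?thesis using assms(2)
  proof (induction B arbitrary: e rule: sigma_sets.induct)
    case (Basic A)
    show ?case
    proof (cases "A = {}")
      case False
      have A: "closed A" using Basic by simp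
      have "(\<lambda>k. integral\<^sup>L M (bump A k) - measure M A) \<longlonglongrightarrow> measure M A - measure M A"
        by (intro tendsto_diff bump_integral_lim A False tendsto_const)
      then have "\<forall>\<^sub>F k in sequentially. integral\<^sup>L M (bump A k) - measure M A < e / 2"
        using Basic(2) by (intro order_tendstoD(2)) auto
      then obtain k where k: "integral\<^sup>L M (bump A k) - measure M A < e / 2"
        by (auto simp: eventually_sequentially)
      \<comment> \<open>On \<open>?U - A\<close> the difference
        \<open>bump A k x - indicator A x\<close> exceeds 1/2, hence the factor 2 in the
        integral.\<close>
      let ?U = "{x. bump A k x > 1/2}"
      have U: "open ?U" by (rule open_Collect_less) (intro continuous_intros bump_cont)+
      have AU: "A \<subseteq> ?U" by (auto simp: bump_in)
      have "measure M (?U - A) \<le> (\<integral>x. 2 * (bump A k x - indicator A x) \<partial>M)"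
      proof -
        have "measure M (?U - A) = integral\<^sup>L M (indicator (?U - A))"
          using meas_open[OF U] meas_closed[OF A] by simp
        also have "\<dots> \<le> (\<integral>x. 2 * (bump A k x - indicator A x) \<partial>M)"
          using meas_open[OF U] meas_closed[OF A] meas_cont[OF bump_cont]
          by (intro integral_mono integrable_bdd[where b = 2])
             (auto simp: indicator_def bump_bounds abs_le_iff bump_in intro!: borel_measurable_times borel_measurable_diff
               intro: order_trans[OF bump_bounds(2)] order_trans[OF _ bump_bounds(1)])
        finally show ?thesis .
      qed
      also have "\<dots> = 2 * (integral\<^sup>L M (bump A k) - measure M A)"
        using meas_closed[OF A] integrable_bdd[OF meas_cont[OF bump_cont], of A k 1]
        by (simp add: bump_bounds emeasure_eq_measure)
      also have "\<dots> < e" using k by simp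
      finally show ?thesis using A U AU by blast
    qed (use Basic in \<open>auto intro!: exI[of _ "{}"]\<close>)
  next
    case Empty
    then show ?case by (auto intro!: exI[of _ "{}"])
  next
    case (Compl A)
    from Compl.IH[OF Compl.prems]
    obtain K U where "closed K" "open U" "K \<subseteq> A" "A \<subseteq> U" "measure M (U - K) < e" by (elim exE conjE)
    moreover have "- K - - U = U - K" by auto
    ultimately show ?case by (intro exI[of _ "- U"] exI[of _ "- K"]) auto
  next
    case (Union A)
    have "\<exists>K U. closed K \<and> open U \<and> K \<subseteq> A i \<and> A i \<subseteq> U \<and> measure M (U - K) < (e / 2) * (1/2) ^ Suc i" for i
      by (rule Union.IH) (use Union.prems in simp)
    then obtain K U where KU: "\<And>i. closed (K i)" "\<And>i. open (U i)" "\<And>i. K i \<subseteq> A i" "\<And>i. A i \<subseteq> U i"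
      "\<And>i. measure M (U i - K i) < (e / 2) * (1/2) ^ Suc i" by metis
    have sK: "K i \<in> sets M" and sU: "U i \<in> sets M" for i using KU meas_closed meas_open by auto
    have s: "(\<lambda>i. (e / 2) * (1/2) ^ Suc i) sums (e / 2)" using sums_mult[OF power_half_series, of "e / 2"] by simp
    have "measure M (\<Union>i. U i - K i) \<le> (\<Sum>i. measure M (U i - K i))"
    proof (rule finite_measure_subadditive_countably)
      show "summable (\<lambda>i. measure M (U i - K i))"
        by (rule summable_comparison_test[OF _ sums_summable[OF s]]) (use KU(5) in \<open>auto intro: less_imp_le\<close>)
    qed (use sK sU in auto)
    also have "\<dots> \<le> (\<Sum>i. (e / 2) * (1/2) ^ Suc i)"
    proof (rule suminf_le)
      show "summable (\<lambda>i. measure M (U i - K i))"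
        by (rule summable_comparison_test[OF _ sums_summable[OF s]]) (use KU(5) in \<open>auto intro: less_imp_le\<close>)
    qed (use KU(5) s in \<open>auto intro: less_imp_le sums_summable\<close>)
    also have "\<dots> = e / 2" using s by (rule sums_unique[symmetric])
    finally have 1: "measure M (\<Union>i. U i - K i) \<le> e / 2" .
    have "(\<lambda>n. measure M (\<Union>i<n. K i)) \<longlonglongrightarrow> measure M (\<Union>n. \<Union>i<n. K i)"
      using sK by (intro finite_Lim_measure_incseq incseq_SucI UN_mono) auto
    moreover have "(\<Union>n. \<Union>i<n. K i) = (\<Union>i. K i)" by auto
    ultimately have "(\<lambda>n. measure M (\<Union>i<n. K i)) \<longlonglongrightarrow> measure M (\<Union>i. K i)" by simp
    from tendsto_diff[OF tendsto_const this, of "measure M (\<Union>i. K i)"]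
    have "(\<lambda>n. measure M (\<Union>i. K i) - measure M (\<Union>i<n. K i)) \<longlonglongrightarrow> 0" by simp
    then have "\<forall>\<^sub>F n in sequentially. measure M (\<Union>i. K i) - measure M (\<Union>i<n. K i) < e / 2"
      using Union.prems by (intro order_tendstoD(2)) auto
    then obtain n where n: "measure M (\<Union>i. K i) - measure M (\<Union>i<n. K i) < e / 2"
      by (auto simp: eventually_sequentially)
    have 2: "measure M ((\<Union>i. K i) - (\<Union>i<n. K i)) < e / 2"
      using n sK by (subst finite_measure_Diff) auto
    have "measure M ((\<Union>i. U i) - (\<Union>i<n. K i)) \<le> measure M ((\<Union>i. U i - K i) \<union> ((\<Union>i. K i) - (\<Union>i<n. K i)))"
      using sK sU by (intro finite_measure_mono) auto
    also have "\<dots> \<le> measure M (\<Union>i. U i - K i) + measure M ((\<Union>i. K i) - (\<Union>i<n. K i))"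
      using sK sU by (intro measure_Un_le) auto
    finally have "measure M ((\<Union>i. U i) - (\<Union>i<n. K i)) < e" using 1 2 by simp
    moreover have "closed (\<Union>i<n. K i)" "open (\<Union>i. U i)" using KU by auto
    moreover have "(\<Union>i<n. K i) \<subseteq> (\<Union>i. A i)" "(\<Union>i. A i) \<subseteq> (\<Union>i. U i)" using KU(3,4) by blast+
    ultimately show ?case by (intro exI[of _ "\<Union>i<n. K i"] exI[of _ "\<Union>i. U i"] conjI)
  qed
qed

lemma inner_closed:
  assumes "B \<in> sets borel" "e > 0"
  obtains K where "closed K" "K \<subseteq> B" "measure M K > measure M B - e"
proof -
  obtain K U where KU: "closed K" "open U" "K \<subseteq> B" "B \<subseteq> U" "measure M (U - K) < e"
    using regular[OF assms] by blast
  have "measure M B - measure M K = measure M (B - K)"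
    using KU assms by (subst finite_measure_Diff) (auto simp: sets_eq)
  also have "\<dots> \<le> measure M (U - K)" using KU by (intro finite_measure_mono) (auto simp: sets_eq)
  finally show ?thesis using KU that[of K] by simp
qed

end

text \<open>Closed sets form an intersection-stable generator and their measures are limits of
  integrals of \<open>bump\<close>. Test functions with values in [0, 1] later give a bounded
  function that separates two different measures.\<close>

lemma borel_prob_eqI:
  fixes M N :: "'a::metric_space measure"
  assumes "borel_prob M" "borel_prob N"
    and eq: "\<And>g :: 'a \<Rightarrow> real. continuous_on UNIV g \<Longrightarrow> (\<And>x. 0 \<le> g x \<and> g x \<le> 1) \<Longrightarrow> integral\<^sup>L M g = integral\<^sup>L N g"
  shows "M = N"
proof -
  interpret M: borel_prob M by fact
  interpret N: borel_prob N by fact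
  show ?thesis
  proof (rule measure_eqI_generator_eq[where E = "Collect closed" and \<Omega> = UNIV and A = "\<lambda>_. UNIV"])
    show "Int_stable (Collect closed :: 'a set set)" by (auto simp: Int_stable_def)
    show "emeasure M X = emeasure N X" if "X \<in> Collect closed" for X
    proof (cases "X = {}")
      case False
      have "(\<lambda>k. integral\<^sup>L M (bump X k)) = (\<lambda>k. integral\<^sup>L N (bump X k))"
        by (intro ext eq bump_cont conjI bump_bounds)
      then have "measure M X = measure N X"
        using M.bump_integral_lim[of X] N.bump_integral_lim[of X] that False LIMSEQ_unique by simp
      then show ?thesis by (simp add: M.emeasure_eq_measure N.emeasure_eq_measure)
    qed simp
    show "sets M = sigma_sets UNIV (Collect closed)" "sets N = sigma_sets UNIV (Collect closed)"
      by (simp_all add: M.sets_eq N.sets_eq borel_eq_closed)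
  qed (auto simp: M.emeasure_eq_measure)
qed

lemma (in mean_functional) borel_prob_riesz: "borel_prob riesz"
  using prob_riesz by (simp add: borel_prob_def borel_prob_axioms_def)

text \<open>Weak-* compactness without subsequences: Tychonoff on the product of the ranges
  of all functionals gives a limit along a filter finer than \<open>sequentially\<close>.\<close>

lemma weak_limit:
  fixes L :: "nat \<Rightarrow> ('a::metric_space \<Rightarrow> real) \<Rightarrow> real"
  assumes L: "\<And>n. mean_functional (L n)"
  obtains M F where "borel_prob M" "F \<noteq> bot" "F \<le> sequentially"
    "\<And>g. continuous_on UNIV g \<Longrightarrow> ((\<lambda>n. L n g) \<longlongrightarrow> integral\<^sup>L M g) F"
proof -
  have cpt: "compact (UNIV :: 'a set)" using L[of 0] by (simp add: mean_functional_def)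
  define C where "C = {g :: 'a \<Rightarrow> real. continuous_on UNIV g}"
  have "\<exists>b. \<forall>x. \<bar>g x\<bar> \<le> b" if "g \<in> C" for g
    using compact_imp_bounded[OF compact_continuous_image[OF _ cpt, of g]] that by (auto simp: bounded_iff C_def)
  then obtain b where b: "\<And>g x. g \<in> C \<Longrightarrow> \<bar>g x\<bar> \<le> b g" by metis
  \<comment> \<open>Discontinuous functions are sent to 0, so that every \<open>T n\<close> lies in
    one product of compact intervals.\<close>
  define T where "T n g = (if g \<in> C then L n g else 0)" for n g
  have Tb: "T n g \<in> {- \<bar>b g\<bar>..\<bar>b g\<bar>}" for n g
  proof (cases "g \<in> C")
    case True
    interpret mean_functional "L n" by (rule L)
    have "L n (\<lambda>_. - \<bar>b g\<bar>) \<le> L n g" "L n g \<le> L n (\<lambda>_. \<bar>b g\<bar>)"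
      using True b[OF True] by (auto intro!: L_mono simp: C_def abs_le_iff) (smt (verit))+
    then show ?thesis using True by (simp add: T_def L_const)
  qed (simp add: T_def)
  let ?S = "PiE UNIV (\<lambda>g. {- \<bar>b g\<bar>..\<bar>b g\<bar>})"
  have "compactin (product_topology (\<lambda>g :: 'a \<Rightarrow> real. euclidean :: real topology) UNIV) ?S"
    by (simp add: compactin_PiE)
  then have cS: "compact ?S" by (simp add: euclidean_product_topology)
  have ev: "eventually (\<lambda>h. h \<in> ?S) (filtermap T sequentially)"
    unfolding eventually_filtermap using Tb by (auto intro!: always_eventually)
  have nb: "filtermap T sequentially \<noteq> bot" by (simp add: filtermap_bot_iff)
  from compact_filter[THEN iffD1, OF cS, rule_format, OF nb ev]
  obtain l where l: "inf (nhds l) (filtermap T sequentially) \<noteq> bot" by (elim bexE)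
  \<comment> \<open>\<open>F\<close> refines \<open>sequentially\<close> by the preimages under
    \<open>T\<close> of neighbourhoods of the cluster point \<open>l\<close>; it is proper because
    each of these meets every tail.\<close>
  define F where "F = inf sequentially (filtercomap T (nhds l))"
  have Fbot: "F \<noteq> bot"
  proof
    assume "F = bot"
    then have "eventually (\<lambda>_. False) F" by simp
    then obtain P R where PR: "eventually P sequentially" "eventually R (filtercomap T (nhds l))" "\<forall>n. P n \<and> R n \<longrightarrow> False"
      unfolding F_def eventually_inf by (elim exE conjE)
    from PR(2) obtain Q where Q: "eventually Q (nhds l)" "\<forall>n. Q (T n) \<longrightarrow> R n"
      unfolding eventually_filtercomap by (elim exE conjE)
    have PQ: "eventually P sequentially" "eventually Q (nhds l)" "\<And>n. P n \<Longrightarrow> Q (T n) \<Longrightarrow> False"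
      using PR Q by auto
    have "eventually (\<lambda>y. \<not> Q y) (filtermap T sequentially)"
      unfolding eventually_filtermap using PQ(1) by (rule eventually_mono) (use PQ(3) in auto)
    then have "eventually (\<lambda>_. False) (inf (nhds l) (filtermap T sequentially))"
      unfolding eventually_inf using PQ(2) by (intro exI[of _ Q] exI[of _ "\<lambda>y. \<not> Q y"]) simp
    then show False using l by (simp add: trivial_limit_def)
  qed
  have "filtermap T F \<le> filtermap T (filtercomap T (nhds l))" unfolding F_def by (intro filtermap_mono inf_le2)
  also have "\<dots> \<le> nhds l" by (rule filtermap_filtercomap)
  finally have "filterlim T (nhds l) F" by (simp add: filterlim_def)
  then have lim: "((\<lambda>n. T n g) \<longlongrightarrow> l g) F" for g
  proof -
    assume T: "filterlim T (nhds l) F"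
    have "continuous_on UNIV (\<lambda>h :: ('a \<Rightarrow> real) \<Rightarrow> real. h g)"
      by (rule continuous_on_product_then_coordinatewise[OF continuous_on_id])
    then have op: "open ((\<lambda>h. h g) -` S)" if "open S" for S :: "real set"
      using open_vimage[OF that] by blast
    show ?thesis
    proof (rule topological_tendstoI)
      fix S :: "real set" assume "open S" "l g \<in> S"
      then have "eventually (\<lambda>h. h \<in> (\<lambda>h. h g) -` S) (nhds l)"
        using op by (intro eventually_nhds_in_open) auto
      then show "eventually (\<lambda>n. T n g \<in> S) F"
        using T by (auto dest: filterlim_iff[THEN iffD1, rule_format])
    qed
  qed
  have limL: "((\<lambda>n. L n g) \<longlongrightarrow> l g) F" if "continuous_on UNIV g" for g
    using lim[of g] that by (simp add: T_def C_def)
  interpret l: mean_functional l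
  proof
    show "compact (UNIV :: 'a set)" by (rule cpt)
    show "l (\<lambda>x. g x + h x) = l g + l h" if g: "continuous_on UNIV g" "continuous_on UNIV h" for g h
    proof -
      have "((\<lambda>n. L n g + L n h) \<longlongrightarrow> l g + l h) F" by (intro tendsto_add limL g)
      moreover have "(\<lambda>n. L n g + L n h) = (\<lambda>n. L n (\<lambda>x. g x + h x))"
        using g by (simp add: mean_functional.L_add[OF L])
      ultimately show ?thesis using limL[of "\<lambda>x. g x + h x"] g tendsto_unique[OF Fbot] by (metis continuous_on_add)
    qed
    show "l (\<lambda>x. c * g x) = c * l g" if g: "continuous_on UNIV g" for g c
    proof -
      have "((\<lambda>n. c * L n g) \<longlongrightarrow> c * l g) F" by (intro tendsto_mult_left limL g)
      moreover have "(\<lambda>n. c * L n g) = (\<lambda>n. L n (\<lambda>x. c * g x))"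
        using g by (simp add: mean_functional.L_scale[OF L])
      ultimately show ?thesis using limL[of "\<lambda>x. c * g x"] g tendsto_unique[OF Fbot] by (metis continuous_on_mult_left)
    qed
    show "0 \<le> l g" if g: "continuous_on UNIV g" "\<And>x. 0 \<le> g x" for g
      using tendsto_lowerbound[OF limL[OF g(1)] _ Fbot, of 0] mean_functional.L_pos[OF L g] by simp
    show "l (\<lambda>_. 1) = 1"
      using tendsto_unique[OF Fbot limL[of "\<lambda>_. 1"]] by (simp add: mean_functional.L_one[OF L])
  qed
  show ?thesis
  proof
    show "borel_prob l.riesz" by (rule l.borel_prob_riesz)
    show "F \<noteq> bot" by (rule Fbot)
    show "F \<le> sequentially" by (simp add: F_def)
    show "((\<lambda>n. L n g) \<longlongrightarrow> integral\<^sup>L l.riesz g) F" if "continuous_on UNIV g" for g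
      using limL[OF that] l.integral_riesz[OF that] by simp
  qed
qed

text \<open>\<open>jset M A\<close> plays the role of \<open>M (frontier A) = 0\<close>: the measure of such a set is continuous under
  weak convergence, and these sets are closed under the Boolean operations and under preimages by continuous measure-preserving maps.\<close>

definition sandwich :: "'a::metric_space measure \<Rightarrow> 'a set \<Rightarrow> real \<Rightarrow> ('a \<Rightarrow> real) \<Rightarrow> ('a \<Rightarrow> real) \<Rightarrow> bool" where
  "sandwich M A e g1 g2 \<longleftrightarrow> continuous_on UNIV g1 \<and> continuous_on UNIV g2 \<and>
      (\<forall>x. 0 \<le> g1 x \<and> g1 x \<le> indicator A x \<and> indicator A x \<le> g2 x \<and> g2 x \<le> 1) \<and>
      (\<integral>x. g2 x - g1 x \<partial>M) < e"

definition jset :: "'a::metric_space measure \<Rightarrow> 'a set \<Rightarrow> bool" where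
  "jset M A \<longleftrightarrow> (\<forall>e>0. \<exists>g1 g2. sandwich M A e g1 g2)"

lemma jsetI: "(\<And>e. e > 0 \<Longrightarrow> \<exists>g1 g2. sandwich M A e g1 g2) \<Longrightarrow> jset M A"
  by (simp add: jset_def)

lemma jsetE:
  assumes "jset M A" "e > 0"
  obtains g1 g2 :: "'a::metric_space \<Rightarrow> real" where "continuous_on UNIV g1" "continuous_on UNIV g2"
    "\<And>x. 0 \<le> g1 x" "\<And>x. g1 x \<le> indicator A x" "\<And>x. indicator A x \<le> g2 x" "\<And>x. g2 x \<le> 1"
    "(\<integral>x. g2 x - g1 x \<partial>M) < e"
proof -
  obtain g1 g2 where "sandwich M A e g1 g2" using assms unfolding jset_def by auto
  then show ?thesis using that[of g1 g2] by (simp add: sandwich_def)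
qed

text \<open>The functionals are abstract, with \<open>lo\<close> and \<open>up\<close> recording
  monotonicity at the indicator, so that the lemma covers both integrals and weighted orbit averages
  that are not given as measures.\<close>

lemma jset_tendsto:
  assumes M: "borel_prob M" and J: "jset M A" and A: "A \<in> sets borel"
    and lim: "\<And>g. continuous_on UNIV g \<Longrightarrow> ((\<lambda>n. L n g) \<longlongrightarrow> integral\<^sup>L M g) F"
    and lo: "\<And>n g. continuous_on UNIV g \<Longrightarrow> (\<And>x. g x \<le> indicator A x) \<Longrightarrow> L n g \<le> p n"
    and up: "\<And>n g. continuous_on UNIV g \<Longrightarrow> (\<And>x. indicator A x \<le> g x) \<Longrightarrow> p n \<le> L n g"
  shows "(p \<longlongrightarrow> measure M A) F"
proof -
  interpret borel_prob M by fact
  have iA: "integrable M (indicator A :: 'a \<Rightarrow> real)"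
    using A by (intro integrable_real_indicator) (auto simp: sets_eq emeasure_eq_measure)
  show ?thesis
  proof (rule tendstoI)
    fix e :: real assume e: "e > 0"
    obtain g1 g2 :: "'a \<Rightarrow> real" where g: "continuous_on UNIV g1" "continuous_on UNIV g2"
      "\<And>x. 0 \<le> g1 x" "\<And>x. g1 x \<le> indicator A x" "\<And>x. indicator A x \<le> g2 x" "\<And>x. g2 x \<le> 1"
      "(\<integral>x. g2 x - g1 x \<partial>M) < e / 2"
      by (rule jsetE[OF J half_gt_zero[OF e]]) (rule that)
    have b: "\<bar>g1 x\<bar> \<le> 1" "\<bar>g2 x\<bar> \<le> 1" for x
      using g(3,4,5,6)[of x] by (auto simp: indicator_def split: if_splits)
    have i: "integrable M g1" "integrable M g2"
      by (auto intro!: integrable_bdd[of _ 1] meas_cont g b)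
    have 1: "integral\<^sup>L M g1 \<le> measure M A" "measure M A \<le> integral\<^sup>L M g2"
      using integral_mono[OF i(1) iA g(4)] integral_mono[OF iA i(2) g(5)] A by (auto simp: space_eq)
    have 2: "integral\<^sup>L M g2 - integral\<^sup>L M g1 < e / 2" using g(7) i by simp
    have "eventually (\<lambda>n. dist (L n g1) (integral\<^sup>L M g1) < e / 2) F"
      "eventually (\<lambda>n. dist (L n g2) (integral\<^sup>L M g2) < e / 2) F"
      using lim[OF g(1)] lim[OF g(2)] e by (auto dest!: tendstoD[of _ _ _ "e / 2"])
    then show "eventually (\<lambda>n. dist (p n) (measure M A) < e) F"
    proof eventually_elim
      case (elim n)
      have "L n g1 \<le> p n" "p n \<le> L n g2" by (rule lo up, use g in auto)+
      then show ?case using elim 1 2 unfolding dist_real_def by linarith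
    qed
  qed
qed

section \<open>Stability of \<open>jset\<close> and partitions into small \<open>jset\<close>
  cells\<close>

context borel_prob
begin

lemma jset_UNIV: "jset M UNIV"
  by (intro jsetI exI[of _ "\<lambda>_. 1"]) (simp add: sandwich_def)

lemma jset_empty: "jset M {}"
  by (intro jsetI exI[of _ "\<lambda>_. 0"]) (simp add: sandwich_def)

lemma jset_Compl:
  assumes "jset M A" shows "jset M (- A)"
proof (rule jsetI)
  fix e :: real assume e: "e > 0"
  obtain g1 g2 :: "'a \<Rightarrow> real" where g: "continuous_on UNIV g1" "continuous_on UNIV g2"
      "\<And>x. 0 \<le> g1 x" "\<And>x. g1 x \<le> indicator A x" "\<And>x. indicator A x \<le> g2 x" "\<And>x. g2 x \<le> 1"
      "(\<integral>x. g2 x - g1 x \<partial>M) < e" by (rule jsetE[OF assms e]) (rule that)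
  have "0 \<le> 1 - g2 x \<and> 1 - g2 x \<le> indicator (- A) x \<and> indicator (- A) x \<le> 1 - g1 x \<and> 1 - g1 x \<le> 1" for x
    using g(3-6)[of x] by (auto simp: indicator_def split: if_splits)
  moreover have "(\<integral>x. (1 - g1 x) - (1 - g2 x) \<partial>M) < e" using g(7) by simp
  moreover have "continuous_on UNIV (\<lambda>x. 1 - g1 x)" "continuous_on UNIV (\<lambda>x. 1 - g2 x)"
    by (intro continuous_intros g)+
  ultimately show "\<exists>g1 g2. sandwich M (- A) e g1 g2"
    unfolding sandwich_def by (intro exI[of _ "\<lambda>x. 1 - g2 x"] exI[of _ "\<lambda>x. 1 - g1 x"]) blast
qed

lemma jset_Int:
  assumes "jset M A" "jset M B" shows "jset M (A \<inter> B)"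
proof (rule jsetI)
  fix e :: real assume e: "e > 0"
  then have e2: "e / 2 > 0" by simp
  obtain g1 g2 :: "'a \<Rightarrow> real" where g: "continuous_on UNIV g1" "continuous_on UNIV g2"
      "\<And>x. 0 \<le> g1 x" "\<And>x. g1 x \<le> indicator A x" "\<And>x. indicator A x \<le> g2 x" "\<And>x. g2 x \<le> 1"
      "(\<integral>x. g2 x - g1 x \<partial>M) < e / 2" by (rule jsetE[OF assms(1) e2]) (rule that)
  obtain h1 h2 :: "'a \<Rightarrow> real" where h: "continuous_on UNIV h1" "continuous_on UNIV h2"
      "\<And>x. 0 \<le> h1 x" "\<And>x. h1 x \<le> indicator B x" "\<And>x. indicator B x \<le> h2 x" "\<And>x. h2 x \<le> 1"
      "(\<integral>x. h2 x - h1 x \<partial>M) < e / 2" by (rule jsetE[OF assms(2) e2]) (rule that)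
  have gb: "0 \<le> g1 x" "g1 x \<le> 1" "0 \<le> g2 x" "g2 x \<le> 1" "g1 x \<le> g2 x"
    and hb: "0 \<le> h1 x" "h1 x \<le> 1" "0 \<le> h2 x" "h2 x \<le> 1" "h1 x \<le> h2 x" for x
    using g(3-6)[of x] h(3-6)[of x] by (auto simp: indicator_def split: if_splits)
  have iI: "indicator (A \<inter> B) x = (indicator A x * indicator B x :: real)" for x by (simp add: indicator_inter_arith)
  have "0 \<le> g1 x * h1 x \<and> g1 x * h1 x \<le> indicator (A \<inter> B) x \<and> indicator (A \<inter> B) x \<le> g2 x * h2 x \<and> g2 x * h2 x \<le> 1" for x
    unfolding iI using gb[of x] hb[of x] g(3-6)[of x] h(3-6)[of x]
    by (auto intro!: mult_nonneg_nonneg mult_mono mult_le_one)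
  moreover have "(\<integral>x. g2 x * h2 x - g1 x * h1 x \<partial>M) < e"
  proof -
    have m: "g1 \<in> borel_measurable M" "g2 \<in> borel_measurable M" "h1 \<in> borel_measurable M" "h2 \<in> borel_measurable M"
      by (intro meas_cont g h)+
    have i: "integrable M g1" "integrable M g2" "integrable M h1" "integrable M h2"
      using gb hb m by (auto intro!: integrable_bdd[of _ 1])
    have i1: "integrable M (\<lambda>x. g2 x - g1 x)" "integrable M (\<lambda>x. h2 x - h1 x)"
      using i by auto
    have "integrable M (\<lambda>x. g2 x * h2 x)" "integrable M (\<lambda>x. g1 x * h1 x)"
      using gb hb m by (auto intro!: integrable_bdd[of _ 1] mult_le_one simp: abs_mult)
    then have i2: "integrable M (\<lambda>x. g2 x * h2 x - g1 x * h1 x)" by simp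
    have "g2 x * h2 x - g1 x * h1 x \<le> (g2 x - g1 x) + (h2 x - h1 x)" for x
    proof -
      have "g2 x * h2 x - g1 x * h1 x = (g2 x - g1 x) * h2 x + g1 x * (h2 x - h1 x)" by (simp add: algebra_simps)
      also have "\<dots> \<le> (g2 x - g1 x) * 1 + 1 * (h2 x - h1 x)"
        using gb[of x] hb[of x] by (intro add_mono mult_left_mono mult_right_mono) auto
      finally show ?thesis by simp
    qed
    then have "(\<integral>x. g2 x * h2 x - g1 x * h1 x \<partial>M) \<le> (\<integral>x. (g2 x - g1 x) + (h2 x - h1 x) \<partial>M)"
      using i1 i2 by (intro integral_mono) auto
    also have "\<dots> = (\<integral>x. g2 x - g1 x \<partial>M) + (\<integral>x. h2 x - h1 x \<partial>M)" using i1 by (rule Bochner_Integration.integral_add)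
    finally show ?thesis using g(7) h(7) by linarith
  qed
  moreover have "continuous_on UNIV (\<lambda>x. g1 x * h1 x)" "continuous_on UNIV (\<lambda>x. g2 x * h2 x)"
    by (intro continuous_intros g h)+
  ultimately show "\<exists>g1 g2. sandwich M (A \<inter> B) e g1 g2"
    unfolding sandwich_def by (intro exI[of _ "\<lambda>x. g1 x * h1 x"] exI[of _ "\<lambda>x. g2 x * h2 x"]) blast
qed

lemma jset_INT: "finite I \<Longrightarrow> (\<And>i. i \<in> I \<Longrightarrow> jset M (A i)) \<Longrightarrow> jset M (\<Inter>i\<in>I. A i)"
  by (induction I rule: finite_induct) (auto simp: jset_UNIV jset_Int)

lemma jset_vimage:
  assumes A: "jset M A" and T: "continuous_on UNIV T" "mpt T M"
  shows "jset M (T -` A)"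
proof (rule jsetI)
  fix e :: real assume e: "e > 0"
  obtain g1 g2 :: "'a \<Rightarrow> real" where g: "continuous_on UNIV g1" "continuous_on UNIV g2"
      "\<And>x. 0 \<le> g1 x" "\<And>x. g1 x \<le> indicator A x" "\<And>x. indicator A x \<le> g2 x" "\<And>x. g2 x \<le> 1"
      "(\<integral>x. g2 x - g1 x \<partial>M) < e" by (rule jsetE[OF A e]) (rule that)
  have "(\<integral>x. g2 (T x) - g1 (T x) \<partial>M) = (\<integral>x. g2 x - g1 x \<partial>distr M M T)"
    using T(2) g(1,2) by (subst integral_distr) (auto simp: mpt_def intro!: meas_cont continuous_on_diff)
  then have "(\<integral>x. g2 (T x) - g1 (T x) \<partial>M) < e" using g(7) T(2) by (simp add: mpt_def)
  moreover have "0 \<le> g1 (T x) \<and> g1 (T x) \<le> indicator (T -` A) x \<and> indicator (T -` A) x \<le> g2 (T x) \<and> g2 (T x) \<le> 1" for x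
    using g(3-6)[of "T x"] by (auto simp: indicator_def split: if_splits)
  moreover have "continuous_on UNIV (\<lambda>x. g1 (T x))" "continuous_on UNIV (\<lambda>x. g2 (T x))"
    using continuous_on_compose2[OF g(1) T(1)] continuous_on_compose2[OF g(2) T(1)] by auto
  ultimately show "\<exists>g1 g2. sandwich M (T -` A) e g1 g2"
    unfolding sandwich_def by (intro exI[of _ "\<lambda>x. g1 (T x)"] exI[of _ "\<lambda>x. g2 (T x)"]) blast
qed

text \<open>The inner and outer piecewise linear approximations eventually agree off the sphere of
  radius \<open>s\<close> and differ by 1 on it, so dominated convergence reduces the error to the
  mass of the sphere.\<close>

lemma jset_ball:
  assumes "measure M {y. dist x y = s} = 0"
  shows "jset M {y. dist x y < s}"
proof (rule jsetI)
  fix e :: real assume e: "e > 0"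
  define g1 where "g1 k y = max 0 (min 1 (real k * (s - dist x y)))" for k y
  define g2 where "g2 k y = max 0 (min 1 (1 + real k * (s - dist x y)))" for k y
  have c: "continuous_on UNIV (g1 k)" "continuous_on UNIV (g2 k)" for k
    unfolding g1_def g2_def by (intro continuous_intros)+
  have b: "0 \<le> g1 k y" "g1 k y \<le> 1" "0 \<le> g2 k y" "g2 k y \<le> 1" for k y by (auto simp: g1_def g2_def)
  have sandwich: "g1 k y \<le> indicator {y. dist x y < s} y" "indicator {y. dist x y < s} y \<le> g2 k y" for k y
    by (auto simp: g1_def g2_def indicator_def mult_nonneg_nonpos min_le_iff_disj)
  have mS: "{y. dist x y = s} \<in> sets M"
    by (intro meas_closed closed_Collect_eq continuous_intros)
  have "(\<lambda>k. \<integral>y. g2 k y - g1 k y \<partial>M) \<longlonglongrightarrow> (\<integral>y. indicator {y. dist x y = s} y \<partial>M)"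
  proof (rule integral_dominated_convergence[where w = "\<lambda>_. 1"])
    show "AE y in M. (\<lambda>k. g2 k y - g1 k y) \<longlonglongrightarrow> indicator {y. dist x y = s} y"
    proof (rule AE_I2)
      fix y
      have "eventually (\<lambda>k. g2 k y - g1 k y = indicator {y. dist x y = s} y) sequentially"
      proof (cases "dist x y = s")
        case True then show ?thesis by (simp add: g1_def g2_def)
      next
        case False
        then have pos: "\<bar>s - dist x y\<bar> > 0" by simp
        obtain K0 :: nat where K0: "real K0 > 1 / \<bar>s - dist x y\<bar>" using reals_Archimedean2 by blast
        have "g2 K y - g1 K y = 0" if "K \<ge> K0" for K
        proof -
          have "real K > 1 / \<bar>s - dist x y\<bar>" using K0 that by linarith
          then have "1 < real K * \<bar>s - dist x y\<bar>" using pos by (simp add: field_simps)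
          then show ?thesis by (cases "dist x y < s") (auto simp: g1_def g2_def algebra_simps abs_if split: if_splits)
        qed
        then show ?thesis using False unfolding eventually_sequentially by auto
      qed
      then show "(\<lambda>k. g2 k y - g1 k y) \<longlonglongrightarrow> indicator {y. dist x y = s} y" by (rule tendsto_eventually)
    qed
    show "AE y in M. norm (g2 k y - g1 k y) \<le> 1" for k
    proof (rule AE_I2)
      fix y show "norm (g2 k y - g1 k y) \<le> 1" using b[of k y] unfolding real_norm_def by linarith
    qed
  qed (use mS c in \<open>auto intro!: meas_cont continuous_on_diff borel_measurable_indicator\<close>)
  then have "(\<lambda>k. \<integral>y. g2 k y - g1 k y \<partial>M) \<longlonglongrightarrow> 0" using mS assms by simp
  then have "eventually (\<lambda>k. (\<integral>y. g2 k y - g1 k y \<partial>M) < e) sequentially"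
    using e by (intro order_tendstoD(2)) auto
  then obtain k where "(\<integral>y. g2 k y - g1 k y \<partial>M) < e" by (auto simp: eventually_sequentially)
  then show "\<exists>g1 g2. sandwich M {y. dist x y < s} e g1 g2"
    unfolding sandwich_def using c b sandwich by (intro exI[of _ "g1 k"] exI[of _ "g2 k"]) auto
qed

text \<open>The distribution of the distance from \<open>x\<close> has at most countably many atoms,
  while the radii below \<open>r\<close> are uncountable.\<close>

lemma null_sphere:
  assumes "r > 0"
  obtains s where "0 < s" "s < r" "measure M {y. dist x y = s} = 0"
proof -
  let ?D = "distr M borel (dist x)"
  have m: "dist x \<in> borel_measurable M" by (intro meas_cont continuous_intros)
  interpret D: prob_space ?D by (rule prob_space_distr[OF m])
  have "countable {t. measure ?D {t} \<noteq> 0}" by (rule D.countable_support)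
  moreover have "uncountable {0<..<r}" using assms by (simp add: uncountable_open_interval)
  ultimately have "\<not> {0<..<r} \<subseteq> {t. measure ?D {t} \<noteq> 0}"
    using countable_subset by blast
  then obtain s where s: "0 < s" "s < r" "measure ?D {s} = 0" by auto
  have "measure ?D {s} = measure M (dist x -` {s} \<inter> space M)" using m by (rule measure_distr) simp
  moreover have "dist x -` {s} \<inter> space M = {y. dist x y = s}" by (auto simp: space_eq)
  ultimately show ?thesis using that s by auto
qed

text \<open>Balls with null spheres are made disjoint by sending a point to the first ball of a
  finite cover that contains it. Small cells whose masses are weakly continuous let entropy at a
  fixed scale pass to weak limits.\<close>

lemma small_jset_partition:
  assumes cpt: "compact (UNIV :: 'a set)" and r: "r > 0"
  obtains X :: "'a \<Rightarrow> nat" where "finite (range X)" "\<And>v. X -` {v} \<in> sets M" "\<And>v. jset M (X -` {v})"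
    "\<And>x y. X x = X y \<Longrightarrow> dist x y \<le> r"
proof -
  have "\<forall>x. \<exists>s. 0 < s \<and> s < r / 2 \<and> measure M {y. dist x y = s} = 0"
  proof
    fix x
    have "r / 2 > 0" using r by simp
    from null_sphere[OF this, of x] obtain s where "0 < s" "s < r / 2" "measure M {y. dist x y = s} = 0" by auto
    then show "\<exists>s. 0 < s \<and> s < r / 2 \<and> measure M {y. dist x y = s} = 0" by auto
  qed
  from choice[OF this] obtain s where s: "\<And>x. 0 < s x" "\<And>x. s x < r / 2" "\<And>x. measure M {y. dist x y = s x} = 0"
    by auto
  let ?B = "\<lambda>x. {y. dist x y < s x}"
  have op: "open (?B x)" for x by (rule open_Collect_less) (intro continuous_intros)+
  have cov: "UNIV \<subseteq> (\<Union>x\<in>UNIV. ?B x)"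
  proof
    fix x
    have "x \<in> ?B x" using s(1)[of x] by simp
    then show "x \<in> (\<Union>x\<in>UNIV. ?B x)" by (rule UN_I[OF UNIV_I])
  qed
  obtain T where T: "finite T" "UNIV \<subseteq> (\<Union>x\<in>T. ?B x)"
    by (rule compactE_image[OF cpt op cov])
  obtain xs where xs: "set xs = T" using finite_list[OF T(1)] by blast
  have ex: "\<exists>i. i < length xs \<and> y \<in> ?B (xs ! i)" for y
  proof -
    obtain t where "t \<in> T" "y \<in> ?B t" using T(2) by auto
    then show ?thesis using xs in_set_conv_nth[of t xs] by auto
  qed
  define X where "X y = (LEAST i. i < length xs \<and> y \<in> ?B (xs ! i))" for y
  have X: "X y < length xs" "y \<in> ?B (xs ! X y)" for y
    using LeastI_ex[OF ex[of y]] unfolding X_def by auto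
  have fib: "X -` {v} = (if v < length xs then ?B (xs ! v) \<inter> (\<Inter>j\<in>{..<v}. - ?B (xs ! j)) else {})" for v
  proof (cases "v < length xs")
    case True
    have "X y = v \<longleftrightarrow> y \<in> ?B (xs ! v) \<and> (\<forall>j<v. y \<notin> ?B (xs ! j))" for y
    proof
      assume "X y = v"
      then show "y \<in> ?B (xs ! v) \<and> (\<forall>j<v. y \<notin> ?B (xs ! j))"
        using X(2)[of y] not_less_Least[of _ "\<lambda>i. i < length xs \<and> y \<in> ?B (xs ! i)", folded X_def[of y]] True by auto
    next
      assume *: "y \<in> ?B (xs ! v) \<and> (\<forall>j<v. y \<notin> ?B (xs ! j))"
      show "X y = v" unfolding X_def
        using * True by (intro Least_equality) (auto simp: not_less[symmetric])
    qed
    then show ?thesis using True by auto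
  next
    case False
    then show ?thesis using X(1) by auto
  qed
  show ?thesis
  proof (rule that[of X])
    show "finite (range X)" by (rule finite_subset[of _ "{..<length xs}"]) (use X in auto)
    have bm: "?B x \<in> sets M" for x by (rule meas_open[OF op])
    show "X -` {v} \<in> sets M" for v
    proof -
      have "?B (xs ! v) - (\<Union>j\<in>{..<v}. ?B (xs ! j)) \<in> sets M"
        by (intro sets.Diff sets.finite_UN bm) auto
      moreover have "?B (xs ! v) \<inter> (\<Inter>j\<in>{..<v}. - ?B (xs ! j)) = ?B (xs ! v) - (\<Union>j\<in>{..<v}. ?B (xs ! j))" by auto
      ultimately show ?thesis unfolding fib by simp
    qed
    show "jset M (X -` {v})" for v unfolding fib
      by (auto intro!: jset_Int jset_INT jset_Compl jset_ball s(3) jset_empty)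
    show "dist x y \<le> r" if "X x = X y" for x y
    proof -
      have "dist (xs ! X x) x < r / 2" "dist (xs ! X x) y < r / 2"
        using X(2)[of x] X(2)[of y] that s(2)[of "xs ! X x"] by auto
      then show ?thesis using dist_triangle3[of x y "xs ! X x"] by linarith
    qed
  qed
qed

lemma jset_itin:
  assumes f: "continuous_on UNIV f" "mpt f M" and X: "\<And>v. jset M (X -` {v})"
  shows "jset M (itin f X n -` {v})"
proof (cases "length v = n")
  case True
  have "itin f X n -` {v} = (\<Inter>k\<in>{..<n}. (f ^^ k) -` (X -` {v ! k}))"
  proof -
    have "itin f X n x = v \<longleftrightarrow> (\<forall>k<n. X ((f ^^ k) x) = v ! k)" for x
      unfolding itin_def list_eq_iff_nth_eq using True by simp
    then show ?thesis by auto
  qed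
  moreover have "continuous_on UNIV (f ^^ k)" for k
  proof (induction k)
    case (Suc k)
    then show ?case using continuous_on_compose2[OF f(1) Suc] by (simp add: o_def)
  qed (simp add: id_def)
  ultimately show ?thesis using X mpt_iter[OF f(2)] by (auto intro!: jset_INT jset_vimage)
next
  case False
  then have "itin f X n -` {v} = {}" by (auto simp: itin_def)
  then show ?thesis using jset_empty by simp
qed

end

section \<open>Birkhoff's ergodic theorem\<close>

lemma birkhoff_Suc_shift: "birkhoff f g (Suc n) x = g x + birkhoff f g n (f x)"
  using birkhoff_add[of f g 1 n x] by (simp add: birkhoff_def)

context mpt_space
begin

lemma f_meas: "f \<in> measurable M M"
  using mpt by (simp add: mpt_def)

lemma iter_meas: "f ^^ k \<in> measurable M M"
  using mpt_iter[OF mpt] by (simp add: mpt_def)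

lemma birkhoff_meas: "g \<in> borel_measurable M \<Longrightarrow> birkhoff f g n \<in> borel_measurable M"
  unfolding birkhoff_def[abs_def] by (intro borel_measurable_sum measurable_compose[OF iter_meas])

lemma integral_mpt:
  fixes g :: "'a \<Rightarrow> real"
  assumes "g \<in> borel_measurable M"
  shows "(\<integral>x. g (f x) \<partial>M) = integral\<^sup>L M g"
proof -
  have "integral\<^sup>L (distr M M f) g = (\<integral>x. g (f x) \<partial>M)"
    using assms by (intro integral_distr[OF f_meas])
  then show ?thesis using mpt by (simp add: mpt_def)
qed

lemma integrable_bounded: "(g :: 'a \<Rightarrow> real) \<in> borel_measurable M \<Longrightarrow> (\<And>x. \<bar>g x\<bar> \<le> b) \<Longrightarrow> integrable M g"
  by (rule integrable_const_bound[of _ b]) auto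

text \<open>Garsia's argument: \<open>F n\<close> below is the maximum of the first \<open>n\<close> Birkhoff sums (including the empty one).\<close>

lemma maximal_ergodic:
  fixes h :: "'a \<Rightarrow> real"
  assumes h: "h \<in> borel_measurable M" "\<And>x. \<bar>h x\<bar> \<le> b"
    and pos: "\<And>x. \<exists>k. birkhoff f h k x > 0"
  shows "0 \<le> integral\<^sup>L M h"
proof -
  define F where "F n = rec_nat (\<lambda>_. 0) (\<lambda>_ G x. max 0 (h x + G (f x))) n" for n :: nat
  have F0: "F 0 x = 0" and FS: "F (Suc n) x = max 0 (h x + F n (f x))" for n x
    by (auto simp: F_def)
  have Fm: "F n \<in> borel_measurable M" for n
  proof (induction n)
    case 0
    have "F 0 = (\<lambda>_. 0)" by (simp add: F0 fun_eq_iff)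
    then show ?case by simp
  next
    case (Suc n)
    have "F (Suc n) = (\<lambda>x. max 0 (h x + F n (f x)))" by (simp add: FS fun_eq_iff)
    then show ?case using h(1) measurable_compose[OF f_meas Suc] by simp
  qed
  have F_nonneg: "0 \<le> F n x" for n x by (cases n) (auto simp: F0 FS)
  have Fmono: "F n x \<le> F (Suc n) x" for n x
  proof (induction n arbitrary: x)
    case (Suc n)
    show ?case unfolding FS[of "Suc n" x] FS[of n x] using Suc[of "f x"] by (intro max.mono) auto
  qed (simp add: F0 F_nonneg)
  have b0: "0 \<le> b" using h(2) abs_ge_zero order_trans by blast
  have Fb: "\<bar>F n x\<bar> \<le> real n * b" for n x
  proof (induction n arbitrary: x)
    case (Suc n)
    have "h x + F n (f x) \<le> b + real n * b" using h(2)[of x] Suc[of "f x"] by (simp add: abs_le_iff)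
    moreover have "0 \<le> b + real n * b" using b0 by simp
    ultimately show ?case using F_nonneg[of "Suc n" x] by (simp add: FS algebra_simps)
  qed (simp add: F0)
  have Fi: "integrable M (F n)" for n by (rule integrable_bounded[OF Fm Fb])
  have Ffi: "integrable M (\<lambda>x. F n (f x))" for n
    by (rule integrable_bounded[OF measurable_compose[OF f_meas Fm] Fb])
  have hi: "integrable M h" by (rule integrable_bounded[OF h])
  have SF: "birkhoff f h k x \<le> F n x" if "k \<le> n" for k n x
    using that
  proof (induction n arbitrary: k x)
    case (Suc n)
    show ?case
    proof (cases k)
      case 0 then show ?thesis by (simp add: F_nonneg)
    next
      case (Suc j)
      have "birkhoff f h j (f x) \<le> F n (f x)" using Suc Suc.prems by (intro Suc.IH) simp
      then show ?thesis using Suc by (simp add: birkhoff_Suc_shift FS max.coboundedI2)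
    qed
  qed (simp add: F0)
  let ?P = "\<lambda>n. {x. 0 < F n x}"
  have Pm: "?P n \<in> sets M" for n
    using borel_measurable_less[OF borel_measurable_const Fm[of n], of 0] by (simp add: space_UNIV)
  have nonneg: "0 \<le> (\<integral>x. indicator (?P (Suc n)) x * h x \<partial>M)" for n
  proof -
    have "0 = (\<integral>x. F (Suc n) x - F (Suc n) (f x) \<partial>M)"
      using Fi[of "Suc n"] Ffi[of "Suc n"] by (simp add: integral_mpt[OF Fm])
    also have "\<dots> \<le> (\<integral>x. indicator (?P (Suc n)) x * h x \<partial>M)"
    proof (rule integral_mono)
      show "integrable M (\<lambda>x. F (Suc n) x - F (Suc n) (f x))"
        using Fi[of "Suc n"] Ffi[of "Suc n"] by simp
      show "integrable M (\<lambda>x. indicator (?P (Suc n)) x * h x)"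
        using integrable_real_mult_indicator[OF Pm[of "Suc n"] hi] by (simp add: mult.commute)
      \<comment> \<open>Where the maximum is positive it is \<open>h\<close> plus the shorter
        maximum at \<open>f x\<close>; elsewhere it vanishes. The left side has integral 0 by
        invariance.\<close>
      show "F (Suc n) x - F (Suc n) (f x) \<le> indicator (?P (Suc n)) x * h x" for x
      proof (cases "x \<in> ?P (Suc n)")
        case True
        then have "F (Suc n) x = h x + F n (f x)" by (simp add: FS max_def split: if_splits)
        then show ?thesis using Fmono[of n "f x"] True by simp
      next
        case False
        then show ?thesis using F_nonneg[of "Suc n" x] F_nonneg[of "Suc n" "f x"] by simp
      qed
    qed
    finally show ?thesis .
  qed
  have "(\<lambda>n. \<integral>x. indicator (?P (Suc n)) x * h x \<partial>M) \<longlonglongrightarrow> integral\<^sup>L M h"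
  proof (rule integral_dominated_convergence[where w = "\<lambda>_. b"])
    show "AE x in M. (\<lambda>n. indicator (?P (Suc n)) x * h x) \<longlonglongrightarrow> h x"
    proof (rule AE_I2)
      fix x
      obtain k where "birkhoff f h k x > 0" using pos by blast
      then have "indicator (?P (Suc n)) x * h x = h x" if "n \<ge> k" for n
        using SF[of k "Suc n" x] that by simp
      then show "(\<lambda>n. indicator (?P (Suc n)) x * h x) \<longlonglongrightarrow> h x"
        by (intro tendsto_eventually) (auto simp: eventually_sequentially)
    qed
    show "AE x in M. norm (indicator (?P (Suc n)) x * h x) \<le> b" for n
      using h(2) b0 by (intro AE_I2) (auto simp: indicator_def)
  qed (use h(1) Pm in auto)
  then show ?thesis by (rule LIMSEQ_le_const) (use nonneg in auto)
qed

end

section \<open>Convergence of Birkhoff averages\<close>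

definition avg :: "('a \<Rightarrow> 'a) \<Rightarrow> ('a \<Rightarrow> real) \<Rightarrow> nat \<Rightarrow> 'a \<Rightarrow> real" where
  "avg f g n x = birkhoff f g (Suc n) x / real (Suc n)"

lemma avg_bound: "(\<And>x. \<bar>g x\<bar> \<le> b) \<Longrightarrow> \<bar>avg f g n x\<bar> \<le> b"
  using birkhoff_abs_le[of g b f "Suc n" x] by (simp add: avg_def divide_le_eq abs_mult mult.commute)

lemma avg_shift:
  assumes "\<And>x. \<bar>g x\<bar> \<le> b"
  shows "(\<lambda>n. avg f g n (f x) - avg f g n x) \<longlonglongrightarrow> 0"
proof (rule Lim_null_comparison)
  have "avg f g n (f x) - avg f g n x = (g ((f ^^ Suc n) x) - g x) / real (Suc n)" for n
    using birkhoff_Suc_shift[of f g "Suc n" x] birkhoff_Suc[of f g "Suc n" x]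
    by (simp add: avg_def diff_divide_distrib[symmetric])
  moreover have "\<bar>g ((f ^^ Suc n) x) - g x\<bar> \<le> 2 * b" for n
    using assms[of "(f ^^ Suc n) x"] assms[of x] by linarith
  ultimately show "\<forall>\<^sub>F n in sequentially. norm (avg f g n (f x) - avg f g n x) \<le> 2 * b / real (Suc n)"
    by (auto intro!: always_eventually divide_right_mono simp: abs_mult)
  show "(\<lambda>n. 2 * b / real (Suc n)) \<longlonglongrightarrow> 0"
    using LIMSEQ_Suc[OF lim_const_over_n[of "2 * b"]] by simp
qed

context mpt_space
begin

lemma avg_meas: "g \<in> borel_measurable M \<Longrightarrow> avg f g n \<in> borel_measurable M"
  unfolding avg_def[abs_def] using birkhoff_meas[of g "Suc n"] by simp

lemma integral_avg:
  assumes g: "g \<in> borel_measurable M" "\<And>x. \<bar>g x\<bar> \<le> b"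
  shows "integral\<^sup>L M (avg f g n) = integral\<^sup>L M g"
proof -
  have "(\<integral>x. g ((f ^^ k) x) \<partial>M) = integral\<^sup>L M g" for k
  proof -
    interpret k: mpt_space M "f ^^ k" by unfold_locales (rule mpt_iter[OF mpt])
    show ?thesis by (rule k.integral_mpt[OF g(1)])
  qed
  moreover have "integrable M (\<lambda>x. g ((f ^^ k) x))" for k
    using g by (intro integrable_bounded[of _ b] measurable_compose[OF iter_meas]) auto
  ultimately show ?thesis
    by (simp add: avg_def[abs_def] birkhoff_def del: sum.lessThan_Suc)
qed

text \<open>The upper limit \<open>u\<close> is invariant, so the \<open>n\<close>-th Birkhoff sum
  of \<open>g - u + e\<close> is that of \<open>g\<close> minus \<open>n * (u - e)\<close>. Some of
  these sums is positive at every point, since otherwise all averages would be at most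
  \<open>u - e\<close>; so the maximal inequality applies on the whole space.\<close>

lemma limsup_integral_le:
  fixes g :: "'a \<Rightarrow> real"
  assumes g: "g \<in> borel_measurable M" "\<And>x. \<bar>g x\<bar> \<le> b"
  defines "u \<equiv> \<lambda>x. real_of_ereal (limsup (\<lambda>n. ereal (avg f g n x)))"
  shows "u \<in> borel_measurable M" "\<And>x. ereal (u x) = limsup (\<lambda>n. ereal (avg f g n x))"
    "\<And>x. \<bar>u x\<bar> \<le> b" "integral\<^sup>L M u \<le> integral\<^sup>L M g"
proof -
  let ?U = "\<lambda>x. limsup (\<lambda>n. ereal (avg f g n x))"
  have ab: "- b \<le> avg f g n x" "avg f g n x \<le> b" for n x
    using avg_bound[of g b f n x] g(2) by (auto simp: abs_le_iff)
  have Ub: "ereal (- b) \<le> ?U x" "?U x \<le> ereal b" for x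
    using ab by (auto intro!: Limsup_bounded le_Limsup always_eventually)
  have Uu: "ereal (u x) = ?U x" for x
    unfolding u_def using Ub[of x] by (intro ereal_real') auto
  then show Uu': "\<And>x. ereal (u x) = ?U x" .
  show um: "u \<in> borel_measurable M"
    unfolding u_def using avg_meas[OF g(1)] by measurable
  show ub: "\<bar>u x\<bar> \<le> b" for x
    using Ub[of x] unfolding Uu[symmetric] by (simp add: abs_le_iff)
  have inv: "u (f x) = u x" for x
  proof -
    have "?U (f x) = limsup (\<lambda>n. ereal (avg f g n (f x) - avg f g n x) + ereal (avg f g n x))" by simp
    also have "\<dots> = 0 + ?U x"
      using avg_shift[of g b f x, OF g(2)] by (intro ereal_limsup_lim_add) (auto simp: zero_ereal_def)
    finally show ?thesis by (simp add: u_def)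
  qed
  have invk: "u ((f ^^ k) x) = u x" for k x by (induction k) (auto simp: inv)
  have "integral\<^sup>L M u \<le> integral\<^sup>L M g + e" if e: "e > 0" for e
  proof -
    define h where "h x = g x - u x + e" for x
    have ui: "integrable M u" "integrable M g" by (rule integrable_bounded[OF um ub], rule integrable_bounded[OF g])
    have "0 \<le> integral\<^sup>L M h"
    proof (rule maximal_ergodic)
      show "h \<in> borel_measurable M" using um g by (simp add: h_def[abs_def])
      show "\<bar>h x\<bar> \<le> 2 * b + e" for x using ub[of x] g(2)[of x] e unfolding h_def by linarith
      show "\<exists>k. birkhoff f h k x > 0" for x
      proof (rule ccontr)
        assume no: "\<not> (\<exists>k. birkhoff f h k x > 0)"
        have "avg f g n x \<le> u x - e" for n
        proof -
          have "birkhoff f h (Suc n) x = birkhoff f g (Suc n) x - real (Suc n) * (u x - e)"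
            by (simp add: birkhoff_def h_def invk sum.distrib sum_subtractf algebra_simps del: sum.lessThan_Suc)
          then have "birkhoff f g (Suc n) x \<le> real (Suc n) * (u x - e)" using no by (metis diff_gt_0_iff_gt not_le)
          then show ?thesis by (simp add: avg_def divide_le_eq mult.commute)
        qed
        then have "?U x \<le> ereal (u x - e)" by (intro Limsup_bounded always_eventually) auto
        then show False using e unfolding Uu[symmetric] by simp
      qed
    qed
    also have "integral\<^sup>L M h = integral\<^sup>L M g - integral\<^sup>L M u + e"
      using ui prob_space by (simp add: h_def[abs_def])
    finally show ?thesis by simp
  qed
  then show "integral\<^sup>L M u \<le> integral\<^sup>L M g" by (rule field_le_epsilon)
qed

text \<open>Applied to \<open>g\<close> and \<open>- g\<close>, the previous bound shows that the
  upper limit minus the lower limit, a nonnegative function, has integral at most 0.\<close>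

theorem birkhoff_AE:
  fixes g :: "'a \<Rightarrow> real"
  assumes g: "g \<in> borel_measurable M" "\<And>x. \<bar>g x\<bar> \<le> b"
  shows "AE x in M. convergent (\<lambda>n. avg f g n x)"
proof -
  define u where "u = (\<lambda>x. real_of_ereal (limsup (\<lambda>n. ereal (avg f g n x))))"
  define v where "v = (\<lambda>x. real_of_ereal (limsup (\<lambda>n. ereal (avg f (\<lambda>x. - g x) n x))))"
  have g': "(\<lambda>x. - g x) \<in> borel_measurable M" "\<And>x. \<bar>- g x\<bar> \<le> b" using g by auto
  have u: "u \<in> borel_measurable M" "\<And>x. ereal (u x) = limsup (\<lambda>n. ereal (avg f g n x))"
    "\<And>x. \<bar>u x\<bar> \<le> b" "integral\<^sup>L M u \<le> integral\<^sup>L M g"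
    unfolding u_def by (rule limsup_integral_le[OF g])+
  have v: "v \<in> borel_measurable M" "\<And>x. ereal (v x) = limsup (\<lambda>n. ereal (avg f (\<lambda>x. - g x) n x))"
    "\<And>x. \<bar>v x\<bar> \<le> b" "integral\<^sup>L M v \<le> integral\<^sup>L M (\<lambda>x. - g x)"
    unfolding v_def by (rule limsup_integral_le[OF g'])+
  have neg: "avg f (\<lambda>x. - g x) n x = - avg f g n x" for n x
    by (simp add: avg_def birkhoff_def sum_negf del: sum.lessThan_Suc)
  have v': "ereal (- v x) = liminf (\<lambda>n. ereal (avg f g n x))" for x
  proof -
    have "ereal (v x) = - liminf (\<lambda>n. ereal (avg f g n x))"
      using v(2)[of x] ereal_Limsup_uminus[of sequentially "\<lambda>n. ereal (avg f g n x)"] by (simp add: neg)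
    then have "- ereal (v x) = liminf (\<lambda>n. ereal (avg f g n x))" by simp
    then show ?thesis by simp
  qed
  have ge: "0 \<le> u x + v x" for x
  proof -
    have "ereal (- v x) \<le> ereal (u x)" unfolding v' u(2) by (rule Liminf_le_Limsup) simp
    then show ?thesis by simp
  qed
  have i: "integrable M u" "integrable M v" by (rule integrable_bounded[OF u(1,3)], rule integrable_bounded[OF v(1,3)])
  have "integral\<^sup>L M (\<lambda>x. u x + v x) \<le> 0"
    using Bochner_Integration.integral_add[OF i] u(4) v(4) by simp
  moreover have "0 \<le> integral\<^sup>L M (\<lambda>x. u x + v x)" using ge by (intro integral_nonneg_AE AE_I2) auto
  ultimately have "AE x in M. u x + v x = 0"
    using integral_nonneg_eq_0_iff_AE[of M "\<lambda>x. u x + v x"] i ge by auto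
  then show ?thesis
  proof eventually_elim
    case (elim x)
    then have "- v x = u x" by simp
    then have "liminf (\<lambda>n. ereal (avg f g n x)) = ereal (u x)" "limsup (\<lambda>n. ereal (avg f g n x)) = ereal (u x)"
      using v'[of x] u(2)[of x] by auto
    then have "(\<lambda>n. ereal (avg f g n x)) \<longlonglongrightarrow> ereal (u x)" by (intro Liminf_eq_Limsup) auto
    then show ?case by (auto simp: convergent_def)
  qed
qed

end

section \<open>The ergodic decomposition by empirical limits\<close>

text \<open>Every continuous function is a uniform limit of finite maxima of cones
  \<open>q - k * dist x p\<close> with rational heights and vertices in a countable dense set.\<close>

fun cones :: "nat \<Rightarrow> ('a::metric_space \<times> rat) list \<Rightarrow> 'a \<Rightarrow> real" where
  "cones k [] x = - real k"
| "cones k ((p, q) # l) x = max (of_rat q - real k * dist x p) (cones k l x)"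

lemma cones_cont: "continuous_on UNIV (cones k l)"
proof (induction l)
  case Nil
  have "cones k [] = (\<lambda>x. - real k)" by (simp add: fun_eq_iff)
  then show ?case by simp
next
  case (Cons a l)
  obtain p q where a: "a = (p, q)" by (cases a)
  have "cones k (a # l) = (\<lambda>x. max (of_rat q - real k * dist x p) (cones k l x))" by (simp add: fun_eq_iff a)
  then show ?case using Cons by (auto intro!: continuous_intros)
qed

lemma cones_le: "- real k \<le> c \<Longrightarrow> (\<And>p q. (p, q) \<in> set l \<Longrightarrow> of_rat q - real k * dist x p \<le> c) \<Longrightarrow> cones k l x \<le> c"
  by (induction l) auto

lemma cones_ge: "(p, q) \<in> set l \<Longrightarrow> of_rat q - real k * dist x p \<le> cones k l x"
  by (induction l) (auto simp: max.coboundedI2)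

lemma dense_continuous:
  assumes cpt: "compact (UNIV :: 'a::metric_space set)"
  obtains gs :: "nat \<Rightarrow> 'a::metric_space \<Rightarrow> real" where "\<And>i. continuous_on UNIV (gs i)"
    "\<And>g e. continuous_on UNIV g \<Longrightarrow> e > 0 \<Longrightarrow> \<exists>i. \<forall>x. \<bar>g x - gs i x\<bar> \<le> e"
proof -
  have "\<exists>T :: 'a set. finite T \<and> (\<forall>x. \<exists>t\<in>T. dist x t < 1 / real (Suc n))" for n
  proof -
    have cov: "(UNIV :: 'a set) \<subseteq> (\<Union>t\<in>UNIV. ball t (1 / real (Suc n)))"
    proof
      fix x :: 'a
      have "x \<in> ball x (1 / real (Suc n))" by simp
      then show "x \<in> (\<Union>t\<in>UNIV. ball t (1 / real (Suc n)))" by (rule UN_I[OF UNIV_I])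
    qed
    obtain T :: "'a set" where "T \<subseteq> UNIV" "finite T" "UNIV \<subseteq> (\<Union>t\<in>T. ball t (1 / real (Suc n)))"
      by (rule compactE_image[OF cpt open_ball cov])
    moreover from this(3) have "\<exists>t\<in>T. dist x t < 1 / real (Suc n)" for x
    proof -
      assume "UNIV \<subseteq> (\<Union>t\<in>T. ball t (1 / real (Suc n)))"
      then have "x \<in> (\<Union>t\<in>T. ball t (1 / real (Suc n)))" by (rule subsetD) simp
      then show ?thesis by (auto simp: dist_commute simp del: of_nat_Suc)
    qed
    ultimately show ?thesis by blast
  qed
  then have "\<forall>n. \<exists>T :: 'a set. finite T \<and> (\<forall>x. \<exists>t\<in>T. dist x t < 1 / real (Suc n))" by blast
  from choice[OF this] obtain T :: "nat \<Rightarrow> 'a set"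
    where T: "\<And>n. finite (T n)" "\<And>n x. \<exists>t\<in>T n. dist x t < 1 / real (Suc n)" by (elim exE) blast
  define D where "D = (\<Union>n. T n)"
  define I where "I = (UNIV :: nat set) \<times> lists (D \<times> (UNIV :: rat set))"
  have "countable D" unfolding D_def using T(1) by (intro countable_UN) (auto intro: countable_finite)
  then have "countable I" unfolding I_def by (intro countable_SIGMA countable_lists) auto
  moreover have "I \<noteq> {}" by (auto simp: I_def)
  ultimately have ran: "range (from_nat_into I) = I" by (simp add: range_from_nat_into)
  define gs where "gs i = cones (fst (from_nat_into I i)) (snd (from_nat_into I i))" for i
  show ?thesis
  proof (rule that[of gs])
    show "continuous_on UNIV (gs i)" for i unfolding gs_def[abs_def] by (rule cones_cont)
    fix g :: "'a \<Rightarrow> real" and e :: real assume g: "continuous_on UNIV g" and e: "e > 0"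
    have "bounded (g ` UNIV)" using compact_imp_bounded[OF compact_continuous_image[OF g cpt]] .
    then obtain b where b: "b > 0" "\<And>x. \<bar>g x\<bar> \<le> b" by (auto simp: bounded_pos)
    define e' where "e' = e / 3"
    have e': "e' > 0" using e by (simp add: e'_def)
    have "\<exists>r>0. \<forall>y\<in>UNIV. \<forall>x\<in>UNIV. dist x y < r \<longrightarrow> dist (g x) (g y) < e'"
      using compact_uniformly_continuous[OF g cpt] e' unfolding uniformly_continuous_on_def by simp
    then obtain r where r: "r > 0" "\<And>x y. dist x y < r \<Longrightarrow> \<bar>g x - g y\<bar> < e'"
      by (auto simp: dist_real_def)
    \<comment> \<open>The slope makes a cone drop by at least \<open>2 * b\<close> beyond distance
      \<open>r\<close>, so far vertices cannot lift the maximum above \<open>g\<close>;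
      \<open>k > b\<close> does the same for the base value \<open>- k\<close>.\<close>
    obtain k :: nat where k: "real k > max b (2 * b / r)" using reals_Archimedean2 by blast
    have kr: "real k * r \<ge> 2 * b" using k r by (simp add: field_simps)
    \<comment> \<open>The net is finer than \<open>r\<close>, and so fine that the cone of the
      nearest vertex has lost less than \<open>e'\<close> at \<open>x\<close>.\<close>
    obtain n :: nat where "real n > max (1 / r) (real k / e')" using reals_Archimedean2 by blast
    then have "1 / r < real (Suc n)" "real k / e' < real (Suc n)" by auto
    then have n: "1 / real (Suc n) < r" "real k * (1 / real (Suc n)) < e'"
      using r e' by (auto simp: field_simps simp del: of_nat_Suc)
    have "\<forall>p. \<exists>q :: rat. of_rat q \<le> g p \<and> g p - e' < of_rat q"
    proof
      fix p
      have "g p - e' < g p" using e' by simp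
      from of_rat_dense[OF this] show "\<exists>q :: rat. of_rat q \<le> g p \<and> g p - e' < of_rat q" by (auto intro: less_imp_le)
    qed
    then obtain q where q: "\<And>p. of_rat (q p) \<le> g p" "\<And>p. g p - e' < of_rat (q p)" by metis
    obtain ps where ps: "set ps = T n" using finite_list[OF T(1)] by blast
    define l where "l = map (\<lambda>p. (p, q p)) ps"
    have "(k, l) \<in> I" using ps by (auto simp: I_def D_def l_def)
    then obtain i where i: "from_nat_into I i = (k, l)" using ran by (metis rangeE)
    have "\<bar>g x - gs i x\<bar> \<le> e" for x
    proof -
      have "cones k l x \<le> g x + e'"
      proof (rule cones_le)
        show "- real k \<le> g x + e'" using k b(2)[of x] e' by linarith
        fix p q' assume "(p, q') \<in> set l"
        then have q': "q' = q p" by (auto simp: l_def)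
        show "of_rat q' - real k * dist x p \<le> g x + e'"
        proof (cases "dist x p < r")
          case True
          have "0 \<le> real k * dist x p" by simp
          then show ?thesis using r(2)[OF True] q(1)[of p] unfolding q' by linarith
        next
          case False
          then have "real k * r \<le> real k * dist x p" by (intro mult_left_mono) auto
          then show ?thesis using kr q(1)[of p] b(2)[of p] b(2)[of x] e' unfolding q' by linarith
        qed
      qed
      moreover have "g x - 3 * e' \<le> cones k l x"
      proof -
        obtain p where p: "p \<in> T n" "dist x p < 1 / real (Suc n)" using T(2) by blast
        have "of_rat (q p) - real k * dist x p \<le> cones k l x"
          by (rule cones_ge) (use p ps in \<open>auto simp: l_def\<close>)
        moreover have "real k * dist x p \<le> real k * (1 / real (Suc n))" using p by (intro mult_left_mono) auto
        moreover have "\<bar>g x - g p\<bar> < e'" using p n by (intro r(2)) linarith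
        ultimately show ?thesis using q(2)[of p] n(2) by linarith
      qed
      ultimately show ?thesis using e' unfolding gs_def i e'_def by (simp add: abs_le_iff)
    qed
    then show "\<exists>i. \<forall>x. \<bar>g x - gs i x\<bar> \<le> e" by blast
  qed
qed

sublocale borel_prob \<subseteq> full_prob_space
  by unfold_locales (rule space_eq)

locale borel_mpt = borel_prob M + compact_dynamics f for M :: "'a::metric_space measure" and f +
  assumes mptf: "mpt f M"

sublocale borel_mpt \<subseteq> mpt_space
  by unfold_locales (rule mptf)

lemma (in compact_dynamics) borel_mptI: "borel_prob M \<Longrightarrow> mpt f M \<Longrightarrow> borel_mpt M f"
  using compact_dynamics_axioms by (simp add: borel_mpt_def borel_mpt_axioms_def)

section \<open>Empirical limits as a measurable kernel\<close>

context compact_dynamics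
begin

lemma invariant_prob_iff: "invariant_prob f M \<longleftrightarrow> borel_prob M \<and> mpt f M"
  by (auto simp: invariant_prob_def borel_prob_def borel_prob_axioms_def mpt_def)

definition Y :: "'a set" where
  "Y = {x. \<forall>g. continuous_on UNIV g \<longrightarrow> convergent (\<lambda>n. avg f g n x)}"

text \<open>The limit of the empirical measures of the orbit of \<open>x\<close>; an arbitrary point mass if they do not converge.\<close>

definition ker :: "'a \<Rightarrow> 'a measure" where
  "ker x = (if x \<in> Y then mean_functional.riesz (\<lambda>g. lim (\<lambda>n. avg f g n x)) else return borel undefined)"

definition ker_mean :: "('a \<Rightarrow> real) \<Rightarrow> 'a \<Rightarrow> real" where
  "ker_mean g x = integral\<^sup>L (ker x) g"

lemma avg_add: "avg f (\<lambda>x. g x + h x) n x = avg f g n x + avg f h n x"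
  by (simp add: avg_def birkhoff_def sum.distrib add_divide_distrib del: sum.lessThan_Suc)

lemma avg_scale: "avg f (\<lambda>x. c * g x) n x = c * avg f g n x"
  by (simp add: avg_def birkhoff_def sum_distrib_left del: sum.lessThan_Suc)

lemma mean_functional_lim:
  assumes x: "x \<in> Y"
  shows "mean_functional (\<lambda>g. lim (\<lambda>n. avg f g n x))"
proof
  have L: "(\<lambda>n. avg f g n x) \<longlonglongrightarrow> lim (\<lambda>n. avg f g n x)" if "continuous_on UNIV g" for g
    using x that by (simp add: Y_def convergent_LIMSEQ_iff)
  show "compact (UNIV :: 'a set)" by (rule compact_space)
  show "lim (\<lambda>n. avg f (\<lambda>x. g x + h x) n x) = lim (\<lambda>n. avg f g n x) + lim (\<lambda>n. avg f h n x)"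
    if "continuous_on UNIV g" "continuous_on UNIV h" for g h
    unfolding avg_add by (rule limI) (intro tendsto_add L that)
  show "lim (\<lambda>n. avg f (\<lambda>x. c * g x) n x) = c * lim (\<lambda>n. avg f g n x)" if "continuous_on UNIV g" for g c
    unfolding avg_scale by (rule limI) (intro tendsto_mult_left L that)
  show "0 \<le> lim (\<lambda>n. avg f g n x)" if "continuous_on UNIV g" "\<And>x. 0 \<le> g x" for g
    by (rule LIMSEQ_le_const[OF L[OF that(1)]])
       (auto simp: avg_def birkhoff_def intro!: exI divide_nonneg_nonneg sum_nonneg that(2) simp del: sum.lessThan_Suc)
  have "avg f (\<lambda>_. 1) n x = 1" for n by (simp add: avg_def birkhoff_def del: sum.lessThan_Suc of_nat_Suc)
  then show "lim (\<lambda>n. avg f (\<lambda>_. 1) n x) = 1" by simp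
qed

lemma ker_mean_Y: "x \<in> Y \<Longrightarrow> continuous_on UNIV g \<Longrightarrow> ker_mean g x = lim (\<lambda>n. avg f g n x)"
  using mean_functional.integral_riesz[OF mean_functional_lim] by (simp add: ker_mean_def ker_def)

lemma borel_prob_ker: "borel_prob (ker x)"
proof (cases "x \<in> Y")
  case True
  then show ?thesis using mean_functional.borel_prob_riesz[OF mean_functional_lim] by (simp add: ker_def)
next
  case False
  then show ?thesis using prob_space_return[of undefined "borel :: 'a measure"]
    by (simp add: ker_def borel_prob_def borel_prob_axioms_def)
qed

lemma avg_shift_lim:
  assumes "continuous_on UNIV g" "(\<lambda>n. avg f g n x) \<longlonglongrightarrow> l"
  shows "(\<lambda>n. avg f g n (f x)) \<longlonglongrightarrow> l"
proof -
  obtain b where "\<And>x. \<bar>g x\<bar> \<le> b" using bdd_cont[OF assms(1)] by metis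
  from tendsto_add[OF avg_shift[of g b f x, OF this] assms(2)] show ?thesis by simp
qed

lemma avg_shift_lim':
  assumes "continuous_on UNIV g" "(\<lambda>n. avg f g n (f x)) \<longlonglongrightarrow> l"
  shows "(\<lambda>n. avg f g n x) \<longlonglongrightarrow> l"
proof -
  obtain b where "\<And>x. \<bar>g x\<bar> \<le> b" using bdd_cont[OF assms(1)] by metis
  from tendsto_diff[OF assms(2) avg_shift[of g b f x, OF this]] show ?thesis by simp
qed

lemma Y_f: "f x \<in> Y \<longleftrightarrow> x \<in> Y"
  unfolding Y_def convergent_def using avg_shift_lim avg_shift_lim' by blast

lemma ker_f: "ker (f x) = ker x"
proof (cases "x \<in> Y")
  case True
  show ?thesis
  proof (rule borel_prob_eqI[OF borel_prob_ker borel_prob_ker])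
    fix g :: "'a \<Rightarrow> real" assume g: "continuous_on UNIV g"
    have "(\<lambda>n. avg f g n x) \<longlonglongrightarrow> lim (\<lambda>n. avg f g n x)"
      using True g by (simp add: Y_def convergent_LIMSEQ_iff)
    then have "lim (\<lambda>n. avg f g n (f x)) = lim (\<lambda>n. avg f g n x)" by (intro limI avg_shift_lim[OF g])
    then show "integral\<^sup>L (ker (f x)) g = integral\<^sup>L (ker x) g"
      using ker_mean_Y[of x g] ker_mean_Y[of "f x" g] True g by (simp add: ker_mean_def Y_f)
  qed
qed (simp add: ker_def Y_f)

lemma ker_mean_avg: "continuous_on UNIV g \<Longrightarrow> x \<in> Y \<Longrightarrow> (\<lambda>n. avg f g n x) \<longlonglongrightarrow> ker_mean g x"
  by (simp add: ker_mean_Y) (simp add: Y_def convergent_LIMSEQ_iff)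

lemma mpt_ker: assumes x: "x \<in> Y" shows "mpt f (ker x)"
proof -
  interpret k: borel_prob "ker x" by (rule borel_prob_ker)
  have fm: "f \<in> measurable (ker x) (ker x)"
    using borel_measurable_continuous_onI[OF cont_f] k.sets_eq measurable_cong_sets by blast
  have "distr (ker x) (ker x) f = ker x"
  proof (rule borel_prob_eqI)
    show "borel_prob (distr (ker x) (ker x) f)"
      using k.prob_space_distr[OF fm] k.sets_eq by (simp add: borel_prob_def borel_prob_axioms_def)
    show "borel_prob (ker x)" by (rule borel_prob_ker)
    fix g :: "'a \<Rightarrow> real" assume g: "continuous_on UNIV g"
    have gf: "continuous_on UNIV (\<lambda>x. g (f x))" by (rule cont_comp[OF g cont_f])
    have e: "avg f (\<lambda>x. g (f x)) n y = avg f g n (f y)" for n y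
      by (simp add: avg_def birkhoff_def funpow_swap1 del: sum.lessThan_Suc)
    have "integral\<^sup>L (distr (ker x) (ker x) f) g = ker_mean (\<lambda>x. g (f x)) x"
      unfolding ker_mean_def by (rule integral_distr[OF fm k.meas_cont[OF g]])
    also have "\<dots> = ker_mean g x"
    proof (rule LIMSEQ_unique)
      show "(\<lambda>n. avg f (\<lambda>x. g (f x)) n x) \<longlonglongrightarrow> ker_mean (\<lambda>x. g (f x)) x" by (rule ker_mean_avg[OF gf x])
      show "(\<lambda>n. avg f (\<lambda>x. g (f x)) n x) \<longlonglongrightarrow> ker_mean g x" unfolding e by (rule avg_shift_lim[OF g ker_mean_avg[OF g x]])
    qed
    finally show "integral\<^sup>L (distr (ker x) (ker x) f) g = integral\<^sup>L (ker x) g" by (simp add: ker_mean_def)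
  qed
  then show ?thesis using fm by (simp add: mpt_def)
qed

lemma avg_cont: "continuous_on UNIV g \<Longrightarrow> continuous_on UNIV (avg f g n)"
  unfolding avg_def[abs_def] using cont_birkhoff[of g "Suc n"] by (auto intro!: continuous_intros)

lemma avg_diff_le:
  assumes "\<And>x. \<bar>g x - h x\<bar> \<le> e"
  shows "\<bar>avg f g n x - avg f h n x\<bar> \<le> e"
proof -
  have "avg f g n x - avg f h n x = avg f (\<lambda>x. g x - h x) n x"
    by (simp add: avg_def birkhoff_def sum_subtractf diff_divide_distrib del: sum.lessThan_Suc)
  then show ?thesis using avg_bound[of "\<lambda>x. g x - h x" e f n x] assms by simp
qed

lemma Y_dense:
  assumes gs: "\<And>i. continuous_on UNIV (gs i)"
    "\<And>g e. continuous_on UNIV g \<Longrightarrow> e > 0 \<Longrightarrow> \<exists>i. \<forall>x. \<bar>g x - gs i x\<bar> \<le> e"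
  shows "Y = {x. \<forall>i :: nat. Cauchy (\<lambda>n. avg f (gs i) n x)}"
proof (intro equalityI subsetI CollectI allI)
  fix x i assume "x \<in> Y"
  then show "Cauchy (\<lambda>n. avg f (gs i) n x)" using gs(1) by (simp add: Y_def Cauchy_convergent_iff)
next
  fix x assume x: "x \<in> {x. \<forall>i. Cauchy (\<lambda>n. avg f (gs i) n x)}"
  have "Cauchy (\<lambda>n. avg f g n x)" if g: "continuous_on UNIV g" for g
  proof (rule metric_CauchyI)
    fix e :: real assume e: "e > 0"
    then obtain i where i: "\<And>x. \<bar>g x - gs i x\<bar> \<le> e / 4" using gs(2)[OF g, of "e / 4"] by auto
    have "Cauchy (\<lambda>n. avg f (gs i) n x)" using x by simp
    then obtain N where N: "\<And>m n. m \<ge> N \<Longrightarrow> n \<ge> N \<Longrightarrow> dist (avg f (gs i) m x) (avg f (gs i) n x) < e / 4"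
      using metric_CauchyD[of _ "e / 4"] e by (metis divide_pos_pos zero_less_numeral)
    have d: "\<bar>avg f g n x - avg f (gs i) n x\<bar> \<le> e / 4" for n by (rule avg_diff_le[OF i])
    have "dist (avg f g m x) (avg f g n x) < e" if "m \<ge> N" "n \<ge> N" for m n
      using N[OF that] d[of m] d[of n] e unfolding dist_real_def by linarith
    then show "\<exists>N. \<forall>m\<ge>N. \<forall>n\<ge>N. dist (avg f g m x) (avg f g n x) < e" by blast
  qed
  then show "x \<in> Y" by (simp add: Y_def Cauchy_convergent_iff)
qed

lemma Y_borel: "Y \<in> sets borel"
proof -
  obtain gs :: "nat \<Rightarrow> 'a \<Rightarrow> real" where gs: "\<And>i. continuous_on UNIV (gs i)"
    "\<And>g e. continuous_on UNIV g \<Longrightarrow> e > 0 \<Longrightarrow> \<exists>i. \<forall>x. \<bar>g x - gs i x\<bar> \<le> e"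
    by (rule dense_continuous[OF compact_space]) (rule that)
  have "{x \<in> space borel. Cauchy (\<lambda>n. avg f (gs i) n x)} \<in> sets borel" for i
    by (rule sets_Collect_Cauchy) (intro borel_measurable_continuous_onI avg_cont gs)
  then have "(\<Inter>i. {x \<in> space borel. Cauchy (\<lambda>n. avg f (gs i) n x)}) \<in> sets borel" by (intro sets.countable_INT) auto
  moreover have "Y = (\<Inter>i. {x \<in> space borel. Cauchy (\<lambda>n. avg f (gs i) n x)})"
    by (subst Y_dense[of gs]) (use gs in auto)
  ultimately show ?thesis by simp
qed

lemma ker_mean_borel:
  assumes g: "continuous_on UNIV g"
  shows "ker_mean g \<in> borel_measurable borel"
proof -
  have "(\<lambda>x. if x \<in> Y then lim (\<lambda>n. avg f g n x) else integral\<^sup>L (return borel undefined) g) \<in> borel_measurable borel"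
    using Y_borel borel_measurable_continuous_onI[OF avg_cont[OF g]]
    by (intro measurable_If_set borel_measurable_lim_metric) auto
  moreover have "ker_mean g = (\<lambda>x. if x \<in> Y then lim (\<lambda>n. avg f g n x) else integral\<^sup>L (return borel undefined) g)"
    using ker_mean_Y[OF _ g] by (auto simp: fun_eq_iff ker_mean_def ker_def)
  ultimately show ?thesis by simp
qed

lemma ker_measurable: "ker \<in> borel \<rightarrow>\<^sub>M prob_algebra borel"
proof (rule measurable_prob_algebra_generated[where G = "Collect closed" and \<Omega> = UNIV])
  show "sets (borel :: 'a measure) = sigma_sets UNIV (Collect closed)" by (simp add: borel_eq_closed)
  show "Int_stable (Collect closed :: 'a set set)" by (auto simp: Int_stable_def)
  show "prob_space (ker a)" "sets (ker a) = sets borel" for a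
    using borel_prob_ker[of a] by (auto simp: borel_prob_def borel_prob_axioms_def)
  show "(\<lambda>a. emeasure (ker a) A) \<in> borel_measurable borel" if "A \<in> Collect closed" for A
  proof (cases "A = {}")
    case False
    have "(\<lambda>a. measure (ker a) A) \<in> borel_measurable borel"
    proof (rule borel_measurable_LIMSEQ_real)
      show "(\<lambda>k. ker_mean (bump A k) a) \<longlonglongrightarrow> measure (ker a) A" for a
        unfolding ker_mean_def using that False borel_prob.bump_integral_lim[OF borel_prob_ker] by auto
      show "ker_mean (bump A k) \<in> borel_measurable borel" for k by (rule ker_mean_borel[OF bump_cont])
    qed
    moreover have "emeasure (ker a) A = ennreal (measure (ker a) A)" for a
    proof -
      interpret borel_prob "ker a" by (rule borel_prob_ker)
      show ?thesis by (rule emeasure_eq_measure)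
    qed
    ultimately show ?thesis by simp
  qed simp
qed auto

lemma ker_subprob: "ker \<in> borel \<rightarrow>\<^sub>M subprob_algebra borel"
  by (rule measurable_prob_algebraD[OF ker_measurable])

lemma ker_measure_borel: "A \<in> sets borel \<Longrightarrow> (\<lambda>x. measure (ker x) A) \<in> borel_measurable borel"
  using measurable_compose[OF ker_subprob measurable_measure_subprob_algebra] by blast

end

section \<open>Disintegration of an invariant measure over its empirical limits\<close>

context borel_mpt
begin

lemma AE_Y: "AE x in M. x \<in> Y"
proof -
  obtain gs :: "nat \<Rightarrow> 'a \<Rightarrow> real" where gs: "\<And>i. continuous_on UNIV (gs i)"
    "\<And>g e. continuous_on UNIV g \<Longrightarrow> e > 0 \<Longrightarrow> \<exists>i. \<forall>x. \<bar>g x - gs i x\<bar> \<le> e"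
    by (rule dense_continuous[OF compact_space]) (rule that)
  have "AE x in M. convergent (\<lambda>n. avg f (gs i) n x)" for i
  proof -
    obtain b where "\<And>x. \<bar>gs i x\<bar> \<le> b" using bdd_cont[OF gs(1)] by metis
    then show ?thesis by (intro birkhoff_AE[of _ b] meas_cont gs) auto
  qed
  then have "AE x in M. \<forall>i. convergent (\<lambda>n. avg f (gs i) n x)" by (simp add: AE_all_countable)
  then show ?thesis by (subst Y_dense[of gs]) (use gs in \<open>auto simp: Cauchy_convergent_iff\<close>)
qed

lemma ker_subprob_M: "ker \<in> M \<rightarrow>\<^sub>M subprob_algebra M"
  using ker_subprob by (simp add: measurable_cong_sets[OF sets_eq subprob_algebra_cong[OF sets_eq, THEN arg_cong[of _ _ sets]]])

lemma integral_ki: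
  assumes g: "continuous_on UNIV g"
  shows "integral\<^sup>L M (ker_mean g) = integral\<^sup>L M g"
proof -
  obtain b where b: "\<And>x. \<bar>g x\<bar> \<le> b" using bdd_cont[OF g] by metis
  have "(\<lambda>n. integral\<^sup>L M (avg f g n)) \<longlonglongrightarrow> integral\<^sup>L M (ker_mean g)"
  proof (rule integral_dominated_convergence[where w = "\<lambda>_. b"])
    show "AE x in M. (\<lambda>n. avg f g n x) \<longlonglongrightarrow> ker_mean g x"
      using AE_Y by eventually_elim (rule ker_mean_avg[OF g])
    show "AE x in M. norm (avg f g n x) \<le> b" for n using avg_bound[of g b] b by simp
    show "ker_mean g \<in> borel_measurable M" using ker_mean_borel[OF g] by (simp add: measurable_cong_sets[OF sets_eq refl])
    show "avg f g n \<in> borel_measurable M" for n by (rule meas_cont[OF avg_cont[OF g]])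
  qed auto
  then have "(\<lambda>n. integral\<^sup>L M g) \<longlonglongrightarrow> integral\<^sup>L M (ker_mean g)"
    using integral_avg[OF meas_cont[OF g] b] by simp
  then show ?thesis using LIMSEQ_unique tendsto_const by blast
qed

lemma integral_bind_ker:
  assumes g: "(g :: 'a \<Rightarrow> real) \<in> borel_measurable borel" "\<And>x. \<bar>g x\<bar> \<le> b"
  shows "integral\<^sup>L (M \<bind> ker) g = (\<integral>x. integral\<^sup>L (ker x) g \<partial>M)"
proof (rule integral_bind[where B = b and B' = 1])
  show "ker \<in> M \<rightarrow>\<^sub>M subprob_algebra M" by (rule ker_subprob_M)
  show "g \<in> borel_measurable M" using g by (simp add: measurable_cong_sets[OF sets_eq refl])
  show "AE x in M. emeasure (ker x) (space (ker x)) \<le> ennreal 1"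
  proof (rule AE_I2)
    fix x
    interpret k: borel_prob "ker x" by (rule borel_prob_ker)
    show "emeasure (ker x) (space (ker x)) \<le> ennreal 1" by (simp add: k.emeasure_space_1)
  qed
qed (use g in \<open>auto intro: finite_measure_axioms\<close>)

text \<open>By invariance all averages of \<open>g\<close> have the integral of \<open>g\<close>,
  and they converge almost surely to its kernel integral; dominated convergence identifies the
  mixture with \<open>M\<close> on continuous functions.\<close>

lemma bind_ker: "M \<bind> ker = M"
proof (rule borel_prob_eqI)
  show bp: "borel_prob (M \<bind> ker)"
  proof -
    have "sets (M \<bind> ker) = sets M"
      by (rule sets_bind) (use borel_prob_ker in \<open>auto simp: borel_prob_def borel_prob_axioms_def sets_eq space_eq\<close>)
    moreover have "prob_space (M \<bind> ker)"
      using borel_prob_ker by (intro prob_space_bind[OF _ ker_subprob_M] AE_I2) (simp add: borel_prob_def)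
    ultimately show ?thesis by (simp add: borel_prob_def borel_prob_axioms_def sets_eq)
  qed
  show "borel_prob M" by unfold_locales
  fix g :: "'a \<Rightarrow> real" assume g: "continuous_on UNIV g" "\<And>x. 0 \<le> g x \<and> g x \<le> 1"
  have "integral\<^sup>L (M \<bind> ker) g = (\<integral>x. integral\<^sup>L (ker x) g \<partial>M)"
    by (rule integral_bind_ker[OF borel_measurable_continuous_onI[OF g(1)], of 1]) (use g(2) in auto)
  then show "integral\<^sup>L (M \<bind> ker) g = integral\<^sup>L M g" using integral_ki[OF g(1)] by (simp add: ker_mean_def[abs_def])
qed

lemma integral_ker:
  assumes g: "(g :: 'a \<Rightarrow> real) \<in> borel_measurable borel" "\<And>x. \<bar>g x\<bar> \<le> b"
  shows "(\<integral>x. integral\<^sup>L (ker x) g \<partial>M) = integral\<^sup>L M g"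
  using integral_bind_ker[OF g] bind_ker by simp

lemma measure_ker:
  assumes A: "A \<in> sets borel"
  shows "(\<integral>x. measure (ker x) A \<partial>M) = measure M A"
proof -
  have "integral\<^sup>L (ker x) (indicator A) = measure (ker x) A" for x
  proof -
    interpret k: borel_prob "ker x" by (rule borel_prob_ker)
    show ?thesis using A by (simp add: k.sets_eq)
  qed
  then show ?thesis using integral_ker[of "indicator A" 1] A by (simp add: sets_eq indicator_def)
qed

end

lemma (in mpt_space) uniform_measure_mpt:
  assumes A: "A \<in> sets M" "f -` A = A" "measure M A > 0"
  shows "full_prob_space (uniform_measure M A)" "mpt f (uniform_measure M A)"
proof -
  let ?U = "uniform_measure M A"
  have pos: "emeasure M A \<noteq> 0" "emeasure M A \<noteq> \<infinity>" using A by (auto simp: emeasure_eq_measure)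
  show "full_prob_space ?U"
    using prob_space_uniform_measure[OF pos] by (simp add: full_prob_space_def full_prob_space_axioms_def space_UNIV)
  have fm: "f \<in> measurable ?U ?U" using f_meas by simp
  have "distr ?U ?U f = ?U"
  proof (rule measure_eqI)
    fix B assume "B \<in> sets (distr ?U ?U f)"
    then have B: "B \<in> sets M" by simp
    have fB: "f -` B \<in> sets M" by (rule mpt_sets[OF mpt space_UNIV B])
    have "A \<inter> f -` B = f -` (A \<inter> B)" using A(2) by blast
    then have "emeasure M (A \<inter> f -` B) = emeasure M (A \<inter> B)"
      using mpt_measure[OF mpt space_UNIV, of "A \<inter> B"] A B by (simp add: emeasure_eq_measure)
    then show "emeasure (distr ?U ?U f) B = emeasure ?U B"
      using A B fB fm by (simp add: emeasure_distr space_UNIV)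
  qed simp
  then show "mpt f ?U" using fm by (simp add: mpt_def)
qed

lemma (in borel_mpt) uniform_measure_borel_mpt:
  assumes A: "A \<in> sets borel" "f -` A = A" "measure M A > 0"
  shows "borel_mpt (uniform_measure M A) f"
proof (rule borel_mptI)
  have A': "A \<in> sets M" using A by (simp add: sets_eq)
  show "mpt f (uniform_measure M A)" by (rule uniform_measure_mpt(2)[OF A' A(2,3)])
  show "borel_prob (uniform_measure M A)"
    using uniform_measure_mpt(1)[OF A' A(2,3)]
    by (simp add: full_prob_space_def borel_prob_def borel_prob_axioms_def sets_eq)
qed

lemma (in borel_prob) abs_integral_le:
  fixes g :: "'a \<Rightarrow> real"
  assumes g: "g \<in> borel_measurable M" "\<And>x. \<bar>g x\<bar> \<le> b"
  shows "\<bar>integral\<^sup>L M g\<bar> \<le> b"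
proof -
  have "integrable M g" by (rule integrable_bdd[OF g])
  then have "(\<integral>x. \<bar>g x\<bar> \<partial>M) \<le> (\<integral>x. b \<partial>M)" using g by (intro integral_mono) auto
  then have "(\<integral>x. \<bar>g x\<bar> \<partial>M) \<le> b" using prob_space by simp
  with integral_abs_bound[of M g] show ?thesis by (rule order_trans)
qed

lemma (in mpt_space) shannon_itin_le: "finmeas M X \<Longrightarrow> shannon M (itin f X n) \<le> real n * shannon M X"
proof (induction n)
  case 0
  then show ?case by (simp add: shannon_const)
next
  case (Suc n)
  have "shannon M (itin f X 1) = shannon M X"
    using shannon_relabel[of "\<lambda>x. [x]" X M] by (simp add: itin_def[abs_def] inj_on_def)
  then show ?case using shannon_itin_add[of X 1 n] Suc by (simp add: algebra_simps)
qed

context borel_mpt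
begin

text \<open>The variance of \<open>ker_mean g\<close> under \<open>ker x\<close> is nonnegative
  almost surely and has integral 0, because averaging the second moment over the kernels returns the
  second moment under \<open>M\<close>.\<close>

lemma ker_mean_ker_const:
  assumes g: "continuous_on UNIV g"
  shows "AE x in M. AE y in ker x. ker_mean g y = ker_mean g x"
proof -
  obtain b where b: "\<And>x. \<bar>g x\<bar> \<le> b" using bdd_cont[OF g] by metis
  have kb: "\<bar>ker_mean g x\<bar> \<le> b" for x
  proof -
    interpret k: borel_prob "ker x" by (rule borel_prob_ker)
    show ?thesis unfolding ker_mean_def by (rule k.abs_integral_le[OF k.meas_cont[OF g] b])
  qed
  have km: "ker_mean g \<in> borel_measurable borel" by (rule ker_mean_borel[OF g])
  have km2: "(\<lambda>x. (ker_mean g x)\<^sup>2) \<in> borel_measurable borel" using km by simp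
  have kb2: "\<bar>(ker_mean g x)\<^sup>2\<bar> \<le> b\<^sup>2" for x using kb[of x] by (simp add: abs_le_square_iff[symmetric])
  define V where "V x = (\<integral>y. (ker_mean g y)\<^sup>2 \<partial>ker x) - (ker_mean g x)\<^sup>2" for x
  have V: "AE x in M. V x = (\<integral>y. (ker_mean g y - ker_mean g x)\<^sup>2 \<partial>ker x)"
    using AE_Y
  proof eventually_elim
    case (elim x)
    interpret k: borel_mpt "ker x" f
      by (rule borel_mptI[OF borel_prob_ker mpt_ker[OF elim]])
    have mk: "ker_mean g \<in> borel_measurable (ker x)" using km by (simp add: measurable_cong_sets[OF k.sets_eq refl])
    have i: "integrable (ker x) (ker_mean g)" "integrable (ker x) (\<lambda>y. (ker_mean g y)\<^sup>2)"
      by (rule k.integrable_bdd[OF mk kb], rule k.integrable_bdd[OF _ kb2]) (use mk in simp)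
    have "(\<integral>y. ker_mean g y \<partial>ker x) = ker_mean g x" by (subst k.integral_ki[OF g]) (simp add: ker_mean_def)
    then have "(\<integral>y. (ker_mean g y)\<^sup>2 - 2 * ker_mean g x * ker_mean g y + (ker_mean g x)\<^sup>2 \<partial>ker x) = V x"
      using i k.prob_space by (simp add: V_def power2_eq_square)
    then show ?case by (simp add: power2_diff algebra_simps)
  qed
  have im: "(\<lambda>x. \<integral>y. (ker_mean g y)\<^sup>2 \<partial>ker x) \<in> borel_measurable M"
  proof -
    have "(\<lambda>N. integral\<^sup>L N (\<lambda>y. (ker_mean g y)\<^sup>2)) \<in> borel_measurable (subprob_algebra borel)"
      using km2 by (rule integral_measurable_subprob_algebra)
    from measurable_compose[OF ker_subprob this] show ?thesis by (simp add: measurable_cong_sets[OF sets_eq refl])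
  qed
  have ib: "\<bar>\<integral>y. (ker_mean g y)\<^sup>2 \<partial>ker x\<bar> \<le> b\<^sup>2" for x
  proof -
    interpret k: borel_prob "ker x" by (rule borel_prob_ker)
    show ?thesis by (rule k.abs_integral_le[OF _ kb2]) (use km2 in \<open>simp add: measurable_cong_sets[OF k.sets_eq refl]\<close>)
  qed
  have m2: "(\<lambda>x. (ker_mean g x)\<^sup>2) \<in> borel_measurable M" using km2 by (simp add: measurable_cong_sets[OF sets_eq refl])
  have i1: "integrable M (\<lambda>x. \<integral>y. (ker_mean g y)\<^sup>2 \<partial>ker x)" "integrable M (\<lambda>x. (ker_mean g x)\<^sup>2)"
    by (rule integrable_bdd[OF im ib], rule integrable_bdd[OF m2 kb2])
  have iV: "integrable M V" unfolding V_def[abs_def] using i1 by simp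
  have "integral\<^sup>L M V = 0"
    unfolding V_def[abs_def] using i1 integral_ker[OF km2 kb2] by simp
  moreover have nn: "AE x in M. 0 \<le> V x"
    using V by eventually_elim simp
  ultimately have "AE x in M. V x = 0" using integral_nonneg_eq_0_iff_AE[OF iV nn] by simp
  then show ?thesis
    using V
  proof eventually_elim
    case (elim x)
    interpret k: borel_prob "ker x" by (rule borel_prob_ker)
    have mk: "ker_mean g \<in> borel_measurable (ker x)" using km by (simp add: measurable_cong_sets[OF k.sets_eq refl])
    have "integrable (ker x) (\<lambda>y. (ker_mean g y - ker_mean g x)\<^sup>2)"
    proof (rule k.integrable_bdd)
      show "(\<lambda>y. (ker_mean g y - ker_mean g x)\<^sup>2) \<in> borel_measurable (ker x)" using mk by simp
      show "\<bar>(ker_mean g y - ker_mean g x)\<^sup>2\<bar> \<le> (2 * b)\<^sup>2" for y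
      proof -
        have "\<bar>ker_mean g y - ker_mean g x\<bar> \<le> \<bar>2 * b\<bar>" using kb[of x] kb[of y] by linarith
        then show ?thesis by (simp add: abs_le_square_iff)
      qed
    qed
    then have "AE y in ker x. (ker_mean g y - ker_mean g x)\<^sup>2 = 0"
      using integral_nonneg_eq_0_iff_AE[of "ker x" "\<lambda>y. (ker_mean g y - ker_mean g x)\<^sup>2"] elim by simp
    then show ?case by simp
  qed
qed

text \<open>A countable dense family of test functions makes the exceptional null set independent of
  the function.\<close>

lemma ker_ker_const: "AE x in M. AE y in ker x. ker y = ker x"
proof -
  obtain gs :: "nat \<Rightarrow> 'a \<Rightarrow> real" where gs: "\<And>i. continuous_on UNIV (gs i)"
    "\<And>g e. continuous_on UNIV g \<Longrightarrow> e > 0 \<Longrightarrow> \<exists>i. \<forall>x. \<bar>g x - gs i x\<bar> \<le> e"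
    by (rule dense_continuous[OF compact_space]) (rule that)
  have "AE x in M. \<forall>i. AE y in ker x. ker_mean (gs i) y = ker_mean (gs i) x"
    unfolding AE_all_countable using ker_mean_ker_const[OF gs(1)] by blast
  then show ?thesis
  proof eventually_elim
    case (elim x)
    then have "AE y in ker x. \<forall>i. ker_mean (gs i) y = ker_mean (gs i) x" by (simp add: AE_all_countable)
    then show ?case
    proof eventually_elim
      case (elim y)
      show ?case
      proof (rule borel_prob_eqI[OF borel_prob_ker borel_prob_ker])
        fix g :: "'a \<Rightarrow> real" assume g: "continuous_on UNIV g"
        have "\<bar>integral\<^sup>L (ker y) g - integral\<^sup>L (ker x) g\<bar> \<le> 0 + e" if e: "e > 0" for e
        proof -
          obtain i where i: "\<And>x. \<bar>g x - gs i x\<bar> \<le> e / 2" using gs(2)[OF g, of "e / 2"] e by auto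
          have d: "\<bar>integral\<^sup>L (ker z) g - integral\<^sup>L (ker z) (gs i)\<bar> \<le> e / 2" for z
          proof -
            interpret k: borel_prob "ker z" by (rule borel_prob_ker)
            note ig = k.integrable_cont[OF compact_space g] k.integrable_cont[OF compact_space gs(1)[of i]]
            have "\<bar>integral\<^sup>L (ker z) (\<lambda>x. g x - gs i x)\<bar> \<le> e / 2"
              using i by (intro k.abs_integral_le k.meas_cont continuous_on_diff g gs(1))
            then show ?thesis using ig by simp
          qed
          show ?thesis using d[of x] d[of y] elim[rule_format, of i] unfolding ker_mean_def by linarith
        qed
        then have "\<bar>integral\<^sup>L (ker y) g - integral\<^sup>L (ker x) g\<bar> \<le> 0" by (rule field_le_epsilon)
        then show "integral\<^sup>L (ker y) g = integral\<^sup>L (ker x) g" by simp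
      qed
    qed
  qed
qed

text \<open>If \<open>ker\<close> is almost surely equal to \<open>m\<close> for \<open>m\<close> itself, then so it is for every conditioning of \<open>m\<close>
  on an invariant set, which therefore equals \<open>m\<close>.\<close>

lemma ergodic_ker: "AE x in M. ergodic f (ker x)"
  using ker_ker_const AE_Y
proof eventually_elim
  case (elim x)
  let ?m = "ker x"
  interpret m: borel_mpt ?m f by (rule borel_mptI[OF borel_prob_ker mpt_ker[OF elim(2)]])
  have "measure ?m A = 0 \<or> measure ?m A = 1" if A: "A \<in> sets ?m" "f -` A \<inter> space ?m = A" for A
  proof (rule disjCI)
    assume "measure ?m A \<noteq> 1"
    show "measure ?m A = 0"
    proof (rule ccontr)
      assume "measure ?m A \<noteq> 0"
      then have pos: "measure ?m A > 0" by (simp add: less_le)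
      have A': "A \<in> sets borel" "f -` A = A" using A by (auto simp: m.sets_eq m.space_eq)
      interpret u: borel_mpt "uniform_measure ?m A" f
        by (rule m.uniform_measure_borel_mpt[OF A' pos])
      have ae: "AE y in uniform_measure ?m A. ker y = ?m"
        by (rule AE_uniform_measureI[OF A(1)]) (use elim(1) in eventually_elim, simp)
      have "measure (uniform_measure ?m A) A = (\<integral>y. measure (ker y) A \<partial>uniform_measure ?m A)"
        by (rule u.measure_ker[OF A'(1), symmetric])
      also have "\<dots> = (\<integral>y. measure ?m A \<partial>uniform_measure ?m A)"
        by (rule integral_cong_AE)
           (use ae ker_measure_borel[OF A'(1)] in \<open>auto simp: measurable_cong_sets[OF u.sets_eq refl]\<close>)
      also have "\<dots> = measure ?m A" using u.prob_space by simp
      also have "measure (uniform_measure ?m A) A = 1"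
        using pos A(1) by (simp add: measure_uniform_measure m.emeasure_eq_measure)
      finally show False using \<open>measure ?m A \<noteq> 1\<close> by simp
    qed
  qed
  then show ?case
    unfolding ergodic_def invariant_prob_iff using borel_prob_ker mpt_ker[OF elim(2)] by blast
qed

lemma AE_ker_full:
  assumes Z: "Z \<in> sets borel" "measure M Z = 1"
  shows "AE x in M. measure (ker x) Z = 1"
proof -
  have m: "(\<lambda>x. measure (ker x) Z) \<in> borel_measurable M"
    using ker_measure_borel[OF Z(1)] by (simp add: measurable_cong_sets[OF sets_eq refl])
  have b: "measure (ker x) Z \<le> 1" for x
  proof -
    interpret k: borel_prob "ker x" by (rule borel_prob_ker)
    show ?thesis by simp
  qed
  have i: "integrable M (\<lambda>x. 1 - measure (ker x) Z)"
    using m b by (intro integrable_bdd[of _ 1]) auto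
  have i2: "integrable M (\<lambda>x. measure (ker x) Z)" using m b by (intro integrable_bdd[of _ 1]) auto
  have "integral\<^sup>L M (\<lambda>x. 1 - measure (ker x) Z) = 0"
    using i2 measure_ker[OF Z(1)] Z(2) prob_space by simp
  then have "AE x in M. 1 - measure (ker x) Z = 0"
    using integral_nonneg_eq_0_iff_AE[OF i] b by simp
  then show ?thesis by eventually_elim simp
qed

text \<open>A finite substitute for the affinity of entropy over the ergodic decomposition. Points
  are sorted by the rounded vector of masses that \<open>ker x\<close> gives to the cylinders. This
  label \<open>R\<close> is invariant, so conditioning on it costs \<open>shannon M R\<close> once,
  which disappears after division by time, and within one class all kernels have nearly the same
  cylinder entropies.\<close>

lemma hent_le_integral:
  fixes X :: "'a \<Rightarrow> 'b"
  assumes X: "finmeas M X" and N: "N \<ge> 1"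
  shows "hent f M X \<le> (\<integral>x. shannon (ker x) (itin f X N) \<partial>M) / real N"
proof -
  let ?Q = "\<lambda>v. itin f X N -` {v}"
  define V where "V = range (itin f X N)"
  define W where "W x = shannon (ker x) (itin f X N)" for x
  have fm: "finmeas M (itin f X N)" by (rule itin_finmeas[OF X])
  have finV: "finite V" using fm by (simp add: V_def finmeas_def)
  have Qb: "?Q v \<in> sets borel" for v using fm by (simp add: finmeas_def sets_eq)
  have q01: "0 \<le> measure (ker x) A" "measure (ker x) A \<le> 1" for x A
  proof -
    interpret k: borel_prob "ker x" by (rule borel_prob_ker)
    show "0 \<le> measure (ker x) A" "measure (ker x) A \<le> 1" by auto
  qed
  have etam: "eta \<in> borel_measurable borel" unfolding eta_def[abs_def] by measurable
  have Wm: "W \<in> borel_measurable M"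
    unfolding W_def[abs_def] shannon_def using ker_measure_borel[OF Qb] etam
    by (intro borel_measurable_sum) (auto simp: measurable_cong_sets[OF sets_eq refl] intro: measurable_compose)
  have Wb: "\<bar>W x\<bar> \<le> real (card V)" for x
  proof -
    have "0 \<le> W x" "W x \<le> (\<Sum>v\<in>V. 1)"
      unfolding W_def shannon_def V_def[symmetric] by (intro sum_nonneg sum_mono eta_nonneg order_trans[OF eta_le] q01; simp add: q01)+
    then show ?thesis by simp
  qed
  have iW: "integrable M W" by (rule integrable_bdd[OF Wm Wb])
  have "hent f M X \<le> integral\<^sup>L M W / real N + e" if e: "e > 0" for e
  proof -
    define e' where "e' = e / (real (card V) + 1)"
    have e': "e' > 0" "real (card V) * e' \<le> e" using e by (auto simp: e'_def field_simps)
    obtain d where d: "d > 0"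
      "\<And>s t. 0 \<le> s \<Longrightarrow> s \<le> 1 \<Longrightarrow> 0 \<le> t \<Longrightarrow> t \<le> 1 \<Longrightarrow> \<bar>s - t\<bar> < d \<Longrightarrow> \<bar>eta s - eta t\<bar> < e'"
      using eta_uniform[OF e'(1)] by metis
    obtain J :: nat where J: "J > 0" "1 / real J < d" using d(1) by (metis ex_inverse_of_nat_less inverse_eq_divide)
    \<comment> \<open>\<open>ker\<close> is constant along orbits, so the fibres of \<open>R\<close>
      are invariant; on one fibre each mass varies by at most \<open>1 / real J\<close>.\<close>
    define R where "R x = restrict (\<lambda>v. nat \<lfloor>measure (ker x) (?Q v) * real J\<rfloor>) V" for x
    have Rf: "R (f x) = R x" for x by (simp add: R_def ker_f)
    have finR: "finite (range R)"
    proof (rule finite_subset)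
      show "range R \<subseteq> PiE V (\<lambda>_. {0..J})"
      proof
        fix r assume "r \<in> range R"
        then obtain x where r: "r = R x" by blast
        have "nat \<lfloor>measure (ker x) (?Q v) * real J\<rfloor> \<le> J" for v
        proof -
          have "measure (ker x) (?Q v) * real J \<le> real J" using q01[of x "?Q v"] by (simp add: mult_left_le_one_le)
          then have "\<lfloor>measure (ker x) (?Q v) * real J\<rfloor> \<le> int J" by (simp add: floor_le_iff)
          then show ?thesis by simp
        qed
        then show "r \<in> PiE V (\<lambda>_. {0..J})" by (auto simp: r R_def)
      qed
      show "finite (PiE V (\<lambda>_. {0..J}))" using finV by (intro finite_PiE) auto
    qed
    have Rm: "R -` {r} \<in> sets M" for r
    proof (cases "r \<in> extensional V")
      case True
      have "R -` {r} = UNIV \<inter> (\<Inter>v\<in>V. {x. nat \<lfloor>measure (ker x) (?Q v) * real J\<rfloor> = r v})"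
        using True by (auto simp: R_def fun_eq_iff extensional_def)
      also have "\<dots> \<in> sets M"
      proof (cases "V = {}")
        case False
        have "{x. nat \<lfloor>measure (ker x) (?Q v) * real J\<rfloor> = r v} \<in> sets M" for v
        proof -
          have [measurable]: "(\<lambda>x. measure (ker x) (?Q v)) \<in> borel_measurable M"
            using ker_measure_borel[OF Qb] by (simp add: measurable_cong_sets[OF sets_eq refl])
          have "{x\<in>space M. nat \<lfloor>measure (ker x) (?Q v) * real J\<rfloor> = r v} \<in> sets M" by measurable
          then show ?thesis by (simp add: space_eq)
        qed
        then show ?thesis using False finV by (auto intro!: sets.finite_INT)
      qed (auto simp: V_def)
      finally show ?thesis .
    next
      case False
      then have "R -` {r} = {}" by (auto simp: R_def)
      then show ?thesis by simp
    qed
    have fR: "finmeas M R" using finR Rm by (simp add: finmeas_def)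
    define p where "p r = measure M (R -` {r})" for r
    define U where "U r = uniform_measure M (R -` {r})" for r
    have inv: "f -` (R -` {r}) = R -` {r}" for r using Rf by auto
    have Umpt: "borel_mpt (U r) f" if "p r > 0" for r
      unfolding U_def by (rule uniform_measure_borel_mpt) (use Rm inv that in \<open>auto simp: p_def sets_eq\<close>)
    have fU: "finmeas (U r) Z = finmeas M Z" for r and Z :: "'a \<Rightarrow> 'b" by (simp add: finmeas_def U_def)
    have "hent f M X \<le> (\<Sum>r\<in>range R. p r * hent f (U r) X)"
    proof (rule LIMSEQ_le[OF hent_LIMSEQ[OF X]])
      have "(\<lambda>n. p r * (shannon (U r) (itin f X (Suc n)) / real (Suc n))) \<longlonglongrightarrow> p r * hent f (U r) X" for r
      proof (cases "p r > 0")
        case True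
        interpret u: borel_mpt "U r" f by (rule Umpt[OF True])
        show ?thesis using fU X by (intro tendsto_mult_left u.hent_LIMSEQ) simp
      next
        case False
        then have "p r = 0" by (simp add: p_def not_less measure_le_0_iff)
        then show ?thesis by simp
      qed
      then have "(\<lambda>n. shannon M R / real (Suc n) + (\<Sum>r\<in>range R. p r * (shannon (U r) (itin f X (Suc n)) / real (Suc n))))
        \<longlonglongrightarrow> 0 + (\<Sum>r\<in>range R. p r * hent f (U r) X)"
        using LIMSEQ_Suc[OF lim_const_over_n] by (intro tendsto_add tendsto_sum) auto
      then show "(\<lambda>n. shannon M R / real (Suc n) + (\<Sum>r\<in>range R. p r * (shannon (U r) (itin f X (Suc n)) / real (Suc n))))
        \<longlonglongrightarrow> (\<Sum>r\<in>range R. p r * hent f (U r) X)" by simp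
      have "shannon M (itin f X (Suc n)) / real (Suc n)
        \<le> shannon M R / real (Suc n) + (\<Sum>r\<in>range R. p r * (shannon (U r) (itin f X (Suc n)) / real (Suc n)))" for n
        using divide_right_mono[OF shannon_condition[OF itin_finmeas[OF X, of "Suc n"] fR], of "real (Suc n)"]
        by (simp add: p_def U_def add_divide_distrib sum_divide_distrib)
      then show "\<exists>K. \<forall>n\<ge>K. shannon M (itin f X (Suc n)) / real (Suc n)
        \<le> shannon M R / real (Suc n) + (\<Sum>r\<in>range R. p r * (shannon (U r) (itin f X (Suc n)) / real (Suc n)))" by blast
    qed
    also have "\<dots> \<le> (\<Sum>r\<in>range R. p r * (shannon (U r) (itin f X N) / real N))"
    proof (rule sum_mono)
      fix r
      show "p r * hent f (U r) X \<le> p r * (shannon (U r) (itin f X N) / real N)"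
      proof (cases "p r > 0")
        case True
        interpret u: borel_mpt "U r" f by (rule Umpt[OF True])
        show ?thesis using fU X N True by (intro mult_left_mono u.hent_le) auto
      next
        case False
        then have "p r = 0" by (simp add: p_def not_less measure_le_0_iff)
        then show ?thesis by simp
      qed
    qed
    also have "\<dots> = (\<Sum>r\<in>range R. p r * shannon (U r) (itin f X N)) / real N"
      by (simp add: sum_divide_distrib)
    also have "\<dots> \<le> (integral\<^sup>L M W + e) / real N"
    proof (intro divide_right_mono)
      have key: "shannon (U (R x)) (itin f X N) \<le> W x + e" if pos: "p (R x) > 0" for x
      proof -
        interpret u: borel_mpt "U (R x)" f by (rule Umpt[OF pos])
        have close: "\<bar>measure (ker y) (?Q v) - measure (ker x) (?Q v)\<bar> \<le> 1 / real J" if "R y = R x" "v \<in> V" for y v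
        proof -
          have "nat \<lfloor>measure (ker y) (?Q v) * real J\<rfloor> = nat \<lfloor>measure (ker x) (?Q v) * real J\<rfloor>"
            using fun_cong[OF that(1), of v] that(2) by (simp add: R_def)
          then have "\<lfloor>measure (ker y) (?Q v) * real J\<rfloor> = \<lfloor>measure (ker x) (?Q v) * real J\<rfloor>"
            using q01 by (simp add: nat_eq_iff)
          then have "\<bar>measure (ker y) (?Q v) * real J - measure (ker x) (?Q v) * real J\<bar> \<le> 1" by linarith
          then have "\<bar>measure (ker y) (?Q v) - measure (ker x) (?Q v)\<bar> * real J \<le> 1"
            by (simp add: left_diff_distrib[symmetric] abs_mult)
          then show ?thesis using J(1) by (simp add: field_simps)
        qed
        have "eta (measure (U (R x)) (?Q v)) \<le> eta (measure (ker x) (?Q v)) + e'" if v: "v \<in> V" for v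
        proof -
          have "AE y in U (R x). R y = R x"
            unfolding U_def by (rule AE_uniform_measureI[OF Rm]) auto
          then have ae: "AE y in U (R x). \<bar>measure (ker y) (?Q v) - measure (ker x) (?Q v)\<bar> \<le> 1 / real J"
            by eventually_elim (rule close[OF _ v])
          have mm: "(\<lambda>y. measure (ker y) (?Q v)) \<in> borel_measurable (U (R x))"
            using ker_measure_borel[OF Qb] by (simp add: measurable_cong_sets[OF u.sets_eq refl])
          have ii: "integrable (U (R x)) (\<lambda>y. measure (ker y) (?Q v))"
            using q01 by (intro u.integrable_bdd[OF mm, of 1]) auto
          have "\<bar>measure (U (R x)) (?Q v) - measure (ker x) (?Q v)\<bar>
            = \<bar>\<integral>y. measure (ker y) (?Q v) - measure (ker x) (?Q v) \<partial>U (R x)\<bar>"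
            using ii u.measure_ker[OF Qb, of v] u.prob_space by simp
          also have "\<dots> \<le> (\<integral>y. \<bar>measure (ker y) (?Q v) - measure (ker x) (?Q v)\<bar> \<partial>U (R x))"
            by (rule integral_abs_bound)
          also have "\<dots> \<le> (\<integral>y. 1 / real J \<partial>U (R x))"
            using ii ae by (intro integral_mono_AE) auto
          also have "\<dots> < d" using J u.prob_space by simp
          finally have "\<bar>eta (measure (U (R x)) (?Q v)) - eta (measure (ker x) (?Q v))\<bar> < e'"
            using q01 by (intro d(2)) auto
          then show ?thesis by linarith
        qed
        then have "shannon (U (R x)) (itin f X N) \<le> (\<Sum>v\<in>V. eta (measure (ker x) (?Q v)) + e')"
          unfolding shannon_def V_def[symmetric] by (intro sum_mono)
        also have "\<dots> = W x + real (card V) * e'" by (simp add: W_def shannon_def V_def sum.distrib)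
        finally show ?thesis using e'(2) by linarith
      qed
      \<comment> \<open>Null classes get the value 0, so that the comparison with
        \<open>W x + e\<close> holds at every point.\<close>
      define c where "c r = (if p r > 0 then shannon (U r) (itin f X N) else 0)" for r
      have eq: "(\<Sum>r\<in>range R. p r * shannon (U r) (itin f X N)) = (\<integral>x. (\<Sum>r\<in>range R. c r * indicator (R -` {r}) x) \<partial>M)"
      proof -
        have "p r * shannon (U r) (itin f X N) = c r * p r" for r
          by (cases "p r > 0") (auto simp: c_def p_def not_less measure_le_0_iff)
        then have "(\<Sum>r\<in>range R. p r * shannon (U r) (itin f X N)) = (\<Sum>r\<in>range R. c r * p r)"
          by (intro sum.cong refl)
        then show ?thesis using Rm
          by (subst Bochner_Integration.integral_sum) (auto simp: p_def emeasure_eq_measure intro!: integrable_mult_right integrable_real_indicator)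
      qed
      also have "\<dots> \<le> (\<integral>x. W x + e \<partial>M)"
      proof (rule integral_mono)
        show "integrable M (\<lambda>x. \<Sum>r\<in>range R. c r * indicator (R -` {r}) x)"
          using Rm by (auto simp: emeasure_eq_measure intro!: integrable_mult_right integrable_real_indicator)
        show "integrable M (\<lambda>x. W x + e)" using iW by simp
        fix x
        have "(\<Sum>r\<in>range R. c r * indicator (R -` {r}) x) = (\<Sum>r\<in>{R x}. c r * indicator (R -` {r}) x)"
          using finR by (intro sum.mono_neutral_right) auto
        also have "\<dots> = c (R x)" by simp
        also have "\<dots> \<le> W x + e"
        proof (cases "p (R x) > 0")
          case True then show ?thesis using key by (simp add: c_def)
        next
          case False
          have "0 \<le> W x" unfolding W_def shannon_def by (intro sum_nonneg eta_nonneg q01)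
          then show ?thesis using False e by (simp add: c_def)
        qed
        finally show "(\<Sum>r\<in>range R. c r * indicator (R -` {r}) x) \<le> W x + e" .
      qed
      also have "\<dots> = integral\<^sup>L M W + e" using iW prob_space by simp
      finally show "(\<Sum>r\<in>range R. p r * shannon (U r) (itin f X N)) \<le> integral\<^sup>L M W + e" .
    qed simp
    also have "\<dots> \<le> integral\<^sup>L M W / real N + e"
      using N e by (simp add: add_divide_distrib divide_le_eq)
    finally show ?thesis .
  qed
  then have "hent f M X \<le> integral\<^sup>L M W / real N" by (rule field_le_epsilon)
  then show ?thesis by (simp add: W_def[abs_def])
qed

text \<open>The free energy carried by one partition is at most the average of that of the ergodic
  components, so some component lies above \<open>c\<close>. The set \<open>Z\<close> has full
  measure for almost every component, which controls where the component found is carried.\<close>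

theorem ergodic_reduction:
  assumes phi: "continuous_on UNIV \<phi>" and c: "ereal c < free_energy f \<phi> M"
    and Z: "Z \<in> sets borel" "measure M Z = 1"
  obtains m where "ergodic f m" "measure m Z = 1" "ereal c < free_energy f \<phi> m"
proof -
  have "ereal (c - integral\<^sup>L M \<phi>) < ks_entropy f M"
    using c by (cases "ks_entropy f M") (auto simp: free_energy_def)
  then obtain X :: "'a \<Rightarrow> 'a set" where X: "finmeas M X" "ereal (c - integral\<^sup>L M \<phi>) < ereal (hent f M X)"
    by (rule ks_less[OF space_UNIV])
  have fk: "finmeas (ker x) X" for x
    using X(1) borel_prob_ker[of x] sets_eq by (simp add: finmeas_def borel_prob_def borel_prob_axioms_def)
  define w where "w n x = shannon (ker x) (itin f X (Suc n)) / real (Suc n)" for n x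
  define C where "C = ln (card (range X))"
  have etam: "eta \<in> borel_measurable borel" unfolding eta_def[abs_def] by measurable
  have wm: "w n \<in> borel_measurable M" for n
    unfolding w_def[abs_def] shannon_def
    using ker_measure_borel etam itin_finmeas[OF X(1), of "Suc n"]
    by (intro borel_measurable_divide borel_measurable_sum)
       (auto simp: measurable_cong_sets[OF sets_eq refl] finmeas_def sets_eq intro: measurable_compose)
  have ker_mpt: "borel_mpt (ker x) f" if "x \<in> Y" for x
    by (rule borel_mptI[OF borel_prob_ker mpt_ker[OF that]])
  have wb: "AE x in M. norm (w n x) \<le> C" for n
    using AE_Y
  proof eventually_elim
    case (elim x)
    interpret k: borel_mpt "ker x" f by (rule ker_mpt[OF elim])
    have "shannon (ker x) (itin f X (Suc n)) \<le> real (Suc n) * C"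
      using k.shannon_itin_le[OF fk, of "Suc n"] k.shannon_le_card[OF fk, of "range X"] X(1)
      by (simp add: C_def finmeas_def) (smt (verit) mult_left_mono of_nat_0_le_iff)
    then show ?case using k.shannon_nonneg[of "itin f X (Suc n)"] by (simp add: w_def divide_le_eq mult.commute)
  qed
  have wl: "AE x in M. (\<lambda>n. w n x) \<longlonglongrightarrow> hent f (ker x) X"
    using AE_Y
  proof eventually_elim
    case (elim x)
    interpret k: borel_mpt "ker x" f by (rule ker_mpt[OF elim])
    show ?case unfolding w_def by (rule k.hent_LIMSEQ[OF fk])
  qed
  define h where "h x = lim (\<lambda>n. w n x)" for x
  have hm: "h \<in> borel_measurable M" unfolding h_def by (intro borel_measurable_lim_metric wm)
  have wl': "AE x in M. (\<lambda>n. w n x) \<longlonglongrightarrow> h x"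
    using wl by eventually_elim (simp add: h_def limI)
  have hh: "AE x in M. h x = hent f (ker x) X" using wl by eventually_elim (simp add: h_def limI)
  note dc = integral_dominated_convergence[OF hm wm integrable_const wl' wb]
    integrable_dominated_convergence[OF hm wm integrable_const wl' wb]
  have "hent f M X \<le> integral\<^sup>L M h"
  proof (rule LIMSEQ_le_const[OF dc(1)])
    have "hent f M X \<le> integral\<^sup>L M (w n)" for n
      using hent_le_integral[OF X(1), of "Suc n"] by (simp add: w_def[abs_def])
    then show "\<exists>N. \<forall>n\<ge>N. hent f M X \<le> integral\<^sup>L M (w n)" by blast
  qed
  moreover have "integral\<^sup>L M (ker_mean \<phi>) = integral\<^sup>L M \<phi>" by (rule integral_ki[OF phi])
  moreover have ik: "integrable M (ker_mean \<phi>)"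
  proof -
    obtain b where b: "\<And>x. \<bar>\<phi> x\<bar> \<le> b" using bdd_cont[OF phi] by metis
    show ?thesis
    proof (rule integrable_bdd)
      show "ker_mean \<phi> \<in> borel_measurable M" using ker_mean_borel[OF phi] by (simp add: measurable_cong_sets[OF sets_eq refl])
      show "\<bar>ker_mean \<phi> x\<bar> \<le> b" for x
      proof -
        interpret k: borel_prob "ker x" by (rule borel_prob_ker)
        show ?thesis unfolding ker_mean_def by (rule k.abs_integral_le[OF k.meas_cont[OF phi] b])
      qed
    qed
  qed
  ultimately have big: "c < (\<integral>x. h x + ker_mean \<phi> x \<partial>M)" using X(2) dc(2) by simp
  have good: "AE x in M. h x = hent f (ker x) X \<and> ergodic f (ker x) \<and> measure (ker x) Z = 1"
    using hh ergodic_ker AE_ker_full[OF Z] by eventually_elim simp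
  have "\<exists>x. c < h x + ker_mean \<phi> x \<and> h x = hent f (ker x) X \<and> ergodic f (ker x) \<and> measure (ker x) Z = 1"
  proof (rule ccontr)
    assume no: "\<not> ?thesis"
    have "AE x in M. h x + ker_mean \<phi> x \<le> c" using good by eventually_elim (use no in force)
    then have "(\<integral>x. h x + ker_mean \<phi> x \<partial>M) \<le> (\<integral>x. c \<partial>M)" using ik dc(2) by (intro integral_mono_AE) auto
    then show False using big prob_space by simp
  qed
  then obtain x where x: "c < h x + ker_mean \<phi> x" "h x = hent f (ker x) X" "ergodic f (ker x)" "measure (ker x) Z = 1"
    by blast
  interpret k: borel_prob "ker x" by (rule borel_prob_ker)
  have "ereal c < ereal (hent f (ker x) X) + ereal (integral\<^sup>L (ker x) \<phi>)" using x by (simp add: ker_mean_def)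
  also have "\<dots> \<le> free_energy f \<phi> (ker x)"
    unfolding free_energy_def by (intro add_right_mono ks_ge fk k.space_eq)
  finally show ?thesis using that x by blast
qed

end

section \<open>Invariant measures of large free energy\<close>

lemma block_sum:
  fixes H :: "nat \<Rightarrow> nat \<Rightarrow> real"
  assumes sub: "\<And>k m n. H k (m + n) \<le> H k m + H (k + m) n"
    and nn: "\<And>k n. 0 \<le> H k n" and bd: "\<And>k n. H k n \<le> real n * c"
    and q: "q \<le> n" "q \<ge> 1"
  shows "real q * H 0 n \<le> (\<Sum>k<n. H k q) + 2 * (real q)\<^sup>2 * c"
proof -
  have c0: "0 \<le> c" using nn[of 0 1] bd[of 0 1] by simp
  have block: "H k (q * i + s) \<le> (\<Sum>t<i. H (k + q * t) q) + real s * c" for k i s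
  proof (induction i arbitrary: k)
    case 0
    then show ?case using bd by simp
  next
    case (Suc i)
    have "H k (q * Suc i + s) = H k (q + (q * i + s))" by (simp add: algebra_simps)
    also have "\<dots> \<le> H k q + H (k + q) (q * i + s)" by (rule sub)
    also have "\<dots> \<le> H k q + ((\<Sum>t<i. H (k + q + q * t) q) + real s * c)" using Suc by (intro add_left_mono)
    also have "\<dots> = (\<Sum>t<Suc i. H (k + q * t) q) + real s * c"
      by (subst sum.lessThan_Suc_shift) (simp add: algebra_simps)
    finally show ?case .
  qed
  \<comment> \<open>Time is cut into blocks of length \<open>q\<close> with offset \<open>j\<close>;
    the initial piece and the remainder cost at most \<open>q * c\<close> each. Over all offsets
    every time starts at most one block, so averaging needs no relation between different starting
    times.\<close>
  have one: "H 0 n \<le> (\<Sum>t<(n - j) div q. H (j + q * t) q) + 2 * real q * c" if j: "j < q" for j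
  proof -
    have "H 0 n = H 0 (j + (n - j))" using j q by simp
    also have "\<dots> \<le> H 0 j + H (0 + j) (n - j)" by (rule sub)
    also have "H (0 + j) (n - j) \<le> (\<Sum>t<(n - j) div q. H (j + q * t) q) + real ((n - j) mod q) * c"
      using block[of j "(n - j) div q" "(n - j) mod q"] by simp
    also have "H 0 j \<le> real q * c" using bd[of 0 j] j c0 by (meson less_imp_le mult_right_mono of_nat_mono order_trans)
    also have "real ((n - j) mod q) * c \<le> real q * c"
      using q c0 by (intro mult_right_mono of_nat_mono less_imp_le[OF mod_less_divisor]) auto
    finally show ?thesis by (simp add: algebra_simps)
  qed
  let ?S = "SIGMA j:{..<q}. {..<(n - j) div q}"
  have lt: "j + q * t < n" if "j < q" "t < (n - j) div q" for j t
  proof -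
    have "q * Suc t \<le> q * ((n - j) div q)" using that by (intro mult_le_mono2) simp
    also have "\<dots> \<le> n - j" by simp
    finally show ?thesis using that q by simp
  qed
  have inj: "inj_on (\<lambda>(j, t). j + q * t) ?S"
  proof (rule inj_onI, clarsimp)
    fix j t j' t' assume jj: "j < q" "j' < q" "j + q * t = j' + q * t'"
    have "j = j'"
      using arg_cong[OF jj(3), of "\<lambda>x. x mod q"] jj(1,2) by (simp only: mod_mult_self2 mod_less)
    then show "j = j' \<and> t = t'" using jj by simp
  qed
  have "real q * H 0 n = (\<Sum>j<q. H 0 n)" by simp
  also have "\<dots> \<le> (\<Sum>j<q. (\<Sum>t<(n - j) div q. H (j + q * t) q) + 2 * real q * c)"
    by (intro sum_mono one) simp
  also have "\<dots> = (\<Sum>j<q. \<Sum>t<(n - j) div q. H (j + q * t) q) + 2 * (real q)\<^sup>2 * c"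
    by (simp add: sum.distrib power2_eq_square)
  also have "(\<Sum>j<q. \<Sum>t<(n - j) div q. H (j + q * t) q) = (\<Sum>(j, t)\<in>?S. H (j + q * t) q)"
    by (rule sum.Sigma) auto
  also have "\<dots> = (\<Sum>k\<in>(\<lambda>(j, t). j + q * t) ` ?S. H k q)"
    using inj by (subst sum.reindex) (auto simp: split_beta)
  also have "\<dots> \<le> (\<Sum>k<n. H k q)"
    using lt nn by (intro sum_mono2) auto
  finally show ?thesis by simp
qed

text \<open>Serves the atomic measures on separated sets, which are not invariant; only their time
  averages become so in the limit.\<close>

lemma (in full_prob_space) shannon_block:
  assumes fm: "\<And>k. finmeas M (\<lambda>x. X ((f ^^ k) x))" and X: "finite (range X)"
    and q: "q \<le> n" "q \<ge> 1"
  shows "real q * shannon M (itin f X n)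
    \<le> (\<Sum>k<n. shannon M (\<lambda>x. itin f X q ((f ^^ k) x))) + 2 * (real q)\<^sup>2 * ln (card (range X))"
proof -
  define H where "H k n = shannon M (\<lambda>x. itin f X n ((f ^^ k) x))" for k n
  have fmi: "finmeas M (\<lambda>x. itin f X n ((f ^^ k) x))" for n k
  proof (induction n)
    case 0
    then show ?case by (simp add: finmeas_const space_UNIV)
  next
    case (Suc n)
    have "finmeas M (\<lambda>x. X ((f ^^ n) ((f ^^ k) x)))" using fm[of "n + k"] by (simp add: funpow_add)
    from finmeas_comp[OF finmeas_pair[OF Suc this], of "\<lambda>(a, b). a @ [b]"] show ?case
      by (simp add: itin_Suc)
  qed
  have sub: "H k (m + n) \<le> H k m + H (k + m) n" for k m n
  proof -
    have e: "(f ^^ m) ((f ^^ k) x) = (f ^^ (k + m)) x" for x by (simp add: funpow_add add.commute[of k m])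
    have "H k (m + n) = shannon M (\<lambda>x. (\<lambda>(a, b). a @ b) (itin f X m ((f ^^ k) x), itin f X n ((f ^^ (k + m)) x)))"
      by (simp add: H_def itin_append e)
    also have "\<dots> \<le> shannon M (\<lambda>x. (itin f X m ((f ^^ k) x), itin f X n ((f ^^ (k + m)) x)))"
      by (intro shannon_comp_le finmeas_pair fmi)
    also have "\<dots> \<le> H k m + H (k + m) n" unfolding H_def by (intro shannon_subadditive fmi)
    finally show ?thesis .
  qed
  have bd: "H k n \<le> real n * ln (card (range X))" for k n
  proof (induction n arbitrary: k)
    case 0
    show ?case by (simp add: H_def shannon_const)
  next
    case (Suc n)
    have "H k 1 = shannon M (\<lambda>x. X ((f ^^ k) x))"
      using shannon_relabel[of "\<lambda>x. [x]" "\<lambda>x. X ((f ^^ k) x)" M] by (simp add: H_def itin_def inj_on_def)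
    also have "\<dots> \<le> ln (card (range X))" by (rule shannon_le_card[OF fm X]) auto
    finally have "H k 1 \<le> ln (card (range X))" .
    then show ?case using sub[of k 1 n] Suc[of "k + 1"] by (simp add: algebra_simps)
  qed
  have "real q * H 0 n \<le> (\<Sum>k<n. H k q) + 2 * (real q)\<^sup>2 * ln (card (range X))"
    by (rule block_sum[OF sub _ bd q]) (simp add: H_def shannon_nonneg)
  then show ?thesis by (simp add: H_def)
qed

lemma finite_pmf:
  fixes w :: "'a \<Rightarrow> real"
  assumes "finite E" "\<And>x. x \<in> E \<Longrightarrow> 0 \<le> w x" "(\<Sum>x\<in>E. w x) = 1"
  obtains p where "\<And>A. measure (measure_pmf p) A = (\<Sum>x\<in>E. w x * indicator A x)"
proof -
  define w' where "w' x = (if x \<in> E then w x else 0)" for x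
  have "(\<integral>\<^sup>+x. ennreal (w' x) \<partial>count_space UNIV) = (\<Sum>x\<in>E. ennreal (w' x))"
    using assms(1) by (intro nn_integral_count_space') (auto simp: w'_def)
  also have "\<dots> = 1" using assms by (simp add: w'_def sum_ennreal)
  finally have p: "pmf (embed_pmf w') x = w' x" for x
    using assms(2) by (intro pmf_embed_pmf) (auto simp: w'_def)
  have "measure (measure_pmf (embed_pmf w')) A = (\<Sum>x\<in>E. w x * indicator A x)" for A
  proof -
    have "measure (measure_pmf (embed_pmf w')) A = (\<integral>x. indicator A x \<partial>measure_pmf (embed_pmf w'))" by simp
    also have "\<dots> = (\<Sum>x\<in>E. indicator A x * pmf (embed_pmf w') x)"
      using assms(1) by (intro integral_measure_pmf_real) (auto simp: set_pmf_iff p w'_def split: if_splits)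
    finally show ?thesis by (simp add: p w'_def mult.commute cong: sum.cong)
  qed
  then show ?thesis using that by blast
qed

context compact_dynamics
begin

lemma mptI_continuous:
  assumes M: "borel_prob M" and inv: "\<And>g. continuous_on UNIV g \<Longrightarrow> (\<integral>x. g (f x) \<partial>M) = integral\<^sup>L M (g :: 'a \<Rightarrow> real)"
  shows "mpt f M"
proof -
  interpret borel_prob M by fact
  have fm: "f \<in> measurable M M"
    using borel_measurable_continuous_onI[OF cont_f] sets_eq measurable_cong_sets by blast
  have "distr M M f = M"
  proof (rule borel_prob_eqI)
    show "borel_prob (distr M M f)"
      using prob_space_distr[OF fm] sets_eq by (simp add: borel_prob_def borel_prob_axioms_def)
    show "borel_prob M" by (rule M)
    show "integral\<^sup>L (distr M M f) g = integral\<^sup>L M g" if "continuous_on UNIV g" for g :: "'a \<Rightarrow> real"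
      using integral_distr[OF fm meas_cont[OF that]] inv[OF that] by simp
  qed
  then show ?thesis using fm by (simp add: mpt_def)
qed

text \<open>The construction of Misiurewicz: empirical averages of the measures that weight separated orbits
  by their Birkhoff sums converge to a measure of large free energy.\<close>

theorem misiurewicz:
  assumes phi: "continuous_on UNIV \<phi>" and r: "r > 0"
    and big: "\<And>N. \<exists>n\<ge>N. \<exists>E. finite E \<and> separated f n r E \<and> exp (real n * c) \<le> (\<Sum>x\<in>E. exp (birkhoff f \<phi> n x))"
  obtains M where "borel_prob M" "mpt f M" "ereal c \<le> free_energy f \<phi> M"
proof -
  have "\<exists>m E. m \<ge> j \<and> finite E \<and> separated f (Suc m) r E \<and> exp (real (Suc m) * c) \<le> (\<Sum>x\<in>E. exp (birkhoff f \<phi> (Suc m) x))" for j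
  proof -
    obtain n E where nE: "n \<ge> Suc j" "finite E" "separated f n r E" "exp (real n * c) \<le> (\<Sum>x\<in>E. exp (birkhoff f \<phi> n x))"
      using big[of "Suc j"] by blast
    then obtain m where "n = Suc m" "m \<ge> j" by (cases n) auto
    then show ?thesis using nE by blast
  qed
  then obtain m E where mE: "\<And>j. m j \<ge> j" "\<And>j. finite (E j)" "\<And>j. separated f (Suc (m j)) r (E j)"
    "\<And>j. exp (real (Suc (m j)) * c) \<le> (\<Sum>x\<in>E j. exp (birkhoff f \<phi> (Suc (m j)) x))" by metis
  define Z where "Z j = (\<Sum>x\<in>E j. exp (birkhoff f \<phi> (Suc (m j)) x))" for j
  \<comment> \<open>Weights proportional to the exponentials of the Birkhoff sums give equality in
    Gibbs' inequality: entropy plus mean equals \<open>ln (Z j)\<close>.\<close>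
  define w where "w j x = exp (birkhoff f \<phi> (Suc (m j)) x) / Z j" for j x
  have Zpos: "Z j > 0" for j using mE(4)[of j] by (simp add: Z_def) (meson exp_gt_zero less_le_trans)
  have w0: "0 \<le> w j x" for j x using Zpos[of j] by (simp add: w_def)
  have w1: "(\<Sum>x\<in>E j. w j x) = 1" for j
    using Zpos[of j] by (simp add: w_def sum_divide_distrib[symmetric] Z_def[symmetric])
  define Q where "Q j g = (\<Sum>x\<in>E j. w j x * avg f g (m j) x)" for j and g :: "'a \<Rightarrow> real"
  have mf: "mean_functional (Q j)" for j
  proof
    show "compact (UNIV :: 'a set)" by (rule compact_space)
    show "Q j (\<lambda>x. g x + h x) = Q j g + Q j h" for g h
      by (simp add: Q_def avg_add algebra_simps sum.distrib)
    show "Q j (\<lambda>x. a * g x) = a * Q j g" for g a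
      by (simp add: Q_def avg_scale sum_distrib_left algebra_simps)
    show "0 \<le> Q j g" if "\<And>x. 0 \<le> g x" for g
      unfolding Q_def avg_def birkhoff_def
      by (intro sum_nonneg mult_nonneg_nonneg w0 divide_nonneg_nonneg that) auto
    have "avg f (\<lambda>_. 1) n x = 1" for n x by (simp add: avg_def birkhoff_def del: sum.lessThan_Suc of_nat_Suc)
    then show "Q j (\<lambda>_. 1) = 1" using w1 by (simp add: Q_def)
  qed
  obtain M F where MF: "borel_prob M" "F \<noteq> bot" "F \<le> sequentially"
    "\<And>g. continuous_on UNIV g \<Longrightarrow> ((\<lambda>j. Q j g) \<longlongrightarrow> integral\<^sup>L M g) F"
    by (rule weak_limit[OF mf]) (rule that)
  have minf: "filterlim (\<lambda>j. real (Suc (m j))) at_top F"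
  proof (rule filterlim_mono[OF _ order_refl MF(3)])
    show "filterlim (\<lambda>j. real (Suc (m j))) at_top sequentially"
      by (rule filterlim_at_top_mono[OF filterlim_real_sequentially]) (intro always_eventually allI of_nat_mono le_SucI mE(1))
  qed
  have to0: "((\<lambda>j. C / real (Suc (m j))) \<longlongrightarrow> 0) F" for C
    using tendsto_divide_0[OF tendsto_const filterlim_at_top_imp_at_infinity[OF minf]] by simp
  interpret M: borel_prob M by (rule MF(1))
  have inv: "mpt f M"
  proof (rule mptI_continuous[OF MF(1)])
    fix g :: "'a \<Rightarrow> real" assume g: "continuous_on UNIV g"
    obtain b where b: "\<And>x. \<bar>g x\<bar> \<le> b" using bdd_cont[OF g] by metis
    have gf: "continuous_on UNIV (\<lambda>x. g (f x))" by (rule cont_comp[OF g cont_f])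
    have diff: "\<bar>Q j (\<lambda>x. g (f x)) - Q j g\<bar> \<le> 2 * b / real (Suc (m j))" for j
    proof -
      have a: "\<bar>avg f (\<lambda>x. g (f x)) n x - avg f g n x\<bar> \<le> 2 * b / real (Suc n)" for n x
      proof -
        have e: "avg f (\<lambda>x. g (f x)) n x = avg f g n (f x)"
          by (simp add: avg_def birkhoff_def funpow_swap1 del: sum.lessThan_Suc)
        have "avg f g n (f x) - avg f g n x = (g ((f ^^ Suc n) x) - g x) / real (Suc n)"
          using birkhoff_Suc_shift[of f g "Suc n" x] birkhoff_Suc[of f g "Suc n" x]
          by (simp add: avg_def diff_divide_distrib[symmetric])
        moreover have "\<bar>g ((f ^^ Suc n) x) - g x\<bar> \<le> 2 * b"
          using b[of "(f ^^ Suc n) x"] b[of x] by linarith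
        ultimately show ?thesis unfolding e by (simp add: abs_mult divide_right_mono)
      qed
      have "\<bar>Q j (\<lambda>x. g (f x)) - Q j g\<bar> = \<bar>\<Sum>x\<in>E j. w j x * (avg f (\<lambda>x. g (f x)) (m j) x - avg f g (m j) x)\<bar>"
        by (simp add: Q_def right_diff_distrib sum_subtractf)
      also have "\<dots> \<le> (\<Sum>x\<in>E j. \<bar>w j x * (avg f (\<lambda>x. g (f x)) (m j) x - avg f g (m j) x)\<bar>)" by (rule sum_abs)
      also have "\<dots> \<le> (\<Sum>x\<in>E j. w j x * (2 * b / real (Suc (m j))))"
        unfolding abs_mult abs_of_nonneg[OF w0] by (intro sum_mono mult_left_mono a w0)
      also have "\<dots> = 2 * b / real (Suc (m j))" by (simp only: sum_distrib_right[symmetric] w1 mult_1)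
      finally show ?thesis .
    qed
    have "((\<lambda>j. Q j (\<lambda>x. g (f x)) - Q j g) \<longlongrightarrow> 0) F"
      by (rule Lim_null_comparison[OF _ to0[of "2 * b"]]) (use diff in \<open>auto intro!: always_eventually\<close>)
    moreover have "((\<lambda>j. Q j (\<lambda>x. g (f x)) - Q j g) \<longlongrightarrow> (\<integral>x. g (f x) \<partial>M) - integral\<^sup>L M g) F"
      by (intro tendsto_diff MF(4) g gf)
    ultimately show "(\<integral>x. g (f x) \<partial>M) = integral\<^sup>L M g"
      using tendsto_unique[OF MF(2)] by force
  qed
  interpret M: borel_mpt M f by (rule borel_mptI[OF MF(1) inv])
  obtain X :: "'a \<Rightarrow> nat" where X: "finite (range X)" "\<And>v. X -` {v} \<in> sets M" "\<And>v. jset M (X -` {v})"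
    "\<And>x y. X x = X y \<Longrightarrow> dist x y \<le> r"
    by (rule M.small_jset_partition[OF compact_space r]) (rule that)
  have fX: "finmeas M X" using X by (simp add: finmeas_def)
  define K where "K = ln (card (range X))"
  have main: "c \<le> shannon M (itin f X q) / real q + integral\<^sup>L M \<phi>" if q: "q \<ge> 1" for q
  proof -
    define V where "V = range (itin f X q)"
    have fq: "finmeas M (itin f X q)" by (rule M.itin_finmeas[OF fX])
    have finV: "finite V" using fq by (simp add: V_def finmeas_def)
    define P where "P j v = Q j (indicator (itin f X q -` {v}))" for j v
    have Plim: "((\<lambda>j. P j v) \<longlongrightarrow> measure M (itin f X q -` {v})) F" for v
    proof (rule jset_tendsto[OF MF(1) _ _ MF(4)])
      show "jset M (itin f X q -` {v})" by (rule M.jset_itin[OF cont_f inv X(3)])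
      show "itin f X q -` {v} \<in> sets borel" using fq by (simp add: finmeas_def M.sets_eq)
      have mono: "Q j g \<le> Q j h" if "\<And>x. g x \<le> h x" for j g h
        unfolding Q_def avg_def birkhoff_def
        by (intro sum_mono mult_left_mono w0 divide_right_mono that) auto
      show "Q j g \<le> P j v" if "\<And>x. g x \<le> indicator (itin f X q -` {v}) x" for j g
        unfolding P_def by (rule mono) (rule that)
      show "P j v \<le> Q j g" if "\<And>x. indicator (itin f X q -` {v}) x \<le> g x" for j g
        unfolding P_def by (rule mono) (rule that)
    qed
    have P01: "0 \<le> P j v" "P j v \<le> 1" for j v
    proof -
      have a: "0 \<le> avg f (indicator A) n x" "avg f (indicator A) n x \<le> 1" for A n and x :: 'a
      proof -
        have "\<bar>avg f (indicator A) n x\<bar> \<le> 1" by (rule avg_bound) (simp add: indicator_def)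
        then show "avg f (indicator A) n x \<le> 1" by linarith
        show "0 \<le> avg f (indicator A) n x"
          unfolding avg_def birkhoff_def by (intro divide_nonneg_nonneg sum_nonneg) auto
      qed
      show "0 \<le> P j v" unfolding P_def Q_def by (intro sum_nonneg mult_nonneg_nonneg w0 a)
      have "P j v \<le> (\<Sum>x\<in>E j. w j x * 1)" unfolding P_def Q_def by (intro sum_mono mult_left_mono w0 a)
      then show "P j v \<le> 1" using w1 by simp
    qed
    have lim: "((\<lambda>j. (\<Sum>v\<in>V. eta (P j v)) / real q + 2 * real q * K / real (Suc (m j)) + Q j \<phi>)
        \<longlongrightarrow> shannon M (itin f X q) / real q + 0 + integral\<^sup>L M \<phi>) F"
    proof (intro tendsto_add to0 MF(4) phi tendsto_divide tendsto_const)
      show "((\<lambda>j. \<Sum>v\<in>V. eta (P j v)) \<longlongrightarrow> shannon M (itin f X q)) F"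
        unfolding shannon_def V_def[symmetric]
        by (intro tendsto_sum continuous_on_tendsto_compose[OF continuous_on_eta Plim])
           (use P01 in \<open>auto intro!: always_eventually\<close>)
    qed (use q in auto)
    have ev: "eventually (\<lambda>j. c \<le> (\<Sum>v\<in>V. eta (P j v)) / real q + 2 * real q * K / real (Suc (m j)) + Q j \<phi>) F"
    proof (rule filter_leD[OF MF(3)], unfold eventually_sequentially, intro exI allI impI)
      fix j assume j: "q \<le> j"
      define n where "n = Suc (m j)"
      have n: "q \<le> n" "n \<ge> 1" using j mE(1)[of j] by (auto simp: n_def)
      obtain p where p: "\<And>A. measure (measure_pmf p) A = (\<Sum>x\<in>E j. w j x * indicator A x)"
        using finite_pmf[OF mE(2) w0 w1] by metis
      interpret p: full_prob_space "measure_pmf p"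
        by (simp add: full_prob_space_def full_prob_space_axioms_def prob_space_measure_pmf)
      have fmp: "finmeas (measure_pmf p) (\<lambda>x. X ((f ^^ k) x))" for k
        unfolding finmeas_def using finite_subset[OF _ X(1), of "range (\<lambda>x. X ((f ^^ k) x))"] by auto
      have b1: "real q * shannon (measure_pmf p) (itin f X n)
          \<le> (\<Sum>k<n. shannon (measure_pmf p) (\<lambda>x. itin f X q ((f ^^ k) x))) + 2 * (real q)\<^sup>2 * K"
        unfolding K_def by (rule p.shannon_block[OF fmp X(1) n(1) q])
      have b2: "(\<Sum>k<n. shannon (measure_pmf p) (\<lambda>x. itin f X q ((f ^^ k) x))) / real n \<le> (\<Sum>v\<in>V. eta (P j v))"
      proof -
        let ?A = "\<lambda>k v. (\<lambda>x. itin f X q ((f ^^ k) x)) -` {v}"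
        have "(\<Sum>k<n. shannon (measure_pmf p) (\<lambda>x. itin f X q ((f ^^ k) x))) / real n
            = (\<Sum>k<n. \<Sum>v\<in>V. 1 / real n * eta (measure (measure_pmf p) (?A k v)))"
        proof -
          have "shannon (measure_pmf p) (\<lambda>x. itin f X q ((f ^^ k) x)) = (\<Sum>v\<in>V. eta (measure (measure_pmf p) (?A k v)))" for k
            by (rule shannon_superset[OF finV]) (auto simp: V_def)
          then show ?thesis by (simp add: sum_divide_distrib)
        qed
        also have "\<dots> = (\<Sum>v\<in>V. \<Sum>k<n. 1 / real n * eta (measure (measure_pmf p) (?A k v)))" by (rule sum.swap)
        \<comment> \<open>Concavity moves the time average inside \<open>eta\<close>, which replaces
          the translates of the atomic measure by the averaged functional
          \<open>Q j\<close>.\<close>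
        also have "\<dots> \<le> (\<Sum>v\<in>V. eta (\<Sum>k<n. 1 / real n * measure (measure_pmf p) (?A k v)))"
          using n by (intro sum_mono eta_concave_sum) auto
        also have "\<dots> = (\<Sum>v\<in>V. eta (P j v))"
        proof (intro sum.cong refl arg_cong[of _ _ eta])
          fix v
          have "(\<Sum>k<n. 1 / real n * measure (measure_pmf p) (?A k v))
            = (\<Sum>k<n. \<Sum>x\<in>E j. w j x * (1 / real n * indicator (itin f X q -` {v}) ((f ^^ k) x)))"
            by (simp add: p sum_distrib_left indicator_def algebra_simps)
          also have "\<dots> = (\<Sum>x\<in>E j. \<Sum>k<n. w j x * (1 / real n * indicator (itin f X q -` {v}) ((f ^^ k) x)))"
            by (rule sum.swap)
          also have "\<dots> = P j v"
            by (simp add: P_def Q_def avg_def birkhoff_def n_def sum_distrib_left sum_divide_distrib del: sum.lessThan_Suc of_nat_Suc)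
          finally show "(\<Sum>k<n. 1 / real n * measure (measure_pmf p) (?A k v)) = P j v" .
        qed
        finally show ?thesis .
      qed
      \<comment> \<open>Cells have diameter at most \<open>r\<close>, so the points of the separated
        set have different itineraries and the itinerary carries the full entropy of the
        weights.\<close>
      have inj: "inj_on (itin f X n) (E j)"
      proof (rule inj_onI, rule ccontr)
        fix x y assume xy: "x \<in> E j" "y \<in> E j" "itin f X n x = itin f X n y" "x \<noteq> y"
        then have "dn f n x y > r" using mE(3)[of j] by (auto simp: separated_def n_def)
        moreover have "dn f n x y \<le> r"
          using xy(3) X(4) r by (subst dn_le_iff) (auto simp: itin_eq_iff)
        ultimately show False by simp
      qed
      have b3: "shannon (measure_pmf p) (itin f X n) = (\<Sum>x\<in>E j. eta (w j x))"
      proof -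
        let ?T = "\<lambda>v. measure (measure_pmf p) (itin f X n -` {v})"
        have fin: "finite (range (itin f X n))" using M.itin_finmeas[OF fX, of n] by (simp add: finmeas_def)
        have zero: "?T v = 0" if "v \<notin> itin f X n ` E j" for v
          unfolding p using that by (intro sum.neutral) (auto simp: indicator_def)
        have "shannon (measure_pmf p) (itin f X n) = (\<Sum>v\<in>itin f X n ` E j. eta (?T v))"
          unfolding shannon_def using zero fin by (intro sum.mono_neutral_right) auto
        also have "\<dots> = (\<Sum>x\<in>E j. eta (?T (itin f X n x)))" using inj by (subst sum.reindex) auto
        also have "\<dots> = (\<Sum>x\<in>E j. eta (w j x))"
        proof (intro sum.cong refl arg_cong[of _ _ eta])
          fix x assume x: "x \<in> E j"
          have "?T (itin f X n x) = (\<Sum>y\<in>{x}. w j y * indicator (itin f X n -` {itin f X n x}) y)"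
            unfolding p using x inj mE(2)
            by (intro sum.mono_neutral_right) (auto simp: indicator_def dest: inj_onD)
          then show "?T (itin f X n x) = w j x" by simp
        qed
        finally show ?thesis .
      qed
      have b4: "(\<Sum>x\<in>E j. eta (w j x)) + real n * Q j \<phi> = ln (Z j)"
      proof -
        have "eta (w j x) + w j x * birkhoff f \<phi> n x = w j x * ln (Z j)" for x
        proof -
          have "ln (w j x) = birkhoff f \<phi> n x - ln (Z j)" using Zpos[of j] by (simp add: w_def ln_div n_def)
          then show ?thesis unfolding eta_def by (simp only:) (simp add: algebra_simps)
        qed
        then have "(\<Sum>x\<in>E j. eta (w j x) + w j x * birkhoff f \<phi> n x) = ln (Z j)"
          by (simp add: sum_distrib_right[symmetric] w1)
        moreover have "real n * Q j \<phi> = (\<Sum>x\<in>E j. w j x * birkhoff f \<phi> n x)"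
          by (simp add: Q_def avg_def n_def sum_distrib_left del: of_nat_Suc)
        ultimately show ?thesis by (simp add: sum.distrib)
      qed
      have "real n * c \<le> ln (Z j)"
        using mE(4)[of j] Zpos[of j] by (simp add: Z_def n_def ln_ge_iff del: of_nat_Suc)
      then have "real q * (real n * c) \<le> real q * (shannon (measure_pmf p) (itin f X n) + real n * Q j \<phi>)"
        unfolding b3 b4 using q by (intro mult_left_mono) auto
      also have "\<dots> \<le> (\<Sum>k<n. shannon (measure_pmf p) (\<lambda>x. itin f X q ((f ^^ k) x))) + 2 * (real q)\<^sup>2 * K + real q * real n * Q j \<phi>"
        using b1 by (simp add: algebra_simps)
      also have "\<dots> \<le> real n * (\<Sum>v\<in>V. eta (P j v)) + 2 * (real q)\<^sup>2 * K + real q * real n * Q j \<phi>"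
        using b2 n by (simp add: divide_le_eq mult.commute)
      finally show "c \<le> (\<Sum>v\<in>V. eta (P j v)) / real q + 2 * real q * K / real (Suc (m j)) + Q j \<phi>"
        using n q unfolding n_def[symmetric] by (simp add: field_simps power2_eq_square)
    qed
    show ?thesis using tendsto_lowerbound[OF lim ev MF(2)] by simp
  qed
  have "c - integral\<^sup>L M \<phi> \<le> shannon M (itin f X (Suc n)) / real (Suc n)" for n
    using main[of "Suc n"] by linarith
  then have "c - integral\<^sup>L M \<phi> \<le> hent f M X"
    by (intro LIMSEQ_le_const[OF M.hent_LIMSEQ[OF fX]]) auto
  then have "ereal c \<le> ereal (hent f M X) + ereal (integral\<^sup>L M \<phi>)" by simp
  also have "\<dots> \<le> free_energy f \<phi> M"
    unfolding free_energy_def by (intro add_right_mono ks_ge fX M.space_eq)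
  finally show ?thesis using that MF(1) inv by blast
qed

end

section \<open>Expansivity and entropy at a fixed scale\<close>

context full_prob_space
begin

lemma shannon_le_factor:
  assumes B: "finmeas M B" and AB: "\<And>x y. B x = B y \<Longrightarrow> A x = A y"
  shows "shannon M A \<le> shannon M B"
proof -
  have "A x = A (inv_into UNIV B (B x))" for x
    using AB[of x "inv_into UNIV B (B x)"] f_inv_into_f[of "B x" B UNIV] by simp
  then have "A = (\<lambda>x. (\<lambda>v. A (inv_into UNIV B v)) (B x))" by (simp add: fun_eq_iff)
  moreover have "shannon M (\<lambda>x. (\<lambda>v. A (inv_into UNIV B v)) (B x)) \<le> shannon M B" by (rule shannon_comp_le[OF B])
  ultimately show ?thesis by metis
qed

text \<open>Off-diagonal joint masses are below \<open>d\<close>, and a diagonal mass differs from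
  that of the \<open>B\<close>-fibre by less than \<open>d\<close>; uniform continuity of
  \<open>eta\<close> makes both effects small. The fixed value set \<open>V\<close> makes
  \<open>d\<close> independent of the functions.\<close>

lemma shannon_conditional_small:
  fixes A B :: "'a \<Rightarrow> 'b"
  assumes V: "finite V" and e: "e > 0"
  obtains d where "d > 0"
    "\<And>A B :: 'a \<Rightarrow> 'b. finmeas M A \<Longrightarrow> finmeas M B \<Longrightarrow> range A \<subseteq> V \<Longrightarrow> range B \<subseteq> V \<Longrightarrow>
       measure M {x. A x \<noteq> B x} < d \<Longrightarrow> shannon M (\<lambda>x. (A x, B x)) - shannon M B \<le> e"
proof -
  define e' where "e' = e / (real (card V) * real (card V) + 1)"
  have e': "e' > 0" "real (card V) * real (card V) * e' \<le> e"
    using e by (auto simp: e'_def field_simps add_pos_nonneg)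
  obtain d where d: "d > 0"
    "\<And>s t. 0 \<le> s \<Longrightarrow> s \<le> 1 \<Longrightarrow> 0 \<le> t \<Longrightarrow> t \<le> 1 \<Longrightarrow> \<bar>s - t\<bar> < d \<Longrightarrow> \<bar>eta s - eta t\<bar> < e'"
    using eta_uniform[OF e'(1)] by metis
  show ?thesis
  proof (rule that[OF d(1)])
    fix A B :: "'a \<Rightarrow> 'b"
    assume AB: "finmeas M A" "finmeas M B" "range A \<subseteq> V" "range B \<subseteq> V" "measure M {x. A x \<noteq> B x} < d"
    have sA: "A -` {a} \<in> sets M" and sB: "B -` {a} \<in> sets M" for a using AB by (auto simp: finmeas_def)
    have sD: "{x. A x \<noteq> B x} \<in> sets M"
      using finmeas_vimage[OF finmeas_pair[OF AB(1,2)], of "{(a, b). a \<noteq> b}"] by (simp add: vimage_def)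
    let ?p = "\<lambda>a b. measure M (A -` {a} \<inter> B -` {b})"
    have "shannon M (\<lambda>x. (A x, B x)) = (\<Sum>(a, b)\<in>V \<times> V. eta (measure M ((\<lambda>x. (A x, B x)) -` {(a, b)})))"
      unfolding split_beta' using V AB by (subst shannon_superset[of "V \<times> V"]) auto
    also have "\<dots> = (\<Sum>b\<in>V. \<Sum>a\<in>V. eta (?p a b))"
    proof -
      have "(\<lambda>x. (A x, B x)) -` {(a, b)} = A -` {a} \<inter> B -` {b}" for a b by auto
      then show ?thesis by (subst sum.swap) (simp add: sum.cartesian_product)
    qed
    also have "\<dots> \<le> (\<Sum>b\<in>V. eta (measure M (B -` {b})) + (\<Sum>a\<in>V. e'))"
    proof (rule sum_mono)
      fix b assume b: "b \<in> V"
      have off: "eta (?p a b) \<le> e'" if "a \<noteq> b" for a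
      proof -
        have "?p a b \<le> measure M {x. A x \<noteq> B x}" using sD that by (intro finite_measure_mono) auto
        then have "\<bar>?p a b - 0\<bar> < d" using AB(5) by simp
        then have "\<bar>eta (?p a b) - eta 0\<bar> < e'" by (intro d(2)) auto
        then show ?thesis by simp
      qed
      have dia: "eta (?p b b) \<le> eta (measure M (B -` {b})) + e'"
      proof -
        have "measure M (B -` {b}) \<le> measure M ((A -` {b} \<inter> B -` {b}) \<union> {x. A x \<noteq> B x})"
          using sA sB sD by (intro finite_measure_mono) auto
        also have "\<dots> \<le> ?p b b + measure M {x. A x \<noteq> B x}" using sA sB sD by (intro measure_Un_le) auto
        finally have "measure M (B -` {b}) - ?p b b < d" using AB(5) by simp
        moreover have "?p b b \<le> measure M (B -` {b})" using sB by (intro finite_measure_mono) auto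
        ultimately have "\<bar>eta (?p b b) - eta (measure M (B -` {b}))\<bar> < e'" by (intro d(2)) auto
        then show ?thesis by linarith
      qed
      have "(\<Sum>a\<in>V. eta (?p a b)) = eta (?p b b) + (\<Sum>a\<in>V - {b}. eta (?p a b))"
        using V b by (rule sum.remove)
      also have "\<dots> \<le> (eta (measure M (B -` {b})) + e') + (\<Sum>a\<in>V - {b}. e')"
        using off dia by (intro add_mono sum_mono) auto
      also have "\<dots> = eta (measure M (B -` {b})) + (\<Sum>a\<in>V. e')"
        using sum.remove[OF V b, of "\<lambda>_. e'"] by linarith
      finally show "(\<Sum>a\<in>V. eta (?p a b)) \<le> eta (measure M (B -` {b})) + (\<Sum>a\<in>V. e')" .
    qed
    also have "\<dots> = shannon M B + real (card V) * real (card V) * e'"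
      using shannon_superset[OF V AB(4), of M] by (simp add: sum.distrib)
    finally show "shannon M (\<lambda>x. (A x, B x)) - shannon M B \<le> e" using e'(2) by linarith
  qed
qed

end

section \<open>Two-sided orbits, the nonexpansive set and shrinking cells\<close>

context compact_dynamics
begin

lemma seq_subseq:
  fixes u :: "nat \<Rightarrow> 'a"
  obtains l r where "strict_mono (r :: nat \<Rightarrow> nat)" "(\<lambda>k. u (r k)) \<longlonglongrightarrow> l"
proof -
  have "\<exists>l\<in>UNIV. \<exists>r. strict_mono r \<and> (u \<circ> r) \<longlonglongrightarrow> l"
    using compact_imp_seq_compact[OF compact_space] unfolding seq_compact_def by blast
  then obtain l r where "strict_mono (r :: nat \<Rightarrow> nat)" "(u \<circ> r) \<longlonglongrightarrow> l" by auto
  then show ?thesis using that[of r l] by (simp add: o_def)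
qed

lemma inv_f_f: "inv f (f x) = x" and f_inv_f: "f (inv f x) = x"
  using bij_f by (auto simp: bij_is_inj bij_is_surj surj_f_inv_f)

lemma iter_inv_iter: "(f ^^ s) ((inv f ^^ s) x) = x"
proof (induction s)
  case (Suc s)
  have "(f ^^ Suc s) ((inv f ^^ Suc s) x) = (f ^^ s) (f (inv f ((inv f ^^ s) x)))"
    by (simp add: funpow_swap1)
  then show ?case using Suc by (simp add: f_inv_f)
qed simp

lemma inv_iter_iter: "(inv f ^^ s) ((f ^^ s) x) = x"
proof (induction s)
  case (Suc s)
  have "(inv f ^^ Suc s) ((f ^^ Suc s) x) = (inv f ^^ s) (inv f (f ((f ^^ s) x)))"
    by (simp add: funpow_swap1)
  then show ?case using Suc by (simp add: inv_f_f)
qed simp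

lemma fpow_diff: "(f ^^ t) ((inv f ^^ s) x) = fpow f (int t - int s) x"
proof (cases "s \<le> t")
  case True
  then have "(f ^^ t) ((inv f ^^ s) x) = (f ^^ (t - s)) ((f ^^ s) ((inv f ^^ s) x))"
    by (metis comp_apply funpow_add le_add_diff_inverse2)
  then show ?thesis using True by (simp add: iter_inv_iter fpow_def nat_diff_distrib)
next
  case False
  then have "(inv f ^^ s) x = (inv f ^^ t) ((inv f ^^ (s - t)) x)"
    by (metis comp_apply funpow_add le_add_diff_inverse nat_le_linear)
  then show ?thesis using False by (simp add: iter_inv_iter fpow_def nat_diff_distrib)
qed

lemma fpow_f: "fpow f k (f x) = fpow f (k + 1) x"
proof -
  obtain s t where k: "k = int t - int s" by (metis diff_zero int_diff_cases)
  have "fpow f k (f x) = (f ^^ t) ((inv f ^^ s) (f x))" by (simp add: k fpow_diff)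
  also have "(inv f ^^ s) (f x) = f ((inv f ^^ s) x)"
    by (induction s) (auto simp: inv_f_f f_inv_f)
  also have "(f ^^ t) (f ((inv f ^^ s) x)) = (f ^^ Suc t) ((inv f ^^ s) x)" by (simp add: funpow_swap1)
  also have "\<dots> = fpow f (k + 1) x" by (simp add: k fpow_diff algebra_simps del: funpow.simps)
  finally show ?thesis .
qed

lemma inv_dynamics: "compact_dynamics (inv f)"
proof
  show "compact (UNIV :: 'a set)" by (rule compact_space)
  show "\<exists>h. homeomorphism UNIV UNIV (inv f) h"
    using cont_f cont_inv_f bij_f
    by (intro exI[of _ f]) (auto simp: homeomorphism_def inv_f_f f_inv_f bij_is_surj bij_imp_bij_inv)
qed

lemma fpow_cont: "continuous_on UNIV (fpow f k)"
proof -
  interpret i: compact_dynamics "inv f" by (rule inv_dynamics)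
  show ?thesis by (cases "k \<ge> 0") (simp_all add: fpow_def cont_iter i.cont_iter)
qed

lemma mpt_inv: assumes M: "borel_prob M" "mpt f M" shows "mpt (inv f) M"
proof -
  interpret i: compact_dynamics "inv f" by (rule inv_dynamics)
  interpret borel_mpt M f by (rule borel_mptI[OF M])
  show ?thesis
  proof (rule i.mptI_continuous[OF M(1)])
    fix g :: "'a \<Rightarrow> real" assume g: "continuous_on UNIV g"
    have "continuous_on UNIV (\<lambda>x. g (inv f x))" by (rule cont_comp[OF g cont_inv_f])
    from integral_mpt[OF meas_cont[OF this]] show "(\<integral>x. g (inv f x) \<partial>M) = integral\<^sup>L M g"
      by (simp add: inv_f_f)
  qed
qed

lemma NE_f: "f x \<in> NE f e \<longleftrightarrow> x \<in> NE f e"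
proof -
  have G: "f y \<in> Gamma f e (f x) \<longleftrightarrow> y \<in> Gamma f e x" for y
  proof -
    have "(\<forall>k. dist (fpow f (k + 1) x) (fpow f (k + 1) y) \<le> e) \<longleftrightarrow> (\<forall>k. dist (fpow f k x) (fpow f k y) \<le> e)"
      by (metis diff_add_cancel)
    then show ?thesis by (simp add: Gamma_def fpow_f)
  qed
  then have "Gamma f e (f x) = f ` Gamma f e x"
    by (auto simp: image_iff) (metis f_inv_f)
  then show ?thesis
    unfolding NE_def by simp (metis bij_f bij_is_inj image_empty image_insert inj_image_eq_iff)
qed

text \<open>Requiring a companion at distance at least \<open>1 / real (Suc j)\<close> gives a
  closed set: companions accumulate by compactness and the two-sided inequalities pass to the
  limit.\<close>

lemma NE_borel:
  assumes e: "e \<ge> 0"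
  shows "NE f e \<in> sets borel"
proof -
  let ?N = "\<lambda>j. {x. \<exists>y. dist x y \<ge> 1 / real (Suc j) \<and> (\<forall>k. dist (fpow f k x) (fpow f k y) \<le> e)}"
  have "closed (?N j)" for j
    unfolding closed_sequential_limits
  proof (intro allI impI, elim conjE)
    fix u x assume u: "\<forall>n. u n \<in> ?N j" "u \<longlonglongrightarrow> x"
    then have "\<forall>n. \<exists>y. dist (u n) y \<ge> 1 / real (Suc j) \<and> (\<forall>k. dist (fpow f k (u n)) (fpow f k y) \<le> e)" by simp
    from choice[OF this] obtain v where v: "\<And>n. dist (u n) (v n) \<ge> 1 / real (Suc j)"
      "\<And>n k. dist (fpow f k (u n)) (fpow f k (v n)) \<le> e" by auto
    obtain y r where r: "strict_mono (r :: nat \<Rightarrow> nat)" "(\<lambda>k. v (r k)) \<longlonglongrightarrow> y" by (rule seq_subseq)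
    have ur: "(\<lambda>k. u (r k)) \<longlonglongrightarrow> x" using LIMSEQ_subseq_LIMSEQ[OF u(2) r(1)] by (simp add: o_def)
    have "1 / real (Suc j) \<le> dist x y"
      by (rule LIMSEQ_le_const[OF tendsto_dist[OF ur r(2)]]) (use v(1) in blast)
    moreover have "dist (fpow f k x) (fpow f k y) \<le> e" for k
    proof (rule LIMSEQ_le_const2)
      show "(\<lambda>i. dist (fpow f k (u (r i))) (fpow f k (v (r i)))) \<longlonglongrightarrow> dist (fpow f k x) (fpow f k y)"
        by (intro tendsto_dist continuous_on_tendsto_compose[OF fpow_cont] ur r(2)) auto
    qed (use v(2) in blast)
    ultimately show "x \<in> ?N j" by auto
  qed
  then have "(\<Union>j. ?N j) \<in> sets borel" by (intro sets.countable_UN) auto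
  moreover have "NE f e = (\<Union>j. ?N j)"
  proof (intro equalityI subsetI)
    fix x assume "x \<in> NE f e"
    moreover have "x \<in> Gamma f e x" using e by (simp add: Gamma_def)
    ultimately obtain y where y: "y \<in> Gamma f e x" "y \<noteq> x" by (auto simp: NE_def)
    then have "dist x y > 0" by simp
    then obtain j :: nat where "1 / real (Suc j) < dist x y" by (rule nat_approx_posE)
    then show "x \<in> (\<Union>j. ?N j)" using y(1) by (auto simp: Gamma_def intro!: exI[of _ j] exI[of _ y])
  next
    fix x assume "x \<in> (\<Union>j. ?N j)"
    then obtain j y where y: "dist x y \<ge> 1 / real (Suc j)" "y \<in> Gamma f e x" by (auto simp: Gamma_def)
    have "0 < 1 / real (Suc j)" by simp
    then have "y \<noteq> x" using y(1) by (metis dist_self not_le)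
    then show "x \<in> NE f e" using y(2) by (auto simp: NE_def)
  qed
  ultimately show ?thesis by simp
qed

text \<open>The symbols of \<open>X\<close> under \<open>f ^^ n\<close> at the times from
  \<open>- m\<close> to \<open>m\<close>; the itinerary starts \<open>n * m\<close> iterates of
  \<open>f\<close> in the past.\<close>

definition cell :: "('a \<Rightarrow> 'b) \<Rightarrow> nat \<Rightarrow> nat \<Rightarrow> 'a \<Rightarrow> 'b list" where
  "cell X n m x = itin (f ^^ n) X (2 * m + 1) ((inv f ^^ (n * m)) x)"

lemma cell_close:
  assumes X: "\<And>x y. X x = X y \<Longrightarrow> dn f n x y \<le> e" and n: "n \<ge> 1"
    and c: "cell X n m x = cell X n m y" and k: "\<bar>k\<bar> \<le> int m"
  shows "dist (fpow f k x) (fpow f k y) \<le> e"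
proof -
  let ?z = "(inv f ^^ (n * m)) x" and ?w = "(inv f ^^ (n * m)) y"
  \<comment> \<open>Time \<open>k\<close> counted from the start of the itinerary: position
    \<open>t mod n\<close> in the block \<open>t div n\<close>.\<close>
  define t where "t = nat (k + int (n * m))"
  have mn: "m \<le> n * m" using mult_le_mono1[OF n, of m] by simp
  then have "int m \<le> int (n * m)" by (rule of_nat_mono)
  then have t: "int t = k + int (n * m)" "int t \<le> int (n * m) + int m" using k by (auto simp: t_def)
  have tlt: "t < n * (2 * m + 1)"
  proof -
    have "t \<le> n * m + m" using t(2) by linarith
    also have "\<dots> \<le> n * m + n * m" using mn by simp
    also have "\<dots> < n * (2 * m + 1)" using n by (simp add: algebra_simps)
    finally show ?thesis .
  qed
  have "t div n < 2 * m + 1" using tlt n by (simp add: less_mult_imp_div_less mult.commute)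
  then have "X (((f ^^ n) ^^ (t div n)) ?z) = X (((f ^^ n) ^^ (t div n)) ?w)"
    using c unfolding cell_def itin_eq_iff by blast
  then have d: "dn f n ((f ^^ (n * (t div n))) ?z) ((f ^^ (n * (t div n))) ?w) \<le> e"
    using X by (simp add: funpow_mult mult.commute)
  have "t mod n < n" using n by simp
  from dist_le_dn[OF this, of f "(f ^^ (n * (t div n))) ?z" "(f ^^ (n * (t div n))) ?w"] d
  have "dist ((f ^^ (t mod n)) ((f ^^ (n * (t div n))) ?z)) ((f ^^ (t mod n)) ((f ^^ (n * (t div n))) ?w)) \<le> e" by linarith
  moreover have "(f ^^ (t mod n)) ((f ^^ (n * (t div n))) u) = (f ^^ t) u" for u
    by (metis comp_apply funpow_add mod_mult_div_eq)
  ultimately have "dist ((f ^^ t) ?z) ((f ^^ t) ?w) \<le> e" by simp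
  then show ?thesis unfolding fpow_diff using t(1) by simp
qed

text \<open>Otherwise points at distance at least \<open>r\<close> from \<open>x\<close> that share
  finer and finer cells with it accumulate at a point of \<open>Gamma f e x\<close> different from
  \<open>x\<close>.\<close>

lemma cell_shrink:
  assumes X: "\<And>x y. X x = X y \<Longrightarrow> dn f n x y \<le> e" and n: "n \<ge> 1"
    and x: "x \<notin> NE f e" and r: "r > 0"
  shows "\<exists>m. \<forall>m'\<ge>m. \<forall>y. cell X n m' y = cell X n m' x \<longrightarrow> dist x y < r"
proof (rule ccontr)
  assume no: "\<not> ?thesis"
  have "\<exists>m' y. m' \<ge> m \<and> cell X n m' y = cell X n m' x \<and> dist x y \<ge> r" for m
    using no by (metis not_le)
  then obtain ms y where y: "\<And>m. ms m \<ge> m" "\<And>m. cell X n (ms m) (y m) = cell X n (ms m) x" "\<And>m. dist x (y m) \<ge> r"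
    by metis
  obtain l s where s: "strict_mono (s :: nat \<Rightarrow> nat)" "(\<lambda>k. y (s k)) \<longlonglongrightarrow> l" by (rule seq_subseq)
  have "r \<le> dist x l"
    by (rule LIMSEQ_le_const[OF tendsto_dist[OF tendsto_const s(2)]]) (use y(3) in blast)
  then have "l \<noteq> x" using r by auto
  moreover have "dist (fpow f k x) (fpow f k l) \<le> e" for k
  proof (rule LIMSEQ_le_const2)
    show "(\<lambda>i. dist (fpow f k x) (fpow f k (y (s i)))) \<longlonglongrightarrow> dist (fpow f k x) (fpow f k l)"
      by (intro tendsto_dist tendsto_const continuous_on_tendsto_compose[OF fpow_cont] s(2)) auto
    have "dist (fpow f k x) (fpow f k (y (s i))) \<le> e" if "i \<ge> nat \<bar>k\<bar>" for i
    proof -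
      have "i \<le> s i" by (rule seq_suble[OF s(1)])
      then have "\<bar>k\<bar> \<le> int (ms (s i))" using that y(1)[of "s i"] by linarith
      then show ?thesis by (intro cell_close[OF X n y(2)[symmetric]]) auto
    qed
    then show "\<exists>N. \<forall>i\<ge>N. dist (fpow f k x) (fpow f k (y (s i))) \<le> e" by blast
  qed
  ultimately have "l \<in> Gamma f e x" "l \<noteq> x" by (auto simp: Gamma_def)
  then show False using x by (auto simp: NE_def)
qed

end

lemma separated_compacts:
  fixes K :: "'b \<Rightarrow> 'a::metric_space set"
  assumes "finite V" "\<And>v. v \<in> V \<Longrightarrow> compact (K v)" "\<And>v w. v \<in> V \<Longrightarrow> w \<in> V \<Longrightarrow> v \<noteq> w \<Longrightarrow> K v \<inter> K w = {}"
  obtains r where "r > 0" "\<And>v w x y. v \<in> V \<Longrightarrow> w \<in> V \<Longrightarrow> x \<in> K v \<Longrightarrow> y \<in> K w \<Longrightarrow> dist x y < r \<Longrightarrow> v = w"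
proof -
  have "\<exists>d>0. \<forall>x\<in>K v. \<forall>y\<in>K w. d \<le> dist x y" if "v \<in> V" "w \<in> V" "v \<noteq> w" for v w
  proof (cases "K v = {} \<or> K w = {}")
    case True
    then show ?thesis by (intro exI[of _ 1]) auto
  next
    case False
    have cl: "closed (K w)" using assms(2)[OF that(2)] by (rule compact_imp_closed)
    have "continuous_on (K v) (\<lambda>x. infdist x (K w))" by (intro continuous_intros)
    from continuous_attains_inf[OF assms(2)[OF that(1)] _ this] False
    obtain x0 where x0: "x0 \<in> K v" "\<And>x. x \<in> K v \<Longrightarrow> infdist x0 (K w) \<le> infdist x (K w)" by auto
    have "x0 \<notin> K w" using x0(1) assms(3)[OF that] by auto
    then have "infdist x0 (K w) > 0" using infdist_pos_not_in_closed[OF cl] False by auto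
    moreover have "infdist x0 (K w) \<le> dist x y" if "x \<in> K v" "y \<in> K w" for x y
      using x0(2)[OF that(1)] infdist_le[OF that(2), of x] by linarith
    ultimately show ?thesis by blast
  qed
  then obtain d where d: "\<And>v w. v \<in> V \<Longrightarrow> w \<in> V \<Longrightarrow> v \<noteq> w \<Longrightarrow> d v w > 0 \<and> (\<forall>x\<in>K v. \<forall>y\<in>K w. d v w \<le> dist x y)"
    by metis
  define D where "D = insert 1 ((\<lambda>(v, w). d v w) ` {(v, w) \<in> V \<times> V. v \<noteq> w})"
  have finD: "finite D"   proof -
    have "finite {(v, w) \<in> V \<times> V. v \<noteq> w}" by (rule finite_subset[of _ "V \<times> V"]) (use assms(1) in auto)
    then show ?thesis unfolding D_def by simp
  qed
  show ?thesis
  proof (rule that[of "Min D"])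
    show "Min D > 0" using finD d by (subst Min_gr_iff) (auto simp: D_def)
    fix v w x y assume vw: "v \<in> V" "w \<in> V" "x \<in> K v" "y \<in> K w" "dist x y < Min D"
    show "v = w"
    proof (rule ccontr)
      assume "v \<noteq> w"
      then have "d v w \<in> D" using vw by (auto simp: D_def)
      then have "Min D \<le> d v w" using finD by simp
      then show False using d[OF vw(1,2) \<open>v \<noteq> w\<close>] vw by fastforce
    qed
  qed
qed

context borel_mpt
begin

lemma cell_finmeas: "finmeas M X \<Longrightarrow> finmeas M (cell X n m)"
  unfolding cell_def[abs_def]
  by (intro finmeas_mpt[OF space_UNIV mpt_iter[OF mpt_inv]] finmeas_itin[OF space_UNIV mpt_iter[OF mpt]] mptf)
     (unfold_locales)

text \<open>The fibres of \<open>Z\<close> contain compact sets of almost full measure at mutual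
  distance at least \<open>r\<close>. Once the cell of a point is smaller than \<open>r\<close>, the
  value of \<open>Z\<close> can be read off at any other good point of the cell, so a function of
  the cell reproduces \<open>Z\<close> up to small measure.\<close>

lemma cell_determines:
  assumes X: "finmeas M X" "\<And>x y. X x = X y \<Longrightarrow> dn f n x y \<le> e" and n: "n \<ge> 1" and e: "e \<ge> 0"
    and ne: "measure M (NE f e) = 0"
    and Z: "finmeas M Z" and d: "d > 0"
  obtains m B where "finmeas M B" "range B \<subseteq> range Z" "\<And>x y. cell X n m x = cell X n m y \<Longrightarrow> B x = B y"
    "measure M {x. Z x \<noteq> B x} < d"
proof -
  define V where "V = range Z"
  have finV: "finite V" "V \<noteq> {}" using Z by (auto simp: finmeas_def V_def)
  define d' where "d' = d / (2 * real (card V))"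
  have cV: "real (card V) > 0" using finV by (simp add: card_gt_0_iff)
  have d': "d' > 0" using d cV by (simp add: d'_def)
  have Zb: "Z -` {v} \<in> sets borel" for v using Z by (simp add: finmeas_def sets_eq)
  have "\<forall>v. \<exists>K. closed K \<and> K \<subseteq> Z -` {v} \<and> measure M K > measure M (Z -` {v}) - d'"
    using inner_closed[OF Zb d'] by metis
  from choice[OF this] obtain K where K: "\<And>v. closed (K v)" "\<And>v. K v \<subseteq> Z -` {v}"
    "\<And>v. measure M (K v) > measure M (Z -` {v}) - d'" by auto
  have cK: "compact (K v)" for v using K(1) compact_space by (metis Int_UNIV_left closed_Int_compact compact_Int_closed inf_top.left_neutral)
  obtain r where r: "r > 0" "\<And>v w x y. v \<in> V \<Longrightarrow> w \<in> V \<Longrightarrow> x \<in> K v \<Longrightarrow> y \<in> K w \<Longrightarrow> dist x y < r \<Longrightarrow> v = w"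
  proof (rule separated_compacts[OF finV(1), of K])
    show "K v \<inter> K w = {}" if "v \<noteq> w" for v w using K(2)[of v] K(2)[of w] that by auto
  qed (use cK in auto)
  define KK where "KK = (\<Union>v\<in>V. K v)"
  have sK: "K v \<in> sets M" for v using K(1) meas_closed by blast
  have sKK: "KK \<in> sets M" unfolding KK_def using finV sK by (intro sets.finite_UN) auto
  have sKc: "- KK \<in> sets M" using sets.compl_sets[OF sKK] by (simp add: space_eq Compl_eq_Diff_UNIV)
  have mKK: "measure M (- KK) < d / 2 + d / 4"
  proof -
    have "- KK \<subseteq> (\<Union>v\<in>V. Z -` {v} - K v)" by (auto simp: KK_def V_def)
    then have "measure M (- KK) \<le> measure M (\<Union>v\<in>V. Z -` {v} - K v)"
      using finV sK Z by (intro finite_measure_mono sets.finite_UN) (auto simp: finmeas_def)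
    also have "\<dots> \<le> (\<Sum>v\<in>V. measure M (Z -` {v} - K v))"
      using finV sK Z by (intro finite_measure_subadditive_finite) (auto simp: finmeas_def)
    also have "\<dots> \<le> (\<Sum>v\<in>V. d')"
    proof (rule sum_mono)
      fix v
      have "measure M (Z -` {v} - K v) = measure M (Z -` {v}) - measure M (K v)"
        using K(2) sK Z by (intro finite_measure_Diff) (auto simp: finmeas_def)
      then show "measure M (Z -` {v} - K v) \<le> d'" using K(3)[of v] by simp
    qed
    also have "\<dots> = d / 2" using cV by (simp add: d'_def)
    finally show ?thesis using d by simp
  qed
  define G where "G m = {x \<in> KK. \<forall>y. cell X n m y = cell X n m x \<longrightarrow> dist x y < r}" for m
  \<comment> \<open>One representative in \<open>G m\<close> decides for its whole cell; cells that
    miss \<open>G m\<close> get an arbitrary attained value, which keeps the range inside that of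
    \<open>Z\<close>.\<close>
  define B' where "B' m x = (if \<exists>y\<in>G m. cell X n m y = cell X n m x then Z (SOME y. y \<in> G m \<and> cell X n m y = cell X n m x) else Z undefined)" for m x
  have B'cell: "B' m x = B' m y" if "cell X n m x = cell X n m y" for m x y
    using that by (simp add: B'_def)
  have B'ran: "range (B' m) \<subseteq> range Z" for m by (auto simp: B'_def)
  have B'fm: "finmeas M (B' m)" for m
  proof -
    have "B' m x = B' m (inv_into UNIV (cell X n m) (cell X n m x))" for x
      by (rule B'cell) (simp add: f_inv_into_f)
    then have "B' m = (\<lambda>x. (\<lambda>c. B' m (inv_into UNIV (cell X n m) c)) (cell X n m x))" by (simp add: fun_eq_iff)
    then show ?thesis using finmeas_comp[OF cell_finmeas[OF X(1)], of "\<lambda>c. B' m (inv_into UNIV (cell X n m) c)" n m] by metis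
  qed
  have good: "B' m x = Z x" if x: "x \<in> G m" for m x
  proof -
    define y where "y = (SOME y. y \<in> G m \<and> cell X n m y = cell X n m x)"
    have ex: "\<exists>y. y \<in> G m \<and> cell X n m y = cell X n m x" using x by blast
    from someI_ex[OF this] have y: "y \<in> G m" "cell X n m y = cell X n m x" by (auto simp: y_def)
    have "dist x y < r" using x y(2) by (simp add: G_def)
    moreover obtain v w where "v \<in> V" "x \<in> K v" "w \<in> V" "y \<in> K w" using x y(1) by (auto simp: G_def KK_def)
    ultimately have "\<exists>v. x \<in> K v \<and> y \<in> K v" using r(2) by metis
    then have "Z x = Z y" using K(2) by blast
    then show ?thesis using ex by (auto simp: B'_def y_def)
  qed
  define D where "D m = {x. Z x \<noteq> B' m x}" for m
  have sD: "D m \<in> sets M" for m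
    using finmeas_vimage[OF finmeas_pair[OF Z B'fm[of m]], of "{(a, b). a \<noteq> b}"] by (simp add: D_def vimage_def)
  have sN: "NE f e \<in> sets M" using NE_borel[OF e] by (simp add: sets_eq)
  have "(\<lambda>m. \<integral>x. indicator (D m \<inter> (KK - NE f e)) x \<partial>M) \<longlonglongrightarrow> (\<integral>x. (0::real) \<partial>M)"
  proof (rule integral_dominated_convergence[where w = "\<lambda>_. 1"])
    show "AE x in M. (\<lambda>m. indicator (D m \<inter> (KK - NE f e)) x) \<longlonglongrightarrow> (0::real)"
    proof (rule AE_I2)
      fix x
      show "(\<lambda>m. indicator (D m \<inter> (KK - NE f e)) x) \<longlonglongrightarrow> (0::real)"
      proof (cases "x \<in> KK - NE f e")
        case True
        then have "x \<notin> NE f e" by simp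
        then have "\<exists>m. \<forall>m'\<ge>m. \<forall>y. cell X n m' y = cell X n m' x \<longrightarrow> dist x y < r"
          by (intro cell_shrink[OF _ n _ r(1)]) (rule X(2))
        then obtain m where m: "\<forall>m'\<ge>m. \<forall>y. cell X n m' y = cell X n m' x \<longrightarrow> dist x y < r" by (elim exE)
        then have "x \<notin> D m'" if "m' \<ge> m" for m'
          using good[of x m'] True that by (auto simp: D_def G_def)
        then have "indicator (D m' \<inter> (KK - NE f e)) x = (0::real)" if "m' \<ge> m" for m' using that by simp
        then have "eventually (\<lambda>m'. indicator (D m' \<inter> (KK - NE f e)) x = (0::real)) sequentially"
          unfolding eventually_sequentially by blast
        then show ?thesis by (rule tendsto_eventually)
      qed simp
    qed
  qed (use sD sKK sN in \<open>auto simp: indicator_def\<close>)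
  then have "(\<lambda>m. measure M (D m \<inter> (KK - NE f e))) \<longlonglongrightarrow> 0" using sD sKK sN by simp
  then have "eventually (\<lambda>m. measure M (D m \<inter> (KK - NE f e)) < d / 4) sequentially"
    using d by (intro order_tendstoD(2)) auto
  then obtain m where m: "measure M (D m \<inter> (KK - NE f e)) < d / 4" by (auto simp: eventually_sequentially)
  have "measure M (D m) \<le> measure M ((D m \<inter> (KK - NE f e)) \<union> (- KK \<union> NE f e))"
    using sD sKK sN sKc by (intro finite_measure_mono) auto
  also have "\<dots> \<le> measure M (D m \<inter> (KK - NE f e)) + measure M (- KK \<union> NE f e)"
    using sD sKK sN sKc by (intro measure_Un_le) auto
  also have "measure M (- KK \<union> NE f e) \<le> measure M (- KK) + measure M (NE f e)"
    using sKc sN by (intro measure_Un_le) auto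
  finally have "measure M (D m) < d" using m mKK ne by linarith
  then have lt: "measure M {x. Z x \<noteq> B' m x} < d" by (simp add: D_def)
  show ?thesis by (rule that[OF B'fm[of m] B'ran[of m] _ lt]) (rule B'cell)
qed

text \<open>For \<open>f ^^ n\<close> the function \<open>X\<close> acts as a generator: the symbols
  within time \<open>m\<close> determine \<open>Z\<close> up to conditional entropy
  \<open>a\<close>. So \<open>N\<close> symbols of \<open>Z\<close> have entropy at most that of
  \<open>N + 2 * m\<close> symbols of \<open>X\<close> plus \<open>N * a\<close>, and in the limit
  one block of length \<open>n\<close> bounds the entropy without an error term.\<close>

theorem expansive_entropy_le:
  assumes X: "finmeas M X" "\<And>x y. X x = X y \<Longrightarrow> dn f n x y \<le> e" and n: "n \<ge> 1" and e: "e \<ge> 0"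
    and ne: "measure M (NE f e) = 0"
  shows "ks_entropy f M \<le> ereal (shannon M X / real n)"
proof (rule ks_le[OF space_UNIV])
  fix Q :: "'a \<Rightarrow> 'a set" assume Q: "finmeas M Q"
  define Z where "Z = itin f Q n"
  have fZ: "finmeas M Z" unfolding Z_def by (rule itin_finmeas[OF Q])
  let ?g = "f ^^ n"
  interpret g: mpt_space M ?g by unfold_locales (rule mpt_iter[OF mpt])
  have "hent f M Q * real n \<le> shannon M X + a" if a: "a > 0" for a
  proof -
    have finr: "finite (range Z)" using fZ by (simp add: finmeas_def)
    obtain d where d: "d > 0" "\<And>A B. finmeas M A \<Longrightarrow> finmeas M B \<Longrightarrow> range A \<subseteq> range Z \<Longrightarrow> range B \<subseteq> range Z \<Longrightarrow>
       measure M {x. A x \<noteq> B x} < d \<Longrightarrow> shannon M (\<lambda>x. (A x, B x)) - shannon M B \<le> a"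
      by (rule shannon_conditional_small[OF finr a]) (rule that)
    obtain m B where B: "finmeas M B" "range B \<subseteq> range Z" "\<And>x y. cell X n m x = cell X n m y \<Longrightarrow> B x = B y"
      "measure M {x. Z x \<noteq> B x} < d"
      by (rule cell_determines[OF X(1) _ n e ne fZ d(1)]) (erule X(2), rule that)
    let ?C = "cell X n m"
    have fC: "finmeas M ?C" by (rule cell_finmeas[OF X(1)])
    have cond: "shannon M (\<lambda>x. (Z x, ?C x)) - shannon M ?C \<le> a"
    proof -
      have "shannon M (\<lambda>x. (Z x, ?C x, B x)) + shannon M B \<le> shannon M (\<lambda>x. (Z x, B x)) + shannon M (\<lambda>x. (?C x, B x))"
        by (rule shannon_strong_subadditive[OF fZ fC B(1)])
      moreover have "shannon M (\<lambda>x. (Z x, ?C x)) \<le> shannon M (\<lambda>x. (Z x, ?C x, B x))"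
        by (rule shannon_le_factor[OF finmeas_pair[OF fZ finmeas_pair[OF fC B(1)]]]) auto
      moreover have "shannon M (\<lambda>x. (?C x, B x)) \<le> shannon M ?C"
        by (rule shannon_le_factor[OF fC]) (auto intro: B(3))
      moreover have "shannon M (\<lambda>x. (Z x, B x)) - shannon M B \<le> a" by (rule d(2)[OF fZ B(1) _ B(2) B(4)]) simp
      ultimately show ?thesis by linarith
    qed
    have bound: "hent f M Q * real n \<le> shannon M X + a + 2 * real m * shannon M X / real N" if N: "N \<ge> 1" for N
    proof -
      have 1: "shannon M (itin f Q (n * N)) \<le> shannon M (itin ?g Z N)"
      proof (rule shannon_le_factor[OF g.itin_finmeas[OF fZ]])
        fix x y assume xy: "itin ?g Z N x = itin ?g Z N y"
        have "Q ((f ^^ k) x) = Q ((f ^^ k) y)" if k: "k < n * N" for k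
        proof -
          have "k div n < N" using k n by (simp add: less_mult_imp_div_less mult.commute)
          then have "Z ((?g ^^ (k div n)) x) = Z ((?g ^^ (k div n)) y)" using xy by (simp add: itin_eq_iff)
          moreover have "k mod n < n" using n by simp
          ultimately have "Q ((f ^^ (k mod n)) ((?g ^^ (k div n)) x)) = Q ((f ^^ (k mod n)) ((?g ^^ (k div n)) y))"
            by (simp add: Z_def itin_eq_iff)
          moreover have "(f ^^ (k mod n)) ((?g ^^ (k div n)) u) = (f ^^ k) u" for u
            by (simp add: funpow_mult) (metis comp_apply funpow_add mod_mult_div_eq mult.commute)
          ultimately show ?thesis by simp
        qed
        then show "itin f Q (n * N) x = itin f Q (n * N) y" by (simp add: itin_eq_iff)
      qed
      have 2: "shannon M (itin ?g Z N) \<le> shannon M (itin ?g ?C N) + real N * (shannon M (\<lambda>x. (Z x, ?C x)) - shannon M ?C)"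
        by (rule g.shannon_itin_compare[OF fZ fC])
      have 3: "shannon M (itin ?g ?C N) \<le> shannon M (itin ?g X (N + 2 * m))"
      proof -
        \<comment> \<open>Translation by \<open>m\<close> steps of \<open>?g\<close> moves the
          two-sided symbols to the times from 0 to \<open>N + 2 * m - 1\<close>.\<close>
        have "shannon M (itin ?g ?C N) = shannon M (\<lambda>z. itin ?g ?C N ((?g ^^ m) z))"
          by (rule g.iter_HH[OF g.itin_finmeas[OF fC], symmetric])
        also have "\<dots> \<le> shannon M (itin ?g X (N + 2 * m))"
        proof (rule shannon_le_factor[OF g.itin_finmeas[OF X(1)]])
          fix x y assume xy: "itin ?g X (N + 2 * m) x = itin ?g X (N + 2 * m) y"
          have "?C ((?g ^^ k) ((?g ^^ m) x)) = ?C ((?g ^^ k) ((?g ^^ m) y))" if k: "k < N" for k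
          proof -
            have e: "(inv f ^^ (n * m)) ((?g ^^ k) ((?g ^^ m) u)) = (?g ^^ k) u" for u
            proof -
              have "(?g ^^ k) ((?g ^^ m) u) = (?g ^^ m) ((?g ^^ k) u)"
                by (metis add.commute comp_apply funpow_add)
              then show ?thesis by (simp add: funpow_mult inv_iter_iter mult.commute)
            qed
            have "X ((?g ^^ j) ((?g ^^ k) x)) = X ((?g ^^ j) ((?g ^^ k) y))" if j: "j < 2 * m + 1" for j
            proof -
              have "j + k < N + 2 * m" using j k by simp
              then have "X ((?g ^^ (j + k)) x) = X ((?g ^^ (j + k)) y)" using xy unfolding itin_eq_iff by blast
              then show ?thesis by (simp add: funpow_add)
            qed
            then show ?thesis unfolding cell_def e by (simp add: itin_eq_iff)
          qed
          then show "itin ?g ?C N ((?g ^^ m) x) = itin ?g ?C N ((?g ^^ m) y)" by (simp add: itin_eq_iff)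
        qed
        finally show ?thesis .
      qed
      have 4: "shannon M (itin ?g X (N + 2 * m)) \<le> real (N + 2 * m) * shannon M X" by (rule g.shannon_itin_le[OF X(1)])
      have "hent f M Q \<le> shannon M (itin f Q (n * N)) / real (n * N)"
        using n N by (intro hent_le[OF Q]) simp
      then have "hent f M Q * (real n * real N) \<le> shannon M (itin f Q (n * N))"
        using n N by (simp add: field_simps)
      also have "\<dots> \<le> real (N + 2 * m) * shannon M X + real N * a"
        using 1 2 3 4 mult_left_mono[OF cond, of "real N"] by linarith
      finally have "(hent f M Q * real n) * real N \<le> (shannon M X + a) * real N + 2 * real m * shannon M X"
        by (simp add: algebra_simps)
      then have "hent f M Q * real n \<le> ((shannon M X + a) * real N + 2 * real m * shannon M X) / real N"
        using N by (simp add: le_divide_eq)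
      then show ?thesis using N by (simp add: add_divide_distrib)
    qed
    have lim: "(\<lambda>N. shannon M X + a + 2 * real m * shannon M X / real N) \<longlonglongrightarrow> shannon M X + a + 0"
      by (intro tendsto_add tendsto_const lim_const_over_n)
    have "hent f M Q * real n \<le> shannon M X + a + 0"
      by (rule LIMSEQ_le_const[OF lim]) (use bound in blast)
    then show ?thesis by simp
  qed
  then have "hent f M Q * real n \<le> shannon M X" by (rule field_le_epsilon)
  then show "ereal (hent f M Q) \<le> ereal (shannon M X / real n)" using n by (simp add: field_simps)
qed

end

section \<open>Pressure and equilibrium states\<close>

text \<open>The order of the list is a priority: a point goes to the first centre within
  \<open>r\<close>. The fibres form a Borel partition subordinate to the closed Bowen balls whenever
  the list is a net.\<close>

fun pick :: "('a::metric_space \<Rightarrow> 'a) \<Rightarrow> nat \<Rightarrow> real \<Rightarrow> 'a list \<Rightarrow> 'a \<Rightarrow> 'a" where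
  "pick f n r [] y = undefined"
| "pick f n r (x # xs) y = (if dn f n y x \<le> r then x else pick f n r xs y)"

lemma pick_in: "\<exists>x\<in>set xs. dn f n y x \<le> r \<Longrightarrow> pick f n r xs y \<in> set xs \<and> dn f n y (pick f n r xs y) \<le> r"
  by (induction xs) auto

lemma pick_append: "pick f n r (xs @ zs) y = (if \<exists>x\<in>set xs. dn f n y x \<le> r then pick f n r xs y else pick f n r zs y)"
  by (induction xs) auto

context compact_dynamics
begin

lemma closed_bowen_ball:
  assumes "r \<ge> 0"
  shows "closed {y. dn f n y x \<le> r}"
proof -
  have "{y. dn f n y x \<le> r} = (\<Inter>k\<in>{..<n}. {y. dist ((f ^^ k) y) ((f ^^ k) x) \<le> r})"
    using dn_le_iff[OF assms, of f n] by auto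
  moreover have "closed {y. dist ((f ^^ k) y) ((f ^^ k) x) \<le> r}" for k
    by (intro closed_Collect_le continuous_intros cont_iter)
  ultimately show ?thesis by auto
qed

lemma pick_borel: "r \<ge> 0 \<Longrightarrow> pick f n r xs -` {v} \<in> sets borel"
proof (induction xs)
  case Nil
  have "pick f n r [] -` {v} = (if v = undefined then UNIV else {})" by auto
  then show ?case by simp
next
  case (Cons x xs)
  let ?B = "{y. dn f n y x \<le> r}"
  have B: "?B \<in> sets borel" using closed_bowen_ball[OF Cons.prems] by (rule borel_closed)
  have eq: "pick f n r (x # xs) -` {v} = (if x = v then ?B else {}) \<union> (pick f n r xs -` {v} - ?B)" by auto
  show ?case unfolding eq using B Cons by auto
qed

lemma pick_finmeas:
  assumes "sets M = sets borel" "r \<ge> 0"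
  shows "finmeas M (pick f n r xs)"
proof -
  have "pick f n r xs y \<in> insert undefined (set xs)" for y by (induction xs) auto
  then have "finite (range (pick f n r xs))" using finite_subset[of "range (pick f n r xs)" "insert undefined (set xs)"] by auto
  then show ?thesis using pick_borel[OF assms(2)] assms(1) by (simp add: finmeas_def)
qed

end

lemma (in borel_prob) integral_uniform_measure:
  fixes g :: "'a \<Rightarrow> real"
  assumes A: "A \<in> sets M" "measure M A > 0" and g: "g \<in> borel_measurable M"
  shows "integral\<^sup>L (uniform_measure M A) g = (\<integral>x. indicator A x * g x \<partial>M) / measure M A"
proof -
  have "uniform_measure M A = density M (\<lambda>x. ennreal (indicator A x / measure M A))"
    unfolding uniform_measure_def using A
    by (intro arg_cong[of _ _ "density M"] ext) (auto simp: emeasure_eq_measure indicator_def ennreal_divide_numeral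
        divide_ennreal ennreal_1[symmetric] simp del: ennreal_1)
  then have "integral\<^sup>L (uniform_measure M A) g = (\<integral>x. (indicator A x / measure M A) *\<^sub>R g x \<partial>M)"
    using A g by (simp add: integral_density)
  also have "\<dots> = (\<integral>x. indicator A x * g x / measure M A \<partial>M)" by simp
  finally show ?thesis by simp
qed

context borel_mpt
begin

lemma integral_birkhoff:
  assumes phi: "continuous_on UNIV \<phi>"
  shows "integral\<^sup>L M (birkhoff f \<phi> n) = real n * integral\<^sup>L M \<phi>" "integrable M (birkhoff f \<phi> n)"
proof -
  have "(\<integral>x. \<phi> ((f ^^ k) x) \<partial>M) = integral\<^sup>L M \<phi>" for k
  proof -
    interpret k: mpt_space M "f ^^ k" by unfold_locales (rule mpt_iter[OF mpt])
    show ?thesis by (rule k.integral_mpt[OF meas_cont[OF phi]])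
  qed
  moreover have "integrable M (\<lambda>x. \<phi> ((f ^^ k) x))" for k
    by (rule integrable_cont[OF compact_space cont_comp[OF phi cont_iter]])
  ultimately show "integral\<^sup>L M (birkhoff f \<phi> n) = real n * integral\<^sup>L M \<phi>"
    by (simp add: birkhoff_def[abs_def])
  show "integrable M (birkhoff f \<phi> n)" by (rule integrable_cont[OF compact_space cont_birkhoff[OF phi]])
qed

lemma integral_le_cells:
  assumes X: "finmeas M X" and g: "integrable M (g :: 'a \<Rightarrow> real)" and ga: "\<And>y. g y \<le> a (X y)"
  shows "integral\<^sup>L M g \<le> (\<Sum>v\<in>range X. measure M (X -` {v}) * a v)"
proof -
  have s: "X -` {v} \<in> sets M" for v using X by (simp add: finmeas_def)
  have fin: "finite (range X)" using X by (simp add: finmeas_def)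
  have i: "integrable M (\<lambda>x. indicator (X -` {v}) x * a v)" for v
    using s by (intro integrable_mult_left integrable_real_indicator) (auto simp: emeasure_eq_measure)
  have "integral\<^sup>L M g \<le> (\<integral>x. (\<Sum>v\<in>range X. indicator (X -` {v}) x * a v) \<partial>M)"
  proof (rule integral_mono[OF g])
    show "integrable M (\<lambda>x. \<Sum>v\<in>range X. indicator (X -` {v}) x * a v)" using i by auto
    fix x
    have "(\<Sum>v\<in>range X. indicator (X -` {v}) x * a v) = (\<Sum>v\<in>{X x}. indicator (X -` {v}) x * a v)"
      using fin by (intro sum.mono_neutral_right) auto
    then show "g x \<le> (\<Sum>v\<in>range X. indicator (X -` {v}) x * a v)" using ga[of x] by simp
  qed
  also have "\<dots> = (\<Sum>v\<in>range X. measure M (X -` {v}) * a v)"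
    using i s by (subst Bochner_Integration.integral_sum) auto
  finally show ?thesis .
qed

text \<open>Entropy at scale \<open>e\<close> and the integral of the Birkhoff sum are combined over
  one block of length \<open>n\<close>. The right-hand side stays a sum over cells because it is
  later split into groups of cells.\<close>

lemma free_energy_le_cells:
  assumes phi: "continuous_on UNIV \<phi>"
    and X: "finmeas M X" "\<And>x y. X x = X y \<Longrightarrow> dn f n x y \<le> e" and n: "n \<ge> 1" and e: "e \<ge> 0"
    and ne: "measure M (NE f e) = 0" and a: "\<And>y. birkhoff f \<phi> n y \<le> a (X y)"
    and F: "ereal c \<le> free_energy f \<phi> M"
  shows "real n * c \<le> (\<Sum>v\<in>range X. eta (measure M (X -` {v})) + measure M (X -` {v}) * a v)"
proof -
  have ks: "ks_entropy f M \<le> ereal (shannon M X / real n)" by (rule expansive_entropy_le[OF X(1) _ n e ne]) (rule X(2))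
  have "ereal c \<le> ereal (shannon M X / real n) + ereal (integral\<^sup>L M \<phi>)"
    using F ks unfolding free_energy_def by (meson add_right_mono order_trans)
  then have "c \<le> shannon M X / real n + integral\<^sup>L M \<phi>" by simp
  then have "real n * c \<le> shannon M X + real n * integral\<^sup>L M \<phi>"
    using n mult_left_mono[of c "shannon M X / real n + integral\<^sup>L M \<phi>" "real n"] by (simp add: distrib_left)
  also have "real n * integral\<^sup>L M \<phi> = integral\<^sup>L M (birkhoff f \<phi> n)" by (rule integral_birkhoff(1)[OF phi, symmetric])
  also have "\<dots> \<le> (\<Sum>v\<in>range X. measure M (X -` {v}) * a v)"
    by (rule integral_le_cells[OF X(1) integral_birkhoff(2)[OF phi] a])
  finally show ?thesis by (simp add: shannon_def sum.distrib)
qed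

end

section \<open>Pressures as bounds for finite partition sums\<close>

lemma elog_greater:
  assumes "n \<ge> 1" "ereal c < elog t / ereal (real n)"
  shows "ereal (exp (real n * c)) < t"
proof (cases "t = \<infinity>")
  case False
  show ?thesis
  proof (cases "t \<le> 0")
    case True
    then show ?thesis using assms False by (simp add: elog_def)
  next
    case F: False
    then obtain s where s: "t = ereal s" "s > 0" using False by (cases t) auto
    then have "c < ln s / real n" using assms by (simp add: elog_def)
    then have "real n * c < ln s" using assms(1) by (simp add: field_simps)
    then have "exp (real n * c) < exp (ln s)" by simp
    then show ?thesis using s by simp
  qed
qed simp

lemma elog_le:
  assumes "n \<ge> 1" "elog t / ereal (real n) < ereal c"
  shows "t \<le> ereal (exp (real n * c))"
proof (cases "t = \<infinity>")
  case True
  then show ?thesis using assms by (simp add: elog_def)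
next
  case False
  show ?thesis
  proof (cases "t \<le> 0")
    case True
    then show ?thesis by (rule order_trans) simp
  next
    case F: False
    then obtain s where s: "t = ereal s" "s > 0" using False by (cases t) auto
    then have "ln s / real n < c" using assms by (simp add: elog_def)
    then have "ln s < real n * c" using assms(1) by (simp add: field_simps)
    then have "exp (ln s) < exp (real n * c)" by simp
    then show ?thesis using s by simp
  qed
qed

lemma pressure_greater:
  assumes "ereal c < pressure_C f C \<phi> \<delta> \<epsilon>"
  shows "\<exists>n\<ge>N. \<exists>E. finite E \<and> E \<subseteq> slice C n \<and> separated f n \<delta> E \<and> exp (real n * c) \<le> (\<Sum>x\<in>E. exp (Phi f \<phi> \<epsilon> x n))"
proof -
  let ?u = "\<lambda>n. elog (Lambda f C \<phi> \<delta> \<epsilon> n) / ereal (real n)"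
  have "\<exists>n\<ge>max N 1. ereal c < ?u n"
  proof (rule ccontr)
    assume "\<not> ?thesis"
    then have "eventually (\<lambda>n. ?u n \<le> ereal c) sequentially"
      unfolding eventually_sequentially by (metis not_le)
    then have "limsup ?u \<le> ereal c" by (rule Limsup_bounded)
    then show False using assms by (simp add: pressure_C_def)
  qed
  then obtain n where n: "n \<ge> N" "n \<ge> 1" "ereal c < ?u n" by auto
  from elog_greater[OF n(2,3)] obtain E where "finite E" "E \<subseteq> slice C n" "separated f n \<delta> E"
    "ereal (exp (real n * c)) < ereal (\<Sum>x\<in>E. exp (Phi f \<phi> \<epsilon> x n))"
    unfolding Lambda_def less_SUP_iff by auto
  then show ?thesis using n(1) by (intro exI[of _ n] conjI exI[of _ E]) auto
qed

lemma pressure_less: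
  assumes "pressure_C f C \<phi> \<delta> \<epsilon> < ereal c"
  shows "\<exists>N. \<forall>n\<ge>N. \<forall>E. finite E \<and> E \<subseteq> slice C n \<and> separated f n \<delta> E \<longrightarrow> (\<Sum>x\<in>E. exp (Phi f \<phi> \<epsilon> x n)) \<le> exp (real n * c)"
proof -
  let ?u = "\<lambda>n. elog (Lambda f C \<phi> \<delta> \<epsilon> n) / ereal (real n)"
  have "eventually (\<lambda>n. ?u n < ereal c) sequentially"
    using assms unfolding pressure_C_def by (rule Limsup_lessD)
  then obtain N where N: "\<And>n. n \<ge> N \<Longrightarrow> ?u n < ereal c" by (auto simp: eventually_sequentially)
  have "(\<Sum>x\<in>E. exp (Phi f \<phi> \<epsilon> x n)) \<le> exp (real n * c)"
    if "n \<ge> max N 1" "finite E \<and> E \<subseteq> slice C n \<and> separated f n \<delta> E" for n E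
  proof -
    have "Lambda f C \<phi> \<delta> \<epsilon> n \<le> ereal (exp (real n * c))" by (rule elog_le) (use that N in auto)
    moreover have "ereal (\<Sum>x\<in>E. exp (Phi f \<phi> \<epsilon> x n)) \<le> Lambda f C \<phi> \<delta> \<epsilon> n"
      unfolding Lambda_def using that by (intro SUP_upper) auto
    ultimately show ?thesis by (metis ereal_less_eq(3) order_trans)
  qed
  then show ?thesis by blast
qed

lemma slice_UNIV [simp]: "slice UNIV n = UNIV"
  by (simp add: slice_def)

lemma Phi_0 [simp]: "Phi f \<phi> 0 x n = birkhoff f \<phi> n x"
  by (simp add: Phi_def)

section \<open>Free energies above the obstruction and equilibrium states\<close>

locale expansive_potential = compact_dynamics f for f :: "'a::metric_space \<Rightarrow> 'a" +
  fixes \<phi> :: "'a \<Rightarrow> real" and \<epsilon> :: real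
  assumes phi_cont: "continuous_on UNIV \<phi>" and eps: "\<epsilon> > 0"
    and obstruction: "P_perp_exp f \<phi> \<epsilon> < top_pressure f \<phi>"
begin

lemma ergodic_borel_mpt: "ergodic f m \<Longrightarrow> borel_mpt m f"
  unfolding ergodic_def invariant_prob_iff by (intro borel_mptI) auto

lemma ergodic_expansive:
  assumes m: "ergodic f m" and F: "P_perp_exp f \<phi> \<epsilon> < free_energy f \<phi> m"
  shows "measure m (NE f \<epsilon>) = 0"
proof (rule ccontr)
  assume "measure m (NE f \<epsilon>) \<noteq> 0"
  then have "measure m (NE f \<epsilon>) > 0" by (simp add: less_le)
  then have "free_energy f \<phi> m \<le> P_perp_exp f \<phi> \<epsilon>"
    unfolding P_perp_exp_def using m by (intro SUP_upper) simp
  then show False using F by simp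
qed

text \<open>Some ergodic component has energy above \<open>c\<close>, and by definition of the
  obstruction it cannot charge \<open>NE\<close>. Upper bounds for free energy thus reduce to
  measures to which the entropy bound at scale \<epsilon> applies.\<close>

lemma ergodic_large_energy:
  assumes M: "borel_mpt M f" and c: "ereal c < free_energy f \<phi> M" "P_perp_exp f \<phi> \<epsilon> \<le> ereal c"
  obtains m where "borel_mpt m f" "measure m (NE f \<epsilon>) = 0" "ereal c < free_energy f \<phi> m"
proof -
  interpret borel_mpt M f by (rule M)
  have "measure M UNIV = 1" using prob_space by (simp add: space_eq)
  then obtain m where m: "ergodic f m" "ereal c < free_energy f \<phi> m"
    using ergodic_reduction[OF phi_cont c(1), of UNIV] by auto
  then have "measure m (NE f \<epsilon>) = 0" using c(2) by (intro ergodic_expansive) auto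
  then show ?thesis using that m ergodic_borel_mpt by blast
qed

text \<open>The cells of \<open>pick\<close> have \<open>d_n\<close>-diameter at most
  \<open>2 * r \<le> \<epsilon>\<close>, so the cell bound applies; Gibbs' inequality replaces the
  unknown masses by the logarithm of a partition sum.\<close>

lemma cover_bound:
  assumes M: "borel_mpt m f" "measure m (NE f \<epsilon>) = 0" and F: "ereal c \<le> free_energy f \<phi> m"
    and E: "finite E" "\<And>y. \<exists>x\<in>E. dn f n y x \<le> r" and r: "0 \<le> r" "2 * r \<le> \<epsilon>" and n: "n \<ge> 1"
    and a: "\<And>x y. x \<in> E \<Longrightarrow> dn f n y x \<le> r \<Longrightarrow> birkhoff f \<phi> n y \<le> a x"
  shows "real n * c \<le> ln (\<Sum>x\<in>E. exp (a x))"
proof -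
  interpret borel_mpt m f by (rule M)
  obtain xs where xs: "set xs = E" using finite_list[OF E(1)] by blast
  let ?X = "pick f n r xs"
  have p: "?X y \<in> E" "dn f n y (?X y) \<le> r" for y
    using pick_in[of xs f n y r] E(2)[of y] xs by auto
  have fX: "finmeas m ?X" by (rule pick_finmeas[OF sets_eq r(1)])
  have "real n * c \<le> (\<Sum>v\<in>range ?X. eta (measure m (?X -` {v})) + measure m (?X -` {v}) * a v)"
  proof (rule free_energy_le_cells[OF phi_cont fX _ n _ M(2) _ F])
    show "dn f n x y \<le> \<epsilon>" if "?X x = ?X y" for x y
      using dn_triangle[of f n x y "?X x"] p(2)[of x] p(2)[of y] that r by (simp add: dn_commute)
  qed (use a p eps in auto)
  also have "\<dots> \<le> ln (\<Sum>v\<in>range ?X. exp (a v))"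
    using shannon_le_ln_sum[OF fX, of a] by (simp add: shannon_def sum.distrib)
  also have "\<dots> \<le> ln (\<Sum>x\<in>E. exp (a x))"
  proof -
    have "(\<Sum>v\<in>range ?X. exp (a v)) > 0" using fX by (intro sum_pos) (auto simp: finmeas_def)
    moreover have "(\<Sum>v\<in>range ?X. exp (a v)) \<le> (\<Sum>x\<in>E. exp (a x))"
      using p E(1) by (intro sum_mono2) auto
    ultimately show ?thesis by simp
  qed
  finally show ?thesis .
qed

lemma energy_bounded:
  obtains C where "\<And>m c. borel_mpt m f \<Longrightarrow> measure m (NE f \<epsilon>) = 0 \<Longrightarrow> ereal c \<le> free_energy f \<phi> m \<Longrightarrow> c \<le> C"
proof -
  obtain b where b: "\<And>x. \<bar>\<phi> x\<bar> \<le> b" using bdd_cont[OF phi_cont] by metis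
  have e2: "\<epsilon> / 2 > 0" using eps by simp
  obtain E where E: "finite E" "\<And>x. x \<in> UNIV \<Longrightarrow> \<exists>e\<in>E. dn f 1 x e \<le> \<epsilon> / 2"
    by (rule maximal_separated[OF e2, of UNIV 1]) (rule that)
  have "c \<le> ln (\<Sum>x\<in>E. exp b)" if "borel_mpt m f" "measure m (NE f \<epsilon>) = 0" "ereal c \<le> free_energy f \<phi> m" for m c
  proof -
    have "real 1 * c \<le> ln (\<Sum>x\<in>E. exp b)"
      by (rule cover_bound[OF that E(1), of 1 "\<epsilon> / 2"]) (use E(2) eps b in \<open>auto simp: birkhoff_def abs_le_iff\<close>)
    then show ?thesis by simp
  qed
  then show ?thesis using that by blast
qed

text \<open>At a scale \<open>r\<close> on which the potential varies by less than \<open>t\<close>,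
  half the gap between \<open>c'\<close> and \<open>c\<close>, a Birkhoff sum exceeds its value at
  the centre of the cell by at most \<open>n * t\<close>. The partition sum over a maximal separated
  set would then grow faster than the pressure allows.\<close>

lemma energy_le_pressure:
  assumes m: "borel_mpt m f" "measure m (NE f \<epsilon>) = 0"
  shows "free_energy f \<phi> m \<le> top_pressure f \<phi>"
proof (rule ccontr)
  assume "\<not> ?thesis"
  then obtain c where c: "top_pressure f \<phi> < ereal c" "ereal c < free_energy f \<phi> m"
    using ereal_dense2 by (metis not_le)
  then obtain c' where c': "top_pressure f \<phi> < ereal c'" "c' < c" using ereal_dense2 by (metis ereal_less(2) less_ereal.simps(1))
  define t where "t = (c - c') / 2"
  have t: "t > 0" using c' by (simp add: t_def)
  obtain d where d: "d > 0" "\<And>x y. dist x y < d \<Longrightarrow> dist (\<phi> x) (\<phi> y) < t"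
    by (rule uniform_cont[OF phi_cont t]) (rule that)
  define r where "r = min (\<epsilon> / 2) (d / 2)"
  have r: "r > 0" "r < d" "2 * r \<le> \<epsilon>" using eps d(1) by (auto simp: r_def)
  have "pressure_C f UNIV \<phi> r 0 \<le> top_pressure f \<phi>"
    unfolding top_pressure_def using r(1) by (intro SUP_upper) simp
  then have "pressure_C f UNIV \<phi> r 0 < ereal c'" using c'(1) by simp
  from pressure_less[OF this] obtain N where N: "\<And>n E. n \<ge> N \<Longrightarrow> finite E \<Longrightarrow> separated f n r E \<Longrightarrow>
      (\<Sum>x\<in>E. exp (birkhoff f \<phi> n x)) \<le> exp (real n * c')" by auto
  define n where "n = Suc N"
  obtain E where E: "finite E" "separated f n r E" "\<And>x. x \<in> UNIV \<Longrightarrow> \<exists>e\<in>E. dn f n x e \<le> r"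
    by (rule maximal_separated[OF r(1), of UNIV n]) (rule that)
  have "real n * c \<le> ln (\<Sum>x\<in>E. exp (birkhoff f \<phi> n x + real n * t))"
  proof (rule cover_bound[OF m less_imp_le[OF c(2)] E(1), of n r])
    show "birkhoff f \<phi> n y \<le> birkhoff f \<phi> n x + real n * t" if "dn f n y x \<le> r" for x y
    proof -
      have "\<phi> ((f ^^ k) y) \<le> \<phi> ((f ^^ k) x) + t" if "k < n" for k
        using d(2)[of "(f ^^ k) y" "(f ^^ k) x"] dist_le_dn[OF that, of f y x] \<open>dn f n y x \<le> r\<close> r(2)
        by (simp add: dist_real_def)
      then have "birkhoff f \<phi> n y \<le> (\<Sum>k<n. \<phi> ((f ^^ k) x) + t)" unfolding birkhoff_def by (intro sum_mono) auto
      then show ?thesis by (simp add: birkhoff_def sum.distrib)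
    qed
  qed (use E r in \<open>auto simp: n_def\<close>)
  also have "(\<Sum>x\<in>E. exp (birkhoff f \<phi> n x + real n * t)) = (\<Sum>x\<in>E. exp (birkhoff f \<phi> n x)) * exp (real n * t)"
    by (simp add: exp_add sum_distrib_right)
  also have "ln \<dots> \<le> ln (exp (real n * c') * exp (real n * t))"
  proof -
    have "E \<noteq> {}" using E(3) by auto
    then have "(\<Sum>x\<in>E. exp (birkhoff f \<phi> n x)) > 0" using E(1) by (intro sum_pos) auto
    moreover have "(\<Sum>x\<in>E. exp (birkhoff f \<phi> n x)) \<le> exp (real n * c')" using E by (intro N) (auto simp: n_def)
    ultimately show ?thesis by (simp add: mult_pos_pos)
  qed
  also have "\<dots> = real n * (c' + t)" by (simp add: exp_add[symmetric] distrib_left)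
  finally have "c \<le> c' + t" by (simp add: n_def)
  then show False using c' by (simp add: t_def field_simps)
qed

lemma ergodic_near_pressure:
  assumes c: "ereal c < top_pressure f \<phi>" "P_perp_exp f \<phi> \<epsilon> \<le> ereal c"
  obtains m where "borel_mpt m f" "measure m (NE f \<epsilon>) = 0" "ereal c < free_energy f \<phi> m"
proof -
  obtain c' where c': "ereal c < ereal c'" "ereal c' < top_pressure f \<phi>" using ereal_dense2[OF c(1)] by auto
  then obtain r where r: "r > 0" "ereal c' < pressure_C f UNIV \<phi> r 0"
    unfolding top_pressure_def less_SUP_iff by auto
  obtain M where M: "borel_prob M" "mpt f M" "ereal c' \<le> free_energy f \<phi> M"
  proof (rule misiurewicz[OF phi_cont r(1), of c'])
    show "\<exists>n\<ge>N. \<exists>E. finite E \<and> separated f n r E \<and> exp (real n * c') \<le> (\<Sum>x\<in>E. exp (birkhoff f \<phi> n x))" for N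
      using pressure_greater[OF r(2), of N] by auto
  qed (rule that)
  have "ereal c < free_energy f \<phi> M" using c'(1) M(3) by (rule less_le_trans)
  then show ?thesis by (rule ergodic_large_energy[OF borel_mptI[OF M(1,2)] _ c(2)]) (rule that)
qed

text \<open>The strict inequality in \<open>obstruction\<close> excludes minus infinity. If the
  pressure were infinite, invariant measures of arbitrarily large energy that do not charge
  \<open>NE\<close> would violate \<open>energy_bounded\<close>.\<close>

lemma top_pressure_real: obtains P where "top_pressure f \<phi> = ereal P"
proof -
  obtain C where C: "\<And>m c. borel_mpt m f \<Longrightarrow> measure m (NE f \<epsilon>) = 0 \<Longrightarrow> ereal c \<le> free_energy f \<phi> m \<Longrightarrow> c \<le> C"
    by (rule energy_bounded) (rule that)
  have "top_pressure f \<phi> \<noteq> \<infinity>"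
  proof
    assume inf: "top_pressure f \<phi> = \<infinity>"
    obtain c0 where c0: "P_perp_exp f \<phi> \<epsilon> < ereal c0" using obstruction ereal_dense2[of "P_perp_exp f \<phi> \<epsilon>" \<infinity>] inf by auto
    define c where "c = max c0 C + 1"
    have c: "P_perp_exp f \<phi> \<epsilon> \<le> ereal c" using c0 by (rule order_trans[OF less_imp_le]) (simp add: c_def)
    obtain m where "borel_mpt m f" "measure m (NE f \<epsilon>) = 0" "ereal c < free_energy f \<phi> m"
      by (rule ergodic_near_pressure[OF _ c]) (simp add: inf, rule that)
    then have "c \<le> C" by (intro C) auto
    then show False by (simp add: c_def)
  qed
  then show ?thesis using that obstruction by (cases "top_pressure f \<phi>") auto
qed

lemma invariant_le_pressure:
  assumes M: "borel_mpt M f"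
  shows "free_energy f \<phi> M \<le> top_pressure f \<phi>"
proof (rule ccontr)
  assume "\<not> ?thesis"
  then obtain c where c: "top_pressure f \<phi> < ereal c" "ereal c < free_energy f \<phi> M"
    using ereal_dense2 by (metis not_le)
  have "P_perp_exp f \<phi> \<epsilon> \<le> ereal c" using obstruction c(1) by simp
  then obtain m where "borel_mpt m f" "measure m (NE f \<epsilon>) = 0" "ereal c < free_energy f \<phi> m"
    by (rule ergodic_large_energy[OF M c(2)]) (rule that)
  then show False using energy_le_pressure[of m] c(1) by simp
qed

text \<open>For measures that do not charge \<open>NE\<close> the entropy is bounded by the block
  entropies of one partition of scale \<epsilon>, for every block length \<open>q\<close>. These
  block entropies are weakly continuous because the cells are \<open>jset\<close> for the limit, so
  free energy does not drop in the limit.\<close>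

theorem equilibrium_exists: obtains M where "borel_mpt M f" "free_energy f \<phi> M = top_pressure f \<phi>"
proof -
  obtain P where P: "top_pressure f \<phi> = ereal P" by (rule top_pressure_real)
  obtain c0 where c0: "P_perp_exp f \<phi> \<epsilon> < ereal c0" "c0 < P"
    using obstruction ereal_dense2[of "P_perp_exp f \<phi> \<epsilon>" "ereal P"] P by auto
  \<comment> \<open>The sequence starts at \<open>c0\<close>, above the obstruction, and increases
    to \<open>P\<close>.\<close>
  define c where "c j = P - (P - c0) / real (Suc j)" for j
  have c: "ereal (c j) < top_pressure f \<phi>" "P_perp_exp f \<phi> \<epsilon> \<le> ereal (c j)" for j
  proof -
    show "ereal (c j) < top_pressure f \<phi>" using c0 by (simp add: c_def P)
    have "(P - c0) / real (Suc j) \<le> (P - c0) / 1" using c0 by (intro divide_left_mono) auto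
    then have "c0 \<le> c j" by (simp add: c_def)
    then show "P_perp_exp f \<phi> \<epsilon> \<le> ereal (c j)" using c0(1) by (meson ereal_less_eq(3) less_imp_le order_trans)
  qed
  have "\<exists>m. borel_mpt m f \<and> measure m (NE f \<epsilon>) = 0 \<and> ereal (c j) < free_energy f \<phi> m" for j
    using ergodic_near_pressure[OF c] by metis
  then obtain m where m: "\<And>j. borel_mpt (m j) f" "\<And>j. measure (m j) (NE f \<epsilon>) = 0" "\<And>j. ereal (c j) < free_energy f \<phi> (m j)"
    by metis
  have mf: "mean_functional (\<lambda>g. integral\<^sup>L (m j) g)" for j
  proof -
    interpret borel_mpt "m j" f by (rule m)
    show ?thesis by (rule mean_functional[OF compact_space])
  qed
  obtain M F where MF: "borel_prob M" "F \<noteq> bot" "F \<le> sequentially"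
    "\<And>g :: 'a \<Rightarrow> real. continuous_on UNIV g \<Longrightarrow> ((\<lambda>j. integral\<^sup>L (m j) g) \<longlongrightarrow> integral\<^sup>L M g) F"
    by (rule weak_limit[of "\<lambda>j g. integral\<^sup>L (m j) g", OF mf]) (rule that)
  have inv: "mpt f M"
  proof (rule mptI_continuous[OF MF(1)])
    fix g :: "'a \<Rightarrow> real" assume g: "continuous_on UNIV g"
    have "(\<integral>x. g (f x) \<partial>m j) = integral\<^sup>L (m j) g" for j
    proof -
      interpret borel_mpt "m j" f by (rule m)
      show ?thesis by (rule integral_mpt[OF meas_cont[OF g]])
    qed
    then have "((\<lambda>j. integral\<^sup>L (m j) g) \<longlongrightarrow> (\<integral>x. g (f x) \<partial>M)) F"
      using MF(4)[OF cont_comp[OF g cont_f]] by simp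
    then show "(\<integral>x. g (f x) \<partial>M) = integral\<^sup>L M g" using MF(4)[OF g] tendsto_unique[OF MF(2)] by blast
  qed
  have Mm: "borel_mpt M f" by (rule borel_mptI[OF MF(1) inv])
  interpret M: borel_mpt M f by (rule Mm)
  obtain X :: "'a \<Rightarrow> nat" where X: "finite (range X)" "\<And>v. X -` {v} \<in> sets M" "\<And>v. jset M (X -` {v})"
    "\<And>x y. X x = X y \<Longrightarrow> dist x y \<le> \<epsilon>"
    by (rule M.small_jset_partition[OF compact_space eps]) (rule that)
  have fX: "finmeas M X" using X by (simp add: finmeas_def)
  have main: "P \<le> shannon M (itin f X q) / real q + integral\<^sup>L M \<phi>" if q: "q \<ge> 1" for q
  proof -
    define V where "V = range (itin f X q)"
    have fq: "finmeas M (itin f X q)" by (rule M.itin_finmeas[OF fX])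
    have le: "c j \<le> (\<Sum>v\<in>V. eta (measure (m j) (itin f X q -` {v}))) / real q + integral\<^sup>L (m j) \<phi>" for j
    proof -
      interpret mj: borel_mpt "m j" f by (rule m)
      have fqj: "finmeas (m j) (itin f X q)" using fq by (simp add: finmeas_def mj.sets_eq M.sets_eq)
      have "ks_entropy f (m j) \<le> ereal (shannon (m j) (itin f X q) / real q)"
      proof (rule mj.expansive_entropy_le[OF fqj _ q _ m(2)])
        show "dn f q x y \<le> \<epsilon>" if "itin f X q x = itin f X q y" for x y
          using that X(4) eps by (subst dn_le_iff) (auto simp: itin_eq_iff)
      qed (use eps in simp)
      then have "free_energy f \<phi> (m j) \<le> ereal (shannon (m j) (itin f X q) / real q) + ereal (integral\<^sup>L (m j) \<phi>)"
        unfolding free_energy_def by (rule add_right_mono)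
      with m(3)[of j] have "ereal (c j) < ereal (shannon (m j) (itin f X q) / real q) + ereal (integral\<^sup>L (m j) \<phi>)"
        by (rule less_le_trans)
      then show ?thesis by (simp add: shannon_def V_def)
    qed
    have lim: "((\<lambda>j. (\<Sum>v\<in>V. eta (measure (m j) (itin f X q -` {v}))) / real q + integral\<^sup>L (m j) \<phi>)
        \<longlongrightarrow> shannon M (itin f X q) / real q + integral\<^sup>L M \<phi>) F"
    proof (intro tendsto_add MF(4) phi_cont tendsto_divide tendsto_const)
      have "((\<lambda>j. measure (m j) (itin f X q -` {v})) \<longlongrightarrow> measure M (itin f X q -` {v})) F" for v
      proof (rule jset_tendsto[OF MF(1) _ _ MF(4)])
        show "jset M (itin f X q -` {v})" by (rule M.jset_itin[OF cont_f inv X(3)])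
        show B: "itin f X q -` {v} \<in> sets borel" using fq by (simp add: finmeas_def M.sets_eq)
        fix j and g :: "'a \<Rightarrow> real" assume g: "continuous_on UNIV g"
        interpret mj: borel_mpt "m j" f by (rule m)
        have i: "integrable (m j) g" "integrable (m j) (indicator (itin f X q -` {v}) :: 'a \<Rightarrow> real)"
          using B by (auto intro!: mj.integrable_cont[OF compact_space g] integrable_real_indicator simp: mj.sets_eq mj.emeasure_eq_measure)
        have e: "integral\<^sup>L (m j) (indicator (itin f X q -` {v})) = measure (m j) (itin f X q -` {v})"
          using B by (simp add: mj.sets_eq)
        show "integral\<^sup>L (m j) g \<le> measure (m j) (itin f X q -` {v})" if "\<And>x. g x \<le> indicator (itin f X q -` {v}) x"
          using integral_mono[OF i that] e by simp
        show "measure (m j) (itin f X q -` {v}) \<le> integral\<^sup>L (m j) g" if "\<And>x. indicator (itin f X q -` {v}) x \<le> g x"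
          using integral_mono[OF i(2,1) that] e by simp
      qed
      then show "((\<lambda>j. \<Sum>v\<in>V. eta (measure (m j) (itin f X q -` {v}))) \<longlongrightarrow> shannon M (itin f X q)) F"
        unfolding shannon_def V_def[symmetric]
      proof (intro tendsto_sum continuous_on_tendsto_compose[OF continuous_on_eta])
        show "\<forall>\<^sub>F j in F. measure (m j) (itin f X q -` {v}) \<in> {0..1}" for v
        proof (intro always_eventually allI)
          fix j
          interpret mj: borel_mpt "m j" f by (rule m)
          show "measure (m j) (itin f X q -` {v}) \<in> {0..1}" by simp
        qed
      qed auto
    qed (use q in auto)
    have limc: "(c \<longlongrightarrow> P) F"
    proof (rule filterlim_mono[OF _ order_refl MF(3)])
      have "(\<lambda>j. P - (P - c0) / real (Suc j)) \<longlonglongrightarrow> P - 0"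
        by (intro tendsto_diff tendsto_const LIMSEQ_Suc[OF lim_const_over_n])
      then show "c \<longlonglongrightarrow> P" by (simp add: c_def[abs_def])
    qed
    show ?thesis by (rule tendsto_le[OF MF(2) lim limc]) (use le in \<open>auto intro!: always_eventually\<close>)
  qed
  have "P - integral\<^sup>L M \<phi> \<le> shannon M (itin f X (Suc n)) / real (Suc n)" for n
    using main[of "Suc n"] by linarith
  then have "P - integral\<^sup>L M \<phi> \<le> hent f M X"
    by (intro LIMSEQ_le_const[OF M.hent_LIMSEQ[OF fX]]) auto
  then have "ereal P \<le> ereal (hent f M X) + ereal (integral\<^sup>L M \<phi>)" by simp
  also have "\<dots> \<le> free_energy f \<phi> M"
    unfolding free_energy_def by (intro add_right_mono ks_ge fX M.space_eq)
  finally have "free_energy f \<phi> M = top_pressure f \<phi>" using invariant_le_pressure[OF Mm] P by simp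
  then show ?thesis using that Mm by blast
qed

text \<open>The label telling the invariant set from its complement is paid once, so entropy is at
  most the convex combination of the two conditional entropies. A deficit on one side cannot be made
  up on the other, where free energy is at most the pressure. Measure 1 is treated apart, as the
  complement cannot be conditioned on.\<close>

lemma equilibrium_condition:
  assumes M: "borel_mpt M f" "free_energy f \<phi> M = top_pressure f \<phi>"
    and A: "A \<in> sets borel" "f -` A = A" "measure M A > 0"
  shows "free_energy f \<phi> (uniform_measure M A) = top_pressure f \<phi>"
proof (cases "measure M A = 1")
  case True
  interpret M: borel_mpt M f by (rule M)
  have "uniform_measure M A = M"
  proof (rule measure_eqI)
    fix B assume "B \<in> sets (uniform_measure M A)"
    then have B: "B \<in> sets M" by simp
    have sA: "A \<in> sets M" using A(1) by (simp add: M.sets_eq)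
    have "measure M (B - A) \<le> measure M (space M - A)"
      using sets.compl_sets[OF sA] by (intro M.finite_measure_mono) (auto simp: M.space_eq)
    then have "measure M (B - A) = 0" using M.prob_compl[OF sA] True by (simp add: measure_le_0_iff)
    then have "measure M (A \<inter> B) = measure M B"
      using M.finite_measure_Diff'[OF B sA] by (simp add: Int_commute)
    then show "emeasure (uniform_measure M A) B = emeasure M B"
      using A B True by (simp add: M.emeasure_eq_measure M.sets_eq divide_ennreal_def)
  qed simp
  then show ?thesis using M by simp
next
  case False
  obtain P where P: "top_pressure f \<phi> = ereal P" by (rule top_pressure_real)
  interpret M: borel_mpt M f by (rule M)
  define a where "a = measure M A"
  have a: "0 < a" "a < 1" using A(3) False M.prob_le_1[of A] by (auto simp: a_def less_le)
  have sA: "A \<in> sets M" "- A \<in> sets M" using A(1) by (auto simp: M.sets_eq)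
  have ac: "measure M (- A) = 1 - a" using M.prob_compl[OF sA(1)] by (simp add: a_def M.space_eq Compl_eq_Diff_UNIV)
  let ?U = "uniform_measure M A" and ?W = "uniform_measure M (- A)"
  have U: "borel_mpt ?U f" by (rule M.uniform_measure_borel_mpt[OF A])
  have W: "borel_mpt ?W f" by (rule M.uniform_measure_borel_mpt) (use A ac a in auto)
  interpret U: borel_mpt ?U f by (rule U)
  interpret W: borel_mpt ?W f by (rule W)
  have int: "integral\<^sup>L M \<phi> = a * integral\<^sup>L ?U \<phi> + (1 - a) * integral\<^sup>L ?W \<phi>"
  proof -
    have mphi: "\<phi> \<in> borel_measurable M" by (rule M.meas_cont[OF phi_cont])
    have iphi: "integrable M \<phi>" by (rule M.integrable_cont[OF compact_space phi_cont])
    have "integral\<^sup>L M \<phi> = (\<integral>x. indicator A x * \<phi> x + indicator (- A) x * \<phi> x \<partial>M)"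
      by (intro Bochner_Integration.integral_cong) (auto simp: indicator_def)
    also have "\<dots> = (\<integral>x. indicator A x * \<phi> x \<partial>M) + (\<integral>x. indicator (- A) x * \<phi> x \<partial>M)"
      using integrable_real_mult_indicator[OF sA(1) iphi] integrable_real_mult_indicator[OF sA(2) iphi]
      by (intro Bochner_Integration.integral_add) (auto simp: mult.commute)
    finally show ?thesis
      using M.integral_uniform_measure[OF sA(1) _ mphi] M.integral_uniform_measure[OF sA(2) _ mphi] a ac
      by (simp add: a_def[symmetric])
  qed
  show ?thesis
  proof (rule ccontr)
    assume "free_energy f \<phi> ?U \<noteq> top_pressure f \<phi>"
    then have "free_energy f \<phi> ?U < ereal P" using invariant_le_pressure[OF U] P by simp
    then obtain p where p: "free_energy f \<phi> ?U < ereal p" "p < P" using ereal_dense2 by (metis less_ereal.simps(1))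
    have "ks_entropy f M \<le> ereal (a * p + (1 - a) * P - integral\<^sup>L M \<phi>)"
    proof (rule ks_le[OF M.space_eq])
      fix X :: "'a \<Rightarrow> 'a set" assume X: "finmeas M X"
      have fU: "finmeas ?U Z = finmeas M Z" and fW: "finmeas ?W Z = finmeas M Z" for Z :: "'a \<Rightarrow> 'a set"
        by (simp_all add: finmeas_def)
      define R where "R = (\<lambda>x. x \<in> A)"
      have RT: "R -` {True} = A" unfolding R_def by (rule set_eqI) simp
      have RF: "R -` {False} = - A" unfolding R_def by (rule set_eqI) simp
      have fR: "finmeas M R"
        unfolding finmeas_def
      proof (intro conjI allI)
        show "finite (range R)" by (rule finite_subset[of _ UNIV]) auto
        show "R -` {v} \<in> sets M" for v using RT RF sA by (cases v) simp_all
      qed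
      have "A \<noteq> {}" "- A \<noteq> {}" using a ac by (auto simp: a_def)
      then have "\<exists>x. R x" "\<exists>x. \<not> R x" by (auto simp: R_def)
      then have ran: "range R = {True, False}" by (intro set_eqI) (metis (full_types) insertCI rangeI)
      have h: "hent f M X \<le> a * hent f ?U X + (1 - a) * hent f ?W X"
      proof (rule LIMSEQ_le[OF M.hent_LIMSEQ[OF X]])
        have "(\<lambda>n. shannon M R / real (Suc n) + (a * (shannon ?U (itin f X (Suc n)) / real (Suc n)) + (1 - a) * (shannon ?W (itin f X (Suc n)) / real (Suc n))))
          \<longlonglongrightarrow> 0 + (a * hent f ?U X + (1 - a) * hent f ?W X)"
          using X by (intro tendsto_add tendsto_mult_left LIMSEQ_Suc[OF lim_const_over_n] U.hent_LIMSEQ W.hent_LIMSEQ) (simp_all add: fU fW)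
        then show "(\<lambda>n. shannon M R / real (Suc n) + (a * (shannon ?U (itin f X (Suc n)) / real (Suc n)) + (1 - a) * (shannon ?W (itin f X (Suc n)) / real (Suc n))))
          \<longlonglongrightarrow> a * hent f ?U X + (1 - a) * hent f ?W X" by simp
        have "shannon M (itin f X (Suc n)) / real (Suc n) \<le> shannon M R / real (Suc n) +
          (a * (shannon ?U (itin f X (Suc n)) / real (Suc n)) + (1 - a) * (shannon ?W (itin f X (Suc n)) / real (Suc n)))" for n
          using divide_right_mono[OF M.shannon_condition[OF M.itin_finmeas[OF X, of "Suc n"] fR], of "real (Suc n)"]
          by (simp add: ran RT RF ac a_def[symmetric] add_divide_distrib)
        then show "\<exists>N. \<forall>n\<ge>N. shannon M (itin f X (Suc n)) / real (Suc n) \<le> shannon M R / real (Suc n) +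
          (a * (shannon ?U (itin f X (Suc n)) / real (Suc n)) + (1 - a) * (shannon ?W (itin f X (Suc n)) / real (Suc n)))" by blast
      qed
      have "ereal (hent f ?U X) + ereal (integral\<^sup>L ?U \<phi>) \<le> free_energy f \<phi> ?U"
        unfolding free_energy_def using X fU by (intro add_right_mono ks_ge U.space_eq) auto
      from le_less_trans[OF this p(1)] have "ereal (hent f ?U X) + ereal (integral\<^sup>L ?U \<phi>) < ereal p" .
      then have u: "hent f ?U X + integral\<^sup>L ?U \<phi> \<le> p" by simp
      have "ereal (hent f ?W X) + ereal (integral\<^sup>L ?W \<phi>) \<le> free_energy f \<phi> ?W"
        unfolding free_energy_def using X fW by (intro add_right_mono ks_ge W.space_eq) auto
      also have "\<dots> \<le> ereal P" using invariant_le_pressure[OF W] P by simp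
      finally have w: "hent f ?W X + integral\<^sup>L ?W \<phi> \<le> P" by simp
      have "hent f M X + integral\<^sup>L M \<phi> \<le> a * (hent f ?U X + integral\<^sup>L ?U \<phi>) + (1 - a) * (hent f ?W X + integral\<^sup>L ?W \<phi>)"
        using h int by (simp add: algebra_simps)
      also have "\<dots> \<le> a * p + (1 - a) * P" using u w a by (intro add_mono mult_left_mono) auto
      finally show "ereal (hent f M X) \<le> ereal (a * p + (1 - a) * P - integral\<^sup>L M \<phi>)" by simp
    qed
    then have "free_energy f \<phi> M \<le> ereal (a * p + (1 - a) * P - integral\<^sup>L M \<phi>) + ereal (integral\<^sup>L M \<phi>)"
      unfolding free_energy_def by (rule add_right_mono)
    then have "P \<le> a * p + (1 - a) * P" using M(2) P by simp
    then have "a * P \<le> a * p" by (simp add: algebra_simps)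
    then show False using a p(2) by simp
  qed
qed

text \<open>Conditioned on the invariant set \<open>NE\<close> the measure would still be an
  equilibrium state, and one of its ergodic components would be carried by \<open>NE\<close> with
  energy above the obstruction.\<close>

lemma equilibrium_expansive:
  assumes M: "borel_mpt M f" "free_energy f \<phi> M = top_pressure f \<phi>"
  shows "measure M (NE f \<epsilon>) = 0"
proof (rule ccontr)
  assume "measure M (NE f \<epsilon>) \<noteq> 0"
  then have pos: "measure M (NE f \<epsilon>) > 0" by (simp add: less_le)
  interpret M: borel_mpt M f by (rule M)
  have A: "NE f \<epsilon> \<in> sets borel" "f -` NE f \<epsilon> = NE f \<epsilon>"
    using NE_borel[of \<epsilon>] eps by (auto simp: NE_f)
  let ?U = "uniform_measure M (NE f \<epsilon>)"
  have FU: "free_energy f \<phi> ?U = top_pressure f \<phi>" by (rule equilibrium_condition[OF M A pos])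
  interpret U: borel_mpt ?U f by (rule M.uniform_measure_borel_mpt[OF A pos])
  have full: "measure ?U (NE f \<epsilon>) = 1"
    using pos A(1) by (simp add: M.emeasure_eq_measure M.sets_eq)
  obtain c where c: "P_perp_exp f \<phi> \<epsilon> < ereal c" "ereal c < top_pressure f \<phi>"
    using ereal_dense2[OF obstruction] by auto
  obtain m where m: "ergodic f m" "measure m (NE f \<epsilon>) = 1" "ereal c < free_energy f \<phi> m"
    by (rule U.ergodic_reduction[OF phi_cont _ A(1) full, of c]) (use c FU in auto)
  then show False using ergodic_expansive[OF m(1)] c(1) by simp
qed

end

section \<open>Gluing orbit segments\<close>

lemma sum_lessThan_add: "(\<Sum>i<a + b. h i) = (\<Sum>i<a. h i) + (\<Sum>j<b. h (a + j :: nat))" for h :: "nat \<Rightarrow> 'b::comm_monoid_add"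
  by (induction b) (auto simp: add.assoc)

lemma sum_blocks:
  fixes h :: "nat \<Rightarrow> 'b::comm_monoid_add"
  shows "(\<Sum>i<k * q. h i) = (\<Sum>m<k. \<Sum>j<q. h (m * q + j))"
proof (induction k)
  case (Suc k)
  have "(\<Sum>i<Suc k * q. h i) = (\<Sum>i<k * q + q. h i)" by (simp add: add.commute)
  also have "\<dots> = (\<Sum>i<k * q. h i) + (\<Sum>j<q. h (k * q + j))" by (rule sum_lessThan_add)
  finally show ?case using Suc by simp
qed simp

lemma birkhoff_chain:
  fixes k :: nat
  assumes b: "\<And>x. \<bar>\<phi> x\<bar> \<le> b"
  shows "(\<Sum>i<k. birkhoff f \<phi> (ns i) ((f ^^ (\<Sum>l<i. ns l + ts l)) y)) - real (\<Sum>i<k. ts i) * b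
    \<le> birkhoff f \<phi> (\<Sum>i<k. ns i + ts i) y"
proof (induction k)
  case (Suc k)
  let ?s = "\<Sum>i<k. ns i + ts i"
  have "birkhoff f \<phi> (\<Sum>i<Suc k. ns i + ts i) y = birkhoff f \<phi> ?s y + birkhoff f \<phi> (ns k) ((f ^^ ?s) y)
      + birkhoff f \<phi> (ts k) ((f ^^ ns k) ((f ^^ ?s) y))"
    by (simp add: birkhoff_add add.assoc)
  moreover have "birkhoff f \<phi> (ts k) ((f ^^ ns k) ((f ^^ ?s) y)) \<ge> - (real (ts k) * b)"
    using birkhoff_abs_le[of \<phi> b f "ts k" "(f ^^ ns k) ((f ^^ ?s) y)"] b by (simp add: abs_le_iff)
  ultimately show ?case using Suc by (simp add: algebra_simps)
qed simp

context expansive_potential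
begin

definition pres :: real where "pres = real_of_ereal (top_pressure f \<phi>)"

lemma top_pressure_PP: "top_pressure f \<phi> = ereal pres"
  using top_pressure_real unfolding pres_def by (metis real_of_ereal.simps(1))

definition phi_bound :: real where "phi_bound = (SOME b. 0 \<le> b \<and> (\<forall>x. \<bar>\<phi> x\<bar> \<le> b))"

lemma phi_bound: "0 \<le> phi_bound" "\<bar>\<phi> x\<bar> \<le> phi_bound"
proof -
  have "\<exists>b. 0 \<le> b \<and> (\<forall>x. \<bar>\<phi> x\<bar> \<le> b)" by (rule bdd_cont[OF phi_cont]) blast
  from someI_ex[OF this] show "0 \<le> phi_bound" "\<bar>\<phi> x\<bar> \<le> phi_bound" unfolding phi_bound_def by auto
qed

lemma birkhoff_nphi: "\<bar>birkhoff f \<phi> n x\<bar> \<le> real n * phi_bound"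
  by (rule birkhoff_abs_le) (rule phi_bound)

text \<open>The threshold depends on the scale \<open>r\<close>, the rate does not; this is what
  makes the scale disappear from the gluing bound.\<close>

lemma separated_growth:
  assumes "r > 0" "z > 0"
  obtains N where "\<And>n E. n \<ge> N \<Longrightarrow> finite E \<Longrightarrow> separated f n r E \<Longrightarrow>
      (\<Sum>x\<in>E. exp (birkhoff f \<phi> n x)) \<le> exp (real n * (pres + z))"
proof -
  have "pressure_C f UNIV \<phi> r 0 \<le> top_pressure f \<phi>"
    unfolding top_pressure_def using assms(1) by (intro SUP_upper) simp
  also have "\<dots> < ereal (pres + z)" using assms(2) by (simp add: top_pressure_PP)
  finally have "pressure_C f UNIV \<phi> r 0 < ereal (pres + z)" .
  from pressure_less[OF this] obtain N where N: "\<And>n E. n \<ge> N \<Longrightarrow> finite E \<Longrightarrow> separated f n r E \<Longrightarrow>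
      (\<Sum>x\<in>E. exp (birkhoff f \<phi> n x)) \<le> exp (real n * (pres + z))" by auto
  show ?thesis by (rule that[of N]) (rule N)
qed

text \<open>Concatenating \<open>k\<close> blocks chosen freely from \<open>I\<close>, each made of \<open>q\<close> specified segments, multiplies
  the partition sums; the gaps cost a bounded factor per segment and are handled by pigeonhole.\<close>

theorem glue:
  fixes X :: "'b \<Rightarrow> nat \<Rightarrow> 'a" and N :: "'b \<Rightarrow> nat \<Rightarrow> nat" and \<tau> :: nat
  assumes spec: "\<And>(k::nat) xs ns. \<forall>i<k. (xs i, ns i) \<in> C \<Longrightarrow> \<exists>y ts. (\<forall>i. i + 1 < k \<longrightarrow> 1 \<le> ts i \<and> ts i \<le> \<tau>) \<and>
        (\<forall>j<k. dn f (ns j) ((f ^^ (\<Sum>i<j. ns i + ts i)) y) (xs j) < \<delta>)"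
    and tau: "\<tau> \<ge> 1"
    and bow: "\<And>x n y. (x, n) \<in> C \<Longrightarrow> dn f n y x < \<delta> \<Longrightarrow> birkhoff f \<phi> n x \<le> birkhoff f \<phi> n y + K"
    and I: "finite I" "I \<noteq> {}"
    and seg: "\<And>b j. b \<in> I \<Longrightarrow> j < q \<Longrightarrow> (X b j, N b j) \<in> C"
    and len: "\<And>b. b \<in> I \<Longrightarrow> (\<Sum>j<q. N b j) = l"
    and q: "q \<ge> 1" and r: "r > 0"
    and sep: "\<And>b b' t y y'. b \<in> I \<Longrightarrow> b' \<in> I \<Longrightarrow> b \<noteq> b' \<Longrightarrow> \<forall>j. 1 \<le> t j \<and> t j \<le> \<tau> \<Longrightarrow>
        \<forall>j<q. dn f (N b j) ((f ^^ (\<Sum>i<j. N b i + t i)) y) (X b j) < \<delta> \<Longrightarrow>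
        \<forall>j<q. dn f (N b' j) ((f ^^ (\<Sum>i<j. N b' i + t i)) y') (X b' j) < \<delta> \<Longrightarrow>
        dn f (l + q * \<tau>) y y' > r"
  shows "ln (\<Sum>b\<in>I. exp (\<Sum>j<q. birkhoff f \<phi> (N b j) (X b j)))
    \<le> real (l + q * \<tau>) * pres + real q * (K + real \<tau> * phi_bound + ln (real \<tau>))"
proof -
  define W where "W b = (\<Sum>j<q. birkhoff f \<phi> (N b j) (X b j))" for b
  define A where "A = (\<Sum>b\<in>I. exp (W b))"
  have A: "A > 0" unfolding A_def using I by (intro sum_pos) auto
  define h where "h = l + q * \<tau>"
  have "1 * 1 \<le> q * \<tau>" by (rule mult_le_mono[OF q tau])
  then have h: "h \<ge> 1" unfolding h_def by linarith
  have bound: "ln A \<le> real h * (pres + z) + real q * (K + real \<tau> * phi_bound + ln (real \<tau>))" if z: "z > 0" for z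
  proof -
    obtain n0 where n0: "\<And>n E. n \<ge> n0 \<Longrightarrow> finite E \<Longrightarrow> separated f n r E \<Longrightarrow>
      (\<Sum>x\<in>E. exp (birkhoff f \<phi> n x)) \<le> exp (real n * (pres + z))"
      by (rule separated_growth[OF r z]) (rule that)
    \<comment> \<open>Enough blocks to reach the lengths for which the growth bound at scale
      \<open>r\<close> holds.\<close>
    define k where "k = Suc n0"
    define B where "B = PiE {..<k} (\<lambda>_. I)"
    have finB: "finite B" unfolding B_def using I by (intro finite_PiE) auto
    \<comment> \<open>Every gap is counted with its maximal length \<tau>, so that orbits with
      different gaps are compared at one common length.\<close>
    define Tot where "Tot = k * h"
    have "1 * n0 \<le> h * Suc n0" using h by (intro mult_le_mono) auto
    then have Tot: "Tot \<ge> n0" by (simp add: Tot_def k_def mult.commute)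
    have BI: "\<beta> m \<in> I" if "\<beta> \<in> B" "m < k" for \<beta> m using that by (auto simp: B_def)
    define ns where "ns \<beta> i = N (\<beta> (i div q)) (i mod q)" for \<beta> :: "nat \<Rightarrow> 'b" and i
    define xs where "xs \<beta> i = X (\<beta> (i div q)) (i mod q)" for \<beta> :: "nat \<Rightarrow> 'b" and i
    have ex: "\<exists>y t. (\<forall>i. 1 \<le> t i \<and> t i \<le> \<tau>) \<and>
        (\<forall>j<k * q. dn f (ns \<beta> j) ((f ^^ (\<Sum>i<j. ns \<beta> i + t i)) y) (xs \<beta> j) < \<delta>)" if b: "\<beta> \<in> B" for \<beta>
    proof -
      have "\<forall>i<k * q. (xs \<beta> i, ns \<beta> i) \<in> C"
      proof (intro allI impI)
        fix i assume "i < k * q"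
        then have "i div q < k" by (simp add: less_mult_imp_div_less)
        then show "(xs \<beta> i, ns \<beta> i) \<in> C" unfolding xs_def ns_def using q by (intro seg BI[OF b]) auto
      qed
      from spec[OF this] obtain y ts where yt: "\<forall>i. i + 1 < k * q \<longrightarrow> 1 \<le> ts i \<and> ts i \<le> \<tau>"
        "\<forall>j<k * q. dn f (ns \<beta> j) ((f ^^ (\<Sum>i<j. ns \<beta> i + ts i)) y) (xs \<beta> j) < \<delta>" by blast
      \<comment> \<open>The gap after the last segment is left open by specification; the value 1
        makes all gaps admissible.\<close>
      define t where "t i = (if i + 1 < k * q then ts i else 1)" for i
      have "(\<Sum>i<j. ns \<beta> i + t i) = (\<Sum>i<j. ns \<beta> i + ts i)" if "j < k * q" for j
        using that by (intro sum.cong) (auto simp: t_def)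
      then have "\<forall>j<k * q. dn f (ns \<beta> j) ((f ^^ (\<Sum>i<j. ns \<beta> i + t i)) y) (xs \<beta> j) < \<delta>"
        using yt(2) by simp
      moreover have "\<forall>i. 1 \<le> t i \<and> t i \<le> \<tau>" using yt(1) tau by (auto simp: t_def)
      ultimately show ?thesis by blast
    qed
    then have "\<forall>\<beta>. \<exists>y t. \<beta> \<in> B \<longrightarrow> (\<forall>i. 1 \<le> t i \<and> t i \<le> \<tau>) \<and>
        (\<forall>j<k * q. dn f (ns \<beta> j) ((f ^^ (\<Sum>i<j. ns \<beta> i + t i)) y) (xs \<beta> j) < \<delta>)" by blast
    then obtain Y0 t where Yt: "\<And>\<beta> i. \<beta> \<in> B \<Longrightarrow> 1 \<le> t \<beta> i \<and> t \<beta> i \<le> \<tau>"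
      "\<And>\<beta> j. \<beta> \<in> B \<Longrightarrow> j < k * q \<Longrightarrow> dn f (ns \<beta> j) ((f ^^ (\<Sum>i<j. ns \<beta> i + t \<beta> i)) (Y0 \<beta>)) (xs \<beta> j) < \<delta>"
      by metis
    have nsblock: "ns \<beta> (m * q + j) = N (\<beta> m) j" "xs \<beta> (m * q + j) = X (\<beta> m) j" if "j < q" for \<beta> m j
      using that by (auto simp: ns_def xs_def)
    have total: "(\<Sum>i<m * q. ns \<beta> i) = m * l" if "\<beta> \<in> B" "m \<le> k" for \<beta> m
    proof -
      have "(\<Sum>i<m * q. ns \<beta> i) = (\<Sum>m'<m. \<Sum>j<q. N (\<beta> m') j)" unfolding sum_blocks by (intro sum.cong refl) (auto simp: nsblock)
      also have "\<dots> = (\<Sum>m'<m. l)" using that BI by (intro sum.cong refl len) auto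
      finally show ?thesis by simp
    qed
    have wt: "(\<Sum>m<k. W (\<beta> m)) \<le> birkhoff f \<phi> Tot (Y0 \<beta>) + real (k * q) * (K + real \<tau> * phi_bound)" if b: "\<beta> \<in> B" for \<beta>
    proof -
      define s where "s = (\<Sum>i<k * q. ns \<beta> i + t \<beta> i)"
      have s: "s = k * l + (\<Sum>i<k * q. t \<beta> i)" using total[OF b, of k] by (simp add: s_def sum.distrib)
      have "(\<Sum>i<k * q. t \<beta> i) \<le> (\<Sum>i<k * q. \<tau>)" using Yt(1)[OF b] by (intro sum_mono) auto
      then have sT: "(\<Sum>i<k * q. t \<beta> i) \<le> k * q * \<tau>" by simp
      have Tot': "Tot = k * l + k * q * \<tau>" by (simp add: Tot_def h_def algebra_simps)
      have sle: "s \<le> Tot" using s sT Tot' by simp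
      have "(\<Sum>m<k. W (\<beta> m)) = (\<Sum>i<k * q. birkhoff f \<phi> (ns \<beta> i) (xs \<beta> i))"
        unfolding sum_blocks W_def by (intro sum.cong refl) (auto simp: nsblock)
      also have "\<dots> \<le> (\<Sum>i<k * q. birkhoff f \<phi> (ns \<beta> i) ((f ^^ (\<Sum>l<i. ns \<beta> l + t \<beta> l)) (Y0 \<beta>)) + K)"
      proof (rule sum_mono)
        fix i assume "i \<in> {..<k * q}"
        then have i: "i < k * q" "i div q < k" by (auto simp: less_mult_imp_div_less)
        have "(xs \<beta> i, ns \<beta> i) \<in> C" unfolding xs_def ns_def using q i by (intro seg BI[OF b]) auto
        then show "birkhoff f \<phi> (ns \<beta> i) (xs \<beta> i) \<le> birkhoff f \<phi> (ns \<beta> i) ((f ^^ (\<Sum>l<i. ns \<beta> l + t \<beta> l)) (Y0 \<beta>)) + K"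
          by (rule bow) (rule Yt(2)[OF b i(1)])
      qed
      also have "\<dots> = (\<Sum>i<k * q. birkhoff f \<phi> (ns \<beta> i) ((f ^^ (\<Sum>l<i. ns \<beta> l + t \<beta> l)) (Y0 \<beta>))) + real (k * q) * K"
        by (simp add: sum.distrib)
      also have "\<dots> \<le> birkhoff f \<phi> s (Y0 \<beta>) + real (\<Sum>i<k * q. t \<beta> i) * phi_bound + real (k * q) * K"
        using birkhoff_chain[of \<phi> phi_bound f "ns \<beta>" "t \<beta>" "Y0 \<beta>" "k * q"] phi_bound(2) by (simp add: s_def)
      also have "birkhoff f \<phi> s (Y0 \<beta>) \<le> birkhoff f \<phi> Tot (Y0 \<beta>) + real (Tot - s) * phi_bound"
        using birkhoff_add[of f \<phi> s "Tot - s" "Y0 \<beta>"] birkhoff_nphi[of "Tot - s" "(f ^^ s) (Y0 \<beta>)"] sle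
        by (simp add: abs_le_iff)
      also have "real (Tot - s) = real (k * q * \<tau>) - real (\<Sum>i<k * q. t \<beta> i)"
        using s sT Tot' by (simp add: of_nat_diff)
      finally show ?thesis by (simp add: algebra_simps)
    qed
    define TT where "TT = PiE {..<k * q} (\<lambda>_. {1..\<tau>})"
    define tr where "tr \<beta> = restrict (t \<beta>) {..<k * q}" for \<beta>
    have finTT: "finite TT" unfolding TT_def by (intro finite_PiE) auto
    have cTT: "card TT = \<tau> ^ (k * q)" unfolding TT_def by (simp add: card_PiE)
    have trTT: "tr ` B \<subseteq> TT" using Yt(1) by (auto simp: tr_def TT_def PiE_iff split: if_splits)
    \<comment> \<open>With equal gaps the blocks of two choices start at equal times, so a block in
      which they differ separates the orbits. Different gap sequences are not compared but counted
      by \<open>TT\<close>.\<close>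
    have sepY: "dn f Tot (Y0 \<beta>) (Y0 \<beta>') > r" if b: "\<beta> \<in> B" "\<beta>' \<in> B" "\<beta> \<noteq> \<beta>'" "tr \<beta> = tr \<beta>'" for \<beta> \<beta>'
    proof -
      have "\<exists>m<k. \<beta> m \<noteq> \<beta>' m"
      proof (rule ccontr)
        assume "\<not> ?thesis"
        then have "\<beta> = \<beta>'" using b(1,2) unfolding B_def by (intro PiE_ext[of \<beta> "{..<k}"]) auto
        then show False using b(3) by simp
      qed
      then obtain m where m: "m < k" "\<beta> m \<noteq> \<beta>' m" by blast
      have teq: "t \<beta> i = t \<beta>' i" if "i < k * q" for i
        using fun_cong[OF b(4), of i] that by (simp add: tr_def)
      have mq: "m * q + j < k * q" if "j < q" for j
      proof -
        have "m * q + j < Suc m * q" using that by simp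
        also have "\<dots> \<le> k * q" using m(1) by (intro mult_le_mono1) simp
        finally show ?thesis .
      qed
      define s where "s = m * l + (\<Sum>i<m * q. t \<beta> i)"
      have start: "(\<Sum>i<m * q + j. ns \<gamma> i + t \<gamma> i) = s + (\<Sum>i<j. N (\<gamma> m) i + t \<beta> (m * q + i))"
        if g: "\<gamma> \<in> B" "\<And>i. i < k * q \<Longrightarrow> t \<gamma> i = t \<beta> i" and j: "j < q" for \<gamma> j
      proof -
        have "(\<Sum>i<m * q + j. ns \<gamma> i + t \<gamma> i) = (\<Sum>i<m * q. ns \<gamma> i + t \<gamma> i) + (\<Sum>i<j. ns \<gamma> (m * q + i) + t \<gamma> (m * q + i))"
          by (rule sum_lessThan_add)
        also have "(\<Sum>i<m * q. ns \<gamma> i + t \<gamma> i) = m * l + (\<Sum>i<m * q. t \<gamma> i)"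
          using total[OF g(1), of m] m by (simp add: sum.distrib)
        also have "(\<Sum>i<m * q. t \<gamma> i) = (\<Sum>i<m * q. t \<beta> i)"
          using mq[of 0] q by (intro sum.cong refl g(2)) (auto intro: less_trans)
        also have "(\<Sum>i<j. ns \<gamma> (m * q + i) + t \<gamma> (m * q + i)) = (\<Sum>i<j. N (\<gamma> m) i + t \<beta> (m * q + i))"
          using j mq by (intro sum.cong refl) (auto simp: nsblock g(2))
        finally show ?thesis by (simp add: s_def)
      qed
      have shad: "\<forall>j<q. dn f (N (\<gamma> m) j) ((f ^^ (\<Sum>i<j. N (\<gamma> m) i + t \<beta> (m * q + i))) ((f ^^ s) (Y0 \<gamma>))) (X (\<gamma> m) j) < \<delta>"
        if g: "\<gamma> \<in> B" "\<And>i. i < k * q \<Longrightarrow> t \<gamma> i = t \<beta> i" for \<gamma>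
      proof (intro allI impI)
        fix j assume j: "j < q"
        have st: "(\<Sum>i<m * q + j. ns \<gamma> i + t \<gamma> i) = s + (\<Sum>i<j. N (\<gamma> m) i + t \<beta> (m * q + i))"
          by (rule start[OF g(1) _ j]) (rule g(2))
        have "(f ^^ (\<Sum>i<j. N (\<gamma> m) i + t \<beta> (m * q + i))) ((f ^^ s) (Y0 \<gamma>)) = (f ^^ (\<Sum>i<m * q + j. ns \<gamma> i + t \<gamma> i)) (Y0 \<gamma>)"
          unfolding st add.commute[of s] funpow_add comp_apply ..
        then show "dn f (N (\<gamma> m) j) ((f ^^ (\<Sum>i<j. N (\<gamma> m) i + t \<beta> (m * q + i))) ((f ^^ s) (Y0 \<gamma>))) (X (\<gamma> m) j) < \<delta>"
          using Yt(2)[OF g(1) mq[OF j]] by (simp add: nsblock[OF j])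
      qed
      have "r < dn f h ((f ^^ s) (Y0 \<beta>)) ((f ^^ s) (Y0 \<beta>'))"
        unfolding h_def
      proof (rule sep[OF BI[OF b(1) m(1)] BI[OF b(2) m(1)] m(2)])
        show "\<forall>j. 1 \<le> t \<beta> (m * q + j) \<and> t \<beta> (m * q + j) \<le> \<tau>" using Yt(1)[OF b(1)] by simp
      next
        show "\<forall>j<q. dn f (N (\<beta> m) j) ((f ^^ (\<Sum>i<j. N (\<beta> m) i + t \<beta> (m * q + i))) ((f ^^ s) (Y0 \<beta>))) (X (\<beta> m) j) < \<delta>"
          by (rule shad[OF b(1) refl])
        show "\<forall>j<q. dn f (N (\<beta>' m) j) ((f ^^ (\<Sum>i<j. N (\<beta>' m) i + t \<beta> (m * q + i))) ((f ^^ s) (Y0 \<beta>'))) (X (\<beta>' m) j) < \<delta>"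
          by (rule shad[OF b(2) teq[symmetric]])
      qed
      also have "\<dots> \<le> dn f Tot (Y0 \<beta>) (Y0 \<beta>')"
      proof (rule dn_shift)
        have "(\<Sum>i<m * q. t \<beta> i) \<le> (\<Sum>i<m * q. \<tau>)" using Yt(1)[OF b(1)] by (intro sum_mono) auto
        then have "s \<le> m * h" by (simp add: s_def h_def algebra_simps)
        moreover have "Suc m * h \<le> Tot" unfolding Tot_def using m(1) by (intro mult_le_mono1) simp
        ultimately show "s + h \<le> Tot" by simp
      qed
      finally show ?thesis .
    qed
    have fib: "(\<Sum>\<beta>\<in>{\<beta> \<in> B. tr \<beta> = v}. exp (\<Sum>m<k. W (\<beta> m))) \<le> exp (real (k * q) * (K + real \<tau> * phi_bound)) * exp (real Tot * (pres + z))" for v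
    proof -
      let ?Bv = "{\<beta> \<in> B. tr \<beta> = v}"
      have inj: "inj_on Y0 ?Bv"
      proof (rule inj_onI, rule ccontr)
        fix \<beta> \<beta>' assume "\<beta> \<in> ?Bv" "\<beta>' \<in> ?Bv" "Y0 \<beta> = Y0 \<beta>'" "\<beta> \<noteq> \<beta>'"
        then show False using sepY[of \<beta> \<beta>'] r by simp
      qed
      have "separated f Tot r (Y0 ` ?Bv)" unfolding separated_def by (auto intro!: sepY)
      then have le: "(\<Sum>x\<in>Y0 ` ?Bv. exp (birkhoff f \<phi> Tot x)) \<le> exp (real Tot * (pres + z))"
        using finB by (intro n0 Tot) auto
      have "(\<Sum>\<beta>\<in>?Bv. exp (\<Sum>m<k. W (\<beta> m))) \<le> (\<Sum>\<beta>\<in>?Bv. exp (real (k * q) * (K + real \<tau> * phi_bound)) * exp (birkhoff f \<phi> Tot (Y0 \<beta>)))"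
      proof (rule sum_mono)
        fix \<beta> assume "\<beta> \<in> ?Bv"
        then show "exp (\<Sum>m<k. W (\<beta> m)) \<le> exp (real (k * q) * (K + real \<tau> * phi_bound)) * exp (birkhoff f \<phi> Tot (Y0 \<beta>))"
          unfolding exp_add[symmetric] exp_le_cancel_iff using wt[of \<beta>] by simp
      qed
      also have "\<dots> = exp (real (k * q) * (K + real \<tau> * phi_bound)) * (\<Sum>x\<in>Y0 ` ?Bv. exp (birkhoff f \<phi> Tot x))"
        using inj by (simp add: sum.reindex sum_distrib_left)
      also have "\<dots> \<le> exp (real (k * q) * (K + real \<tau> * phi_bound)) * exp (real Tot * (pres + z))"
        using le by (intro mult_left_mono) auto
      finally show ?thesis .
    qed
    \<comment> \<open>The power expands into all choices of blocks, which fall into at most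
      \<open>\<tau> ^ (k * q)\<close> classes of equal gaps, each giving a separated set. Dividing
      the logarithm by \<open>k\<close> leaves a cost per segment, and \<open>z\<close> tends to 0
      at the end.\<close>
    have "A ^ k = (\<Prod>m<k. \<Sum>b\<in>I. exp (W b))" by (simp add: A_def)
    also have "\<dots> = (\<Sum>\<beta>\<in>B. \<Prod>m<k. exp (W (\<beta> m)))" unfolding B_def using I by (intro prod_sum_PiE) auto
    also have "\<dots> = (\<Sum>\<beta>\<in>B. exp (\<Sum>m<k. W (\<beta> m)))" by (simp add: exp_sum)
    also have "\<dots> = (\<Sum>v\<in>TT. \<Sum>\<beta>\<in>{\<beta> \<in> B. tr \<beta> = v}. exp (\<Sum>m<k. W (\<beta> m)))"
      by (rule sum.group[OF finB finTT trTT, symmetric])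
    also have "\<dots> \<le> (\<Sum>v\<in>TT. exp (real (k * q) * (K + real \<tau> * phi_bound)) * exp (real Tot * (pres + z)))"
      by (intro sum_mono fib)
    also have "\<dots> = real (\<tau> ^ (k * q)) * (exp (real (k * q) * (K + real \<tau> * phi_bound)) * exp (real Tot * (pres + z)))"
      by (simp add: cTT)
    finally have "ln (A ^ k) \<le> ln (real (\<tau> ^ (k * q)) * (exp (real (k * q) * (K + real \<tau> * phi_bound)) * exp (real Tot * (pres + z))))"
      using A tau by (subst ln_le_cancel_iff) auto
    also have "\<dots> = real k * (real q * ln (real \<tau>)) + real k * (real q * (K + real \<tau> * phi_bound)) + real k * (real h * (pres + z))"
      using tau by (simp add: ln_mult ln_realpow Tot_def algebra_simps)
    finally have "real k * ln A \<le> real k * (real q * ln (real \<tau>) + real q * (K + real \<tau> * phi_bound) + real h * (pres + z))"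
      using A by (simp add: ln_realpow distrib_left)
    then have "ln A \<le> real q * ln (real \<tau>) + real q * (K + real \<tau> * phi_bound) + real h * (pres + z)"
      by (subst (asm) mult_le_cancel_left_pos) (auto simp: k_def)
    then show ?thesis by (simp add: algebra_simps)
  qed
  have "ln A \<le> real h * pres + real q * (K + real \<tau> * phi_bound + ln (real \<tau>)) + e" if e: "e > 0" for e
    using bound[of "e / real h"] e h by (simp add: algebra_simps)
  then have "ln A \<le> real h * pres + real q * (K + real \<tau> * phi_bound + ln (real \<tau>))" by (rule field_le_epsilon)
  then show ?thesis by (simp add: A_def W_def h_def)
qed

end

section \<open>Bounds for partition sums\<close>

lemma sum_power_le:
  fixes x :: real
  assumes "0 \<le> x" "x < 1"
  shows "(\<Sum>i\<le>n. x ^ i) \<le> 1 / (1 - x)"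
proof -
  have "(\<Sum>i\<in>{..n}. x ^ i) \<le> (\<Sum>i. x ^ i)" using assms by (intro sum_le_suminf) (auto simp: summable_geometric)
  then show ?thesis using assms by (simp add: suminf_geometric)
qed

text \<open>Pairs with a coordinate beyond \<open>M\<close> lie in a copy of the square shifted by
  \<open>Suc M\<close> in that coordinate, which contributes the factor
  \<open>x ^ Suc M\<close>.\<close>

lemma sum_power_tail:
  fixes x :: real
  assumes x: "0 \<le> x" "x < 1" and T: "T \<subseteq> {..n} \<times> {..n}" "\<And>a c. (a, c) \<in> T \<Longrightarrow> a > M \<or> c > M"
  shows "(\<Sum>(a, c)\<in>T. x ^ (a + c)) \<le> 2 * x ^ Suc M / (1 - x)\<^sup>2"
proof -
  let ?h = "\<lambda>(a, c). x ^ (a + c)" and ?Q = "{..n} \<times> {..n}"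
  let ?f1 = "\<lambda>(a, c). (Suc M + a, c)" and ?f2 = "\<lambda>(a, c). (a, Suc M + c)"
  have sub: "T \<subseteq> ?f1 ` ?Q \<union> ?f2 ` ?Q"
  proof
    fix t assume t: "t \<in> T"
    obtain a c where ac: "t = (a, c)" by (cases t)
    have le: "a \<le> n" "c \<le> n" using T(1) t ac by auto
    consider "a > M" | "c > M" using T(2) t ac by auto
    then show "t \<in> ?f1 ` ?Q \<union> ?f2 ` ?Q"
    proof cases
      case 1
      then have "t = ?f1 (a - Suc M, c)" "(a - Suc M, c) \<in> ?Q" using le ac by auto
      then show ?thesis by blast
    next
      case 2
      then have "t = ?f2 (a, c - Suc M)" "(a, c - Suc M) \<in> ?Q" using le ac by auto
      then show ?thesis by blast
    qed
  qed
  have nn: "0 \<le> ?h t" for t using x(1) by (auto simp: case_prod_beta)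
  have sq: "(\<Sum>t\<in>?Q. ?h t) \<le> 1 / (1 - x)\<^sup>2"
  proof -
    have "(\<Sum>t\<in>?Q. ?h t) = (\<Sum>i\<le>n. x ^ i) * (\<Sum>i\<le>n. x ^ i)"
      by (simp add: sum_product sum.cartesian_product case_prod_beta power_add)
    also have "\<dots> \<le> 1 / (1 - x) * (1 / (1 - x))" using sum_power_le[OF x, of n] x by (intro mult_mono) (auto simp: sum_nonneg)
    finally show ?thesis by (simp add: power2_eq_square)
  qed
  have i1: "(\<Sum>t\<in>?f1 ` ?Q. ?h t) = x ^ Suc M * (\<Sum>t\<in>?Q. ?h t)"
    by (subst sum.reindex) (auto simp: inj_on_def sum_distrib_left case_prod_beta power_add algebra_simps)
  have i2: "(\<Sum>t\<in>?f2 ` ?Q. ?h t) = x ^ Suc M * (\<Sum>t\<in>?Q. ?h t)"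
    by (subst sum.reindex) (auto simp: inj_on_def sum_distrib_left case_prod_beta power_add algebra_simps)
  have "sum ?h T \<le> sum ?h (?f1 ` ?Q \<union> ?f2 ` ?Q)" by (rule sum_mono2) (use sub nn in auto)
  also have "\<dots> \<le> sum ?h (?f1 ` ?Q) + sum ?h (?f2 ` ?Q)"
    by (subst sum.union_inter[symmetric]) (use nn in \<open>auto intro!: sum_nonneg\<close>)
  also have "\<dots> = 2 * x ^ Suc M * (\<Sum>t\<in>?Q. ?h t)" unfolding i1 i2 by simp
  also have "\<dots> \<le> 2 * x ^ Suc M * (1 / (1 - x)\<^sup>2)" using sq x by (intro mult_left_mono) auto
  finally show ?thesis by simp
qed

section \<open>Decay of bad segments and the renewal induction\<close>

locale nonuniform_spec = expansive_potential f \<phi> \<epsilon>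
  for f :: "'a::metric_space \<Rightarrow> 'a" and \<phi> :: "'a \<Rightarrow> real" and \<epsilon> :: real +
  fixes \<delta> :: real and D P G S :: "('a \<times> nat) set" and p g s :: "'a \<times> nat \<Rightarrow> nat"
  assumes delta: "\<delta> > 0" "\<epsilon> > 40 * \<delta>"
    and D: "D \<subseteq> UNIV \<times> {1..}"
    and decomp: "decomposition f D P G S p g s"
    and spec_tail: "M \<ge> 1 \<Longrightarrow> tail_W_spec f (GM D p s M) \<delta>"
    and bowen: "bowen_prop f \<phi> \<epsilon> G"
    and gap: "pressure_C f (P \<union> S \<union> ((UNIV \<times> {1..}) - D)) \<phi> \<delta> \<epsilon> < top_pressure f \<phi>"
begin

lemma Phi_ge: "e > 0 \<Longrightarrow> dn f n x y < e \<Longrightarrow> birkhoff f \<phi> n y \<le> Phi f \<phi> e x n"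
  unfolding Phi_def using birkhoff_nphi[of n]
  by (auto intro!: cSUP_upper bdd_aboveI2[where M = "real n * phi_bound"] simp: abs_le_iff)

lemma Phi_le:
  assumes "e > 0" "\<And>y. dn f n x y < e \<Longrightarrow> birkhoff f \<phi> n y \<le> c"
  shows "Phi f \<phi> e x n \<le> c"
proof -
  have "{y. dn f n x y < e} \<noteq> {}" using assms(1) dn_refl[of f n x] by (metis empty_Collect_eq)
  then show ?thesis unfolding Phi_def using assms by (auto intro!: cSUP_least)
qed

lemma Phi_mono: "0 < e \<Longrightarrow> e \<le> e' \<Longrightarrow> Phi f \<phi> e x n \<le> Phi f \<phi> e' x n"
  by (intro Phi_le Phi_ge) auto

lemma Phi_nphi: "e > 0 \<Longrightarrow> Phi f \<phi> e x n \<le> real n * phi_bound"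
  using birkhoff_nphi[of n] by (intro Phi_le) (auto simp: abs_le_iff)

abbreviation bad :: "('a \<times> nat) set" where "bad \<equiv> P \<union> S \<union> ((UNIV \<times> {1..}) - D)"

text \<open>The radius exceeds the mesh \<open>2 * \<delta>\<close> of the nets, so that the weight
  of a centre dominates the Birkhoff sums over its whole cell.\<close>

definition Z :: "nat \<Rightarrow> 'a set \<Rightarrow> real" where "Z n E = (\<Sum>x\<in>E. exp (Phi f \<phi> (3 * \<delta>) x n))"

lemma sep_finite: "r > 0 \<Longrightarrow> separated f n r E \<Longrightarrow> finite E"
  by (rule separated_bound[of r n]) auto

text \<open>The rate is a value strictly between the two pressures; \<open>C0\<close> absorbs the
  finitely many lengths below the asymptotic threshold.\<close>

lemma bad_decay:
  obtains \<kappa> C0 where "\<kappa> > 0" "C0 \<ge> 1"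
    "\<And>n E. E \<subseteq> slice bad n \<Longrightarrow> separated f n \<delta> E \<Longrightarrow> (\<Sum>x\<in>E. exp (Phi f \<phi> \<epsilon> x n)) \<le> C0 * exp (real n * (pres - \<kappa>))"
proof -
  obtain c where c: "pressure_C f bad \<phi> \<delta> \<epsilon> < ereal c" "ereal c < ereal pres"
    using ereal_dense2[OF gap] by (auto simp: top_pressure_PP)
  from pressure_less[OF c(1)] obtain N where
    N: "\<And>n E. n \<ge> N \<Longrightarrow> finite E \<Longrightarrow> E \<subseteq> slice bad n \<Longrightarrow> separated f n \<delta> E \<Longrightarrow> (\<Sum>x\<in>E. exp (Phi f \<phi> \<epsilon> x n)) \<le> exp (real n * c)"
    by auto
  have "\<exists>B. 0 \<le> B \<and> (\<forall>E. separated f n \<delta> E \<longrightarrow> (\<Sum>x\<in>E. exp (Phi f \<phi> \<epsilon> x n)) \<le> B)" for n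
    by (rule separated_sum_bound[of \<delta> "\<lambda>x. Phi f \<phi> \<epsilon> x n" "real n * phi_bound" n])
       (use delta Phi_nphi[OF eps, where n = n] in blast)+
  then obtain B where B: "\<And>n. 0 \<le> B n" "\<And>n E. separated f n \<delta> E \<Longrightarrow> (\<Sum>x\<in>E. exp (Phi f \<phi> \<epsilon> x n)) \<le> B n"
    by metis
  define C0 where "C0 = 1 + (\<Sum>n<N. B n * exp (- (real n * c)))"
  have C0: "C0 \<ge> 1" unfolding C0_def using B(1) by (simp add: sum_nonneg)
  have "(\<Sum>x\<in>E. exp (Phi f \<phi> \<epsilon> x n)) \<le> C0 * exp (real n * c)" if E: "E \<subseteq> slice bad n" "separated f n \<delta> E" for n E
  proof (cases "n \<ge> N")
    case True
    then have "(\<Sum>x\<in>E. exp (Phi f \<phi> \<epsilon> x n)) \<le> 1 * exp (real n * c)"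
      using N[OF True _ E] sep_finite[OF delta(1) E(2)] by simp
    also have "\<dots> \<le> C0 * exp (real n * c)" using C0 by (intro mult_right_mono) auto
    finally show ?thesis .
  next
    case False
    have "B n * exp (- (real n * c)) \<le> (\<Sum>n<N. B n * exp (- (real n * c)))"
      using False B(1) by (intro member_le_sum) auto
    then have "B n * exp (- (real n * c)) * exp (real n * c) \<le> C0 * exp (real n * c)"
      unfolding C0_def by (intro mult_right_mono) auto
    then have "B n \<le> C0 * exp (real n * c)" by (simp add: mult.assoc exp_add[symmetric])
    then show ?thesis using B(2)[OF E(2)] by linarith
  qed
  then show ?thesis using that[of "pres - c" C0] c(2) C0 by simp
qed

definition decay :: "real \<Rightarrow> real \<Rightarrow> bool" where
  "decay \<kappa> C0 \<longleftrightarrow> \<kappa> > 0 \<and> C0 \<ge> 1 \<and> (\<forall>n E. E \<subseteq> slice bad n \<longrightarrow> separated f n \<delta> E \<longrightarrow>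
     (\<Sum>x\<in>E. exp (Phi f \<phi> \<epsilon> x n)) \<le> C0 * exp (real n * (pres - \<kappa>)))"

text \<open>After fixing the approximate prefix and suffix, the middle parts of the orbit segments stay
  separated at the original scale, so that no scale is lost in the renewal induction.\<close>

lemma split_sum:
  assumes kc: "decay \<kappa> C0"
    and E: "separated f n (2 * \<delta>) E" "n = a + m + c"
    and dec: "\<And>x. x \<in> E \<Longrightarrow> (x, a) \<in> P \<and> ((f ^^ (a + m)) x, c) \<in> S"
    and Bm: "\<And>F. separated f m (2 * \<delta>) F \<Longrightarrow> Z m F \<le> Bm"
  shows "Z n E \<le> C0\<^sup>2 * exp (real (a + c) * (pres - \<kappa>)) * Bm"
proof -
  have finE: "finite E" by (rule sep_finite[OF _ E(1)]) (use delta in simp)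
  obtain U where U: "U \<subseteq> slice P a" "finite U" "separated f a \<delta> U" "\<And>x. x \<in> slice P a \<Longrightarrow> \<exists>e\<in>U. dn f a x e \<le> \<delta>"
    by (rule maximal_separated[OF delta(1), of "slice P a" a]) (rule that)
  obtain W where W: "W \<subseteq> slice S c" "finite W" "separated f c \<delta> W" "\<And>x. x \<in> slice S c \<Longrightarrow> \<exists>e\<in>W. dn f c x e \<le> \<delta>"
    by (rule maximal_separated[OF delta(1), of "slice S c" c]) (rule that)
  have "\<forall>x\<in>E. \<exists>u. u \<in> U \<and> dn f a x u \<le> \<delta>" using U(4) dec by (fastforce simp: slice_def)
  then obtain u where u: "\<And>x. x \<in> E \<Longrightarrow> u x \<in> U" "\<And>x. x \<in> E \<Longrightarrow> dn f a x (u x) \<le> \<delta>" by metis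
  have "\<forall>x\<in>E. \<exists>w. w \<in> W \<and> dn f c ((f ^^ (a + m)) x) w \<le> \<delta>" using W(4) dec by (fastforce simp: slice_def)
  then obtain w where w: "\<And>x. x \<in> E \<Longrightarrow> w x \<in> W" "\<And>x. x \<in> E \<Longrightarrow> dn f c ((f ^^ (a + m)) x) (w x) \<le> \<delta>" by metis
  define uw where "uw x = (u x, w x)" for x
  \<comment> \<open>A point within 3\<delta> of \<open>x\<close> is within 4\<delta> of
    \<open>u x\<close> and \<open>w x\<close> on the outer parts, hence inside the radius \<epsilon>
    for which the bad segments decay.\<close>
  have Phi_split: "Phi f \<phi> (3 * \<delta>) x n \<le> Phi f \<phi> \<epsilon> (u x) a + Phi f \<phi> (3 * \<delta>) ((f ^^ a) x) m + Phi f \<phi> \<epsilon> (w x) c"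
    if x: "x \<in> E" for x
  proof (rule Phi_le)
    fix y assume y: "dn f n x y < 3 * \<delta>"
    have "birkhoff f \<phi> n y = birkhoff f \<phi> a y + birkhoff f \<phi> m ((f ^^ a) y) + birkhoff f \<phi> c ((f ^^ (a + m)) y)"
      by (simp add: E(2) birkhoff_add)
    moreover have "birkhoff f \<phi> a y \<le> Phi f \<phi> \<epsilon> (u x) a"
      using dn_triangle[of f a "u x" y x] u(2)[OF x] dn_mono[of a n f x y] y E(2) delta eps
      by (intro Phi_ge) (auto simp: dn_commute)
    moreover have "birkhoff f \<phi> m ((f ^^ a) y) \<le> Phi f \<phi> (3 * \<delta>) ((f ^^ a) x) m"
      using dn_shift[of a m n f x y] y E(2) delta by (intro Phi_ge) auto
    moreover have "birkhoff f \<phi> c ((f ^^ (a + m)) y) \<le> Phi f \<phi> \<epsilon> (w x) c"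
      using dn_triangle[of f c "w x" "(f ^^ (a + m)) y" "(f ^^ (a + m)) x"] w(2)[OF x] dn_shift[of "a + m" c n f x y] y E(2) delta eps
      by (intro Phi_ge) (auto simp: dn_commute)
    ultimately show "birkhoff f \<phi> n y \<le> Phi f \<phi> \<epsilon> (u x) a + Phi f \<phi> (3 * \<delta>) ((f ^^ a) x) m + Phi f \<phi> \<epsilon> (w x) c" by linarith
  qed (use delta in simp)
  have fiber: "(\<Sum>x\<in>{x \<in> E. uw x = v}. exp (Phi f \<phi> (3 * \<delta>) x n)) \<le> exp (Phi f \<phi> \<epsilon> (fst v) a) * exp (Phi f \<phi> \<epsilon> (snd v) c) * Bm" for v
  proof -
    let ?F = "{x \<in> E. uw x = v}"
    have sep: "dn f m ((f ^^ a) x) ((f ^^ a) y) > 2 * \<delta>" if "x \<in> ?F" "y \<in> ?F" "x \<noteq> y" for x y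
    proof (rule ccontr)
      assume *: "\<not> ?thesis"
      have "dn f a x y \<le> 2 * \<delta>" using dn_triangle[of f a x y "u x"] u(2)[of x] u(2)[of y] that
        by (auto simp: uw_def dn_commute)
      moreover have "dn f c ((f ^^ (a + m)) x) ((f ^^ (a + m)) y) \<le> 2 * \<delta>"
        using dn_triangle[of f c "(f ^^ (a + m)) x" "(f ^^ (a + m)) y" "w x"] w(2)[of x] w(2)[of y] that
        by (auto simp: uw_def dn_commute)
      ultimately have "dn f (a + m + c) x y \<le> 2 * \<delta>" using * delta by (intro dn_split) auto
      then show False using E that by (force simp: separated_def)
    qed
    have inj: "inj_on (f ^^ a) ?F"
    proof (rule inj_onI, rule ccontr)
      fix x y assume "x \<in> ?F" "y \<in> ?F" "(f ^^ a) x = (f ^^ a) y" "x \<noteq> y"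
      then show False using sep[of x y] delta by simp
    qed
    have "separated f m (2 * \<delta>) ((f ^^ a) ` ?F)" unfolding separated_def by (auto intro!: sep)
    then have le: "Z m ((f ^^ a) ` ?F) \<le> Bm" by (rule Bm)
    have "(\<Sum>x\<in>?F. exp (Phi f \<phi> (3 * \<delta>) x n)) \<le>
      (\<Sum>x\<in>?F. exp (Phi f \<phi> \<epsilon> (fst v) a) * exp (Phi f \<phi> \<epsilon> (snd v) c) * exp (Phi f \<phi> (3 * \<delta>) ((f ^^ a) x) m))"
    proof (rule sum_mono)
      fix x assume x: "x \<in> ?F"
      then show "exp (Phi f \<phi> (3 * \<delta>) x n) \<le> exp (Phi f \<phi> \<epsilon> (fst v) a) * exp (Phi f \<phi> \<epsilon> (snd v) c) * exp (Phi f \<phi> (3 * \<delta>) ((f ^^ a) x) m)"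
        unfolding exp_add[symmetric] exp_le_cancel_iff using Phi_split[of x] by (auto simp: uw_def)
    qed
    also have "\<dots> = exp (Phi f \<phi> \<epsilon> (fst v) a) * exp (Phi f \<phi> \<epsilon> (snd v) c) * Z m ((f ^^ a) ` ?F)"
      using inj by (simp add: Z_def sum.reindex sum_distrib_left)
    also have "\<dots> \<le> exp (Phi f \<phi> \<epsilon> (fst v) a) * exp (Phi f \<phi> \<epsilon> (snd v) c) * Bm" using le by (intro mult_left_mono) auto
    finally show ?thesis .
  qed
  have Bm0: "0 \<le> Bm" using Bm[of "{}"] by (simp add: Z_def)
  have sU: "(\<Sum>x\<in>U. exp (Phi f \<phi> \<epsilon> x a)) \<le> C0 * exp (real a * (pres - \<kappa>))"
    using kc U(1,3) by (auto simp: decay_def slice_def)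
  have sW: "(\<Sum>x\<in>W. exp (Phi f \<phi> \<epsilon> x c)) \<le> C0 * exp (real c * (pres - \<kappa>))"
    using kc W(1,3) by (auto simp: decay_def slice_def)
  have "Z n E = (\<Sum>v\<in>U \<times> W. \<Sum>x\<in>{x \<in> E. uw x = v}. exp (Phi f \<phi> (3 * \<delta>) x n))"
    unfolding Z_def using u(1) w(1) by (intro sum.group[OF finE, symmetric]) (auto simp: U W uw_def)
  also have "\<dots> \<le> (\<Sum>v\<in>U \<times> W. exp (Phi f \<phi> \<epsilon> (fst v) a) * exp (Phi f \<phi> \<epsilon> (snd v) c) * Bm)"
    by (intro sum_mono fiber)
  also have "\<dots> = (\<Sum>x\<in>U. exp (Phi f \<phi> \<epsilon> x a)) * (\<Sum>x\<in>W. exp (Phi f \<phi> \<epsilon> x c)) * Bm"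
    by (simp add: sum_product sum.cartesian_product case_prod_beta sum_distrib_right[symmetric])
  also have "\<dots> \<le> (C0 * exp (real a * (pres - \<kappa>))) * (C0 * exp (real c * (pres - \<kappa>))) * Bm"
    using sU sW Bm0 kc by (intro mult_right_mono mult_mono) (auto simp: sum_nonneg decay_def)
  also have "\<dots> = C0\<^sup>2 * exp (real (a + c) * (pres - \<kappa>)) * Bm"
    by (simp add: power2_eq_square exp_add[symmetric] algebra_simps)
  finally show ?thesis .
qed

text \<open>The bound of \<open>sum_power_tail\<close> at \<open>exp (- \<kappa>)\<close>: the total
  weight of all pairs of prefix and suffix lengths of which one exceeds \<open>M\<close>.\<close>

definition tail_weight :: "real \<Rightarrow> nat \<Rightarrow> real" where
  "tail_weight \<kappa> M = 2 * exp (- \<kappa>) ^ Suc M / (1 - exp (- \<kappa>))\<^sup>2"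

lemma tail_weight_tendsto: "\<kappa> > 0 \<Longrightarrow> tail_weight \<kappa> \<longlonglongrightarrow> 0"
proof -
  assume "\<kappa> > 0"
  then have "(\<lambda>M. exp (- \<kappa>) ^ Suc M) \<longlonglongrightarrow> 0" by (intro LIMSEQ_Suc LIMSEQ_power_zero) simp
  from tendsto_mult_left[OF this, of "2 / (1 - exp (- \<kappa>))\<^sup>2"] show ?thesis
    by (simp add: tail_weight_def[abs_def] mult.commute)
qed

text \<open>A segment outside the good collection either misses \<open>D\<close> and is bad itself,
  or has a prefix or suffix longer than \<open>M\<close>. The latter are grouped by the two lengths;
  their middle part is strictly shorter than \<open>n\<close>, which lets the induction
  proceed.\<close>

lemma bad_sum:
  assumes kc: "decay \<kappa> C0" and E: "separated f n (2 * \<delta>) E" "E \<inter> slice (GM D p s M) n = {}" and n: "n \<ge> 1"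
    and B: "B \<ge> 0" "\<And>m F. m < n \<Longrightarrow> separated f m (2 * \<delta>) F \<Longrightarrow> Z m F \<le> B * exp (real m * pres)"
  shows "Z n E \<le> exp (real n * pres) * (C0 * exp (- (real n * \<kappa>)) + B * C0\<^sup>2 * tail_weight \<kappa> M)"
proof -
  have finE: "finite E" by (rule sep_finite[OF _ E(1)]) (use delta in simp)
  have k: "\<kappa> > 0" "C0 \<ge> 1" using kc by (auto simp: decay_def)
  define E0 where "E0 = {x \<in> E. (x, n) \<notin> D}"
  define E1 where "E1 = {x \<in> E. (x, n) \<in> D}"
  define ps where "ps x = (p (x, n), s (x, n))" for x
  have dec: "p (x, n) + g (x, n) + s (x, n) = n" "(x, p (x, n)) \<in> P" "((f ^^ (p (x, n) + g (x, n))) x, s (x, n)) \<in> S"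
    if "(x, n) \<in> D" for x using decomp that unfolding decomposition_def by fast+
  have ZE0: "Z n E0 \<le> exp (real n * pres) * (C0 * exp (- (real n * \<kappa>)))"
  proof -
    have "Z n E0 \<le> (\<Sum>x\<in>E0. exp (Phi f \<phi> \<epsilon> x n))" unfolding Z_def
      using Phi_mono[of "3 * \<delta>" \<epsilon> _ n] delta by (intro sum_mono) auto
    also have "\<dots> \<le> C0 * exp (real n * (pres - \<kappa>))"
    proof -
      have "E0 \<subseteq> slice bad n" using n by (auto simp: E0_def slice_def)
      moreover have "separated f n \<delta> E0" using E(1) delta by (force simp: separated_def E0_def)
      ultimately show ?thesis using kc by (simp add: decay_def)
    qed
    also have "\<dots> = exp (real n * pres) * (C0 * exp (- (real n * \<kappa>)))"
      by (simp add: exp_add[symmetric] algebra_simps exp_diff exp_minus divide_inverse)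
    finally show ?thesis .
  qed
  have fiber: "(\<Sum>x\<in>{x \<in> E1. ps x = v}. exp (Phi f \<phi> (3 * \<delta>) x n)) \<le> exp (real n * pres) * (B * C0\<^sup>2) * exp (- \<kappa>) ^ (fst v + snd v)"
    if v: "v \<in> ps ` E1" for v
  proof -
    obtain a c where ac: "v = (a, c)" by (cases v)
    obtain x where x: "x \<in> E1" "p (x, n) = a" "s (x, n) = c" using v ac by (auto simp: ps_def)
    define m where "m = g (x, n)"
    have nm: "n = a + m + c" using dec(1)[of x] x by (auto simp: E1_def m_def)
    have "a > M \<or> c > M" using x E(2) by (auto simp: E1_def GM_def slice_def)
    then have m: "m < n" using nm by linarith
    have "Z n {x \<in> E1. ps x = v} \<le> C0\<^sup>2 * exp (real (a + c) * (pres - \<kappa>)) * (B * exp (real m * pres))"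
    proof (rule split_sum[OF kc _ nm])
      show "separated f n (2 * \<delta>) {x \<in> E1. ps x = v}" using E(1) by (rule separated_subset) (auto simp: E1_def)
      fix y assume "y \<in> {x \<in> E1. ps x = v}"
      then have y: "(y, n) \<in> D" "p (y, n) = a" "s (y, n) = c" by (auto simp: E1_def ps_def ac)
      moreover have "g (y, n) = m" using dec(1)[OF y(1)] y nm by simp
      ultimately show "(y, a) \<in> P \<and> ((f ^^ (a + m)) y, c) \<in> S" using dec(2,3)[OF y(1)] by simp
    qed (rule B(2)[OF m])
    also have "\<dots> = exp (real n * pres) * (B * C0\<^sup>2) * (exp (real (a + c) * (- \<kappa>)))"
    proof -
      have "real (a + c) * (pres - \<kappa>) + real m * pres = real n * pres + real (a + c) * (- \<kappa>)"
        unfolding nm by (simp add: algebra_simps)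
      then have "exp (real (a + c) * (pres - \<kappa>)) * exp (real m * pres) = exp (real n * pres) * exp (real (a + c) * (- \<kappa>))"
        unfolding exp_add[symmetric] by simp
      then show ?thesis by (simp add: mult_ac)
    qed
    also have "exp (real (a + c) * (- \<kappa>)) = exp (- \<kappa>) ^ (a + c)" by (rule exp_of_nat_mult)
    finally show ?thesis by (simp add: Z_def ac)
  qed
  have "Z n E1 = (\<Sum>v\<in>ps ` E1. \<Sum>x\<in>{x \<in> E1. ps x = v}. exp (Phi f \<phi> (3 * \<delta>) x n))"
    unfolding Z_def using finE by (intro sum.group[symmetric]) (auto simp: E1_def)
  also have "\<dots> \<le> (\<Sum>v\<in>ps ` E1. exp (real n * pres) * (B * C0\<^sup>2) * exp (- \<kappa>) ^ (fst v + snd v))"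
    by (intro sum_mono fiber)
  also have "\<dots> = exp (real n * pres) * (B * C0\<^sup>2) * (\<Sum>(a, c)\<in>ps ` E1. exp (- \<kappa>) ^ (a + c))"
    by (simp add: sum_distrib_left case_prod_beta)
  also have "\<dots> \<le> exp (real n * pres) * (B * C0\<^sup>2) * tail_weight \<kappa> M"
  proof (rule mult_left_mono)
    show "(\<Sum>(a, c)\<in>ps ` E1. exp (- \<kappa>) ^ (a + c)) \<le> tail_weight \<kappa> M"
      unfolding tail_weight_def
    proof (rule sum_power_tail[of _ _ n])
      have "p (x, n) \<le> n" "s (x, n) \<le> n" if "(x, n) \<in> D" for x using dec(1)[OF that] by auto
      then show "ps ` E1 \<subseteq> {..n} \<times> {..n}" by (auto simp: ps_def E1_def)
      show "a > M \<or> c > M" if "(a, c) \<in> ps ` E1" for a c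
        using that E(2) by (auto simp: E1_def GM_def slice_def ps_def)
    qed (use k in auto)
  qed (use B(1) in simp)
  finally have ZE1: "Z n E1 \<le> exp (real n * pres) * (B * C0\<^sup>2 * tail_weight \<kappa> M)" by (simp add: mult.assoc)
  have "Z n E = Z n E0 + Z n E1"
    unfolding Z_def using finE by (subst sum.union_disjoint[symmetric]) (auto simp: E0_def E1_def intro!: sum.cong)
  then show ?thesis using ZE0 ZE1 by (simp add: distrib_left)
qed

lemma spec_GM:
  assumes "M \<ge> 1"
  obtains \<tau> N0 where "\<tau> \<ge> 1"
    "\<And>(k::nat) xs ns. \<forall>i<k. (xs i, ns i) \<in> {(x, n) \<in> GM D p s M. n \<ge> N0} \<Longrightarrow>
      \<exists>y ts. (\<forall>i. i + 1 < k \<longrightarrow> 1 \<le> ts i \<and> ts i \<le> \<tau>) \<and> (\<forall>j<k. dn f (ns j) ((f ^^ (\<Sum>i<j. ns i + ts i)) y) (xs j) < \<delta>)"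
proof -
  obtain N0 where "W_spec f {(x, n) \<in> GM D p s M. n \<ge> N0} \<delta>"
    using spec_tail[OF assms] by (auto simp: tail_W_spec_def)
  then obtain \<tau> :: nat where t: "\<tau> \<ge> 1" "\<forall>(k::nat) xs ns. (\<forall>i<k. (xs i, ns i) \<in> {(x, n) \<in> GM D p s M. n \<ge> N0}) \<longrightarrow>
      (\<exists>y ts. (\<forall>i. i + 1 < k \<longrightarrow> 1 \<le> ts i \<and> ts i \<le> \<tau>) \<and> (\<forall>j<k. dn f (ns j) ((f ^^ (\<Sum>i<j. ns i + ts i)) y) (xs j) < \<delta>))"
    unfolding W_spec_def by (elim exE conjE) (rule that)
  show ?thesis by (rule that[OF t(1)]) (rule mp[OF spec[OF spec[OF spec[OF t(2)]]]])
qed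

text \<open>The middle part lies in \<open>G\<close>; prefix and suffix have length at most
  \<open>M\<close> and are bounded trivially for each of the two points, which makes four terms
  \<open>M * phi_bound\<close>.\<close>

lemma bowen_GM:
  obtains K where "K \<ge> 0"
    "\<And>x n y. (x, n) \<in> GM D p s M \<Longrightarrow> dn f n x y < \<epsilon> \<Longrightarrow> \<bar>birkhoff f \<phi> n x - birkhoff f \<phi> n y\<bar> \<le> K"
proof -
  obtain K where K: "\<forall>(x, n)\<in>G. \<forall>y. dn f n x y < \<epsilon> \<longrightarrow> \<bar>birkhoff f \<phi> n x - birkhoff f \<phi> n y\<bar> \<le> K"
    using bowen by (auto simp: bowen_prop_def)
  have "\<bar>birkhoff f \<phi> n x - birkhoff f \<phi> n y\<bar> \<le> \<bar>K\<bar> + 4 * real M * phi_bound"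
    if x: "(x, n) \<in> GM D p s M" and y: "dn f n x y < \<epsilon>" for x n y
  proof -
    define a m c where "a = p (x, n)" and "m = g (x, n)" and "c = s (x, n)"
    have xD: "(x, n) \<in> D" "a \<le> M" "c \<le> M" using x by (auto simp: GM_def a_def c_def)
    have "p (x, n) + g (x, n) + s (x, n) = n \<and> ((f ^^ p (x, n)) x, g (x, n)) \<in> G"
      using decomp xD(1) unfolding decomposition_def by fast
    then have n: "n = a + m + c" and G: "((f ^^ a) x, m) \<in> G" by (simp_all add: a_def m_def c_def)
    have "dn f m ((f ^^ a) x) ((f ^^ a) y) < \<epsilon>" using dn_shift[of a m n f x y] y n by simp
    then have "\<bar>birkhoff f \<phi> m ((f ^^ a) x) - birkhoff f \<phi> m ((f ^^ a) y)\<bar> \<le> K" using K G by blast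
    moreover have "\<bar>birkhoff f \<phi> a z\<bar> \<le> real M * phi_bound" "\<bar>birkhoff f \<phi> c z\<bar> \<le> real M * phi_bound" for z
      using birkhoff_nphi[of a z] birkhoff_nphi[of c z] mult_right_mono[of "real a" "real M" phi_bound]
        mult_right_mono[of "real c" "real M" phi_bound] phi_bound(1) xD by auto
    note this(1)[of x] this(1)[of y] this(2)[of "(f ^^ (a + m)) x"] this(2)[of "(f ^^ (a + m)) y"]
    ultimately show ?thesis unfolding n birkhoff_add by linarith
  qed
  then show ?thesis using phi_bound(1) by (intro that[of "\<bar>K\<bar> + 4 * real M * phi_bound"]) auto
qed

lemma Phi_le_birkhoff:
  assumes "\<And>x n y. (x, n) \<in> GM D p s M \<Longrightarrow> dn f n x y < \<epsilon> \<Longrightarrow> \<bar>birkhoff f \<phi> n x - birkhoff f \<phi> n y\<bar> \<le> K"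
    and "(x, n) \<in> GM D p s M"
  shows "Phi f \<phi> (3 * \<delta>) x n \<le> birkhoff f \<phi> n x + K"
proof (rule Phi_le)
  fix y assume "dn f n x y < 3 * \<delta>"
  then show "birkhoff f \<phi> n y \<le> birkhoff f \<phi> n x + K" using assms(1)[OF assms(2), of y] delta by (simp add: abs_le_iff)
qed (use delta in simp)

text \<open>Gluing with one segment per block and \<open>E\<close> itself as the family of choices.
  Specification holds from length \<open>N0\<close> on; shorter lengths are absorbed into
  \<open>C\<close>.\<close>

lemma GM_sum:
  assumes M: "M \<ge> 1"
  obtains C where "C \<ge> 0" "\<And>n E. E \<subseteq> slice (GM D p s M) n \<Longrightarrow> separated f n (2 * \<delta>) E \<Longrightarrow> Z n E \<le> C * exp (real n * pres)"
proof -
  obtain \<tau> N0 where sp: "\<tau> \<ge> 1"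
    "\<And>(k::nat) xs ns. \<forall>i<k. (xs i, ns i) \<in> {(x, n) \<in> GM D p s M. n \<ge> N0} \<Longrightarrow>
      \<exists>y ts. (\<forall>i. i + 1 < k \<longrightarrow> 1 \<le> ts i \<and> ts i \<le> \<tau>) \<and> (\<forall>j<k. dn f (ns j) ((f ^^ (\<Sum>i<j. ns i + ts i)) y) (xs j) < \<delta>)"
    by (rule spec_GM[OF M]) (rule that)
  obtain K where K: "K \<ge> 0" "\<And>x n y. (x, n) \<in> GM D p s M \<Longrightarrow> dn f n x y < \<epsilon> \<Longrightarrow> \<bar>birkhoff f \<phi> n x - birkhoff f \<phi> n y\<bar> \<le> K"
    by (rule bowen_GM) (rule that)
  define c where "c = real \<tau> * pres + (K + real \<tau> * phi_bound + ln (real \<tau>))"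
  have large: "Z n E \<le> exp (K + c) * exp (real n * pres)"
    if n: "n \<ge> N0" and E: "E \<subseteq> slice (GM D p s M) n" "separated f n (2 * \<delta>) E" for n E
  proof (cases "E = {}")
    case False
    have finE: "finite E" by (rule sep_finite[OF _ E(2)]) (use delta in simp)
    \<comment> \<open>Shadowing moves each of two points by less than \<delta>, so their distance
      stays above its excess over 2\<delta>; \<open>R\<close> is the least excess in
      \<open>E\<close>. The entry 1 covers sets without pairs.\<close>
    define R where "R = Min (insert 1 ((\<lambda>(x, y). dn f n x y - 2 * \<delta>) ` {(x, y). x \<in> E \<and> y \<in> E \<and> x \<noteq> y}))"
    have "finite {(x, y). x \<in> E \<and> y \<in> E \<and> x \<noteq> y}" by (rule finite_subset[of _ "E \<times> E"]) (use finE in auto)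
    then have fin: "finite (insert 1 ((\<lambda>(x, y). dn f n x y - 2 * \<delta>) ` {(x, y). x \<in> E \<and> y \<in> E \<and> x \<noteq> y}))" by simp
    have R: "R > 0" unfolding R_def using fin E(2) by (subst Min_gr_iff) (auto simp: separated_def)
    have Rle: "R \<le> dn f n x y - 2 * \<delta>" if "x \<in> E" "y \<in> E" "x \<noteq> y" for x y
      unfolding R_def using that by (intro Min_le[OF fin]) force
    have "ln (\<Sum>x\<in>E. exp (\<Sum>j<(1::nat). birkhoff f \<phi> n x))
        \<le> real (n + 1 * \<tau>) * pres + real 1 * (K + real \<tau> * phi_bound + ln (real \<tau>))"
    proof (rule glue[where C = "{(x, n) \<in> GM D p s M. n \<ge> N0}" and \<delta> = \<delta> and r = R and K = K and X = "\<lambda>x _. x" and N = "\<lambda>_ _. n"])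
      show "birkhoff f \<phi> n x \<le> birkhoff f \<phi> n y + K" if "(x, n) \<in> {(x, n) \<in> GM D p s M. n \<ge> N0}" "dn f n y x < \<delta>" for x n y
        using K(2)[of x n y] that delta eps by (auto simp: dn_commute abs_le_iff)
      fix b b' t y y'
      assume b: "b \<in> E" "b' \<in> E" "b \<noteq> b'" and "\<forall>j<(1::nat). dn f n ((f ^^ (\<Sum>i<j. n + t i)) y) b < \<delta>"
        "\<forall>j<(1::nat). dn f n ((f ^^ (\<Sum>i<j. n + t i)) y') b' < \<delta>"
      then have "dn f n y b < \<delta>" "dn f n y' b' < \<delta>" by simp_all
      then have "dn f n y y' > dn f n b b' - 2 * \<delta>"
        using dn_triangle[of f n b b' y] dn_triangle[of f n y b' y'] by (simp add: dn_commute)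
      then show "R < dn f (n + 1 * \<tau>) y y'" using Rle[OF b] dn_mono[of n "n + 1 * \<tau>" f y y'] by simp
    qed (use sp finE False E n R in \<open>auto simp: slice_def\<close>)
    then have ln: "ln (\<Sum>x\<in>E. exp (birkhoff f \<phi> n x)) \<le> real n * pres + c" by (simp add: c_def distrib_right)
    have pos: "(\<Sum>x\<in>E. exp (birkhoff f \<phi> n x)) > 0" using finE False by (intro sum_pos) auto
    have "Z n E \<le> (\<Sum>x\<in>E. exp K * exp (birkhoff f \<phi> n x))"
      unfolding Z_def exp_add[symmetric] using E(1) Phi_le_birkhoff[OF K(2)]
      by (intro sum_mono) (auto simp: slice_def add.commute)
    also have "\<dots> = exp K * (\<Sum>x\<in>E. exp (birkhoff f \<phi> n x))" by (simp add: sum_distrib_left)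
    also have "\<dots> \<le> exp K * exp (real n * pres + c)"
      using ln pos by (intro mult_left_mono) (metis exp_le_cancel_iff exp_ln, simp)
    finally show ?thesis by (simp add: exp_add mult_ac)
  qed (simp add: Z_def)
  have "\<exists>B. 0 \<le> B \<and> (\<forall>E. separated f n (2 * \<delta>) E \<longrightarrow> Z n E \<le> B)" for n
    unfolding Z_def
    by (rule separated_sum_bound[of "2 * \<delta>" "\<lambda>x. Phi f \<phi> (3 * \<delta>) x n" "real n * phi_bound" n])
       (use delta Phi_nphi[of "3 * \<delta>" _ n] in auto)
  then obtain B where B: "\<And>n. 0 \<le> B n" "\<And>n E. separated f n (2 * \<delta>) E \<Longrightarrow> Z n E \<le> B n" by metis
  define C where "C = exp (K + c) + (\<Sum>n<N0. B n * exp (- (real n * pres)))"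
  have C: "C \<ge> exp (K + c)" unfolding C_def using B(1) by (simp add: sum_nonneg)
  have "Z n E \<le> C * exp (real n * pres)" if E: "E \<subseteq> slice (GM D p s M) n" "separated f n (2 * \<delta>) E" for n E
  proof (cases "n \<ge> N0")
    case True
    show ?thesis by (rule order_trans[OF large[OF True E] mult_right_mono[OF C]]) simp
  next
    case False
    have "B n * exp (- (real n * pres)) \<le> (\<Sum>n<N0. B n * exp (- (real n * pres)))"
      using False B(1) by (intro member_le_sum) auto
    then have "B n * exp (- (real n * pres)) * exp (real n * pres) \<le> C * exp (real n * pres)"
      unfolding C_def by (intro mult_right_mono) (auto simp: add_increasing)
    then have "B n \<le> C * exp (real n * pres)" by (simp add: mult.assoc exp_add[symmetric])
    then show ?thesis using B(2)[OF E(2)] by linarith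
  qed
  moreover have "C \<ge> 0" using C exp_gt_zero[of "K + c"] by linarith
  ultimately show ?thesis using that by blast
qed

text \<open>\<open>M\<close> is chosen so that segments with a long prefix or suffix reproduce at
  most half of the inductive bound, and \<open>B\<close> solves
  \<open>C + (C0 + B / 2) = B\<close>.\<close>

lemma upper_bound:
  obtains B where "B \<ge> 1" "\<And>n E. separated f n (2 * \<delta>) E \<Longrightarrow> Z n E \<le> B * exp (real n * pres)"
proof -
  obtain \<kappa> C0 where kc: "decay \<kappa> C0" unfolding decay_def by (rule bad_decay) blast
  then have k: "\<kappa> > 0" "C0 \<ge> 1" by (auto simp: decay_def)
  have "(\<lambda>M. C0\<^sup>2 * tail_weight \<kappa> M) \<longlonglongrightarrow> C0\<^sup>2 * 0" by (intro tendsto_mult_left tail_weight_tendsto k)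
  then have "eventually (\<lambda>M. C0\<^sup>2 * tail_weight \<kappa> M < 1 / 2) sequentially" by (rule order_tendstoD) simp
  then have "eventually (\<lambda>M. C0\<^sup>2 * tail_weight \<kappa> M < 1 / 2 \<and> M \<ge> 1) sequentially"
    using eventually_ge_at_top[of 1] by (rule eventually_conj)
  then obtain M where M: "C0\<^sup>2 * tail_weight \<kappa> M < 1 / 2" "M \<ge> 1" by (auto simp: eventually_sequentially)
  obtain C where C: "C \<ge> 0" "\<And>n E. E \<subseteq> slice (GM D p s M) n \<Longrightarrow> separated f n (2 * \<delta>) E \<Longrightarrow> Z n E \<le> C * exp (real n * pres)"
    by (rule GM_sum[OF M(2)]) (rule that)
  define B where "B = 2 * (C + C0)"
  have "separated f n (2 * \<delta>) E \<Longrightarrow> Z n E \<le> B * exp (real n * pres)" for n E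
  proof (induction n arbitrary: E rule: less_induct)
    case (less n)
    have finE: "finite E" by (rule sep_finite[OF _ less.prems]) (use delta in simp)
    show ?case
    proof (cases "n = 0")
      \<comment> \<open>At length 0 all distances vanish, so a separated set has at most one point,
        of weight at most 1.\<close>
      case True
      have "card E \<le> 1"
      proof -
        have "x = y" if "x \<in> E" "y \<in> E" for x y
          using less.prems that delta by (force simp: separated_def True dn_def)
        then show ?thesis unfolding One_nat_def card_le_Suc0_iff_eq[OF finE] by blast
      qed
      moreover have "Z n E \<le> (\<Sum>x\<in>E. 1)" unfolding Z_def
        using Phi_nphi[of "3 * \<delta>" _ n] delta True by (intro sum_mono) auto
      ultimately have "Z n E \<le> 1" by simp
      then show ?thesis using True k C by (simp add: B_def)
    next
      case False
      let ?G = "E \<inter> slice (GM D p s M) n" and ?H = "E - slice (GM D p s M) n"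
      have ZG: "Z n ?G \<le> C * exp (real n * pres)"
        by (rule C(2)) (auto intro: separated_subset[OF less.prems])
      have "Z n ?H \<le> exp (real n * pres) * (C0 * exp (- (real n * \<kappa>)) + B * C0\<^sup>2 * tail_weight \<kappa> M)"
        using less.IH False k C(1)
        by (intro bad_sum[OF kc]) (auto intro: separated_subset[OF less.prems] simp: B_def)
      also have "\<dots> \<le> exp (real n * pres) * (C0 + B / 2)"
      proof (intro mult_left_mono add_mono)
        show "C0 * exp (- (real n * \<kappa>)) \<le> C0" using k by (simp add: mult_left_le)
        have "B * (C0\<^sup>2 * tail_weight \<kappa> M) \<le> B * (1 / 2)" using M(1) C(1) k by (intro mult_left_mono) (auto simp: B_def)
        then show "B * C0\<^sup>2 * tail_weight \<kappa> M \<le> B / 2" by (simp add: mult.assoc)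
      qed simp
      finally have ZH: "Z n ?H \<le> exp (real n * pres) * (C0 + B / 2)" .
      have "Z n E = Z n ?G + Z n ?H"
        unfolding Z_def using finE by (subst sum.union_disjoint[symmetric]) (auto intro!: sum.cong)
      also have "\<dots> \<le> (C + (C0 + B / 2)) * exp (real n * pres)" using ZG ZH by (simp add: distrib_right distrib_left mult.commute)
      also have "C + (C0 + B / 2) = B" by (simp add: B_def)
      finally show ?thesis .
    qed
  qed
  moreover have "B \<ge> 1" using C k by (simp add: B_def)
  ultimately show ?thesis using that by blast
qed

end

text \<open>A group of cells contributes its total mass times \<open>t\<close>, plus the
  \<open>eta\<close> of its total mass, which is at most 1.\<close>

lemma log_sum_group:
  fixes q a :: "'i \<Rightarrow> real"
  assumes I: "finite I" and q: "\<And>i. i \<in> I \<Longrightarrow> 0 \<le> q i" and Z: "(\<Sum>i\<in>I. exp (a i)) \<le> exp t"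
  shows "(\<Sum>i\<in>I. eta (q i) + q i * a i) \<le> (\<Sum>i\<in>I. q i) * t + 1"
proof (cases "I = {}")
  case False
  have nn: "0 \<le> (\<Sum>i\<in>I. q i)" using q by (rule sum_nonneg)
  have "(\<Sum>i\<in>I. exp (a i)) > 0" using I False by (intro sum_pos) auto
  then have "ln (\<Sum>i\<in>I. exp (a i)) \<le> t" using Z by (metis ln_exp ln_le_cancel_iff exp_gt_zero)
  then have "(\<Sum>i\<in>I. q i) * ln (\<Sum>i\<in>I. exp (a i)) \<le> (\<Sum>i\<in>I. q i) * t" using nn by (rule mult_left_mono)
  moreover have "eta (\<Sum>i\<in>I. q i) \<le> 1" using eta_le[OF nn] nn by linarith
  ultimately show ?thesis using log_sum_le[OF I q, where a = a] by force
qed simp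

context nonuniform_spec
begin

text \<open>An equilibrium state gives weight at least \<open>3/4\<close> to \<open>A\<close>. If the part of \<open>A\<close> in \<open>\<G>\<^sup>M\<close> had too small
  a partition sum, then, as bad orbit segments carry little pressure too, the entropy could not
  be made up for by the remaining quarter of the mass.\<close>

lemma lower_bound:
  obtains c M N1 where "c > 0" "M \<ge> 1" "N1 \<ge> 1"
    "\<And>m n A. borel_mpt m f \<Longrightarrow> free_energy f \<phi> m = top_pressure f \<phi> \<Longrightarrow> n \<ge> N1 \<Longrightarrow> A \<in> sets borel \<Longrightarrow>
      measure m A \<ge> 3 / 4 \<Longrightarrow> \<exists>E. finite E \<and> E \<subseteq> A \<inter> slice (GM D p s M) n \<and> separated f n (2 * \<delta>) E \<and>
        (\<Sum>x\<in>E. exp (birkhoff f \<phi> n x)) \<ge> c * exp (real n * pres)"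
proof -
  obtain \<kappa> C0 where kc: "decay \<kappa> C0" unfolding decay_def by (rule bad_decay) blast
  then have k: "\<kappa> > 0" "C0 \<ge> 1" by (auto simp: decay_def)
  obtain B where B: "B \<ge> 1" "\<And>n E. separated f n (2 * \<delta>) E \<Longrightarrow> Z n E \<le> B * exp (real n * pres)"
    by (rule upper_bound) (rule that)
  \<comment> \<open>The three groups of cells cost 3 in entropy, and the last one, of mass at most
    1/4, may have weight \<open>B\<close>. The value ensures
    \<open>3 / 4 * L > 3 + ln B / 4\<close>, against which the final estimate fails.\<close>
  define L where "L = 4 * (3 + ln B) + 1"
  have "(\<lambda>M. B * C0\<^sup>2 * tail_weight \<kappa> M) \<longlonglongrightarrow> B * C0\<^sup>2 * 0" by (intro tendsto_mult_left tail_weight_tendsto k)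
  then have "eventually (\<lambda>M. B * C0\<^sup>2 * tail_weight \<kappa> M < exp (- L) / 2) sequentially" by (rule order_tendstoD) simp
  then have "eventually (\<lambda>M. B * C0\<^sup>2 * tail_weight \<kappa> M < exp (- L) / 2 \<and> M \<ge> 1) sequentially"
    using eventually_ge_at_top[of 1] by (rule eventually_conj)
  then obtain M where M: "B * C0\<^sup>2 * tail_weight \<kappa> M < exp (- L) / 2" "M \<ge> 1" by (auto simp: eventually_sequentially)
  have "(\<lambda>n. C0 * exp (- \<kappa>) ^ n) \<longlonglongrightarrow> C0 * 0" using k by (intro tendsto_mult_left LIMSEQ_power_zero) simp
  then have "eventually (\<lambda>n. C0 * exp (- \<kappa>) ^ n < exp (- L) / 2) sequentially" by (rule order_tendstoD) simp
  then obtain N where N: "\<And>n. n \<ge> N \<Longrightarrow> C0 * exp (- \<kappa>) ^ n < exp (- L) / 2" by (auto simp: eventually_sequentially)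
  obtain K where K: "K \<ge> 0" "\<And>x n y. (x, n) \<in> GM D p s M \<Longrightarrow> dn f n x y < \<epsilon> \<Longrightarrow> \<bar>birkhoff f \<phi> n x - birkhoff f \<phi> n y\<bar> \<le> K"
    by (rule bowen_GM) (rule that)
  define c where "c = exp (- L - K)"
  have "\<exists>E. finite E \<and> E \<subseteq> A \<inter> slice (GM D p s M) n \<and> separated f n (2 * \<delta>) E \<and>
      (\<Sum>x\<in>E. exp (birkhoff f \<phi> n x)) \<ge> c * exp (real n * pres)"
    if m: "borel_mpt m f" "free_energy f \<phi> m = top_pressure f \<phi>" and n: "n \<ge> max N 1"
      and A: "A \<in> sets borel" "measure m A \<ge> 3 / 4" for m n A
  proof -
    interpret borel_mpt m f by (rule m)
    let ?G = "slice (GM D p s M) n"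
    obtain E1 where E1: "E1 \<subseteq> A \<inter> ?G" "finite E1" "separated f n (2 * \<delta>) E1" "\<And>x. x \<in> A \<inter> ?G \<Longrightarrow> \<exists>e\<in>E1. dn f n x e \<le> 2 * \<delta>"
      by (rule maximal_separated[of "2 * \<delta>" "A \<inter> ?G" n]) (use delta in simp, rule that)
    obtain E2 where E2: "E2 \<subseteq> - ?G" "finite E2" "separated f n (2 * \<delta>) E2" "\<And>x. x \<in> - ?G \<Longrightarrow> \<exists>e\<in>E2. dn f n x e \<le> 2 * \<delta>"
      by (rule maximal_separated[of "2 * \<delta>" "- ?G" n]) (use delta in simp, rule that)
    obtain E3 where E3: "E3 \<subseteq> ?G - A" "finite E3" "separated f n (2 * \<delta>) E3" "\<And>x. x \<in> ?G - A \<Longrightarrow> \<exists>e\<in>E3. dn f n x e \<le> 2 * \<delta>"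
      by (rule maximal_separated[of "2 * \<delta>" "?G - A" n]) (use delta in simp, rule that)
    obtain l1 where l1: "set l1 = E1" using finite_list[OF E1(2)] by blast
    obtain l2 where l2: "set l2 = E2" using finite_list[OF E2(2)] by blast
    obtain l3 where l3: "set l3 = E3" using finite_list[OF E3(2)] by blast
    \<comment> \<open>Centres are tried in the order \<open>A \<inter> ?G\<close>,
      \<open>- ?G\<close>, \<open>?G - A\<close>. Every point of \<open>A\<close> is caught by one
      of the first two nets, so the cells of the third lie outside \<open>A\<close> and have total
      mass at most 1/4.\<close>
    define X where "X = pick f n (2 * \<delta>) (l1 @ l2 @ l3)"
    have Xin: "X y \<in> E1 \<union> E2 \<union> E3" "dn f n y (X y) \<le> 2 * \<delta>" for y
    proof -
      have "y \<in> A \<inter> ?G \<or> y \<in> - ?G \<or> y \<in> ?G - A" by blast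
      then have "\<exists>x\<in>set (l1 @ l2 @ l3). dn f n y x \<le> 2 * \<delta>"
        using E1(4)[of y] E2(4)[of y] E3(4)[of y] by (auto simp: l1 l2 l3)
      from pick_in[OF this] show "X y \<in> E1 \<union> E2 \<union> E3" "dn f n y (X y) \<le> 2 * \<delta>" by (auto simp: X_def l1 l2 l3)
    qed
    have X: "finmeas m X" unfolding X_def by (rule pick_finmeas[OF sets_eq]) (use delta in simp)
    have XE3: "y \<notin> A" if y: "X y \<in> E3" for y
    proof
      assume yA: "y \<in> A"
      show False
      proof (cases "y \<in> ?G")
        case True
        then have "\<exists>x\<in>set l1. dn f n y x \<le> 2 * \<delta>" using yA E1(4) l1 by auto
        then have "X y \<in> E1" unfolding X_def pick_append using pick_in l1 by metis
        then show False using y E1(1) E3(1) by auto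
      next
        case False
        then have e: "\<exists>x\<in>set l2. dn f n y x \<le> 2 * \<delta>" using E2(4) l2 by auto
        have "X y \<in> E1 \<union> E2"
        proof (cases "\<exists>x\<in>set l1. dn f n y x \<le> 2 * \<delta>")
          case True
          then show ?thesis using pick_in[OF True] l1 by (simp add: X_def pick_append)
        next
          case F: False
          show ?thesis using pick_in[OF e] e F l2 by (simp add: X_def pick_append)
        qed
        then show False using y E1(1) E2(1) E3(1) by auto
      qed
    qed
    let ?m = "\<lambda>v. measure m (X -` {v})" and ?a = "\<lambda>v. Phi f \<phi> (3 * \<delta>) v n"
    have bound: "real n * pres \<le> (\<Sum>v\<in>range X. eta (?m v) + ?m v * ?a v)"
    proof (rule free_energy_le_cells[OF phi_cont X])
      show "dn f n x y \<le> \<epsilon>" if "X x = X y" for x y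
        using dn_triangle[of f n x y "X x"] Xin(2)[of x] Xin(2)[of y] that delta by (simp add: dn_commute)
      show "birkhoff f \<phi> n y \<le> ?a (X y)" for y
        using Xin(2)[of y] delta by (intro Phi_ge) (auto simp: dn_commute)
      show "measure m (NE f \<epsilon>) = 0" by (rule equilibrium_expansive[OF m])
      show "ereal pres \<le> free_energy f \<phi> m" using m(2) by (simp add: top_pressure_PP)
    qed (use n eps in auto)
    have fin: "finite (E1 \<union> E2 \<union> E3)" and disj: "E1 \<inter> E2 = {}" "(E1 \<union> E2) \<inter> E3 = {}"
      using E1(1,2) E2(1,2) E3(1,2) by auto
    have zero: "?m v = 0" if "v \<notin> range X" for v
    proof -
      have "X -` {v} = {}" using that by auto
      then show ?thesis by simp
    qed
    have sumE: "(\<Sum>v\<in>range X. h v) = (\<Sum>v\<in>E1. h v) + (\<Sum>v\<in>E2. h v) + (\<Sum>v\<in>E3. h v)"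
      if "\<And>v. v \<notin> range X \<Longrightarrow> h v = 0" for h :: "'a \<Rightarrow> real"
    proof -
      have "(\<Sum>v\<in>range X. h v) = (\<Sum>v\<in>E1 \<union> E2 \<union> E3. h v)"
        using fin Xin(1) that by (intro sum.mono_neutral_left) auto
      then show ?thesis using E1(2) E2(2) E3(2) disj by (simp add: sum.union_disjoint)
    qed
    define p1 p2 p3 where "p1 = (\<Sum>v\<in>E1. ?m v)" and "p2 = (\<Sum>v\<in>E2. ?m v)" and "p3 = (\<Sum>v\<in>E3. ?m v)"
    have p_nn: "0 \<le> p1" "0 \<le> p2" "0 \<le> p3" by (auto simp: p1_def p2_def p3_def sum_nonneg)
    have meas: "X -` {v} \<in> sets m" for v using pick_borel[of "2 * \<delta>"] delta by (simp add: X_def sets_eq)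
    have p1: "p1 + p2 + p3 = 1"
    proof -
      have "measure m (\<Union>v\<in>E1 \<union> E2 \<union> E3. X -` {v}) = (\<Sum>v\<in>E1 \<union> E2 \<union> E3. ?m v)"
        by (rule measure_finite_Union[OF fin]) (use meas in \<open>auto simp: disjoint_family_on_def emeasure_eq_measure\<close>)
      moreover have "(\<Union>v\<in>E1 \<union> E2 \<union> E3. X -` {v}) = space m" unfolding space_eq using Xin(1) by blast
      ultimately show ?thesis using E1(2) E2(2) E3(2) disj prob_space by (simp add: sum.union_disjoint p1_def p2_def p3_def)
    qed
    have p3: "p3 \<le> 1 / 4"
    proof -
      have "p3 = measure m (\<Union>v\<in>E3. X -` {v})" unfolding p3_def
        by (rule measure_finite_Union[symmetric, OF E3(2)]) (use meas in \<open>auto simp: disjoint_family_on_def emeasure_eq_measure\<close>)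
      also have "\<dots> \<le> measure m (space m - A)" using XE3 A(1) by (intro finite_measure_mono) (auto simp: space_eq sets_eq)
      also have "\<dots> = 1 - measure m A" using A(1) by (intro prob_compl) (simp add: sets_eq)
      finally show ?thesis using A(2) by simp
    qed
    have Z2: "Z n E2 \<le> exp (real n * pres - L)"
    proof -
      have "Z n E2 \<le> exp (real n * pres) * (C0 * exp (- (real n * \<kappa>)) + B * C0\<^sup>2 * tail_weight \<kappa> M)"
        using E2(1) n B by (intro bad_sum[OF kc E2(3)]) auto
      also have "\<dots> \<le> exp (real n * pres) * (exp (- L) / 2 + exp (- L) / 2)"
      proof (intro mult_left_mono add_mono)
        have "exp (- \<kappa>) ^ n = exp (- (real n * \<kappa>))" using exp_of_nat_mult[of n "- \<kappa>"] by simp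
        then show "C0 * exp (- (real n * \<kappa>)) \<le> exp (- L) / 2" using N[of n] n by simp
      qed (use M in auto)
      also have "\<dots> = exp (real n * pres - L)" unfolding diff_conv_add_uminus exp_add by simp
      finally show ?thesis .
    qed
    have Z3: "Z n E3 \<le> exp (real n * pres + ln B)" using B(2)[OF E3(3)] B(1) by (simp add: exp_add mult.commute)
    have "Z n E1 \<ge> exp (real n * pres - L)"
    proof (rule ccontr)
      assume "\<not> ?thesis"
      then have Z1: "Z n E1 \<le> exp (real n * pres - L)" by simp
      have "real n * pres \<le> (p1 * (real n * pres - L) + 1) + (p2 * (real n * pres - L) + 1) + (p3 * (real n * pres + ln B) + 1)"
      proof -
        have g1: "(\<Sum>v\<in>E1. eta (?m v) + ?m v * ?a v) \<le> p1 * (real n * pres - L) + 1"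
          unfolding p1_def by (rule log_sum_group[OF E1(2) _ Z1[unfolded Z_def]]) simp
        have g2: "(\<Sum>v\<in>E2. eta (?m v) + ?m v * ?a v) \<le> p2 * (real n * pres - L) + 1"
          unfolding p2_def by (rule log_sum_group[OF E2(2) _ Z2[unfolded Z_def]]) simp
        have g3: "(\<Sum>v\<in>E3. eta (?m v) + ?m v * ?a v) \<le> p3 * (real n * pres + ln B) + 1"
          unfolding p3_def by (rule log_sum_group[OF E3(2) _ Z3[unfolded Z_def]]) simp
        have "(\<Sum>v\<in>range X. eta (?m v) + ?m v * ?a v) =
          (\<Sum>v\<in>E1. eta (?m v) + ?m v * ?a v) + (\<Sum>v\<in>E2. eta (?m v) + ?m v * ?a v) + (\<Sum>v\<in>E3. eta (?m v) + ?m v * ?a v)"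
          by (rule sumE) (simp add: zero)
        then show ?thesis using bound g1 g2 g3 by linarith
      qed
      also have "\<dots> = (p1 + p2 + p3) * (real n * pres) - (p1 + p2) * L + p3 * ln B + 3" by (simp add: algebra_simps)
      finally have *: "(p1 + p2) * L \<le> p3 * ln B + 3" unfolding p1 by simp
      have lnB: "ln B \<ge> 0" using B(1) by simp
      have "3 / 4 * L \<le> (p1 + p2) * L" using p1 p3 lnB by (intro mult_right_mono) (auto simp: L_def)
      moreover have "p3 * ln B \<le> 1 / 4 * ln B" using p3 lnB by (rule mult_right_mono)
      ultimately show False using * lnB by (simp add: L_def)
    qed
    moreover have "Z n E1 \<le> exp K * (\<Sum>x\<in>E1. exp (birkhoff f \<phi> n x))"
      unfolding Z_def sum_distrib_left exp_add[symmetric] using E1(1) Phi_le_birkhoff[OF K(2)]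
      by (intro sum_mono) (auto simp: slice_def add.commute)
    ultimately have "exp (real n * pres - L) \<le> exp K * (\<Sum>x\<in>E1. exp (birkhoff f \<phi> n x))" by linarith
    then have "exp (- K) * exp (real n * pres - L) \<le> exp (- K) * (exp K * (\<Sum>x\<in>E1. exp (birkhoff f \<phi> n x)))"
      by (intro mult_left_mono) auto
    then have "c * exp (real n * pres) \<le> (\<Sum>x\<in>E1. exp (birkhoff f \<phi> n x))"
      by (simp add: mult.assoc[symmetric] exp_add[symmetric] c_def algebra_simps)
    then show ?thesis using E1 by blast
  qed
  then show ?thesis using M(2) by (intro that[of c M "max N 1"]) (auto simp: c_def)
qed

end

section \<open>Uniqueness\<close>

context compact_dynamics
begin

text \<open>Otherwise pairs that stay close on longer and longer centred windows accumulate at some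
  \<open>x\<close> in \<open>K1\<close> and \<open>y\<close> in \<open>K2\<close> with
  \<open>y\<close> in \<open>Gamma f e x\<close>, although \<open>x\<close> lies outside
  \<open>NE f e\<close>. Compactness makes \<open>m\<close> uniform.\<close>

lemma orbits_separate:
  assumes e: "e > 0" and K: "closed K1" "closed K2" "K1 \<inter> K2 = {}" "K1 \<inter> NE f e = {}"
  obtains m where "\<And>x y. (f ^^ m) x \<in> K1 \<Longrightarrow> (f ^^ m) y \<in> K2 \<Longrightarrow> dn f (2 * m + 1) x y > e"
proof (rule ccontr)
  assume "\<not> thesis"
  then have "\<forall>m. \<exists>x y. (f ^^ m) x \<in> K1 \<and> (f ^^ m) y \<in> K2 \<and> dn f (2 * m + 1) x y \<le> e"
    using that by (meson not_le)
  then obtain X Y' where XY: "\<And>m. (f ^^ m) (X m) \<in> K1" "\<And>m. (f ^^ m) (Y' m) \<in> K2" "\<And>m. dn f (2 * m + 1) (X m) (Y' m) \<le> e"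
    by metis
  define u where "u m = (f ^^ m) (X m)" for m
  define v where "v m = (f ^^ m) (Y' m)" for m
  obtain x r where r: "strict_mono (r :: nat \<Rightarrow> nat)" "(\<lambda>k. u (r k)) \<longlonglongrightarrow> x" by (rule seq_subseq)
  obtain y s where s: "strict_mono (s :: nat \<Rightarrow> nat)" "(\<lambda>k. v (r (s k))) \<longlonglongrightarrow> y" by (rule seq_subseq)
  have u: "(\<lambda>k. u (r (s k))) \<longlonglongrightarrow> x" using LIMSEQ_subseq_LIMSEQ[OF r(2) s(1)] by (simp add: o_def)
  have "x \<in> K1" by (rule closed_sequentially[OF K(1) _ u]) (use XY in \<open>simp add: u_def\<close>)
  have "y \<in> K2" by (rule closed_sequentially[OF K(2) _ s(2)]) (use XY in \<open>simp add: v_def\<close>)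
  have "dist (fpow f i x) (fpow f i y) \<le> e" for i
  proof (rule LIMSEQ_le_const2)
    show "(\<lambda>k. dist (fpow f i (u (r (s k)))) (fpow f i (v (r (s k))))) \<longlonglongrightarrow> dist (fpow f i x) (fpow f i y)"
      by (intro tendsto_dist continuous_on_tendsto_compose[OF fpow_cont] u s(2)) auto
    have le: "dist (fpow f i (u m)) (fpow f i (v m)) \<le> e" if m: "m \<ge> nat \<bar>i\<bar>" for m
    proof -
      define t where "t = nat (i + int m)"
      have t: "i = int t - int m" "t < 2 * m + 1" using m by (auto simp: t_def)
      have "fpow f i ((f ^^ m) z) = (f ^^ t) z" for z
        unfolding t(1) fpow_diff[symmetric] inv_iter_iter ..
      then show ?thesis using dist_le_dn[OF t(2), of f "X m" "Y' m"] XY(3)[of m] by (simp add: u_def v_def)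
    qed
    have "k \<le> r (s k)" for k
      using seq_suble[OF r(1), of "s k"] seq_suble[OF s(1), of k] by simp
    then show "\<exists>N. \<forall>n\<ge>N. dist (fpow f i (u (r (s n)))) (fpow f i (v (r (s n)))) \<le> e"
      by (intro exI[of _ "nat \<bar>i\<bar>"] allI impI le) (meson order_trans)
  qed
  then have "y \<in> Gamma f e x" by (simp add: Gamma_def)
  moreover have "Gamma f e x = {x}" using \<open>x \<in> K1\<close> K(4) by (auto simp: NE_def)
  ultimately have "y = x" by simp
  then show False using \<open>x \<in> K1\<close> \<open>y \<in> K2\<close> K(3) by blast
qed

text \<open>In a window of length \<open>L\<close> each orbit misses its set less than a third of
  the time; the shift \<open>t\<close> and a margin \<open>m\<close> at both ends cost less than the
  remaining third. So at some time one orbit is in \<open>K1\<close> and the other in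
  \<open>K2\<close>, with room for the \<open>2 * m + 1\<close> times that separation needs.\<close>

lemma cross_separation:
  assumes m: "\<And>x y. (f ^^ m) x \<in> K1 \<Longrightarrow> (f ^^ m) y \<in> K2 \<Longrightarrow> dn f (2 * m + 1) x y > e"
    and L: "L > 3 * (\<tau> + 2 * m)" "t \<le> \<tau>"
    and v1: "(\<Sum>k<L. indicat_real (- K1) ((f ^^ (L * j1 + k)) x1)) < real L / 3"
    and v2: "(\<Sum>k<L. indicat_real (- K2) ((f ^^ (L * j2 + k)) x2)) < real L / 3"
    and sh: "dn f (L * (j1 + 1)) y' x1 < \<delta>" "dn f (L * (j2 + 1)) ((f ^^ a) y) x2 < \<delta>"
    and a: "L * j1 + t = L * j2 + a"
  shows "dn f (L * (j1 + 1)) y y' > e - 2 * \<delta>"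
proof -
  define S where "S = {m..<L - t - m}"
  have "\<exists>k\<in>S. (f ^^ (L * j1 + (k + t))) x1 \<in> K1 \<and> (f ^^ (L * j2 + k)) x2 \<in> K2"
  proof (rule ccontr)
    assume neg: "\<not> ?thesis"
    have "real (card S) = (\<Sum>k\<in>S. 1)" by simp
    also have "\<dots> \<le> (\<Sum>k\<in>S. indicat_real (- K1) ((f ^^ (L * j1 + (k + t))) x1) + indicat_real (- K2) ((f ^^ (L * j2 + k)) x2))"
      using neg by (intro sum_mono) (auto simp: indicator_def)
    also have "\<dots> = (\<Sum>k\<in>(\<lambda>k. k + t) ` S. indicat_real (- K1) ((f ^^ (L * j1 + k)) x1)) + (\<Sum>k\<in>S. indicat_real (- K2) ((f ^^ (L * j2 + k)) x2))"
      by (simp add: sum.distrib sum.reindex)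
    also have "\<dots> \<le> (\<Sum>k<L. indicat_real (- K1) ((f ^^ (L * j1 + k)) x1)) + (\<Sum>k<L. indicat_real (- K2) ((f ^^ (L * j2 + k)) x2))"
      by (intro add_mono sum_mono2) (auto simp: S_def)
    also have "\<dots> < 2 * real L / 3" using v1 v2 by simp
    finally have "3 * card S < 2 * L" by linarith
    then show False using L by (simp add: S_def)
  qed
  then obtain k where k: "m \<le> k" "k < L - t - m" "(f ^^ (L * j1 + (k + t))) x1 \<in> K1" "(f ^^ (L * j2 + k)) x2 \<in> K2"
    by (auto simp: S_def)
  \<comment> \<open>The separating window starts at time \<open>T\<close> of \<open>y\<close> and
    \<open>y'\<close>, which is position \<open>q\<close> of the segment \<open>x2\<close>;
    \<open>y\<close> follows \<open>x2\<close> from time \<open>a\<close> on, so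
    \<open>q + a = T\<close>.\<close>
  define T q where "T = L * j1 + (k + t) - m" and "q = L * j2 + k - m"
  have Tm: "m + T = L * j1 + (k + t)" "m + q = L * j2 + k" using k(1) by (auto simp: T_def q_def)
  have qa: "q + a = T" using a k(1) by (simp add: T_def q_def)
  have "(f ^^ m) ((f ^^ T) x1) \<in> K1" "(f ^^ m) ((f ^^ q) x2) \<in> K2"
    using k(3,4) unfolding Tm[symmetric] funpow_add by simp_all
  then have far: "dn f (2 * m + 1) ((f ^^ T) x1) ((f ^^ q) x2) > e" by (rule m)
  have Tle: "T + (2 * m + 1) \<le> L * (j1 + 1)" and qle: "q + (2 * m + 1) \<le> L * (j2 + 1)"
    using k(1,2) Tm by auto
  have 1: "dn f (2 * m + 1) ((f ^^ T) y') ((f ^^ T) x1) < \<delta>" using dn_shift[OF Tle, of f y' x1] sh(1) by simp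
  have "(f ^^ q) ((f ^^ a) y) = (f ^^ T) y" unfolding qa[symmetric] funpow_add by simp
  then have 2: "dn f (2 * m + 1) ((f ^^ T) y) ((f ^^ q) x2) < \<delta>" using dn_shift[OF qle, of f "(f ^^ a) y" x2] sh(2) by simp
  have "dn f (2 * m + 1) ((f ^^ T) x1) ((f ^^ q) x2)
      \<le> dn f (2 * m + 1) ((f ^^ T) x1) ((f ^^ T) y') + (dn f (2 * m + 1) ((f ^^ T) y') ((f ^^ T) y) + dn f (2 * m + 1) ((f ^^ T) y) ((f ^^ q) x2))"
    by (intro order_trans[OF dn_triangle[where y = "(f ^^ T) y'"]] add_left_mono dn_triangle)
  then have "dn f (2 * m + 1) ((f ^^ T) y) ((f ^^ T) y') > e - 2 * \<delta>" using far 1 2 by (simp add: dn_commute)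
  then show ?thesis using dn_shift[OF Tle, of f y y'] by linarith
qed

end

text \<open>The expected number of misses in a window is at most \<open>L * \<eta>\<close>, so by
  Markov's inequality a third of \<open>L\<close> is reached with probability at most
  \<open>3 * \<eta>\<close>; a union bound handles the \<open>R\<close> windows.\<close>

lemma (in borel_mpt) frequent_visits:
  fixes R L :: nat
  assumes K: "K \<in> sets borel" "measure M (- K) \<le> \<eta>" and L: "L \<ge> 1"
  defines "A \<equiv> {x. \<forall>j<R. (\<Sum>k<L. indicat_real (- K) ((f ^^ (L * j + k)) x)) < real L / 3}"
  shows "A \<in> sets borel" "measure M A \<ge> 1 - 3 * real R * \<eta>"
proof -
  define v where "v j x = (\<Sum>k<L. indicat_real (- K) ((f ^^ (L * j + k)) x))" for j x
  define Bd where "Bd j = {x. v j x \<ge> real L / 3}" for j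
  have pre: "(f ^^ i) -` (- K) \<in> sets M" "measure M ((f ^^ i) -` (- K)) = measure M (- K)" for i
    using mpt_sets[OF mpt_iter[OF mpt] space_eq, of "- K"] mpt_measure[OF mpt_iter[OF mpt] space_eq, of "- K"] K(1)
    by (auto simp: sets_eq Compl_in_sets_lebesgue)
  have v_eq: "v j = (\<lambda>x. \<Sum>k<L. indicat_real ((f ^^ (L * j + k)) -` (- K)) x)" for j
    unfolding v_def by (auto simp: indicator_def intro!: ext sum.cong)
  have int: "integrable M (indicat_real ((f ^^ i) -` (- K)))" for i
    using pre(1)[of i] by (simp add: emeasure_eq_measure)
  have vint: "integrable M (v j)" for j unfolding v_eq using int by (intro Bochner_Integration.integrable_sum) auto
  have "integral\<^sup>L M (v j) = (\<Sum>k<L. measure M ((f ^^ (L * j + k)) -` (- K)))" for j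
    unfolding v_eq by (subst Bochner_Integration.integral_sum) (use int pre(1) in \<open>auto simp: space_eq\<close>)
  then have vI: "integral\<^sup>L M (v j) \<le> real L * \<eta>" for j using K(2) L by (simp add: pre(2))
  have Bd: "Bd j \<in> sets M" "measure M (Bd j) \<le> 3 * \<eta>" for j
  proof -
    have eq: "Bd j = {x \<in> space M. v j x \<ge> real L / 3}" by (simp add: Bd_def space_eq)
    show "Bd j \<in> sets M" unfolding eq using borel_measurable_integrable[OF vint[of j]] by measurable
    have "measure M (Bd j) \<le> integral\<^sup>L M (v j) / (real L / 3)"
      unfolding eq
    proof (rule integral_Markov_inequality_measure[OF vint, of "{}"])
      have "0 \<le> v j x" for x by (simp add: v_def sum_nonneg)
      then show "AE x in M. 0 \<le> v j x" by simp
    qed (use L in auto)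
    also have "\<dots> \<le> (real L * \<eta>) / (real L / 3)" using vI[of j] L by (intro divide_right_mono) auto
    finally show "measure M (Bd j) \<le> 3 * \<eta>" using L by simp
  qed
  have A: "A = space M - (\<Union>j<R. Bd j)" by (auto simp: A_def Bd_def v_def space_eq not_le)
  have U: "(\<Union>j<R. Bd j) \<in> sets M" using Bd(1) by auto
  have "A \<in> sets M" unfolding A using U by blast
  then show "A \<in> sets borel" by (simp add: sets_eq)
  have "measure M (\<Union>j<R. Bd j) \<le> (\<Sum>j<R. measure M (Bd j))"
    using Bd(1) by (intro finite_measure_subadditive_finite) auto
  also have "\<dots> \<le> (\<Sum>j<R. 3 * \<eta>)" by (intro sum_mono Bd(2))
  finally show "measure M A \<ge> 1 - 3 * real R * \<eta>" unfolding A using prob_compl[OF U] by simp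
qed

context expansive_potential
begin

text \<open>Some continuous \<open>g\<close> has different integrals; let \<open>t\<close> lie
  between them. The set where the empirical limit of \<open>g\<close> exceeds \<open>t\<close> is
  invariant. Since this limit integrates to the same value as \<open>g\<close>, the complement is
  charged by one state and the set by the other, and conditioning preserves equilibrium.\<close>

lemma singular_equilibria:
  assumes M1: "borel_mpt M1 f" "free_energy f \<phi> M1 = top_pressure f \<phi>"
    and M2: "borel_mpt M2 f" "free_energy f \<phi> M2 = top_pressure f \<phi>" and ne: "M1 \<noteq> M2"
  obtains N1 N2 A where "borel_mpt N1 f" "free_energy f \<phi> N1 = top_pressure f \<phi>"
    "borel_mpt N2 f" "free_energy f \<phi> N2 = top_pressure f \<phi>" "A \<in> sets borel" "measure N1 (- A) = 1" "measure N2 A = 1"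
proof -
  have main: thesis
    if M: "borel_mpt M f" "free_energy f \<phi> M = top_pressure f \<phi>" and N: "borel_mpt N f" "free_energy f \<phi> N = top_pressure f \<phi>"
      and g: "continuous_on UNIV g" "\<And>x. 0 \<le> g x \<and> g x \<le> 1" and lt: "integral\<^sup>L M g < integral\<^sup>L N g"
      and th: "\<And>N1 N2 A. borel_mpt N1 f \<Longrightarrow> free_energy f \<phi> N1 = top_pressure f \<phi> \<Longrightarrow>
        borel_mpt N2 f \<Longrightarrow> free_energy f \<phi> N2 = top_pressure f \<phi> \<Longrightarrow> A \<in> sets borel \<Longrightarrow> measure N1 (- A) = 1 \<Longrightarrow> measure N2 A = 1 \<Longrightarrow> thesis"
    for M N and g :: "'a \<Rightarrow> real" and thesis
  proof -
    interpret M: borel_mpt M f by (rule M)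
    interpret N: borel_mpt N f by (rule N)
    obtain t where t: "integral\<^sup>L M g < t" "t < integral\<^sup>L N g" using dense[OF lt] by blast
    define A where "A = {y. ker_mean g y > t}"
    have Ab: "A \<in> sets borel" using ker_mean_borel[OF g(1)] unfolding A_def by measurable
    have inv: "f -` A = A" "f -` (- A) = - A" unfolding A_def by (auto simp: ker_mean_def ker_f)
    have kb: "\<bar>ker_mean g y\<bar> \<le> 1" for y
    proof -
      interpret k: borel_prob "ker y" by (rule borel_prob_ker)
      have "\<bar>g x\<bar> \<le> 1" for x using g(2)[of x] by simp
      then show ?thesis unfolding ker_mean_def by (rule k.abs_integral_le[OF k.meas_cont[OF g(1)]])
    qed
    have kM: "integrable M (ker_mean g)" and kN: "integrable N (ker_mean g)"
      using ker_mean_borel[OF g(1)] kb by (auto intro!: M.integrable_bdd N.integrable_bdd simp: measurable_cong_sets[OF M.sets_eq refl] measurable_cong_sets[OF N.sets_eq refl])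
    have posM: "measure M (- A) > 0"
    proof (rule ccontr)
      assume "\<not> ?thesis"
      then have "measure M (- A) = 0" by (simp add: not_less antisym)
      then have "AE y in M. y \<in> A"
        using M.prob_compl[of A] Ab by (intro M.AE_prob_1) (simp add: M.sets_eq M.space_eq Compl_eq_Diff_UNIV)
      then have "t \<le> integral\<^sup>L M (ker_mean g)" by (intro M.integral_ge_const[OF kM]) (auto simp: A_def elim: eventually_mono)
      then show False using t M.integral_ki[OF g(1)] by simp
    qed
    have posN: "measure N A > 0"
    proof (rule ccontr)
      assume "\<not> ?thesis"
      then have "measure N A = 0" by (simp add: not_less antisym)
      then have "AE y in N. y \<in> - A"
        using N.prob_compl[of A] Ab by (intro N.AE_prob_1) (simp add: N.sets_eq N.space_eq Compl_eq_Diff_UNIV)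
      then have "integral\<^sup>L N (ker_mean g) \<le> t" by (intro N.integral_le_const[OF kN]) (auto simp: A_def elim: eventually_mono)
      then show False using t N.integral_ki[OF g(1)] by simp
    qed
    have Ac: "- A \<in> sets borel" using Ab by auto
    show thesis
    proof (rule th)
      show "borel_mpt (uniform_measure M (- A)) f" by (rule M.uniform_measure_borel_mpt[OF Ac inv(2) posM])
      show "borel_mpt (uniform_measure N A) f" by (rule N.uniform_measure_borel_mpt[OF Ab inv(1) posN])
      show "free_energy f \<phi> (uniform_measure M (- A)) = top_pressure f \<phi>" by (rule equilibrium_condition[OF M Ac inv(2) posM])
      show "free_energy f \<phi> (uniform_measure N A) = top_pressure f \<phi>" by (rule equilibrium_condition[OF N Ab inv(1) posN])
      show "measure (uniform_measure M (- A)) (- A) = 1" using posM Ac by (simp add: M.emeasure_eq_measure M.sets_eq)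
      show "measure (uniform_measure N A) A = 1" using posN Ab by (simp add: N.emeasure_eq_measure N.sets_eq)
    qed (rule Ab)
  qed
  interpret M1: borel_mpt M1 f by (rule M1)
  interpret M2: borel_mpt M2 f by (rule M2)
  have "\<exists>g :: 'a \<Rightarrow> real. continuous_on UNIV g \<and> (\<forall>x. 0 \<le> g x \<and> g x \<le> 1) \<and> integral\<^sup>L M1 g \<noteq> integral\<^sup>L M2 g"
    using borel_prob_eqI[OF M1.borel_prob_axioms M2.borel_prob_axioms] ne by blast
  then obtain g :: "'a \<Rightarrow> real" where g: "continuous_on UNIV g" "\<And>x. 0 \<le> g x \<and> g x \<le> 1" "integral\<^sup>L M1 g \<noteq> integral\<^sup>L M2 g" by blast
  show thesis
  proof (cases "integral\<^sup>L M1 g < integral\<^sup>L M2 g")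
    case True
    show ?thesis by (rule main[OF M1 M2 g(1,2) True]) (rule that)
  next
    case False
    then have "integral\<^sup>L M2 g < integral\<^sup>L M1 g" using g(3) by simp
    then show ?thesis by (rule main[OF M2 M1 g(1,2)]) (rule that)
  qed
qed

end

lemma positive_lower_bound:
  fixes h :: "'b \<Rightarrow> real"
  assumes "finite A" "\<And>a. a \<in> A \<Longrightarrow> h a > 0"
  obtains r where "r > 0" "\<And>a. a \<in> A \<Longrightarrow> r \<le> h a"
  by (rule that[of "Min (insert 1 (h ` A))"]) (use assms in \<open>auto simp: Min_gr_iff\<close>)

context nonuniform_spec
begin

text \<open>Orbit segments typical for the first measure followed by segments typical for the second one can
  be told apart by the time of the switch: the \<open>R\<close> possible switching times multiply the partition sum by \<open>R\<close>,
  which is more than the upper bound on partition sums of glued orbits allows.\<close>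

lemma singular_equilibria_contradiction:
  assumes M1: "borel_mpt M1 f" "free_energy f \<phi> M1 = top_pressure f \<phi>"
    and M2: "borel_mpt M2 f" "free_energy f \<phi> M2 = top_pressure f \<phi>"
    and A: "A \<in> sets borel" "measure M1 (- A) = 1" "measure M2 A = 1"
  shows False
proof -
  interpret M1: borel_mpt M1 f by (rule M1)
  interpret M2: borel_mpt M2 f by (rule M2)
  obtain c M N1 where c: "c > 0" "M \<ge> 1" "N1 \<ge> 1" and lower:
    "\<And>m n A. borel_mpt m f \<Longrightarrow> free_energy f \<phi> m = top_pressure f \<phi> \<Longrightarrow> n \<ge> N1 \<Longrightarrow> A \<in> sets borel \<Longrightarrow>
      measure m A \<ge> 3 / 4 \<Longrightarrow> \<exists>E. finite E \<and> E \<subseteq> A \<inter> slice (GM D p s M) n \<and> separated f n (2 * \<delta>) E \<and>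
        (\<Sum>x\<in>E. exp (birkhoff f \<phi> n x)) \<ge> c * exp (real n * pres)"
    by (rule lower_bound) (rule that)
  obtain \<tau> N0 where tau: "\<tau> \<ge> 1" and spec_C:
    "\<And>(k::nat) xs ns. \<forall>i<k. (xs i, ns i) \<in> {(x, n) \<in> GM D p s M. n \<ge> N0} \<Longrightarrow>
      \<exists>y ts. (\<forall>i. i + 1 < k \<longrightarrow> 1 \<le> ts i \<and> ts i \<le> \<tau>) \<and> (\<forall>j<k. dn f (ns j) ((f ^^ (\<Sum>i<j. ns i + ts i)) y) (xs j) < \<delta>)"
    by (rule spec_GM[OF c(2)]) (rule that)
  obtain K where K: "K \<ge> 0" "\<And>x n y. (x, n) \<in> GM D p s M \<Longrightarrow> dn f n x y < \<epsilon> \<Longrightarrow> \<bar>birkhoff f \<phi> n x - birkhoff f \<phi> n y\<bar> \<le> K"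
    by (rule bowen_GM) (rule that)
  \<comment> \<open>The excess over \<open>l * pres\<close> in the gluing bound for two segments. It
    does not depend on the lengths, so the number \<open>R\<close> of switching times can be chosen
    against it.\<close>
  define Q where "Q = 2 * (real \<tau> * pres + (K + real \<tau> * phi_bound + ln (real \<tau>)))"
  obtain R :: nat where R: "real R * c\<^sup>2 > exp Q" using c(1) reals_Archimedean3[of "c\<^sup>2"] by auto
  have R0: "R \<ge> 1"
  proof (rule ccontr)
    assume "\<not> ?thesis"
    then show False using R by (simp add: not_less[symmetric])
  qed
  \<comment> \<open>With \<open>R\<close> windows the visits fail with probability at most
    \<open>3 * R * \<eta> = 1 / 4\<close>, the loss that \<open>lower_bound\<close>
    tolerates.\<close>
  define \<eta> where "\<eta> = 1 / (12 * real R)"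
  have eta: "\<eta> > 0" "3 * real R * \<eta> = 1 / 4" using R0 by (auto simp: \<eta>_def)
  have NEb: "NE f \<epsilon> \<in> sets borel" using eps by (intro NE_borel) simp
  obtain K1 where K1: "closed K1" "K1 \<subseteq> - A - NE f \<epsilon>" "measure M1 (- K1) \<le> \<eta>"
  proof -
    have "measure M1 (- A - NE f \<epsilon>) = 1"
      using A equilibrium_expansive[OF M1] NEb by (subst measure_Diff_null_set) (auto simp: null_sets_def M1.sets_eq M1.emeasure_eq_measure)
    moreover obtain K1 where "closed K1" "K1 \<subseteq> - A - NE f \<epsilon>" "measure M1 K1 > measure M1 (- A - NE f \<epsilon>) - \<eta>"
      by (rule M1.inner_closed[of "- A - NE f \<epsilon>" \<eta>]) (use A NEb eta in auto)
    ultimately show ?thesis using that M1.prob_compl[of K1] M1.meas_closed[of K1] by (auto simp: M1.space_eq Compl_eq_Diff_UNIV)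
  qed
  obtain K2 where K2: "closed K2" "K2 \<subseteq> A" "measure M2 (- K2) \<le> \<eta>"
  proof -
    obtain K2 where "closed K2" "K2 \<subseteq> A" "measure M2 K2 > measure M2 A - \<eta>"
      by (rule M2.inner_closed[of A \<eta>]) (use A eta in auto)
    then show ?thesis using that A(3) M2.prob_compl[of K2] M2.meas_closed[of K2] by (auto simp: M2.space_eq Compl_eq_Diff_UNIV)
  qed
  have disj: "K1 \<inter> K2 = {}" "K1 \<inter> NE f \<epsilon> = {}" using K1(2) K2(2) by auto
  obtain m where m: "\<And>x y. (f ^^ m) x \<in> K1 \<Longrightarrow> (f ^^ m) y \<in> K2 \<Longrightarrow> dn f (2 * m + 1) x y > \<epsilon>"
    by (rule orbits_separate[OF eps K1(1) K2(1) disj]) (rule that)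
  \<comment> \<open>Long enough for \<open>cross_separation\<close>; every positive multiple is long
    enough for specification and for the lower bound.\<close>
  define L where "L = 3 * (\<tau> + 2 * m) + 1 + N0 + N1"
  have L: "L > 3 * (\<tau> + 2 * m)" "L \<ge> N0" "L \<ge> N1" "L \<ge> 1" by (auto simp: L_def)
  define A1 where "A1 = {x. \<forall>j<R. (\<Sum>k<L. indicat_real (- K1) ((f ^^ (L * j + k)) x)) < real L / 3}"
  define A2 where "A2 = {x. \<forall>j<R. (\<Sum>k<L. indicat_real (- K2) ((f ^^ (L * j + k)) x)) < real L / 3}"
  have fv1: "1 - 3 * real R * \<eta> \<le> measure M1 A1"
    unfolding A1_def by (rule M1.frequent_visits(2)[OF borel_closed[OF K1(1)] K1(3) L(4)])
  have A1: "A1 \<in> sets borel" "measure M1 A1 \<ge> 3 / 4"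
  proof -
    show "A1 \<in> sets borel" unfolding A1_def by (rule M1.frequent_visits(1)[OF borel_closed[OF K1(1)] K1(3) L(4)])
    show "measure M1 A1 \<ge> 3 / 4" using fv1 unfolding eta(2) by simp
  qed
  have fv2: "1 - 3 * real R * \<eta> \<le> measure M2 A2"
    unfolding A2_def by (rule M2.frequent_visits(2)[OF borel_closed[OF K2(1)] K2(3) L(4)])
  have A2: "A2 \<in> sets borel" "measure M2 A2 \<ge> 3 / 4"
  proof -
    show "A2 \<in> sets borel" unfolding A2_def by (rule M2.frequent_visits(1)[OF borel_closed[OF K2(1)] K2(3) L(4)])
    show "measure M2 A2 \<ge> 3 / 4" using fv2 unfolding eta(2) by simp
  qed
  have len: "L * r \<ge> N0" "L * r \<ge> N1" if "r \<ge> 1" for r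
    using mult_le_mono[OF L(2) that] mult_le_mono[OF L(3) that] by auto
  have "\<forall>r\<in>{1..}. \<exists>E. finite E \<and> E \<subseteq> A1 \<inter> slice (GM D p s M) (L * r) \<and> separated f (L * r) (2 * \<delta>) E \<and>
      c * exp (real (L * r) * pres) \<le> (\<Sum>x\<in>E. exp (birkhoff f \<phi> (L * r) x))"
    by (intro ballI lower[OF M1 _ A1] len) simp
  from bchoice[OF this] obtain E1 where "\<forall>r\<in>{1..}. finite (E1 r) \<and> E1 r \<subseteq> A1 \<inter> slice (GM D p s M) (L * r) \<and>
      separated f (L * r) (2 * \<delta>) (E1 r) \<and> c * exp (real (L * r) * pres) \<le> (\<Sum>x\<in>E1 r. exp (birkhoff f \<phi> (L * r) x))"
    by (elim exE) (rule that)
  then have E1: "finite (E1 r)" "E1 r \<subseteq> A1 \<inter> slice (GM D p s M) (L * r)" "separated f (L * r) (2 * \<delta>) (E1 r)"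
    "c * exp (real (L * r) * pres) \<le> (\<Sum>x\<in>E1 r. exp (birkhoff f \<phi> (L * r) x))" if "1 \<le> r" for r
    using that by auto
  have "\<forall>r\<in>{1..}. \<exists>E. finite E \<and> E \<subseteq> A2 \<inter> slice (GM D p s M) (L * r) \<and> separated f (L * r) (2 * \<delta>) E \<and>
      c * exp (real (L * r) * pres) \<le> (\<Sum>x\<in>E. exp (birkhoff f \<phi> (L * r) x))"
    by (intro ballI lower[OF M2 _ A2] len) simp
  from bchoice[OF this] obtain E2 where "\<forall>r\<in>{1..}. finite (E2 r) \<and> E2 r \<subseteq> A2 \<inter> slice (GM D p s M) (L * r) \<and>
      separated f (L * r) (2 * \<delta>) (E2 r) \<and> c * exp (real (L * r) * pres) \<le> (\<Sum>x\<in>E2 r. exp (birkhoff f \<phi> (L * r) x))"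
    by (elim exE) (rule that)
  then have E2: "finite (E2 r)" "E2 r \<subseteq> A2 \<inter> slice (GM D p s M) (L * r)" "separated f (L * r) (2 * \<delta>) (E2 r)"
    "c * exp (real (L * r) * pres) \<le> (\<Sum>x\<in>E2 r. exp (birkhoff f \<phi> (L * r) x))" if "1 \<le> r" for r
    using that by auto
  \<comment> \<open>Segments of lengths \<open>L * r\<close> and \<open>L * co r\<close> have total
    length \<open>L * (R + 1)\<close> for every \<open>r\<close>, and both lengths are
    positive.\<close>
  define co where "co r = R + 1 - r" for r
  define I where "I = (SIGMA r:{1..R}. E1 r \<times> E2 (co r))"
  define X where "X b j = (if j = 0 then fst (snd b) else snd (snd b))" for b :: "nat \<times> 'a \<times> 'a" and j :: nat
  define N where "N b j = (if j = 0 then L * fst b else L * co (fst b))" for b :: "nat \<times> 'a \<times> 'a" and j :: nat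
  define l where "l = L * (R + 1)"
  have co: "1 \<le> co r" "L * r + L * co r = l" if "r \<in> {1..R}" for r
    using that by (auto simp: co_def l_def distrib_left[symmetric])
  have finI: "finite I" unfolding I_def using E1(1) E2(1) co(1) by (intro finite_SigmaI) auto
  have IE: "r \<in> {1..R}" "x1 \<in> E1 r" "x2 \<in> E2 (co r)" if "(r, x1, x2) \<in> I" for r x1 x2
    using that by (auto simp: I_def)
  \<comment> \<open>The excesses over 2\<delta> of all distances within the finitely many sets used.
    Their lower bound \<rho> is what shadowing leaves of the separation.\<close>
  define PE where "PE = (\<Union>r\<in>{1..R}. (\<lambda>(x, y). dn f (L * r) x y - 2 * \<delta>) ` {(x, y). x \<in> E1 r \<and> y \<in> E1 r \<and> x \<noteq> y}) \<union>
     (\<Union>r\<in>{1..R}. (\<lambda>(x, y). dn f (L * r) x y - 2 * \<delta>) ` {(x, y). x \<in> E2 r \<and> y \<in> E2 r \<and> x \<noteq> y})"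
  have "finite {(x, y). x \<in> E1 r \<and> y \<in> E1 r \<and> x \<noteq> y}" "finite {(x, y). x \<in> E2 r \<and> y \<in> E2 r \<and> x \<noteq> y}" if "r \<ge> 1" for r
    using E1(1)[OF that] E2(1)[OF that] by (auto intro: finite_subset[of _ "E1 r \<times> E1 r"] finite_subset[of _ "E2 r \<times> E2 r"])
  note finpairs = this
  have finPE: "finite PE" unfolding PE_def by (intro finite_UnI finite_UN_I finite_imageI finpairs) auto
  have posPE: "v > 0" if "v \<in> PE" for v
    using that E1(3) E2(3) unfolding PE_def separated_def by auto
  obtain \<rho> where rho: "\<rho> > 0" "\<And>v. v \<in> PE \<Longrightarrow> \<rho> \<le> v"
    by (rule positive_lower_bound[of PE "\<lambda>v. v", OF finPE]) (rule posPE, assumption, rule that)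
  have rho1: "\<rho> \<le> dn f (L * r) x y - 2 * \<delta>" if "r \<in> {1..R}" "x \<in> E1 r" "y \<in> E1 r" "x \<noteq> y" for r x y
    by (rule rho(2)) (use that in \<open>force simp: PE_def\<close>)
  have rho2: "\<rho> \<le> dn f (L * r) x y - 2 * \<delta>" if "r \<in> {1..R}" "x \<in> E2 r" "y \<in> E2 r" "x \<noteq> y" for r x y
    by (rule rho(2)) (use that in \<open>force simp: PE_def\<close>)
  \<comment> \<open>\<rho> serves choices with the same switching time, \<delta> those with
    different ones, whose orbits are more than \<open>\<epsilon> - 2 * \<delta>\<close>
    apart.\<close>
  define r0 where "r0 = min \<rho> \<delta>"
  have near: "dn f n u v > e - 2 * \<delta>" if "dn f n x y \<ge> e" "dn f n u x < \<delta>" "dn f n v y < \<delta>" for n u v x y e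
    using dn_triangle[of f n x y u] dn_triangle[of f n u y v] that by (simp add: dn_commute)
  have "I \<noteq> {}"
  proof -
    have ne: "E \<noteq> {}" if "(\<Sum>x\<in>E. exp (h x)) \<ge> c * exp t" for E :: "'a set" and h t
      using that c(1) mult_pos_pos[OF c(1) exp_gt_zero[of t]] by force
    have "E1 1 \<noteq> {}" by (rule ne[OF E1(4)]) simp
    moreover have "E2 (co 1) \<noteq> {}" by (rule ne[OF E2(4)]) (use R0 in \<open>simp add: co_def\<close>)
    ultimately obtain x1 x2 where "x1 \<in> E1 1" "x2 \<in> E2 (co 1)" by blast
    then have "(1, x1, x2) \<in> I" using R0 by (simp add: I_def)
    then show ?thesis by blast
  qed
  define Cs where "Cs = {(x, n) \<in> GM D p s M. n \<ge> N0}"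
  have sum2: "(\<Sum>j<2. h j) = h 0 + h 1" for h :: "nat \<Rightarrow> 'z::comm_monoid_add" by (simp add: numeral_2_eq_2)
  have "ln (\<Sum>b\<in>I. exp (\<Sum>j<2. birkhoff f \<phi> (N b j) (X b j)))
      \<le> real (l + 2 * \<tau>) * pres + real 2 * (K + real \<tau> * phi_bound + ln (real \<tau>))"
  proof (rule glue[where C = Cs and \<delta> = \<delta> and r = r0])
    show "\<exists>y ts. (\<forall>i. i + 1 < k \<longrightarrow> 1 \<le> ts i \<and> ts i \<le> \<tau>) \<and> (\<forall>j<k. dn f (ns j) ((f ^^ (\<Sum>i<j. ns i + ts i)) y) (xs j) < \<delta>)"
      if "\<forall>i<k. (xs i, ns i) \<in> Cs" for k :: nat and xs ns
      using that unfolding Cs_def by (rule spec_C)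
    show "birkhoff f \<phi> n x \<le> birkhoff f \<phi> n y + K" if "(x, n) \<in> Cs" "dn f n y x < \<delta>" for x n y
      using K(2)[of x n y] that delta eps by (auto simp: dn_commute abs_le_iff Cs_def)
    show "(X b j, N b j) \<in> Cs" if "b \<in> I" "j < 2" for b j
    proof -
      obtain r x1 x2 where b: "b = (r, x1, x2)" by (cases b)
      note bI = IE[OF that(1)[unfolded b]]
      have "x1 \<in> slice (GM D p s M) (L * r)" "x2 \<in> slice (GM D p s M) (L * co r)"
        using bI E1(2)[of r] E2(2)[OF co(1)[OF bI(1)]] by auto
      then show ?thesis using len(1)[of r] len(1)[OF co(1)[OF bI(1)]] bI(1)
        by (auto simp: X_def N_def b Cs_def slice_def)
    qed
    show "(\<Sum>j<2. N b j) = l" if "b \<in> I" for b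
      using IE(1)[of "fst b" "fst (snd b)" "snd (snd b)"] that co(2)[of "fst b"] by (simp add: sum2 N_def)
    have cross: "dn f (l + 2 * \<tau>) y y' > r0"
      if bI: "(r, x1, x2) \<in> I" "(r', x1', x2') \<in> I" and rr: "r < r'" and t: "1 \<le> t \<and> t \<le> \<tau>"
        and y: "dn f (L * co r) ((f ^^ (L * r + t)) y) x2 < \<delta>" and y': "dn f (L * r') y' x1' < \<delta>"
      for r x1 x2 r' x1' x2' t y y'
    proof -
      note b = IE[OF bI(1)] and b' = IE[OF bI(2)]
      \<comment> \<open>The stretch just before the later switch: the last window of the first
        segment \<open>x1'\<close> and, up to the gap, the same stretch as seen from
        \<open>x2\<close>, which started at time \<open>L * r + t\<close>.\<close>
      define j1 j2 where "j1 = r' - 1" and "j2 = r' - 1 - r"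
      have j: "j1 < R" "j2 < R" "r' = j1 + 1" "j1 = j2 + r" "j2 + 1 \<le> co r" "r' \<le> R + 1"
        using b(1) b'(1) rr by (auto simp: j1_def j2_def co_def)
      have "x1' \<in> A1" "x2 \<in> A2" using b' b E1(2)[of r'] E2(2)[OF co(1)[OF b(1)]] by auto
      then have v: "(\<Sum>k<L. indicat_real (- K1) ((f ^^ (L * j1 + k)) x1')) < real L / 3"
        "(\<Sum>k<L. indicat_real (- K2) ((f ^^ (L * j2 + k)) x2)) < real L / 3"
        using j by (auto simp: A1_def A2_def)
      have "dn f (L * (j1 + 1)) y y' > \<epsilon> - 2 * \<delta>"
      proof (rule cross_separation[OF m L(1) _ v])
        show "t \<le> \<tau>" using t by simp
        show "dn f (L * (j1 + 1)) y' x1' < \<delta>" using y' j(3) by simp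
        have "L * (j2 + 1) \<le> L * co r" using j(5) by (rule mult_le_mono2)
        from dn_mono[OF this, of f "(f ^^ (L * r + t)) y" x2] y
        show "dn f (L * (j2 + 1)) ((f ^^ (L * r + t)) y) x2 < \<delta>" by linarith
        show "L * j1 + t = L * j2 + (L * r + t)" unfolding j(4) by (simp add: distrib_left)
      qed
      moreover have "L * (j1 + 1) \<le> l + 2 * \<tau>" unfolding l_def j(3)[symmetric]
        using mult_le_mono2[OF j(6), of L] by simp
      note dn_mono[OF this, of f y y']
      ultimately show ?thesis using delta by (simp add: r0_def)
    qed
    fix b b' t y y'
    assume b: "b \<in> I" "b' \<in> I" "b \<noteq> b'" and t: "\<forall>j::nat. 1 \<le> t j \<and> t j \<le> \<tau>"
      and "\<forall>j<2. dn f (N b j) ((f ^^ (\<Sum>i<j. N b i + t i)) y) (X b j) < \<delta>"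
      and "\<forall>j<2. dn f (N b' j) ((f ^^ (\<Sum>i<j. N b' i + t i)) y') (X b' j) < \<delta>"
    then have
      sh: "dn f (N b 0) y (X b 0) < \<delta>" "dn f (N b 1) ((f ^^ (N b 0 + t 0)) y) (X b 1) < \<delta>"
      and sh': "dn f (N b' 0) y' (X b' 0) < \<delta>" "dn f (N b' 1) ((f ^^ (N b' 0 + t 0)) y') (X b' 1) < \<delta>"
      by (simp_all add: numeral_2_eq_2 All_less_Suc)
    obtain r x1 x2 where bb: "b = (r, x1, x2)" by (cases b)
    obtain r' x1' x2' where bb': "b' = (r', x1', x2')" by (cases b')
    have sh: "dn f (L * r) y x1 < \<delta>" "dn f (L * co r) ((f ^^ (L * r + t 0)) y) x2 < \<delta>" using sh by (auto simp: N_def X_def bb)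
    have sh': "dn f (L * r') y' x1' < \<delta>" "dn f (L * co r') ((f ^^ (L * r' + t 0)) y') x2' < \<delta>" using sh' by (auto simp: N_def X_def bb')
    note bI = b(1)[unfolded bb] and bI' = b(2)[unfolded bb']
    have t0: "1 \<le> t 0 \<and> t 0 \<le> \<tau>" using t by blast
    consider "r < r'" | "r' < r" | "r = r'" "x1 \<noteq> x1'" | "r = r'" "x2 \<noteq> x2'" using b(3) bb bb' by fastforce
    then show "r0 < dn f (l + 2 * \<tau>) y y'"
    proof cases
      case 1
      show ?thesis by (rule cross[OF bI bI' 1 t0 sh(2) sh'(1)])
    next
      case 2
      show ?thesis using cross[OF bI' bI 2 t0 sh'(2) sh(1)] by (simp add: dn_commute)
    next
      case 3
      have "dn f (L * r) x1 x1' \<ge> \<rho> + 2 * \<delta>" using rho1[of r x1 x1'] IE[OF bI] IE[OF bI'] 3 by simp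
      from near[OF this sh(1) sh'(1)[folded 3(1)]] have "dn f (L * r) y y' > \<rho>" by simp
      moreover have "L * r \<le> l + 2 * \<tau>" using co(2)[OF IE(1)[OF bI]] by linarith
      note dn_mono[OF this, of f y y']
      ultimately show ?thesis by (simp add: r0_def)
    next
      case 4
      have "co r \<in> {1..R}" using IE(1)[OF bI] by (auto simp: co_def)
      then have "dn f (L * co r) x2 x2' \<ge> \<rho> + 2 * \<delta>"
        using rho2[of "co r" x2 x2'] IE[OF bI] IE[OF bI'] 4 by simp
      from near[OF this sh(2) sh'(2)[folded 4(1)]]
      have "dn f (L * co r) ((f ^^ (L * r + t 0)) y) ((f ^^ (L * r + t 0)) y') > \<rho>" by simp
      moreover have "(L * r + t 0) + L * co r \<le> l + 2 * \<tau>" using co(2)[OF IE(1)[OF bI]] t0 by linarith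
      note dn_shift[OF this, of f y y']
      ultimately show ?thesis by (simp add: r0_def)
    qed
  qed (use tau finI \<open>I \<noteq> {}\<close> rho(1) delta in \<open>auto simp: r0_def\<close>)
  also have "real (l + 2 * \<tau>) * pres + real 2 * (K + real \<tau> * phi_bound + ln (real \<tau>)) = real l * pres + Q"
    by (simp add: Q_def algebra_simps)
  finally have up: "ln (\<Sum>b\<in>I. exp (\<Sum>j<2. birkhoff f \<phi> (N b j) (X b j))) \<le> real l * pres + Q" .
  \<comment> \<open>Each of the \<open>R\<close> switching times contributes a product of two lower
    bounds, whose exponents always add up to the same total length.\<close>
  have "real R * c\<^sup>2 * exp (real l * pres) = (\<Sum>r\<in>{1..R}. (c * exp (real (L * r) * pres)) * (c * exp (real (L * co r) * pres)))"
  proof -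
    have "(c * exp (real (L * r) * pres)) * (c * exp (real (L * co r) * pres)) = c\<^sup>2 * exp (real l * pres)" if "r \<in> {1..R}" for r
      unfolding co(2)[OF that, symmetric] by (simp add: power2_eq_square exp_add distrib_right)
    then show ?thesis by simp
  qed
  also have "\<dots> \<le> (\<Sum>r\<in>{1..R}. (\<Sum>x\<in>E1 r. exp (birkhoff f \<phi> (L * r) x)) * (\<Sum>x\<in>E2 (co r). exp (birkhoff f \<phi> (L * co r) x)))"
    using E1(4) E2(4) co(1) c(1) by (intro sum_mono mult_mono) (auto simp: sum_nonneg)
  also have "\<dots> = (\<Sum>r\<in>{1..R}. \<Sum>z\<in>E1 r \<times> E2 (co r). exp (\<Sum>j<2. birkhoff f \<phi> (N (r, z) j) (X (r, z) j)))"
    by (intro sum.cong refl) (simp add: sum_product sum.cartesian_product sum2 N_def X_def exp_add case_prod_beta)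
  also have "\<dots> = (\<Sum>(r, z)\<in>I. exp (\<Sum>j<2. birkhoff f \<phi> (N (r, z) j) (X (r, z) j)))"
    unfolding I_def by (rule sum.Sigma) (use E1(1) E2(1) co(1) in auto)
  also have "\<dots> = (\<Sum>b\<in>I. exp (\<Sum>j<2. birkhoff f \<phi> (N b j) (X b j)))" by (simp add: case_prod_beta)
  also have "\<dots> \<le> exp (real l * pres + Q)"
  proof -
    have pos: "(\<Sum>b\<in>I. exp (\<Sum>j<2. birkhoff f \<phi> (N b j) (X b j))) > 0" using finI \<open>I \<noteq> {}\<close> by (intro sum_pos) auto
    from exp_le_cancel_iff[THEN iffD2, OF up] show ?thesis unfolding exp_ln[OF pos] .
  qed
  finally have "real R * c\<^sup>2 \<le> exp Q" by (simp add: exp_add)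
  then show False using R by simp
qed

lemma equilibrium_unique:
  assumes "borel_mpt M1 f" "free_energy f \<phi> M1 = top_pressure f \<phi>" "borel_mpt M2 f" "free_energy f \<phi> M2 = top_pressure f \<phi>"
  shows "M1 = M2"
proof (rule ccontr)
  assume "M1 \<noteq> M2"
  then show False
    by (rule singular_equilibria[OF assms]) (rule singular_equilibria_contradiction)
qed

end

theorem theorem6p1:
  fixes f :: "'a::metric_space \<Rightarrow> 'a" and \<phi> :: "'a \<Rightarrow> real" and \<delta> \<epsilon> :: real
    and D P G S :: "('a \<times> nat) set" and p g s :: "'a \<times> nat \<Rightarrow> nat"
  assumes "compact (UNIV :: 'a set)"
    and "\<exists>h. homeomorphism UNIV UNIV f h"
    and "continuous_on UNIV \<phi>"
    and "\<delta> > 0" and "\<epsilon> > 0" and "\<epsilon> > 40 * \<delta>"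
    and "P_perp_exp f \<phi> \<epsilon> < top_pressure f \<phi>"
    and "D \<subseteq> UNIV \<times> {1..}"
    and "decomposition f D P G S p g s"
    and "\<forall>M::nat. M \<ge> 1 \<longrightarrow> tail_W_spec f (GM D p s M) \<delta>"
    and "bowen_prop f \<phi> \<epsilon> G"
    and "pressure_C f (P \<union> S \<union> ((UNIV \<times> {1..}) - D)) \<phi> \<delta> \<epsilon> < top_pressure f \<phi>"
  shows "\<exists>!\<mu>. equilibrium_state f \<phi> \<mu>"
proof -
  interpret nonuniform_spec f \<phi> \<epsilon> \<delta> D P G S p g s by unfold_locales (use assms in auto)
  obtain M where M: "borel_mpt M f" "free_energy f \<phi> M = top_pressure f \<phi>" by (rule equilibrium_exists)
  have inv: "invariant_prob f N \<longleftrightarrow> borel_mpt N f" for N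
    unfolding invariant_prob_iff using borel_mptI borel_mpt.mptf borel_mpt.axioms(1) by blast
  \<comment> \<open>Some measure attains the pressure and none exceeds it, so maximizing free energy
    is the same as attaining the pressure.\<close>
  have eq: "equilibrium_state f \<phi> N \<longleftrightarrow> borel_mpt N f \<and> free_energy f \<phi> N = top_pressure f \<phi>" for N
    unfolding equilibrium_state_def inv using M invariant_le_pressure by (metis antisym)
  show ?thesis unfolding eq using M equilibrium_unique by blast
qed

end
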